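(* Let $k>1$. Let $(\mathbf u,p)\in H^1_0(\Omega)^2\times L^2_0(\Omega)$ be the weak solution of the Stokes equations with right-hand side $\mathbf f$, with $\mathbf u\in H^{k+3}(\Omega)^2$, and let $(\mathbf u_h,p_h)\in\mathbf V_h\times P_h$ be the finite element solution. If $$\mathbf I_h\mathbf u\in \mathbf Z_h:=\{\mathbf z_h\in\mathbf V_h:\operatorname{div}\mathbf z_h=0\},$$ then $$\|\mathbf u_h-\mathbf I_h\mathbf u\|_{H^1(\Omega)}\le C h^{k+2}\|\mathbf u\|_{H^{k+3}(\Omega)},$$ where $C$ is a constant independent of $h$ and $\mathbf u$.
   Context: Domain and grids: $\Omega\subset\mathbb R^2$ is a polygonal domain that can be subdivided into (axis-parallel) rectangles. $\mathcal T_h$ is a conforming finite element grid of $\overline\Omega$ consisting of rectangles $K=[x_a,x_b]\times[y_c,y_d]$ with size $h_K=\max\{x_b-x_a,y_d-y_c\}\le h$. Weak Stokes problem: $L^2_0(\Omega)=\{q\in L^2(\Omega):\int_\Omega q=0\}$; $a(\mathbf u,\mathbf v)=\int_\Omega\nabla\mathbf u\cdot\nabla\mathbf v\,d\mathbf x$, $b(\mathbf v,q)=-\int_\Omega(\operatorname{div}\mathbf v)\,q\,d\mathbf x$, $(\mathbf f,\mathbf v)=\int_\Omega\mathbf f\cdot\mathbf v\,d\mathbf x$. The weak solution $(\mathbf u,p)\in H^1_0(\Omega)^2\times L^2_0(\Omega)$ satisfies $a(\mathbf u,\mathbf v)+b(\mathbf v,p)=(\mathbf f,\mathbf v)$ for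 all $\mathbf v\in H^1_0(\Omega)^2$ and $b(\mathbf u,q)=0$ for all $q\in L^2_0(\Omega)$. Discrete problem: $Q_{m,l}=\{\sum_{0\le i\le m,\,0\le j\le l}c_{ij}x^iy^j\}$. $V_{h,1}=\{\phi\in H^1_0(\Omega):\phi|_K\in Q_{k+1,k}\ \forall K\in\mathcal T_h\}$, $V_{h,2}=\{\phi\in H^1_0(\Omega):\phi|_K\in Q_{k,k+1}\ \forall K\in\mathcal T_h\}$, $\mathbf V_h=V_{h,1}\times V_{h,2}$ and $P_h=\{\operatorname{div}\mathbf v_h:\mathbf v_h\in\mathbf V_h\}\subset L^2_0(\Omega)$. The finite element solution $(\mathbf u_h,p_h)\in\mathbf V_h\times P_h$ is the unique pair with $a(\mathbf u_h,\mathbf v)+b(\mathbf v,p_h)=(\mathbf f,\mathbf v)$ for all $\mathbf v\in\mathbf V_h$ and $b(\mathbf u_h,q)=0$ for all $q\in P_h$. Interpolation: for $\mathbf u=(u,v)$ (regular enough for point values), $\mathbf I_h\mathbf u=(u_I,v_I)$. The function $u_I$, with $u_I|_K\in Q_{k+1,k}$ for each $K\in\mathcal T_h$, is determined by: (i) $u_I=u$ at the four vertices of $K$; (ii) $\int_e(u-u_I)\,r(x)\,dx=0$ for every 1D polynomial $r$ of degree $\le k-1$, on the top and bottom edges $e$ of $K$; (iii) $\int_e(u-u_I)\,r(y)\,dy=0$ for every 1D polynomial $r$ of degree $\le k-2$, on the left and right edges $e$ of $K$; (iv) $\int_K(u-u_I)\,q\,d\mathbf x=0$ for every $q\in Q_{k-1,k-2}$.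 The function $v_I$, with $v_I|_K\in Q_{k,k+1}$, is defined symmetrically by exchanging the roles of $x$ and $y$. For $\mathbf u$ vanishing on $\partial\Omega$, $\mathbf I_h\mathbf u\in\mathbf V_h$. *)

theory Defs
  imports "HOL-Analysis.Analysis" "HOL-Computational_Algebra.Polynomial"
begin

type_synonym sfield = "real \<times> real \<Rightarrow> real"
type_synonym vfield = "real \<times> real \<Rightarrow> real \<times> real"

text \<open>Elements of \<open>L\<^sup>2\<close> and of the Sobolev spaces are represented by functions, not by
  equivalence classes. All sets of such functions below are closed under equality almost everywhere
  in the domain, and values outside the domain are irrelevant.\<close>

definition L2 :: "(real \<times> real) set \<Rightarrow> sfield set" where
  "L2 \<Omega> = {f. f \<in> borel_measurable (lebesgue_on \<Omega>) \<and> integrable (lebesgue_on \<Omega>) (\<lambda>z. (f z)\<^sup>2)}"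

definition L2_0 :: "(real \<times> real) set \<Rightarrow> sfield set" where
  "L2_0 \<Omega> = {q \<in> L2 \<Omega>. integral\<^sup>L (lebesgue_on \<Omega>) q = 0}"

definition pdx :: "sfield \<Rightarrow> sfield" where
  "pdx f z = frechet_derivative f (at z) (1, 0)"

definition pdy :: "sfield \<Rightarrow> sfield" where
  "pdy f z = frechet_derivative f (at z) (0, 1)"

primrec Ck :: "nat \<Rightarrow> sfield \<Rightarrow> bool" where
  "Ck 0 f \<longleftrightarrow> continuous_on UNIV f"
| "Ck (Suc n) f \<longleftrightarrow> f differentiable_on UNIV \<and> Ck n (pdx f) \<and> Ck n (pdy f)"

definition test_functions :: "(real \<times> real) set \<Rightarrow> sfield set" where
  "test_functions \<Omega> =
     {\<phi>. (\<forall>n. Ck n \<phi>) \<and> compact (closure {z. \<phi> z \<noteq> 0}) \<and> closure {z. \<phi> z \<noteq> 0} \<subseteq> \<Omega>}"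

definition is_weak_deriv :: "(real \<times> real) set \<Rightarrow> nat \<Rightarrow> nat \<Rightarrow> sfield \<Rightarrow> sfield \<Rightarrow> bool" where
  "is_weak_deriv \<Omega> i j f g \<longleftrightarrow>
     (\<forall>\<phi>\<in>test_functions \<Omega>.
        (\<integral>z. f z * ((pdx ^^ i) ((pdy ^^ j) \<phi>)) z \<partial>lebesgue_on \<Omega>) =
        (-1) ^ (i + j) * (\<integral>z. g z * \<phi> z \<partial>lebesgue_on \<Omega>))"

text \<open>The weak derivative of order \<open>(i, j)\<close>, meaningful if one exists in \<open>L\<^sup>2\<close>; it is then
  determined up to equality almost everywhere in \<open>\<Omega>\<close>.\<close>

definition weak_deriv :: "(real \<times> real) set \<Rightarrow> nat \<Rightarrow> nat \<Rightarrow> sfield \<Rightarrow> sfield" where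
  "weak_deriv \<Omega> i j f = (SOME g. g \<in> L2 \<Omega> \<and> is_weak_deriv \<Omega> i j f g)"

definition Hspace :: "nat \<Rightarrow> (real \<times> real) set \<Rightarrow> sfield set" where
  "Hspace m \<Omega> =
     {f \<in> L2 \<Omega>. \<forall>i j. i + j \<le> m \<longrightarrow> (\<exists>g\<in>L2 \<Omega>. is_weak_deriv \<Omega> i j f g)}"

definition Hnorm :: "nat \<Rightarrow> (real \<times> real) set \<Rightarrow> sfield \<Rightarrow> real" where
  "Hnorm m \<Omega> f =
     sqrt (\<Sum>(i, j)\<in>{(i, j). i + j \<le> m}. \<integral>z. (weak_deriv \<Omega> i j f z)\<^sup>2 \<partial>lebesgue_on \<Omega>)"

definition H1_0 :: "(real \<times> real) set \<Rightarrow> sfield set" where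
  "H1_0 \<Omega> =
     {f \<in> Hspace 1 \<Omega>. \<forall>\<epsilon>>0. \<exists>\<phi>\<in>test_functions \<Omega>. Hnorm 1 \<Omega> (\<lambda>z. f z - \<phi> z) < \<epsilon>}"

definition both_components :: "sfield set \<Rightarrow> vfield set" where
  "both_components X = {v. fst \<circ> v \<in> X \<and> snd \<circ> v \<in> X}"

definition Hnorm_vec :: "nat \<Rightarrow> (real \<times> real) set \<Rightarrow> vfield \<Rightarrow> real" where
  "Hnorm_vec m \<Omega> v = sqrt ((Hnorm m \<Omega> (fst \<circ> v))\<^sup>2 + (Hnorm m \<Omega> (snd \<circ> v))\<^sup>2)"

definition divg :: "(real \<times> real) set \<Rightarrow> vfield \<Rightarrow> sfield" where
  "divg \<Omega> v z = weak_deriv \<Omega> 1 0 (fst \<circ> v) z + weak_deriv \<Omega> 0 1 (snd \<circ> v) z"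

definition grad_dot :: "(real \<times> real) set \<Rightarrow> sfield \<Rightarrow> sfield \<Rightarrow> sfield" where
  "grad_dot \<Omega> f g z =
     weak_deriv \<Omega> 1 0 f z * weak_deriv \<Omega> 1 0 g z + weak_deriv \<Omega> 0 1 f z * weak_deriv \<Omega> 0 1 g z"

definition a_form :: "(real \<times> real) set \<Rightarrow> vfield \<Rightarrow> vfield \<Rightarrow> real" where
  "a_form \<Omega> u v =
     (\<integral>z. grad_dot \<Omega> (fst \<circ> u) (fst \<circ> v) z + grad_dot \<Omega> (snd \<circ> u) (snd \<circ> v) z \<partial>lebesgue_on \<Omega>)"

definition b_form :: "(real \<times> real) set \<Rightarrow> vfield \<Rightarrow> sfield \<Rightarrow> real" where
  "b_form \<Omega> v q = - (\<integral>z. divg \<Omega> v z * q z \<partial>lebesgue_on \<Omega>)"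

definition load :: "(real \<times> real) set \<Rightarrow> vfield \<Rightarrow> vfield \<Rightarrow> real" where
  "load \<Omega> f v = (\<integral>z. f z \<bullet> v z \<partial>lebesgue_on \<Omega>)"

definition stokes_weak_solution ::
  "(real \<times> real) set \<Rightarrow> vfield \<Rightarrow> vfield \<Rightarrow> sfield \<Rightarrow> bool" where
  "stokes_weak_solution \<Omega> f u p \<longleftrightarrow>
     u \<in> both_components (H1_0 \<Omega>) \<and> p \<in> L2_0 \<Omega> \<and>
     (\<forall>v\<in>both_components (H1_0 \<Omega>). a_form \<Omega> u v + b_form \<Omega> v p = load \<Omega> f v) \<and>
     (\<forall>q\<in>L2_0 \<Omega>. b_form \<Omega> u q = 0)"

definition rectangle :: "(real \<times> real) set \<Rightarrow> bool" where
  "rectangle K \<longleftrightarrow> (\<exists>a b c d. a < b \<and> c < d \<and> K = {a..b} \<times> {c..d})"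

text \<open>The condition \<open>\<Omega> = interior (closure \<Omega>)\<close> rules out slits and punctures, which
  \<open>closure \<Omega>\<close> does not see.\<close>

definition rectangular_domain :: "(real \<times> real) set \<Rightarrow> bool" where
  "rectangular_domain \<Omega> \<longleftrightarrow>
     \<Omega> \<noteq> {} \<and> connected \<Omega> \<and> \<Omega> = interior (closure \<Omega>) \<and>
     (\<exists>R. R division_of closure \<Omega> \<and> (\<forall>K\<in>R. rectangle K))"

text \<open>Conformity: the intersection of two cells is empty, a common vertex, a common edge, or the
  cells coincide.\<close>

definition conforming_grid :: "(real \<times> real) set \<Rightarrow> real \<Rightarrow> (real \<times> real) set set \<Rightarrow> bool" where
  "conforming_grid \<Omega> h T \<longleftrightarrow>
     T division_of closure \<Omega> \<and> (\<forall>K\<in>T. rectangle K) \<and>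
     (\<forall>K\<in>T. \<forall>K'\<in>T. K \<inter> K' face_of K \<and> K \<inter> K' face_of K') \<and>
     (\<forall>a b c d. a < b \<longrightarrow> c < d \<longrightarrow> {a..b} \<times> {c..d} \<in> T \<longrightarrow> max (b - a) (d - c) \<le> h)"

definition Qpoly :: "nat \<Rightarrow> nat \<Rightarrow> sfield set" where
  "Qpoly m l = range (\<lambda>c :: nat \<Rightarrow> nat \<Rightarrow> real. \<lambda>(x, y). \<Sum>i\<le>m. \<Sum>j\<le>l. c i j * x ^ i * y ^ j)"

definition FE_space ::
  "(real \<times> real) set \<Rightarrow> (real \<times> real) set set \<Rightarrow> nat \<Rightarrow> nat \<Rightarrow> sfield set" where
  "FE_space \<Omega> T m l =
     {\<phi> \<in> H1_0 \<Omega>. \<forall>K\<in>T. \<exists>q\<in>Qpoly m l. AE z in lebesgue_on K. \<phi> z = q z}"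

definition Vh :: "(real \<times> real) set \<Rightarrow> (real \<times> real) set set \<Rightarrow> nat \<Rightarrow> vfield set" where
  "Vh \<Omega> T k = {v. fst \<circ> v \<in> FE_space \<Omega> T (k + 1) k \<and> snd \<circ> v \<in> FE_space \<Omega> T k (k + 1)}"

definition Ph :: "(real \<times> real) set \<Rightarrow> (real \<times> real) set set \<Rightarrow> nat \<Rightarrow> sfield set" where
  "Ph \<Omega> T k = {q. \<exists>v\<in>Vh \<Omega> T k. AE z in lebesgue_on \<Omega>. q z = divg \<Omega> v z}"

definition Zh :: "(real \<times> real) set \<Rightarrow> (real \<times> real) set set \<Rightarrow> nat \<Rightarrow> vfield set" where
  "Zh \<Omega> T k = {v \<in> Vh \<Omega> T k. AE z in lebesgue_on \<Omega>. divg \<Omega> v z = 0}"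

definition stokes_FE_solution ::
  "(real \<times> real) set \<Rightarrow> (real \<times> real) set set \<Rightarrow> nat \<Rightarrow> vfield \<Rightarrow> vfield \<Rightarrow> sfield \<Rightarrow> bool" where
  "stokes_FE_solution \<Omega> T k f u p \<longleftrightarrow>
     u \<in> Vh \<Omega> T k \<and> p \<in> Ph \<Omega> T k \<and>
     (\<forall>v\<in>Vh \<Omega> T k. a_form \<Omega> u v + b_form \<Omega> v p = load \<Omega> f v) \<and>
     (\<forall>q\<in>Ph \<Omega> T k. b_form \<Omega> u q = 0)"

text \<open>\<open>w\<close> is the interpolant of \<open>g\<close> on \<open>[a, b] \<times> [c, d]\<close> in \<open>Q\<^bsub>m,l\<^esub>\<close>, where \<open>m, l \<ge> 2\<close>. The two
  velocity components use \<open>(m, l) = (k + 1, k)\<close> and \<open>(m, l) = (k, k + 1)\<close>.\<close>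

definition interpolates_on ::
  "nat \<Rightarrow> nat \<Rightarrow> real \<Rightarrow> real \<Rightarrow> real \<Rightarrow> real \<Rightarrow> sfield \<Rightarrow> sfield \<Rightarrow> bool" where
  "interpolates_on m l a b c d g w \<longleftrightarrow>
     (\<exists>q\<in>Qpoly m l. \<forall>z\<in>{a..b} \<times> {c..d}. w z = q z) \<and>
     (\<forall>x\<in>{a, b}. \<forall>y\<in>{c, d}. w (x, y) = g (x, y)) \<and>
     (\<forall>y\<in>{c, d}. \<forall>r. degree r \<le> m - 2 \<longrightarrow>
        (\<integral>x. (g (x, y) - w (x, y)) * poly r x \<partial>lebesgue_on {a..b}) = 0) \<and>
     (\<forall>x\<in>{a, b}. \<forall>r. degree r \<le> l - 2 \<longrightarrow>
        (\<integral>y. (g (x, y) - w (x, y)) * poly r y \<partial>lebesgue_on {c..d}) = 0) \<and>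
     (\<forall>q\<in>Qpoly (m - 2) (l - 2).
        (\<integral>z. (g z - w z) * q z \<partial>lebesgue_on ({a..b} \<times> {c..d})) = 0)"

text \<open>Point values of \<open>u\<close> are those of its representative that is continuous on \<open>closure \<Omega>\<close>.\<close>

definition interpolant ::
  "(real \<times> real) set \<Rightarrow> (real \<times> real) set set \<Rightarrow> nat \<Rightarrow> nat \<Rightarrow> sfield \<Rightarrow> sfield \<Rightarrow> bool" where
  "interpolant \<Omega> T m l u w \<longleftrightarrow>
     (\<exists>g. continuous_on (closure \<Omega>) g \<and> (AE z in lebesgue_on \<Omega>. g z = u z) \<and>
        (\<forall>a b c d. a < b \<longrightarrow> c < d \<longrightarrow> {a..b} \<times> {c..d} \<in> T \<longrightarrow> interpolates_on m l a b c d g w))"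

text \<open>\<open>is_Ih \<Omega> T k u w\<close> states that \<open>w = I\<^sub>h u\<close>; it determines \<open>w\<close> on \<open>closure \<Omega>\<close>.\<close>

definition is_Ih ::
  "(real \<times> real) set \<Rightarrow> (real \<times> real) set set \<Rightarrow> nat \<Rightarrow> vfield \<Rightarrow> vfield \<Rightarrow> bool" where
  "is_Ih \<Omega> T k u w \<longleftrightarrow>
     interpolant \<Omega> T (k + 1) k (fst \<circ> u) (fst \<circ> w) \<and>
     interpolant \<Omega> T k (k + 1) (snd \<circ> u) (snd \<circ> w)"

end

theory Submission
  imports Defs "HOL-Real_Asymp.Real_Asymp"
begin

text \<open>The error \<open>e = u\<^sub>h - I\<^sub>h u\<close> lies in \<open>V\<^sub>h\<close> and is divergence free, so the pressures drop out and
  Galerkin orthogonality gives \<open>a(e, e) = a(u - I\<^sub>h u, e)\<close>. Consider first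
  components, with \<open>v\<close> that of \<open>e\<close>. On each cell the interpolation conditions turn \<open>\<integral> \<partial>\<^sub>x(u - u\<^sub>I) \<partial>\<^sub>xv\<close> into \<open>\<integral> J(1 - P)\<partial>\<^sub>x\<partial>\<^sub>yu \<partial>\<^sub>xv\<close>, where
  \<open>J\<close> is the primitive in \<open>y\<close> from the bottom of the cell and \<open>P\<close> the \<open>L\<^sup>2\<close> projection in \<open>y\<close> onto polynomials of
  degree less than \<open>k\<close>. This gains only \<open>h\<^bsup>k+1\<^esup>\<close>. But \<open>J(1 - P)\<partial>\<^sub>x\<partial>\<^sub>yu\<close> is the \<open>y\<close>-derivative of
  \<open>Z = JJ(1 - P)\<partial>\<^sub>x\<partial>\<^sub>yu\<close>, which is weakly differentiable across the cells because \<open>k > 1\<close> and the grid is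
  conforming. As \<open>v\<close> vanishes on the boundary, \<open>\<integral> \<partial>\<^sub>yZ \<partial>\<^sub>xv = \<integral> \<partial>\<^sub>xZ \<partial>\<^sub>yv\<close>, and
  \<open>\<partial>\<^sub>xZ = JJ(1 - P)\<partial>\<^sub>x\<partial>\<^sub>x\<partial>\<^sub>yu\<close> is of order \<open>h\<^bsup>k+2\<^esup>\<close>. The \<open>y\<close>-derivatives gain \<open>h\<^bsup>k+2\<^esup>\<close> directly, as \<open>u\<^sub>I\<close> has degree
  \<open>k + 1\<close> in \<open>x\<close>. The second component is symmetric, and Poincare's inequality bounds the full \<open>H\<^sup>1\<close> norm.\<close>

section \<open>Restricted Borel measures and square-integrable functions\<close>

text \<open>The last power of \<open>h\<close> is a global effect. Moving derivatives between the
  factors creates edge terms on every cell. They cancel because \<open>J\<close> and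
  \<open>P\<close> depend on a cell through its \<open>y\<close>-interval only, which a conforming
  grid shares between left and right neighbours, and because \<open>JJ(1 - P)\<close> vanishes at
  the bottom and the top of a cell. The exchange costs one \<open>x\<close>-derivative of
  \<open>u\<close>, so it ends at total order \<open>k + 3\<close>, the assumed regularity. The
  discrete error lies only in \<open>H1_0\<close>; the exchange is therefore proved for test
  functions and extended by density, which avoids traces on the boundary. All estimates live on
  coordinate lines: a primitive on an interval of length at most \<open>h\<close> has norm at most
  \<open>h\<close>, and duality bounds \<open>1 - P\<close> with constant 1. Constants are thus
  independent of the shape of the cells, and \<open>C\<close> comes from two derivative terms and
  Poincare's inequality. This needs Fubini's theorem on slices, hence Borel functions, whereas the
  function spaces consist of Lebesgue measurable functions given up to null sets; all work is done
  with Borel representatives and the measures \<open>lb_on\<close>.\<close>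

definition lb_on :: "'a::euclidean_space set \<Rightarrow> 'a measure" where
  "lb_on S = density lborel (indicator S)"

lemma sets_lb_on [simp, measurable_cong]: "sets (lb_on S) = sets borel"
  by (simp add: lb_on_def)

lemma space_lb_on [simp]: "space (lb_on S) = UNIV"
  by (simp add: lb_on_def)

text \<open>A density leaves the carrier at \<open>UNIV\<close>, so one Borel function is measurable
  for every \<open>lb_on S\<close> and can be moved between cells, joined boxes and the
  domain.\<close>

lemma measurable_lb_on [simp]: "borel_measurable (lb_on S) = borel_measurable borel"
  by (rule measurable_cong_sets) auto

lemma AE_lb_on:
  assumes [measurable]: "S \<in> sets borel"
  shows "(AE z in lb_on S. P z) \<longleftrightarrow> (AE z in lborel. z \<in> S \<longrightarrow> P z)"
  unfolding lb_on_def by (subst AE_density) (auto simp: indicator_def intro!: AE_cong)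

lemma AE_lb_on_in:
  assumes "S \<in> sets borel"
  shows "AE z in lb_on S. z \<in> S"
  using assms by (simp add: AE_lb_on)

lemma AE_lb_on_mono:
  assumes "AE z in lb_on S. P z" "S' \<subseteq> S" "S \<in> sets borel" "S' \<in> sets borel"
  shows "AE z in lb_on S'. P z"
  using assms by (auto simp: AE_lb_on)

lemma integral_lb_on:
  fixes f :: "'a::euclidean_space \<Rightarrow> real"
  assumes [measurable]: "S \<in> sets borel" "f \<in> borel_measurable borel"
  shows "integral\<^sup>L (lb_on S) f = (\<integral>z. indicator S z * f z \<partial>lborel)"
proof -
  have "lb_on S = density lborel (\<lambda>z. ennreal (indicator S z))"
    unfolding lb_on_def by (rule arg_cong[where f = "density lborel"]) (simp add: fun_eq_iff ennreal_indicator)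
  then show ?thesis
    by (simp add: integral_density)
qed

lemma integrable_lb_on:
  fixes f :: "'a::euclidean_space \<Rightarrow> real"
  assumes [measurable]: "S \<in> sets borel" "f \<in> borel_measurable borel"
  shows "integrable (lb_on S) f \<longleftrightarrow> integrable lborel (\<lambda>z. indicator S z * f z)"
proof -
  have "lb_on S = density lborel (\<lambda>z. ennreal (indicator S z))"
    unfolding lb_on_def by (rule arg_cong[where f = "density lborel"]) (simp add: fun_eq_iff ennreal_indicator)
  then show ?thesis
    by (simp add: integrable_density)
qed

lemma emeasure_lb_on:
  assumes [measurable]: "S \<in> sets borel" "B \<in> sets borel"
  shows "emeasure (lb_on S) B = emeasure lborel (S \<inter> B)"
proof -
  have "emeasure (lb_on S) B = (\<integral>\<^sup>+x. indicator S x * indicator B x \<partial>lborel)"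
    unfolding lb_on_def by (subst emeasure_density) auto
  also have "\<dots> = (\<integral>\<^sup>+x. indicator (S \<inter> B) x \<partial>lborel)"
    by (simp only: indicator_inter_arith)
  also have "\<dots> = emeasure lborel (S \<inter> B)" by (rule nn_integral_indicator) simp
  finally show ?thesis .
qed

lemma finite_measure_lb_on:
  assumes "S \<in> sets borel" "bounded S"
  shows "finite_measure (lb_on S)"
proof (rule finite_measureI)
  show "emeasure (lb_on S) (space (lb_on S)) \<noteq> \<infinity>"
    using emeasure_bounded_finite[OF assms(2)] assms(1) by (simp add: emeasure_lb_on)
qed

lemma finite_measure_lb_on_Icc [simp]: "finite_measure (lb_on {c..d::real})"
  by (rule finite_measure_lb_on) auto

text \<open>The form in which Fubini's theorem is applied; boundedness of \<open>B\<close> gives the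
  sigma-finiteness of the second factor.\<close>

lemma lb_on_Times:
  fixes A B :: "real set"
  assumes [measurable]: "A \<in> sets borel" "B \<in> sets borel" and "bounded B"
  shows "lb_on (A \<times> B) = lb_on A \<Otimes>\<^sub>M lb_on B"
proof -
  have "sigma_finite_measure (density lborel (indicator B :: real \<Rightarrow> ennreal))"
    using finite_measure.axioms(1)[OF finite_measure_lb_on[OF assms(2,3)]]
    unfolding lb_on_def .
  then have "lb_on A \<Otimes>\<^sub>M lb_on B
      = density (lborel \<Otimes>\<^sub>M lborel) (\<lambda>(x, y). indicator A x * indicator B y)"
    unfolding lb_on_def by (intro pair_measure_density) (auto intro: lborel.sigma_finite_measure_axioms)
  also have "\<dots> = density lborel (indicator (A \<times> B))"
    unfolding lborel_prod
    by (rule arg_cong[where f = "density lborel"]) (auto simp: fun_eq_iff indicator_def)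
  finally show ?thesis by (simp add: lb_on_def)
qed

text \<open>The set of disagreement inside the interval is open, and a nonempty open set is not
  negligible; the end points follow by continuity. Identities known almost everywhere thereby become
  usable at vertices and on edges.\<close>

lemma continuous_on_AE_eq:
  fixes f g :: "real \<Rightarrow> real"
  assumes "a < b" "continuous_on {a..b} f" "continuous_on {a..b} g"
    and "AE x in lb_on {a..b}. f x = g x" and "x \<in> {a..b}"
  shows "f x = g x"
proof -
  have ae: "AE x in lborel. x \<in> {a..b} \<longrightarrow> f x = g x"
    using assms(4) by (simp add: AE_lb_on)
  let ?U = "{x \<in> {a<..<b}. f x - g x \<in> - {0}}"
  have "continuous_on {a<..<b} (\<lambda>x. f x - g x)"
    by (intro continuous_intros continuous_on_subset[OF assms(2)] continuous_on_subset[OF assms(3)]) auto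
  then have op: "open ?U"
    using continuous_open_preimage[of "{a<..<b}" "\<lambda>x. f x - g x" "- {0}"]
    by (auto simp: vimage_def Int_def conj_commute)
  have "AE x in lborel. x \<notin> ?U" using ae by eventually_elim auto
  then have "negligible ?U"
    using AE_iff_null_sets[of ?U lborel] op
    by (auto simp: negligible_iff_null_sets null_sets_completion_iff)
  then have "?U = {}"
    using open_not_negligible[OF op] by auto
  then have eq: "f x - g x = 0" if "x \<in> {a<..<b}" for x using that by auto
  have "continuous_on {a..b} (\<lambda>x. f x - g x)"
    by (intro continuous_intros assms)
  moreover have "closure {a<..<b} = {a..b}" using assms(1) by simp
  ultimately have "f x - g x = 0"
    using continuous_constant_on_closure[of "{a<..<b}" "\<lambda>x. f x - g x" 0 x] eq assms(5) by simp
  then show ?thesis by simp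
qed

section \<open>Square integrability and the Cauchy-Schwarz inequality\<close>

definition sqi :: "'a measure \<Rightarrow> ('a \<Rightarrow> real) \<Rightarrow> bool" where
  "sqi M f \<longleftrightarrow> f \<in> borel_measurable M \<and> integrable M (\<lambda>x. (f x)\<^sup>2)"

lemma sqi_mult_integrable:
  assumes "sqi M f" "sqi M g"
  shows "integrable M (\<lambda>x. f x * g x)"
proof (rule Bochner_Integration.integrable_bound)
  show "integrable M (\<lambda>x. (f x)\<^sup>2 + (g x)\<^sup>2)" using assms by (auto simp: sqi_def)
  show "(\<lambda>x. f x * g x) \<in> borel_measurable M" using assms by (auto simp: sqi_def)
  have "\<bar>f x * g x\<bar> \<le> (f x)\<^sup>2 + (g x)\<^sup>2" for x
  proof -
    have "2 * (\<bar>f x\<bar> * \<bar>g x\<bar>) \<le> (f x)\<^sup>2 + (g x)\<^sup>2"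
      using sum_squares_bound[of "\<bar>f x\<bar>" "\<bar>g x\<bar>"] by (simp add: mult.assoc)
    moreover have "0 \<le> \<bar>f x\<bar> * \<bar>g x\<bar>" by simp
    ultimately show ?thesis unfolding abs_mult by linarith
  qed
  then show "AE x in M. norm (f x * g x) \<le> norm ((f x)\<^sup>2 + (g x)\<^sup>2)"
    by auto
qed

lemma sqi_add:
  assumes "sqi M f" "sqi M g"
  shows "sqi M (\<lambda>x. f x + g x)"
  using assms sqi_mult_integrable[OF assms] unfolding sqi_def
  by (auto simp: power2_sum mult.assoc)

lemma sqi_cmult: "sqi M f \<Longrightarrow> sqi M (\<lambda>x. c * f x)"
  by (auto simp: sqi_def power_mult_distrib)

lemma sqi_diff:
  assumes "sqi M f" "sqi M g"
  shows "sqi M (\<lambda>x. f x - g x)"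
  using sqi_add[OF assms(1) sqi_cmult[OF assms(2), of "-1"]] by simp

lemma sqi_bounded_mult:
  assumes "sqi M f" "g \<in> borel_measurable M" "AE x in M. \<bar>g x\<bar> \<le> B"
  shows "sqi M (\<lambda>x. g x * f x)"
  unfolding sqi_def
proof
  show "(\<lambda>x. g x * f x) \<in> borel_measurable M" using assms by (auto simp: sqi_def)
  show "integrable M (\<lambda>x. (g x * f x)\<^sup>2)"
  proof (rule Bochner_Integration.integrable_bound)
    show "integrable M (\<lambda>x. B\<^sup>2 * (f x)\<^sup>2)" using assms by (auto simp: sqi_def)
    show "(\<lambda>x. (g x * f x)\<^sup>2) \<in> borel_measurable M" using assms by (auto simp: sqi_def)
    show "AE x in M. norm ((g x * f x)\<^sup>2) \<le> norm (B\<^sup>2 * (f x)\<^sup>2)"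
      using assms(3)
    proof eventually_elim
      case (elim x)
      have "(g x)\<^sup>2 \<le> B\<^sup>2" using elim by (simp add: abs_le_square_iff[symmetric])
      then show ?case by (simp add: power_mult_distrib mult_right_mono)
    qed
  qed
qed

lemma sqi_imp_integrable:
  assumes "finite_measure M" "sqi M f"
  shows "integrable M f"
proof -
  interpret finite_measure M by fact
  have "sqi M (\<lambda>_. 1)" by (simp add: sqi_def)
  from sqi_mult_integrable[OF assms(2) this] show ?thesis by simp
qed

lemma sqi_bounded:
  assumes "finite_measure M" "f \<in> borel_measurable M" "AE x in M. \<bar>f x\<bar> \<le> B"
  shows "sqi M f"
proof -
  interpret finite_measure M by fact
  have "sqi M (\<lambda>_. 1)" by (simp add: sqi_def)
  from sqi_bounded_mult[OF this assms(2,3)] show ?thesis by simp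
qed

lemma Cauchy_Schwarz_integral:
  assumes "sqi M f" "sqi M g"
  shows "(\<integral>x. f x * g x \<partial>M)\<^sup>2 \<le> (\<integral>x. (f x)\<^sup>2 \<partial>M) * (\<integral>x. (g x)\<^sup>2 \<partial>M)"
proof -
  have fg: "integrable M (\<lambda>x. f x * g x)" by (rule sqi_mult_integrable[OF assms])
  have f2: "integrable M (\<lambda>x. (f x)\<^sup>2)" and g2: "integrable M (\<lambda>x. (g x)\<^sup>2)"
    using assms by (auto simp: sqi_def)
  define A B C where "A = (\<integral>x. (f x)\<^sup>2 \<partial>M)" and "B = (\<integral>x. f x * g x \<partial>M)"
    and "C = (\<integral>x. (g x)\<^sup>2 \<partial>M)"
  have nn: "0 \<le> t\<^sup>2 * A - 2 * t * s * B + s\<^sup>2 * C" for t s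
  proof -
    have "0 \<le> (\<integral>x. (t * f x - s * g x)\<^sup>2 \<partial>M)" by simp
    also have "\<dots> = (\<integral>x. t\<^sup>2 * (f x)\<^sup>2 - 2 * t * s * (f x * g x) + s\<^sup>2 * (g x)\<^sup>2 \<partial>M)"
      by (simp add: power2_eq_square algebra_simps)
    also have "\<dots> = t\<^sup>2 * A - 2 * t * s * B + s\<^sup>2 * C"
      using fg f2 g2 by (simp add: A_def B_def C_def)
    finally show ?thesis .
  qed
  have "A \<ge> 0" "C \<ge> 0" by (auto simp: A_def C_def)
  show ?thesis
  proof (cases "C = 0")
    case True
    have "B = 0"
    proof (rule ccontr)
      assume "B \<noteq> 0"
      \<comment> \<open>For \<open>C = 0\<close> the form is affine in the second parameter, and
        this value makes it equal to -1.\<close>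
      have "0 \<le> A - 2 * ((A + 1) / (2 * B)) * B"
        using nn[of 1 "(A + 1) / (2 * B)"] True by simp
      then show False using \<open>B \<noteq> 0\<close> by simp
    qed
    then show ?thesis using True by (simp add: A_def B_def C_def)
  next
    case False
    then have "C > 0" using \<open>C \<ge> 0\<close> by simp
    \<comment> \<open>The ratio \<open>B / C\<close> minimizes the form; choosing the parameters
      \<open>C\<close> and \<open>B\<close> clears the denominator.\<close>
    have "0 \<le> C\<^sup>2 * A - 2 * C * B * B + B\<^sup>2 * C" by (rule nn)
    also have "\<dots> = C * (A * C - B\<^sup>2)" by (simp add: power2_eq_square algebra_simps)
    finally have "0 \<le> A * C - B\<^sup>2" using \<open>C > 0\<close> by (simp add: zero_le_mult_iff)
    then show ?thesis by (simp add: A_def B_def C_def)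
  qed
qed

lemma Cauchy_Schwarz_integral_sqrt:
  assumes "sqi M f" "sqi M g"
  shows "\<bar>\<integral>x. f x * g x \<partial>M\<bar> \<le> sqrt (\<integral>x. (f x)\<^sup>2 \<partial>M) * sqrt (\<integral>x. (g x)\<^sup>2 \<partial>M)"
proof -
  have "\<bar>\<integral>x. f x * g x \<partial>M\<bar> = sqrt ((\<integral>x. f x * g x \<partial>M)\<^sup>2)" by simp
  also have "\<dots> \<le> sqrt ((\<integral>x. (f x)\<^sup>2 \<partial>M) * (\<integral>x. (g x)\<^sup>2 \<partial>M))"
    using Cauchy_Schwarz_integral[OF assms] by (rule real_sqrt_le_mono)
  finally show ?thesis by (simp add: real_sqrt_mult)
qed

section \<open>Primitives on an interval\<close>

text \<open>The primitive that vanishes at \<open>c\<close>, extended by constants outside \<open>[c, d]\<close>.\<close>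

definition prim :: "real \<Rightarrow> real \<Rightarrow> (real \<Rightarrow> real) \<Rightarrow> real \<Rightarrow> real" where
  "prim c d f y = (\<integral>s. indicator {..y} s * f s \<partial>lb_on {c..d})"

text \<open>Primitives are applied to slices of functions of two variables, so both the integrand
  and the upper limit depend on a parameter.\<close>

lemma prim_measurable:
  assumes [measurable]: "(\<lambda>(x, s). f x s) \<in> borel_measurable (N \<Otimes>\<^sub>M borel)" "g \<in> borel_measurable N"
  shows "(\<lambda>x. prim c d (f x) (g x)) \<in> borel_measurable N"
proof -
  interpret finite_measure "lb_on {c..d}" by simp
  have [measurable]: "(\<lambda>z. indicator {..g (fst z)} (snd z) * f (fst z) (snd z)) \<in> borel_measurable (N \<Otimes>\<^sub>M lb_on {c..d})"
  proof -
    have eq: "(\<lambda>z. indicator {..g (fst z)} (snd z) * f (fst z) (snd z))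
      = (\<lambda>z. (if snd z \<le> g (fst z) then 1 else 0) * f (fst z) (snd z))"
      by (auto simp: fun_eq_iff)
    have [measurable]: "(\<lambda>z. f (fst z) (snd z)) \<in> borel_measurable (N \<Otimes>\<^sub>M borel)"
      using assms(1) by (simp add: case_prod_unfold)
    have "(\<lambda>z. (if snd z \<le> g (fst z) then 1 else 0) * f (fst z) (snd z)) \<in> borel_measurable (N \<Otimes>\<^sub>M borel)"
      by measurable
    also have "borel_measurable (N \<Otimes>\<^sub>M borel) = borel_measurable (N \<Otimes>\<^sub>M lb_on {c..d})"
      by (rule measurable_cong_sets) (auto intro: sets_pair_measure_cong)
    finally show ?thesis unfolding eq .
  qed
  show ?thesis unfolding prim_def
    by (intro borel_measurable_lebesgue_integral) (simp add: case_prod_unfold)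
qed

lemma prim_borel:
  assumes [measurable]: "f \<in> borel_measurable borel"
  shows "prim c d f \<in> borel_measurable borel"
proof -
  have "(\<lambda>(x :: real, s). f s) \<in> borel_measurable (borel \<Otimes>\<^sub>M borel)" by measurable
  from prim_measurable[OF this, of "\<lambda>x. x"] show ?thesis by simp
qed

lemma integrable_indicator_mult:
  fixes f :: "real \<Rightarrow> real"
  assumes "integrable (lb_on S) f"
  shows "integrable (lb_on S) (\<lambda>s. indicator {..y::real} s * f s)"
  using integrable_real_mult_indicator[OF _ assms, of "{..y}"] by (simp add: mult.commute)

lemma prim_abs_le:
  assumes "integrable (lb_on {c..d}) f"
  shows "\<bar>prim c d f y\<bar> \<le> (\<integral>s. \<bar>f s\<bar> \<partial>lb_on {c..d})"
proof -
  have "\<bar>prim c d f y\<bar> \<le> (\<integral>s. \<bar>indicator {..y} s * f s\<bar> \<partial>lb_on {c..d})"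
    unfolding prim_def by (rule integral_abs_bound)
  also have "\<dots> \<le> (\<integral>s. \<bar>f s\<bar> \<partial>lb_on {c..d})"
    using assms integrable_indicator_mult[OF assms]
    by (intro integral_mono) (auto split: split_indicator)
  finally show ?thesis .
qed

lemma prim_diff:
  assumes "integrable (lb_on {c..d}) f" "integrable (lb_on {c..d}) g"
  shows "prim c d (\<lambda>s. f s - g s) y = prim c d f y - prim c d g y"
  using assms by (simp add: prim_def right_diff_distrib integrable_indicator_mult)

lemma prim_cong_AE:
  assumes "AE s in lb_on {c..d}. f s = g s" "f \<in> borel_measurable borel" "g \<in> borel_measurable borel"
  shows "prim c d f y = prim c d g y"
  unfolding prim_def
proof (rule integral_cong_AE)
  show "AE s in lb_on {c..d}. indicator {..y} s * f s = indicator {..y} s * g s"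
    using assms(1) by eventually_elim simp
qed (use assms(2,3) in simp_all)

lemma prim_left [simp]:
  assumes "y \<le> c"
  shows "prim c d f y = 0"
proof -
  have "AE s in lb_on {c..d}. s \<noteq> c"
    using AE_lborel_singleton[of c] by (auto simp: AE_lb_on)
  moreover have "AE s in lb_on {c..d}. s \<in> {c..d}" by (rule AE_lb_on_in) auto
  ultimately have "AE s in lb_on {c..d}. indicator {..y} s * f s = 0"
    by eventually_elim (use assms in \<open>auto split: split_indicator\<close>)
  then show ?thesis unfolding prim_def by (rule integral_eq_zero_AE)
qed

lemma prim_right:
  assumes "d \<le> y" "f \<in> borel_measurable borel"
  shows "prim c d f y = (\<integral>s. f s \<partial>lb_on {c..d})"
proof -
  have "AE s in lb_on {c..d}. s \<in> {c..d}" by (rule AE_lb_on_in) auto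
  then have "AE s in lb_on {c..d}. indicator {..y} s * f s = f s"
    by eventually_elim (use assms in \<open>auto split: split_indicator\<close>)
  then show ?thesis
    unfolding prim_def by (intro integral_cong_AE) (use assms in auto)
qed

text \<open>Dominated convergence: the indicators of \<open>{..X n}\<close> converge to that of
  \<open>{..y}\<close> except possibly at the single point \<open>s = y\<close>.\<close>

lemma prim_continuous:
  assumes f: "integrable (lb_on {c..d}) f"
  shows "continuous_on UNIV (prim c d f)"
proof (rule continuous_at_imp_continuous_on, rule ballI)
  fix y
  have [measurable]: "f \<in> borel_measurable borel" using borel_measurable_integrable[OF f] by simp
  show "isCont (prim c d f) y"
    unfolding continuous_at_sequentially comp_def
  proof (intro allI impI)
    fix X assume X: "X \<longlonglongrightarrow> y"
    show "(\<lambda>n. prim c d f (X n)) \<longlonglongrightarrow> prim c d f y"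
      unfolding prim_def
    proof (rule integral_dominated_convergence)
      show "integrable (lb_on {c..d}) (\<lambda>s. \<bar>f s\<bar>)" using f by simp
      have "AE s in lb_on {c..d}. s \<noteq> y"
        using AE_lborel_singleton[of y] by (auto simp: AE_lb_on)
      then show "AE s in lb_on {c..d}. (\<lambda>n. indicator {..X n} s * f s) \<longlonglongrightarrow> indicator {..y} s * f s"
      proof eventually_elim
        case (elim s)
        have "(\<lambda>n. indicator {..X n} s :: real) \<longlonglongrightarrow> indicator {..y} s"
        proof (cases "s < y")
          case True
          have "\<forall>\<^sub>F n in sequentially. s < X n" using order_tendstoD(1)[OF X True] .
          then have "\<forall>\<^sub>F n in sequentially. (indicator {..X n} s :: real) = indicator {..y} s"
            by eventually_elim (use True in auto)
          then show ?thesis by (rule tendsto_eventually)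
        next
          case False
          then have "y < s" using elim by auto
          have "\<forall>\<^sub>F n in sequentially. X n < s" using order_tendstoD(2)[OF X \<open>y < s\<close>] .
          then have "\<forall>\<^sub>F n in sequentially. (indicator {..X n} s :: real) = indicator {..y} s"
            by eventually_elim (use \<open>y < s\<close> in auto)
          then show ?thesis by (rule tendsto_eventually)
        qed
        then show ?case by (intro tendsto_intros)
      qed
      show "AE s in lb_on {c..d}. norm (indicator {..X n} s * f s) \<le> \<bar>f s\<bar>" for n
        by (auto split: split_indicator)
      show "(\<lambda>s. indicator {..y} s * f s) \<in> borel_measurable (lb_on {c..d})"
        "(\<lambda>s. indicator {..X n} s * f s) \<in> borel_measurable (lb_on {c..d})" for n
        by simp_all
    qed
  qed
qed

text \<open>Fubini's theorem on the square: the two terms integrate \<open>f s * g y\<close> over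
  the triangles \<open>s \<le> y\<close> and \<open>y \<le> s\<close>, which meet in a null set on
  each line. Integrability of \<open>f\<close> and \<open>g\<close> is enough.\<close>

lemma prim_integration_by_parts:
  assumes f: "integrable (lb_on {c..d}) f" and g: "integrable (lb_on {c..d}) g"
  shows "(\<integral>y. prim c d f y * g y \<partial>lb_on {c..d}) + (\<integral>y. f y * prim c d g y \<partial>lb_on {c..d})
    = (\<integral>y. f y \<partial>lb_on {c..d}) * (\<integral>y. g y \<partial>lb_on {c..d})"
proof -
  let ?M = "lb_on {c..d}"
  interpret finite_measure ?M by simp
  interpret P: pair_sigma_finite ?M ?M by standard
  have [measurable]: "f \<in> borel_measurable borel" "g \<in> borel_measurable borel"
    using borel_measurable_integrable[OF f] borel_measurable_integrable[OF g] by auto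
  have fg: "integrable (?M \<Otimes>\<^sub>M ?M) (\<lambda>(s, y). f s * g y)"
    using f g by (intro P.Fubini_integrable) (auto simp: abs_mult)
  let ?I = "\<lambda>s y :: real. indicator {..y} s :: real"
  have [measurable]: "(\<lambda>(s, y). ?I s y) \<in> borel_measurable (borel \<Otimes>\<^sub>M borel)"
    "(\<lambda>(s, y). ?I y s) \<in> borel_measurable (borel \<Otimes>\<^sub>M borel)"
    unfolding indicator_def by simp_all
  have i1: "integrable (?M \<Otimes>\<^sub>M ?M) (\<lambda>(s, y). ?I s y * (f s * g y))"
    by (rule Bochner_Integration.integrable_bound[OF fg]) (auto split: split_indicator)
  have i2: "integrable (?M \<Otimes>\<^sub>M ?M) (\<lambda>(s, y). ?I y s * (f s * g y))"
    by (rule Bochner_Integration.integrable_bound[OF fg]) (auto split: split_indicator)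
  have "(\<integral>y. prim c d f y * g y \<partial>?M) = (\<integral>y. (\<integral>s. ?I s y * (f s * g y) \<partial>?M) \<partial>?M)"
    unfolding prim_def by (subst integral_mult_left_zero[symmetric]) (simp add: mult.assoc)
  also have "\<dots> = (\<integral>s. (\<integral>y. ?I s y * (f s * g y) \<partial>?M) \<partial>?M)"
    using P.Fubini_integral[OF i1] by simp
  finally have 1: "(\<integral>y. prim c d f y * g y \<partial>?M) = (\<integral>s. (\<integral>y. ?I s y * (f s * g y) \<partial>?M) \<partial>?M)" .
  have 2: "(\<integral>s. f s * prim c d g s \<partial>?M) = (\<integral>s. (\<integral>y. ?I y s * (f s * g y) \<partial>?M) \<partial>?M)"
    unfolding prim_def by (subst integral_mult_right_zero[symmetric]) (simp add: ac_simps)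
  have "(\<integral>s. (\<integral>y. ?I s y * (f s * g y) \<partial>?M) \<partial>?M) + (\<integral>s. (\<integral>y. ?I y s * (f s * g y) \<partial>?M) \<partial>?M)
    = (\<integral>s. (\<integral>y. ?I s y * (f s * g y) \<partial>?M) + (\<integral>y. ?I y s * (f s * g y) \<partial>?M) \<partial>?M)"
    using P.integrable_fst'[OF i1] P.integrable_fst'[OF i2] by simp
  also have "\<dots> = (\<integral>s. f s * (\<integral>y. g y \<partial>?M) \<partial>?M)"
  proof (rule Bochner_Integration.integral_cong[OF refl])
    fix s
    have m: "integrable ?M (\<lambda>y. ?I s y * (f s * g y))" "integrable ?M (\<lambda>y. ?I y s * (f s * g y))"
      by (rule Bochner_Integration.integrable_bound[OF integrable_mult_right[OF g, of "f s"]],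
          auto simp: indicator_def)+
    have "AE y in ?M. y \<noteq> s" using AE_lborel_singleton[of s] by (auto simp: AE_lb_on)
    then have "AE y in ?M. ?I s y * (f s * g y) + ?I y s * (f s * g y) = f s * g y"
      by eventually_elim (auto split: split_indicator)
    then have "(\<integral>y. ?I s y * (f s * g y) + ?I y s * (f s * g y) \<partial>?M) = (\<integral>y. f s * g y \<partial>?M)"
      by (intro integral_cong_AE) (auto simp: indicator_def)
    then show "(\<integral>y. ?I s y * (f s * g y) \<partial>?M) + (\<integral>y. ?I y s * (f s * g y) \<partial>?M) = f s * (\<integral>y. g y \<partial>?M)"
      using m by simp
  qed
  also have "\<dots> = (\<integral>s. f s \<partial>?M) * (\<integral>y. g y \<partial>?M)" by simp
  finally show ?thesis using 1 2 by simp
qed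

text \<open>Cauchy-Schwarz against 1 yields one factor \<open>d - c\<close> pointwise, integration
  over the interval the other. Every primitive thus gains one power of the cell size, with constant
  1.\<close>

lemma sqi_prim:
  assumes "c \<le> d" and f: "sqi (lb_on {c..d}) f"
  shows "sqi (lb_on {c..d}) (prim c d f)"
    and "(\<integral>y. (prim c d f y)\<^sup>2 \<partial>lb_on {c..d}) \<le> (d - c)\<^sup>2 * (\<integral>y. (f y)\<^sup>2 \<partial>lb_on {c..d})"
proof -
  let ?M = "lb_on {c..d}"
  interpret finite_measure ?M by simp
  have [measurable]: "f \<in> borel_measurable borel" using f by (simp add: sqi_def)
  have fi: "integrable ?M f" by (rule sqi_imp_integrable) (use f in simp_all)
  note [measurable] = prim_borel[of f]
  have vol: "measure ?M UNIV = d - c"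
    using assms(1) by (simp add: measure_def emeasure_lb_on)
  show s: "sqi ?M (prim c d f)"
    by (rule sqi_bounded[where B = "\<integral>s. \<bar>f s\<bar> \<partial>?M"]) (use prim_abs_le[OF fi] prim_borel[of f] in auto)
  have "(prim c d f y)\<^sup>2 \<le> (d - c) * (\<integral>y. (f y)\<^sup>2 \<partial>?M)" for y
  proof -
    have "(prim c d f y)\<^sup>2 \<le> (\<integral>s. \<bar>f s\<bar> * 1 \<partial>?M)\<^sup>2"
      using prim_abs_le[OF fi, of y] by (simp add: abs_le_square_iff[symmetric])
    also have "\<dots> \<le> (\<integral>s. \<bar>f s\<bar>\<^sup>2 \<partial>?M) * (\<integral>s. 1\<^sup>2 \<partial>?M)"
      by (rule Cauchy_Schwarz_integral) (use f in \<open>auto simp: sqi_def\<close>)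
    finally show ?thesis by (simp add: vol mult.commute)
  qed
  then have "(\<integral>y. (prim c d f y)\<^sup>2 \<partial>?M) \<le> (\<integral>y. (d - c) * (\<integral>y. (f y)\<^sup>2 \<partial>?M) \<partial>?M)"
    using s by (intro integral_mono) (auto simp: sqi_def)
  also have "\<dots> = (d - c)\<^sup>2 * (\<integral>y. (f y)\<^sup>2 \<partial>?M)"
    by (simp add: vol power2_eq_square)
  finally show "(\<integral>y. (prim c d f y)\<^sup>2 \<partial>?M) \<le> (d - c)\<^sup>2 * (\<integral>y. (f y)\<^sup>2 \<partial>?M)" .
qed

lemma prim_derivative:
  assumes "\<And>x. (F has_real_derivative f x) (at x)" "continuous_on UNIV f" "y \<in> {c..d}"
  shows "prim c d f y = F y - F c"
proof -
  have [measurable]: "f \<in> borel_measurable borel"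
    using assms(2) by (rule borel_measurable_continuous_onI)
  have "prim c d f y = (\<integral>s. indicator {c..d} s * (indicator {..y} s * f s) \<partial>lborel)"
    unfolding prim_def by (rule integral_lb_on) auto
  also have "\<dots> = (\<integral>s. f s * indicator {c..y} s \<partial>lborel)"
    using assms(3) by (intro Bochner_Integration.integral_cong) (auto split: split_indicator)
  also have "\<dots> = F y - F c"
    using assms by (intro integral_FTC_Icc_real) (auto simp: continuous_on_eq_continuous_at)
  finally show ?thesis .
qed

lemma integrable_continuous_lb_on:
  assumes "continuous_on {a..b::real} f" "f \<in> borel_measurable borel"
  shows "integrable (lb_on {a..b}) (f :: real \<Rightarrow> real)"
  using borel_integrable_compact[of "{a..b}" f] assms
  by (simp add: integrable_lb_on)

section \<open>Orthogonality to polynomials and the projection residual\<close>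

text \<open>Unlike \<open>degree r < n\<close>, this admits the zero polynomial for
  \<open>n = 0\<close>, so it describes a vector space for every \<open>n\<close>, and
  \<open>orth c d 0\<close> is vacuous.\<close>

definition deg_lt :: "nat \<Rightarrow> real poly \<Rightarrow> bool" where
  "deg_lt n r \<longleftrightarrow> (\<forall>i\<ge>n. coeff r i = 0)"

definition orth :: "real \<Rightarrow> real \<Rightarrow> nat \<Rightarrow> (real \<Rightarrow> real) \<Rightarrow> bool" where
  "orth c d n f \<longleftrightarrow> (\<forall>r. deg_lt n r \<longrightarrow> (\<integral>s. f s * poly r s \<partial>lb_on {c..d}) = 0)"

lemma deg_lt_degree: "degree r < n \<Longrightarrow> deg_lt n r"
  by (auto simp: deg_lt_def coeff_eq_0)

lemma deg_lt_mono: "deg_lt m r \<Longrightarrow> m \<le> n \<Longrightarrow> deg_lt n r"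
  by (auto simp: deg_lt_def)

lemma deg_lt_diff: "deg_lt n p \<Longrightarrow> deg_lt n q \<Longrightarrow> deg_lt n (p - q)"
  by (auto simp: deg_lt_def)

lemma deg_lt_add: "deg_lt n p \<Longrightarrow> deg_lt n q \<Longrightarrow> deg_lt n (p + q)"
  by (auto simp: deg_lt_def)

lemma deg_lt_smult: "deg_lt n p \<Longrightarrow> deg_lt n (smult c p)"
  by (auto simp: deg_lt_def)

lemma deg_lt_sum: "(\<And>i. i \<in> I \<Longrightarrow> deg_lt n (p i)) \<Longrightarrow> deg_lt n (\<Sum>i\<in>I. p i)"
  by (auto simp: deg_lt_def coeff_sum)

lemma continuous_on_poly_real: "continuous_on S (poly (r :: real poly))"
  by (intro continuous_intros)

lemma poly_borel [measurable]: "poly (r :: real poly) \<in> borel_measurable borel"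
  by (rule borel_measurable_continuous_onI) (intro continuous_intros)

lemma AE_bounded_continuous:
  fixes f :: "real \<Rightarrow> real"
  assumes "continuous_on {c..d} f"
  obtains B where "AE x in lb_on {c..d}. \<bar>f x\<bar> \<le> B"
proof -
  have "compact (f ` {c..d})"
    by (rule compact_continuous_image[OF assms]) simp
  then obtain B where "\<forall>x\<in>{c..d}. \<bar>f x\<bar> \<le> B"
    using compact_imp_bounded[of "f ` {c..d}"] by (auto simp: bounded_iff)
  then have "AE x in lb_on {c..d}. \<bar>f x\<bar> \<le> B" by (auto simp: AE_lb_on)
  then show ?thesis by (rule that)
qed

lemma sqi_poly: "sqi (lb_on {c..d}) (poly (r :: real poly))"
proof -
  obtain B where "AE x in lb_on {c..d}. \<bar>poly r x\<bar> \<le> B"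
    using AE_bounded_continuous[OF continuous_on_poly_real[of "{c..d}" r]] by blast
  then show ?thesis by (intro sqi_bounded[where B = B]) simp_all
qed

lemma integrable_mult_poly:
  fixes f :: "real \<Rightarrow> real"
  assumes "integrable (lb_on {c..d}) f"
  shows "integrable (lb_on {c..d}) (\<lambda>s. f s * poly r s)"
proof -
  obtain B where B: "AE x in lb_on {c..d}. \<bar>poly r x\<bar> \<le> B"
    using AE_bounded_continuous[OF continuous_on_poly_real[of "{c..d}" r]] by blast
  have [measurable]: "f \<in> borel_measurable borel" using borel_measurable_integrable[OF assms] by simp
  show ?thesis
  proof (rule Bochner_Integration.integrable_bound)
    show "integrable (lb_on {c..d}) (\<lambda>s. B * f s)" using assms by simp
    show "AE s in lb_on {c..d}. norm (f s * poly r s) \<le> norm (B * f s)"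
      using B
    proof eventually_elim
      case (elim s)
      have "\<bar>f s\<bar> * \<bar>poly r s\<bar> \<le> \<bar>f s\<bar> * \<bar>B\<bar>" using elim by (intro mult_left_mono) auto
      then show ?case by (simp add: abs_mult mult.commute)
    qed
  qed simp
qed

lemma integrable_poly: "integrable (lb_on {c..d}) (poly (r :: real poly))"
  by (rule sqi_imp_integrable[OF _ sqi_poly]) simp

lemma poly_antiderivative:
  fixes r :: "real poly"
  obtains R where "pderiv R = r" "\<And>n. deg_lt n r \<Longrightarrow> deg_lt (Suc n) R"
proof -
  define S where "S = (\<Sum>i\<le>degree r. monom (coeff r i / of_nat (Suc i)) i)"
  have S: "coeff S i = coeff r i / of_nat (Suc i)" for i
    by (auto simp: S_def coeff_sum coeff_eq_0 if_distrib sum.delta cong: if_cong)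
  have "pderiv (pCons 0 S) = r"
    by (rule poly_eqI) (simp add: coeff_pderiv S del: of_nat_Suc)
  moreover have "deg_lt (Suc n) (pCons 0 S)" if "deg_lt n r" for n
    using that by (auto simp: deg_lt_def S coeff_pCons split: nat.split)
  ultimately show ?thesis by (rule that)
qed

lemma prim_poly:
  assumes "y \<in> {c..d}"
  shows "prim c d (poly (pderiv R)) y = poly R y - poly R c"
  by (rule prim_derivative) (use assms in \<open>auto intro: poly_DERIV continuous_intros\<close>)

text \<open>Integration by parts moves the primitive onto the polynomial and raises its degree by
  one; the boundary term is a multiple of the mean of \<open>f\<close>, which is zero. A primitive
  costs one order of orthogonality and in return vanishes at both end points.\<close>

lemma orth_prim:
  assumes f: "integrable (lb_on {c..d}) f" and o: "orth c d (Suc n) f"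
  shows "orth c d n (prim c d f)" "(\<integral>s. f s \<partial>lb_on {c..d}) = 0"
proof -
  let ?M = "lb_on {c..d}"
  have [measurable]: "f \<in> borel_measurable borel" using borel_measurable_integrable[OF f] by simp
  note [measurable] = prim_borel
  have "deg_lt (Suc n) 1" by (rule deg_lt_degree) simp
  then show 0: "(\<integral>s. f s \<partial>?M) = 0" using o unfolding orth_def by fastforce
  show "orth c d n (prim c d f)"
    unfolding orth_def
  proof (intro allI impI)
    fix r assume r: "deg_lt n r"
    obtain R where R: "pderiv R = r" "deg_lt (Suc n) R"
      using poly_antiderivative[of r] r by metis
    have "deg_lt (Suc n) [:poly R c:]" by (rule deg_lt_degree) simp
    then have "deg_lt (Suc n) (R - [:poly R c:])" using R(2) by (rule deg_lt_diff[rotated])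
    then have z: "(\<integral>s. f s * poly (R - [:poly R c:]) s \<partial>?M) = 0"
      using o unfolding orth_def by blast
    have "AE s in ?M. f s * prim c d (poly r) s = f s * poly (R - [:poly R c:]) s"
      using AE_lb_on_in[of "{c..d}", OF borel_closed[OF closed_atLeastAtMost]]
      by eventually_elim (simp add: prim_poly[of _ c d R] R(1)[symmetric] del: atLeastAtMost_iff)
    then have "(\<integral>s. f s * prim c d (poly r) s \<partial>?M) = 0"
      using z by (subst integral_cong_AE[where g = "\<lambda>s. f s * poly (R - [:poly R c:]) s"]) auto
    then show "(\<integral>s. prim c d f s * poly r s \<partial>?M) = 0"
      using prim_integration_by_parts[OF f integrable_poly[of c d r]] 0 by simp
  qed
qed

lemma poly_square_integral_pos:
  fixes r :: "real poly"
  assumes "c < d" "r \<noteq> 0"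
  shows "0 < (\<integral>s. (poly r s)\<^sup>2 \<partial>lb_on {c..d})"
proof (rule ccontr)
  assume "\<not> ?thesis"
  moreover have "0 \<le> (\<integral>s. (poly r s)\<^sup>2 \<partial>lb_on {c..d})" by simp
  ultimately have "(\<integral>s. (poly r s)\<^sup>2 \<partial>lb_on {c..d}) = 0" by linarith
  moreover have "integrable (lb_on {c..d}) (\<lambda>s. (poly r s)\<^sup>2)"
    using sqi_poly by (simp add: sqi_def)
  ultimately have "AE s in lb_on {c..d}. (poly r s)\<^sup>2 = 0"
    by (subst (asm) integral_nonneg_eq_0_iff_AE) auto
  then have "AE s in lb_on {c..d}. poly r s = 0" by simp
  then have "poly r x = 0" if "x \<in> {c..d}" for x
    using continuous_on_AE_eq[OF assms(1) continuous_on_poly_real continuous_on_const] that by blast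
  then have "{c..d} \<subseteq> {x. poly r x = 0}" by auto
  then have "finite {c..d}" using poly_roots_finite[OF assms(2)] by (rule finite_subset)
  then show False using assms(1) by (simp add: infinite_Icc)
qed

section \<open>Orthonormal polynomials, the projection and the size of its residual\<close>

lemma orthonormal_polynomials:
  assumes "c < d"
  shows "\<exists>e. (\<forall>i<n. deg_lt n (e i)) \<and>
    (\<forall>i<n. \<forall>j<n. (\<integral>s. poly (e i) s * poly (e j) s \<partial>lb_on {c..d}) = (if i = j then 1 else 0)) \<and>
    (\<forall>r. deg_lt n r \<longrightarrow> (\<exists>t. r = (\<Sum>i<n. smult (t i) (e i))))"
proof (induction n)
  case 0
  have "r = 0" if "deg_lt 0 r" for r using that by (auto simp: deg_lt_def poly_eq_iff intro: poly_eqI)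
  then show ?case by auto
next
  case (Suc n)
  let ?M = "lb_on {c..d}"
  obtain e where e: "\<And>i. i < n \<Longrightarrow> deg_lt n (e i)"
    and on: "\<And>i j. i < n \<Longrightarrow> j < n \<Longrightarrow> (\<integral>s. poly (e i) s * poly (e j) s \<partial>?M) = (if i = j then 1 else 0)"
    and sp: "\<And>r. deg_lt n r \<Longrightarrow> \<exists>t. r = (\<Sum>i<n. smult (t i) (e i))"
    using Suc.IH by blast
  have ii: "integrable ?M (\<lambda>s. poly p s * poly q s)" for p q
    by (rule integrable_mult_poly[OF integrable_poly])
  define b where "b i = (\<integral>s. poly (monom 1 n) s * poly (e i) s \<partial>?M)" for i
  \<comment> \<open>A Gram-Schmidt step: the monomial is made orthogonal to the earlier polynomials.
    Its leading coefficient stays 1, so it is nonzero and can be normalized.\<close>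
  define p where "p = monom 1 n - (\<Sum>i<n. smult (b i) (e i))"
  have dS: "deg_lt n (\<Sum>i<n. smult (b i) (e i))"
    by (intro deg_lt_sum deg_lt_smult) (use e in auto)
  then have pn: "coeff p n = 1" by (simp add: p_def deg_lt_def)
  then have "p \<noteq> 0" by auto
  have dp: "deg_lt (Suc n) p"
    unfolding p_def using deg_lt_mono[OF dS, of "Suc n"]
    by (intro deg_lt_diff) (auto simp: deg_lt_def)
  have po: "(\<integral>s. poly p s * poly (e j) s \<partial>?M) = 0" if "j < n" for j
  proof -
    have "(\<integral>s. poly p s * poly (e j) s \<partial>?M)
      = (\<integral>s. poly (monom 1 n) s * poly (e j) s - (\<Sum>i<n. b i * (poly (e i) s * poly (e j) s)) \<partial>?M)"
      by (simp add: p_def poly_sum left_diff_distrib sum_distrib_right mult.assoc)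
    also have "\<dots> = b j - (\<Sum>i<n. b i * (\<integral>s. poly (e i) s * poly (e j) s \<partial>?M))"
      by (subst Bochner_Integration.integral_diff)
         (auto simp: b_def ii Bochner_Integration.integral_sum)
    also have "(\<Sum>i<n. b i * (\<integral>s. poly (e i) s * poly (e j) s \<partial>?M)) = (\<Sum>i<n. if i = j then b i else 0)"
      by (rule sum.cong) (use on that in auto)
    finally show ?thesis using that by simp
  qed
  define N where "N = (\<integral>s. (poly p s)\<^sup>2 \<partial>?M)"
  have N: "N > 0" unfolding N_def by (rule poly_square_integral_pos[OF assms \<open>p \<noteq> 0\<close>])
  define f where "f = e(n := smult (1 / sqrt N) p)"
  have f: "i < n \<Longrightarrow> f i = e i" "f n = smult (1 / sqrt N) p" for i by (auto simp: f_def)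
  have 1: "\<forall>i<Suc n. deg_lt (Suc n) (f i)"
    using e dp by (auto simp: less_Suc_eq f intro: deg_lt_mono[of n] deg_lt_smult)
  have 2: "(\<integral>s. poly (f i) s * poly (f j) s \<partial>?M) = (if i = j then 1 else 0)"
    if "i < Suc n" "j < Suc n" for i j
  proof -
    have "(\<integral>s. poly (f n) s * poly (f n) s \<partial>?M) = (\<integral>s. (1 / N) * (poly p s)\<^sup>2 \<partial>?M)"
      using N by (intro Bochner_Integration.integral_cong) (auto simp: f power2_eq_square field_simps)
    also have "\<dots> = 1" using N by (simp add: N_def[symmetric])
    finally have nn: "(\<integral>s. poly (f n) s * poly (f n) s \<partial>?M) = 1" .
    have nj: "(\<integral>s. poly (f n) s * poly (f j) s \<partial>?M) = 0" if "j < n" for j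
      using po[OF that] by (simp add: f that)
    have jn: "(\<integral>s. poly (f j) s * poly (f n) s \<partial>?M) = 0" if "j < n" for j
      using nj[OF that] by (simp add: mult.commute)
    show ?thesis using that nn nj jn on by (auto simp: less_Suc_eq f)
  qed
  have 3: "\<exists>t. r = (\<Sum>i<Suc n. smult (t i) (f i))" if r: "deg_lt (Suc n) r" for r
  proof -
    \<comment> \<open>Subtracting a multiple of \<open>p\<close> removes the coefficient of order
      \<open>n\<close>, which reduces spanning to the induction hypothesis.\<close>
    have "deg_lt n (r - smult (coeff r n) p)"
      unfolding deg_lt_def
    proof (intro allI impI)
      fix i assume "n \<le> i"
      then consider "i = n" | "Suc n \<le> i" by linarith
      then show "coeff (r - smult (coeff r n) p) i = 0"
        using r dp pn by cases (auto simp: deg_lt_def)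
    qed
    then obtain t where t: "r - smult (coeff r n) p = (\<Sum>i<n. smult (t i) (e i))" using sp by blast
    let ?t = "t(n := coeff r n * sqrt N)"
    have "(\<Sum>i<Suc n. smult (?t i) (f i)) = (\<Sum>i<n. smult (t i) (e i)) + smult (coeff r n) p"
      using N by (simp add: f)
    then show ?thesis using t by (metis diff_add_cancel)
  qed
  show ?case using 1 2 3 by (intro exI[of _ f]) auto
qed

text \<open>Chosen once for each \<open>c\<close>, \<open>d\<close> and \<open>n\<close>: cells over
  the same \<open>y\<close>-interval use literally the same projection.\<close>

definition obasis :: "real \<Rightarrow> real \<Rightarrow> nat \<Rightarrow> nat \<Rightarrow> real poly" where
  "obasis c d n = (SOME e. (\<forall>i<n. deg_lt n (e i)) \<and>
    (\<forall>i<n. \<forall>j<n. (\<integral>s. poly (e i) s * poly (e j) s \<partial>lb_on {c..d}) = (if i = j then 1 else 0)) \<and>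
    (\<forall>r. deg_lt n r \<longrightarrow> (\<exists>t. r = (\<Sum>i<n. smult (t i) (e i)))))"

lemma obasis:
  assumes "c < d"
  shows "i < n \<Longrightarrow> deg_lt n (obasis c d n i)"
    and "i < n \<Longrightarrow> j < n \<Longrightarrow>
      (\<integral>s. poly (obasis c d n i) s * poly (obasis c d n j) s \<partial>lb_on {c..d}) = (if i = j then 1 else 0)"
    and "deg_lt n r \<Longrightarrow> \<exists>t. r = (\<Sum>i<n. smult (t i) (obasis c d n i))"
proof -
  note * = someI_ex[OF orthonormal_polynomials[OF assms, of n], folded obasis_def]
  show "i < n \<Longrightarrow> deg_lt n (obasis c d n i)" using * by simp
  show "i < n \<Longrightarrow> j < n \<Longrightarrow>
      (\<integral>s. poly (obasis c d n i) s * poly (obasis c d n j) s \<partial>lb_on {c..d}) = (if i = j then 1 else 0)"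
    using * by simp
  show "deg_lt n r \<Longrightarrow> \<exists>t. r = (\<Sum>i<n. smult (t i) (obasis c d n i))"
    using *[THEN conjunct2, THEN conjunct2] by blast
qed

text \<open>The orthogonal projection in \<open>L2\<close>, written through finitely many integrals
  against fixed polynomials. In this form it stays measurable in a parameter and interacts with
  Fubini's theorem.\<close>

definition proj :: "real \<Rightarrow> real \<Rightarrow> nat \<Rightarrow> (real \<Rightarrow> real) \<Rightarrow> real poly" where
  "proj c d n f = (\<Sum>i<n. smult (\<integral>s. poly (obasis c d n i) s * f s \<partial>lb_on {c..d}) (obasis c d n i))"

definition resid :: "real \<Rightarrow> real \<Rightarrow> nat \<Rightarrow> (real \<Rightarrow> real) \<Rightarrow> real \<Rightarrow> real" where
  "resid c d n f y = f y - poly (proj c d n f) y"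

lemma deg_lt_proj: "c < d \<Longrightarrow> deg_lt n (proj c d n f)"
  unfolding proj_def by (intro deg_lt_sum deg_lt_smult) (auto intro: obasis)

lemma integrable_resid:
  "integrable (lb_on {c..d}) f \<Longrightarrow> integrable (lb_on {c..d}) (resid c d n f)"
  unfolding resid_def by (intro Bochner_Integration.integrable_diff integrable_poly)

lemma sqi_resid: "sqi (lb_on {c..d}) f \<Longrightarrow> sqi (lb_on {c..d}) (resid c d n f)"
  unfolding resid_def by (intro sqi_diff sqi_poly)

lemma orth_resid:
  assumes "c < d" and f: "integrable (lb_on {c..d}) f"
  shows "orth c d n (resid c d n f)"
  unfolding orth_def
proof (intro allI impI)
  let ?M = "lb_on {c..d}" and ?e = "obasis c d n"
  fix r assume "deg_lt n r"
  then obtain t where r: "r = (\<Sum>i<n. smult (t i) (?e i))" using obasis(3)[OF assms(1)] by blast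
  have ii: "integrable ?M (\<lambda>s. poly p s * poly q s)" for p q
    by (rule integrable_mult_poly[OF integrable_poly])
  have fi: "integrable ?M (\<lambda>s. poly q s * f s)" for q
    using integrable_mult_poly[OF f, of q] by (simp add: mult.commute)
  have "(\<integral>s. resid c d n f s * poly (?e j) s \<partial>?M) = 0" if "j < n" for j
  proof -
    define b where "b i = (\<integral>s. poly (?e i) s * f s \<partial>?M)" for i
    have "(\<integral>s. resid c d n f s * poly (?e j) s \<partial>?M)
      = (\<integral>s. poly (?e j) s * f s - (\<Sum>i<n. b i * (poly (?e i) s * poly (?e j) s)) \<partial>?M)"
      by (intro Bochner_Integration.integral_cong)
        (auto simp: resid_def proj_def poly_sum left_diff_distrib right_diff_distrib sum_distrib_right
          sum_distrib_left b_def ac_simps)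
    also have "\<dots> = b j - (\<Sum>i<n. b i * (\<integral>s. poly (?e i) s * poly (?e j) s \<partial>?M))"
      by (subst Bochner_Integration.integral_diff)
         (auto simp: b_def ii fi Bochner_Integration.integral_sum)
    also have "(\<Sum>i<n. b i * (\<integral>s. poly (?e i) s * poly (?e j) s \<partial>?M)) = (\<Sum>i<n. if i = j then b i else 0)"
      by (rule sum.cong) (use obasis(2)[OF assms(1)] that in auto)
    finally show ?thesis using that by simp
  qed
  then have "(\<Sum>i<n. t i * (\<integral>s. resid c d n f s * poly (?e i) s \<partial>?M)) = 0" by simp
  moreover have "(\<integral>s. resid c d n f s * poly r s \<partial>?M)
    = (\<Sum>i<n. t i * (\<integral>s. resid c d n f s * poly (?e i) s \<partial>?M))"
    unfolding r poly_sum poly_smult sum_distrib_left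
    using integrable_mult_poly[OF integrable_resid[OF f, of n]]
    by (subst Bochner_Integration.integral_sum) (auto simp: mult.left_commute)
  ultimately show "(\<integral>s. resid c d n f s * poly r s \<partial>?M) = 0" by simp
qed

text \<open>\<open>w i\<close> plays the role of the \<open>i\<close>-th derivative of
  \<open>w 0\<close>. Each step moves one derivative off \<open>w\<close> by taking a primitive of
  the other factor, which gains a power of \<open>d - c\<close> in norm.\<close>

lemma iterated_prim:
  assumes "c < d" and \<psi>: "sqi (lb_on {c..d}) \<psi>" "orth c d n \<psi>" and "j \<le> n"
    and w: "\<And>i. i \<le> j \<Longrightarrow> sqi (lb_on {c..d}) (w i)"
    and ftc: "\<And>i. i < j \<Longrightarrow> \<exists>A. AE y in lb_on {c..d}. w i y = A + prim c d (w (Suc i)) y"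
  shows "\<exists>\<Psi>. sqi (lb_on {c..d}) \<Psi> \<and> orth c d (n - j) \<Psi> \<and>
    (\<integral>y. (\<Psi> y)\<^sup>2 \<partial>lb_on {c..d}) \<le> (d - c) ^ (2 * j) * (\<integral>y. (\<psi> y)\<^sup>2 \<partial>lb_on {c..d}) \<and>
    (\<integral>y. w 0 y * \<psi> y \<partial>lb_on {c..d}) = (-1) ^ j * (\<integral>y. w j y * \<Psi> y \<partial>lb_on {c..d})"
  using \<open>j \<le> n\<close> w ftc
proof (induction j)
  case 0
  then show ?case using \<psi> by (intro exI[of _ \<psi>]) auto
next
  case (Suc j)
  let ?M = "lb_on {c..d}"
  note [measurable] = prim_borel
  obtain \<Psi> where P: "sqi ?M \<Psi>" "orth c d (n - j) \<Psi>"
    "(\<integral>y. (\<Psi> y)\<^sup>2 \<partial>?M) \<le> (d - c) ^ (2 * j) * (\<integral>y. (\<psi> y)\<^sup>2 \<partial>?M)"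
    "(\<integral>y. w 0 y * \<psi> y \<partial>?M) = (-1) ^ j * (\<integral>y. w j y * \<Psi> y \<partial>?M)"
    using Suc.IH[OF Suc_leD[OF Suc.prems(1)] Suc.prems(2)[OF le_SucI] Suc.prems(3)[OF less_SucI]]
    by blast
  \<comment> \<open>At least one order of orthogonality is left, so the mean of
    \<open>\<Psi>\<close> is zero; this removes the constant \<open>A\<close> and the boundary
    term.\<close>
  have sn: "n - j = Suc (n - Suc j)" using Suc.prems(1) by auto
  have Pi: "integrable ?M \<Psi>" by (rule sqi_imp_integrable) (use P in simp_all)
  have wi: "integrable ?M (w (Suc j))" by (rule sqi_imp_integrable) (use Suc.prems(2) in simp_all)
  have [measurable]: "\<Psi> \<in> borel_measurable borel" "w (Suc j) \<in> borel_measurable borel"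
    "w j \<in> borel_measurable borel"
    using P(1) Suc.prems(2)[of "Suc j"] Suc.prems(2)[of j] by (auto simp: sqi_def)
  have o: "orth c d (n - Suc j) (prim c d \<Psi>)" "(\<integral>y. \<Psi> y \<partial>?M) = 0"
    using orth_prim[OF Pi P(2)[unfolded sn]] by auto
  obtain A where A: "AE y in ?M. w j y = A + prim c d (w (Suc j)) y" using Suc.prems(3)[of j] by auto
  have s: "sqi ?M (prim c d \<Psi>)" "sqi ?M (prim c d (w (Suc j)))"
    using sqi_prim(1)[of c d] P(1) Suc.prems(2)[of "Suc j"] assms(1) by auto
  have "(\<integral>y. (prim c d \<Psi> y)\<^sup>2 \<partial>?M) \<le> (d - c)\<^sup>2 * (\<integral>y. (\<Psi> y)\<^sup>2 \<partial>?M)"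
    by (rule sqi_prim(2)) (use assms(1) P(1) in auto)
  also have "\<dots> \<le> (d - c)\<^sup>2 * ((d - c) ^ (2 * j) * (\<integral>y. (\<psi> y)\<^sup>2 \<partial>?M))"
    using P(3) by (rule mult_left_mono) simp
  finally have b: "(\<integral>y. (prim c d \<Psi> y)\<^sup>2 \<partial>?M) \<le> (d - c) ^ (2 * Suc j) * (\<integral>y. (\<psi> y)\<^sup>2 \<partial>?M)"
    by (simp add: power2_eq_square algebra_simps)
  have "(\<integral>y. w j y * \<Psi> y \<partial>?M) = (\<integral>y. A * \<Psi> y + prim c d (w (Suc j)) y * \<Psi> y \<partial>?M)"
    by (rule integral_cong_AE) (use A in \<open>auto elim!: eventually_mono simp: distrib_right\<close>)
  also have "\<dots> = (\<integral>y. prim c d (w (Suc j)) y * \<Psi> y \<partial>?M)"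
    using Pi sqi_mult_integrable[OF s(2) P(1)] o(2) by simp
  also have "\<dots> = - (\<integral>y. w (Suc j) y * prim c d \<Psi> y \<partial>?M)"
    using prim_integration_by_parts[OF wi Pi] o(2) by simp
  finally show ?case using P(4) s(1) o(1) b by (intro exI[of _ "prim c d \<Psi>"]) auto
qed

text \<open>Duality in place of Taylor polynomials. The residual is orthogonal to the projection, so
  its squared norm is its product with \<open>w 0\<close>; after \<open>n\<close> integrations by
  parts, Cauchy-Schwarz returns the norm of the residual times \<open>(d - c) ^ n\<close> and the
  norm of \<open>w n\<close>, and one norm of the residual cancels.\<close>

lemma resid_bound:
  assumes "c < d"
    and w: "\<And>i. i \<le> n \<Longrightarrow> sqi (lb_on {c..d}) (w i)"
    and ftc: "\<And>i. i < n \<Longrightarrow> \<exists>A. AE y in lb_on {c..d}. w i y = A + prim c d (w (Suc i)) y"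
  shows "(\<integral>y. (resid c d n (w 0) y)\<^sup>2 \<partial>lb_on {c..d}) \<le> (d - c) ^ (2 * n) * (\<integral>y. (w n y)\<^sup>2 \<partial>lb_on {c..d})"
proof -
  let ?M = "lb_on {c..d}" and ?\<psi> = "resid c d n (w 0)"
  have w0: "sqi ?M (w 0)" using w by simp
  have wi: "integrable ?M (w 0)" by (rule sqi_imp_integrable) (use w in simp_all)
  have p: "sqi ?M ?\<psi>" "orth c d n ?\<psi>"
    using sqi_resid[OF w0] orth_resid[OF assms(1) wi] by auto
  obtain \<Psi> where P: "sqi ?M \<Psi>"
    "(\<integral>y. (\<Psi> y)\<^sup>2 \<partial>?M) \<le> (d - c) ^ (2 * n) * (\<integral>y. (?\<psi> y)\<^sup>2 \<partial>?M)"
    "(\<integral>y. w 0 y * ?\<psi> y \<partial>?M) = (-1) ^ n * (\<integral>y. w n y * \<Psi> y \<partial>?M)"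
    using iterated_prim[of c d ?\<psi> n n w, OF assms(1) p order_refl w ftc] by auto
  define R where "R = (\<integral>y. (?\<psi> y)\<^sup>2 \<partial>?M)"
  have "(\<integral>y. ?\<psi> y * poly (proj c d n (w 0)) y \<partial>?M) = 0"
    using p(2) deg_lt_proj[OF assms(1)] by (simp add: orth_def)
  moreover have "R = (\<integral>y. w 0 y * ?\<psi> y - ?\<psi> y * poly (proj c d n (w 0)) y \<partial>?M)"
    unfolding R_def by (rule Bochner_Integration.integral_cong)
      (auto simp: resid_def power2_eq_square algebra_simps)
  ultimately have "R = (\<integral>y. w 0 y * ?\<psi> y \<partial>?M)"
    using sqi_mult_integrable[OF w0 p(1)] sqi_mult_integrable[OF p(1) sqi_poly] by simp
  then have "R\<^sup>2 = (\<integral>y. w n y * \<Psi> y \<partial>?M)\<^sup>2"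
    using P(3) by (simp add: power_mult_distrib power2_eq_square flip: power_add mult_2)
  also have "\<dots> \<le> (\<integral>y. (w n y)\<^sup>2 \<partial>?M) * (\<integral>y. (\<Psi> y)\<^sup>2 \<partial>?M)"
    by (rule Cauchy_Schwarz_integral) (use w P(1) in auto)
  also have "\<dots> \<le> (\<integral>y. (w n y)\<^sup>2 \<partial>?M) * ((d - c) ^ (2 * n) * R)"
    using P(2) unfolding R_def by (rule mult_left_mono) simp
  finally have "R * R \<le> ((d - c) ^ (2 * n) * (\<integral>y. (w n y)\<^sup>2 \<partial>?M)) * R"
    by (simp add: power2_eq_square algebra_simps)
  moreover have "R \<ge> 0" by (simp add: R_def)
  moreover have "0 \<le> (d - c) ^ (2 * n) * (\<integral>y. (w n y)\<^sup>2 \<partial>?M)" using assms(1) by simp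
  ultimately show ?thesis unfolding R_def[symmetric]
    by (cases "R = 0") auto
qed

text \<open>The zeros at the end points leave a cofactor \<open>r\<close> with
  \<open>deg_lt n r\<close>; tested with \<open>r\<close>, the integrand has one sign on the
  interval. This is the unisolvence of interpolation by two end values and \<open>n\<close>
  moments.\<close>

lemma poly_eq_0_if_orth:
  assumes "c < d" and p: "deg_lt (n + 2) p" "poly p c = 0" "poly p d = 0"
    and o: "\<And>r. deg_lt n r \<Longrightarrow> (\<integral>s. poly p s * poly r s \<partial>lb_on {c..d}) = 0"
  shows "p = 0"
proof (rule ccontr)
  assume "p \<noteq> 0"
  let ?M = "lb_on {c..d}"
  obtain q where q: "p = [:-c, 1:] * q" using p(2) by (auto simp: poly_eq_0_iff_dvd)
  then have "poly q d = 0" using p(3) assms(1) by simp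
  then obtain r where r: "q = [:-d, 1:] * r" by (auto simp: poly_eq_0_iff_dvd)
  have pr: "p = [:-c, 1:] * ([:-d, 1:] * r)" using q r by simp
  have r0: "r \<noteq> 0" using \<open>p \<noteq> 0\<close> pr by auto
  have "degree p < n + 2" using p(1) \<open>p \<noteq> 0\<close> unfolding deg_lt_def
    by (metis leading_coeff_0_iff linorder_not_le)
  moreover have "degree p = 2 + degree r" unfolding pr using r0 by (simp add: degree_mult_eq del: mult_pCons_left)
  ultimately have "deg_lt n r" by (intro deg_lt_degree) simp
  then have z: "(\<integral>s. poly p s * poly r s \<partial>?M) = 0" by (rule o)
  have i: "integrable ?M (\<lambda>s. - (poly p s * poly r s))"
    using integrable_mult_poly[OF integrable_poly[of c d p], of r] by simp
  have nn: "0 \<le> - (poly p s * poly r s)" if "s \<in> {c..d}" for s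
  proof -
    have "- (poly p s * poly r s) = ((s - c) * (d - s)) * (poly r s)\<^sup>2"
      by (simp add: pr power2_eq_square algebra_simps)
    also have "\<dots> \<ge> 0" using that by (intro mult_nonneg_nonneg) auto
    finally show ?thesis .
  qed
  have "AE s in ?M. 0 \<le> - (poly p s * poly r s)"
    using nn by (auto simp: AE_lb_on)
  then have "AE s in ?M. - (poly p s * poly r s) = 0"
    using integral_nonneg_eq_0_iff_AE[OF i] z by simp
  then have ae: "AE s in ?M. poly (p * r) s = 0" by simp
  have "poly (p * r) x = 0" if "x \<in> {c..d}" for x
    using continuous_on_AE_eq[OF assms(1) continuous_on_poly_real continuous_on_const ae that] .
  then have "{c..d} \<subseteq> {x. poly (p * r) x = 0}" by blast
  moreover have "p * r \<noteq> 0" using \<open>p \<noteq> 0\<close> r0 by simp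
  ultimately have "finite {c..d}" using poly_roots_finite finite_subset by blast
  then show False using assms(1) by (simp add: infinite_Icc)
qed

section \<open>Smooth functions of one variable\<close>

text \<open>Differentiability of order \<open>n\<close> on the whole line, with no continuity asked
  of the last derivative. The recursion through some \<open>f'\<close> makes closure properties
  plain inductions.\<close>

primrec sm :: "nat \<Rightarrow> (real \<Rightarrow> real) \<Rightarrow> bool" where
  "sm 0 f \<longleftrightarrow> True"
| "sm (Suc n) f \<longleftrightarrow> (\<exists>f'. (\<forall>x. (f has_real_derivative f' x) (at x)) \<and> sm n f')"

definition smooth :: "(real \<Rightarrow> real) \<Rightarrow> bool" where
  "smooth f \<longleftrightarrow> (\<forall>n. sm n f)"

lemma sm_SucD: "sm (Suc n) f \<Longrightarrow> sm n f"
proof (induction n arbitrary: f)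
  case (Suc n)
  then obtain f' where "\<forall>x. (f has_real_derivative f' x) (at x)" "sm (Suc n) f'" by auto
  then show ?case using Suc.IH[of f'] by auto
qed simp

text \<open>One joint induction, because the product rule turns a product into a sum of
  products.\<close>

lemma sm_mult: "sm n f \<Longrightarrow> sm n g \<Longrightarrow> sm n (\<lambda>x. f x * g x)"
  and sm_add: "sm n f \<Longrightarrow> sm n g \<Longrightarrow> sm n (\<lambda>x. f x + g x)"
proof (induction n arbitrary: f g)
  case (Suc n)
  {
    case 1
    then obtain f' g' where *: "\<forall>x. (f has_real_derivative f' x) (at x)" "sm n f'"
      "\<forall>x. (g has_real_derivative g' x) (at x)" "sm n g'" by auto
    have "\<forall>x. ((\<lambda>x. f x * g x) has_real_derivative f x * g' x + f' x * g x) (at x)"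
      using * by (auto intro!: derivative_eq_intros)
    moreover have "sm n (\<lambda>x. f x * g' x + f' x * g x)"
      by (rule Suc.IH(2)[OF Suc.IH(1)[OF sm_SucD[OF 1(1)] *(4)] Suc.IH(1)[OF *(2) sm_SucD[OF 1(2)]]])
    ultimately show ?case unfolding sm.simps by (intro exI[of _ "\<lambda>x. f x * g' x + f' x * g x"]) blast
  next
    case 2
    then obtain f' g' where *: "\<forall>x. (f has_real_derivative f' x) (at x)" "sm n f'"
      "\<forall>x. (g has_real_derivative g' x) (at x)" "sm n g'" by auto
    have "\<forall>x. ((\<lambda>x. f x + g x) has_real_derivative f' x + g' x) (at x)"
      using * by (auto intro!: derivative_eq_intros)
    moreover have "sm n (\<lambda>x. f' x + g' x)" by (rule Suc.IH(2)[OF *(2) *(4)])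
    ultimately show ?case unfolding sm.simps by (intro exI[of _ "\<lambda>x. f' x + g' x"]) blast
  }
qed simp_all

lemma sm_const: "sm n (\<lambda>_. c)"
proof (induction n arbitrary: c)
  case (Suc n)
  show ?case unfolding sm.simps using Suc.IH[of 0] by (intro exI[of _ "\<lambda>_. 0"]) auto
qed simp

lemma sm_affine: "sm n f \<Longrightarrow> sm n (\<lambda>x. f (s * x + t))"
proof (induction n arbitrary: f)
  case (Suc n)
  then obtain f' where *: "\<forall>x. (f has_real_derivative f' x) (at x)" "sm n f'" by auto
  have "((\<lambda>x. f (s * x + t)) has_real_derivative s * f' (s * x + t)) (at x)" for x
  proof -
    have "(f has_real_derivative f' (s * x + t)) (at (s * x + t))" using * by blast
    moreover have "((\<lambda>x. s * x + t) has_real_derivative s) (at x)"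
      by (auto intro!: derivative_eq_intros)
    ultimately have "((\<lambda>x. f (s * x + t)) has_real_derivative f' (s * x + t) * s) (at x)"
      by (rule DERIV_chain2[where g = "\<lambda>x. s * x + t"])
    then show ?thesis by (simp add: mult.commute)
  qed
  moreover have "sm n (\<lambda>x. s * f' (s * x + t))"
    by (intro sm_mult sm_const Suc.IH *)
  ultimately show ?case unfolding sm.simps by (intro exI[of _ "\<lambda>x. s * f' (s * x + t)"]) blast
qed simp

lemma smooth_mult: "smooth f \<Longrightarrow> smooth g \<Longrightarrow> smooth (\<lambda>x. f x * g x)"
  by (simp add: smooth_def sm_mult)

lemma smooth_add: "smooth f \<Longrightarrow> smooth g \<Longrightarrow> smooth (\<lambda>x. f x + g x)"
  by (simp add: smooth_def sm_add)

lemma smooth_const: "smooth (\<lambda>_. c)"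
  by (simp add: smooth_def sm_const)

lemma smooth_affine: "smooth f \<Longrightarrow> smooth (\<lambda>x. f (s * x + t))"
  by (simp add: smooth_def sm_affine)

lemma smooth_diff: "smooth f \<Longrightarrow> smooth g \<Longrightarrow> smooth (\<lambda>x. f x - g x)"
  using smooth_add[of f "\<lambda>x. (-1) * g x"] smooth_mult[OF smooth_const[of "-1"]] by simp

lemma smooth_deriv:
  assumes "smooth f"
  shows "(f has_real_derivative deriv f x) (at x)" "smooth (deriv f)"
proof -
  have "\<forall>n. \<exists>f'. (\<forall>x. (f has_real_derivative f' x) (at x)) \<and> sm n f'"
    using assms unfolding smooth_def by (metis sm.simps(2))
  then have "(\<forall>x. (f has_real_derivative deriv f x) (at x)) \<and> sm n (deriv f)" for n
  proof -
    obtain f' where f': "\<forall>x. (f has_real_derivative f' x) (at x)" "sm n f'"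
      using \<open>\<forall>n. \<exists>f'. _ n f'\<close> by blast
    then have "deriv f = f'" by (auto simp: fun_eq_iff intro: DERIV_imp_deriv)
    then show ?thesis using f' by simp
  qed
  then show "(f has_real_derivative deriv f x) (at x)" "smooth (deriv f)"
    by (auto simp: smooth_def)
qed

lemma smooth_antideriv:
  assumes "\<And>x. (F has_real_derivative f x) (at x)" "smooth f"
  shows "smooth F"
  unfolding smooth_def
proof
  fix n
  show "sm n F"
    using assms by (cases n) (auto simp: smooth_def)
qed

lemma smooth_continuous: "smooth f \<Longrightarrow> continuous_on S f"
  using smooth_deriv(1) by (intro DERIV_continuous_on[where D = "deriv f"]) (auto intro: has_field_derivative_at_within)

lemma smooth_borel: "smooth f \<Longrightarrow> f \<in> borel_measurable borel"
  by (rule borel_measurable_continuous_onI[OF smooth_continuous])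

section \<open>Smooth steps and test functions on an interval, from
  \<open>exp (- (1 / x))\<close>\<close>

definition flat :: "nat \<Rightarrow> real \<Rightarrow> real" where
  "flat m x = (if x \<le> 0 then 0 else (1 / x) ^ m * exp (- (1 / x)))"

lemma flat_tendsto: "((\<lambda>x. (1 / x) ^ m * exp (- (1 / x))) \<longlongrightarrow> 0) (at_right (0::real))"
proof -
  have "((\<lambda>x::real. x ^ m * exp (- x)) \<longlongrightarrow> 0) at_top"
    using tendsto_power_div_exp_0[of m] by (simp add: exp_minus field_simps)
  moreover have "filterlim (\<lambda>x::real. 1 / x) at_top (at_right 0)"
    using filterlim_inverse_at_top_right by (simp add: inverse_eq_divide)
  ultimately show ?thesis by (rule filterlim_compose)
qed

text \<open>The powers of \<open>1 / x\<close> are part of the family so that it is closed under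
  differentiation up to linear combinations; smoothness of all members then follows by one
  induction.\<close>

lemma DERIV_flat: "(flat m has_real_derivative flat (m + 2) x - of_nat m * flat (m + 1) x) (at x)"
proof -
  consider "x < 0" | "x = 0" | "x > 0" by linarith
  then show ?thesis
  proof cases
    case 1
    have "((\<lambda>_. 0) has_real_derivative 0) (at x)" by simp
    then have "(flat m has_real_derivative 0) (at x)"
      by (rule has_field_derivative_transform_within_open[where S = "{..<0}"]) (use 1 in \<open>auto simp: flat_def\<close>)
    then show ?thesis using 1 by (simp add: flat_def)
  next
    case 2
    have "((\<lambda>h. (flat m (0 + h) - flat m 0) / h) \<longlongrightarrow> 0) (at 0)"
      unfolding filterlim_split_at_real
    proof (rule filterlim_split_at)
      show "((\<lambda>h. (flat m (0 + h) - flat m 0) / h) \<longlongrightarrow> 0) (at_left 0)"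
        by (rule tendsto_eventually, rule eventually_at_leftI[of "-1"]) (auto simp: flat_def)
      \<comment> \<open>The right difference quotient at 0 is the next member of the family, which
        tends to 0.\<close>
      have "\<forall>\<^sub>F h in at_right 0. (1 / h) ^ (Suc m) * exp (- (1 / h)) = (flat m (0 + h) - flat m 0) / h"
        by (rule eventually_at_rightI[of 0 1]) (auto simp: flat_def)
      then show "((\<lambda>h. (flat m (0 + h) - flat m 0) / h) \<longlongrightarrow> 0) (at_right 0)"
        using flat_tendsto[of "Suc m"] by (rule Lim_transform_eventually[rotated])
    qed
    then show ?thesis using 2 by (simp add: DERIV_def flat_def)
  next
    case 3
    have "((\<lambda>x. (1 / x) ^ m * exp (- (1 / x))) has_real_derivative flat (m + 2) x - of_nat m * flat (m + 1) x) (at x)"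
    proof -
      have i: "((\<lambda>x. 1 / x) has_real_derivative - ((1 / x)\<^sup>2)) (at x)"
        using 3 by (auto intro!: derivative_eq_intros simp: power2_eq_square)
      have p: "((\<lambda>x. (1 / x) ^ m) has_real_derivative - (of_nat m * (1 / x) ^ (m + 1))) (at x)"
        using DERIV_power[OF i, of m] by (cases m) (simp_all add: power2_eq_square ac_simps)
      have e: "((\<lambda>x. exp (- (1 / x))) has_real_derivative exp (- (1 / x)) * (1 / x)\<^sup>2) (at x)"
        using DERIV_chain2[OF DERIV_exp DERIV_minus[OF i]] by simp
      show ?thesis
        by (rule DERIV_cong[OF DERIV_mult[OF p e]]) (use 3 in \<open>simp add: flat_def power2_eq_square algebra_simps\<close>)
    qed
    then show ?thesis
      by (rule has_field_derivative_transform_within_open[where S = "{0<..}"]) (use 3 in \<open>auto simp: flat_def\<close>)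
  qed
qed

lemma smooth_flat: "smooth (flat m)"
proof -
  have "sm n (flat m)" for n
  proof (induction n arbitrary: m)
    case (Suc n)
    have "sm n (\<lambda>x. flat (m + 2) x + (- of_nat m) * flat (m + 1) x)"
      by (intro sm_add sm_mult sm_const Suc.IH)
    then show ?case unfolding sm.simps using DERIV_flat[of m]
      by (intro exI[of _ "\<lambda>x. flat (m + 2) x - of_nat m * flat (m + 1) x"]) simp
  qed simp
  then show ?thesis by (simp add: smooth_def)
qed

definition bump :: "real \<Rightarrow> real \<Rightarrow> real \<Rightarrow> real" where
  "bump p q x = flat 0 (x - p) * flat 0 (q - x)"

lemma smooth_bump: "smooth (bump p q)"
  using smooth_mult[OF smooth_affine[OF smooth_flat[of 0], of 1 "-p"] smooth_affine[OF smooth_flat[of 0], of "-1" q]]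
  by (simp add: bump_def[abs_def])

lemma bump_nonneg: "bump p q x \<ge> 0"
  by (simp add: bump_def flat_def)

lemma bump_pos: "p < x \<Longrightarrow> x < q \<Longrightarrow> bump p q x > 0"
  by (simp add: bump_def flat_def)

lemma bump_zero: "x \<notin> {p..q} \<Longrightarrow> bump p q x = 0"
  by (auto simp: bump_def flat_def)

lemma smooth_compact_antideriv:
  assumes f: "smooth f" "\<And>x. x \<notin> {p..q} \<Longrightarrow> f x = 0"
  obtains F where "smooth F" "\<And>x. (F has_real_derivative f x) (at x)"
    "\<And>x. x \<le> p \<Longrightarrow> F x = 0" "\<And>x. x \<ge> q \<Longrightarrow> F x = F q"
proof -
  \<comment> \<open>Starting one unit to the left of \<open>p\<close> keeps \<open>p\<close> in the
    interior of the range of integration, so that the derivative at \<open>p\<close> itself is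
    two-sided.\<close>
  define G where "G x = integral {p - 1..x} f" for x
  define F where "F x = G x - G p" for x
  have G0: "G x = 0" if "x < p" for x
  proof -
    have "integral {p - 1..x} f = integral {p - 1..x} (\<lambda>_. 0)"
      by (rule integral_cong) (use f(2) that in auto)
    then show ?thesis by (simp add: G_def)
  qed
  have DG: "(G has_real_derivative f x) (at x)" for x
  proof (cases "x < p")
    case True
    have "((\<lambda>_. 0) has_real_derivative 0) (at x)" by simp
    then have "(G has_real_derivative 0) (at x)"
      by (rule has_field_derivative_transform_within_open[where S = "{..<p}"]) (use True G0 in auto)
    then show ?thesis using f(2)[of x] True by simp
  next
    case False
    have "(G has_real_derivative f x) (at x within {p - 1..x + 1})"
      unfolding G_def by (rule integral_has_real_derivative[OF smooth_continuous[OF f(1)]]) (use False in auto)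
    moreover have "x \<in> interior {p - 1..x + 1}" using False by simp
    ultimately show ?thesis by (metis at_within_interior)
  qed
  have DF: "(F has_real_derivative f x) (at x)" for x
    unfolding F_def using DG by (auto intro!: derivative_eq_intros)
  have "F x = 0" if "x \<le> p" for x
  proof (cases "x = p")
    case False
    have "G (p - 1) = G p"
    proof (rule DERIV_isconst2[of "p - 1" p G, symmetric])
      show "continuous_on {p - 1..p} G"
        by (rule DERIV_continuous_on[OF has_field_derivative_at_within[OF DG]])
      show "DERIV G x :> 0" if "p - 1 < x" "x < p" for x
        using DG[of x] f(2)[of x] that by simp
    qed auto
    then show ?thesis using G0[of x] G0[of "p - 1"] that False by (simp add: F_def)
  qed (simp add: F_def)
  moreover have "F x = F q" if "x \<ge> q" for x
  proof (cases "x = q")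
    case False
    show ?thesis
    proof (rule DERIV_isconst2[of q x F])
      show "continuous_on {q..x} F"
        by (rule DERIV_continuous_on[OF has_field_derivative_at_within[OF DF]])
      show "DERIV F y :> 0" if "q < y" "y < x" for y
        using DF[of y] f(2)[of y] that by simp
    qed (use that False in auto)
  qed simp
  ultimately show ?thesis using that[OF smooth_antideriv[OF DF f(1)] DF] by blast
qed

text \<open>The primitive of a bump, divided by its total mass; the mass is positive because the
  bump is positive inside the interval.\<close>

lemma smooth_step:
  assumes "p < q"
  obtains \<sigma> where "smooth \<sigma>" "\<And>x. x \<le> p \<Longrightarrow> \<sigma> x = 0" "\<And>x. x \<ge> q \<Longrightarrow> \<sigma> x = 1"
    "\<And>x. 0 \<le> \<sigma> x" "\<And>x. \<sigma> x \<le> 1"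
proof -
  obtain F where F: "smooth F" "\<And>x. (F has_real_derivative bump p q x) (at x)"
    "\<And>x. x \<le> p \<Longrightarrow> F x = 0" "\<And>x. x \<ge> q \<Longrightarrow> F x = F q"
    using smooth_compact_antideriv[OF smooth_bump bump_zero, of p q] by metis
  have mono: "F x \<le> F y" if "x \<le> y" for x y
    by (rule DERIV_nonneg_imp_nondecreasing[OF that]) (use F(2) bump_nonneg in blast)
  have "F p < F q"
  proof (rule DERIV_pos_imp_increasing_open[OF assms])
    show "\<exists>y. DERIV F x :> y \<and> y > 0" if "p < x" "x < q" for x
      using F(2) bump_pos that by blast
    show "continuous_on {p..q} F" by (rule smooth_continuous[OF F(1)])
  qed
  then have pos: "F q > 0" using F(3)[of p] by simp
  have bd: "0 \<le> F x" "F x \<le> F q" for x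
  proof -
    show "0 \<le> F x" using mono[of p x] F(3)[of x] F(3)[of p] by (cases "x \<le> p") auto
    show "F x \<le> F q" using mono[of x q] F(4)[of x] by (cases "x \<le> q") auto
  qed
  show ?thesis
  proof (rule that[of "\<lambda>x. (1 / F q) * F x"])
    show "smooth (\<lambda>x. (1 / F q) * F x)" by (intro smooth_mult smooth_const F)
    show "(1 / F q) * F x = 1" if "x \<ge> q" for x using F(4)[OF that] pos by simp
  qed (use pos bd F(3) in auto)
qed

text \<open>The support lies in a compact interval strictly inside. A product of two such functions
  is therefore a test function on any domain that contains the open rectangle.\<close>

definition test1 :: "real \<Rightarrow> real \<Rightarrow> (real \<Rightarrow> real) \<Rightarrow> bool" where
  "test1 a b \<psi> \<longleftrightarrow> smooth \<psi> \<and> (\<exists>p q. a < p \<and> p \<le> q \<and> q < b \<and> (\<forall>x. x \<notin> {p..q} \<longrightarrow> \<psi> x = 0))"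

lemma test1_mono: "test1 p q \<psi> \<Longrightarrow> a \<le> p \<Longrightarrow> q \<le> b \<Longrightarrow> test1 a b \<psi>"
  unfolding test1_def by (meson le_less_trans less_le_trans)

lemma test1_zero: "test1 a b \<psi> \<Longrightarrow> x \<notin> {a<..<b} \<Longrightarrow> \<psi> x = 0"
  unfolding test1_def by force

lemma test1_deriv:
  assumes "test1 a b \<psi>"
  shows "test1 a b (deriv \<psi>)"
proof -
  obtain p q where pq: "smooth \<psi>" "a < p" "p \<le> q" "q < b" "\<And>x. x \<notin> {p..q} \<Longrightarrow> \<psi> x = 0"
    using assms by (auto simp: test1_def)
  have "deriv \<psi> x = 0" if "x \<notin> {p..q}" for x
  proof -
    have "((\<lambda>_. 0) has_real_derivative 0) (at x)" by simp
    then have "(\<psi> has_real_derivative 0) (at x)"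
      by (rule has_field_derivative_transform_within_open[where S = "- {p..q}"]) (use that pq(5) in auto)
    then show ?thesis by (rule DERIV_imp_deriv)
  qed
  then show ?thesis unfolding test1_def using smooth_deriv(2)[OF pq(1)] pq(2-4) by blast
qed

lemma test1_bounded:
  assumes "test1 a b \<psi>"
  obtains B where "\<And>x. \<bar>\<psi> x\<bar> \<le> B"
proof -
  have "continuous_on {a..b} \<psi>" using assms smooth_continuous by (auto simp: test1_def)
  then have "bounded (\<psi> ` {a..b})" by (intro compact_imp_bounded compact_continuous_image) auto
  then obtain B where B: "\<forall>x\<in>{a..b}. \<bar>\<psi> x\<bar> \<le> B" by (auto simp: bounded_iff)
  have "\<bar>\<psi> x\<bar> \<le> max B 0" for x
  proof (cases "x \<in> {a..b}")
    case True
    then show ?thesis using B by fastforce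
  next
    case False
    then have "\<psi> x = 0" by (intro test1_zero[OF assms]) auto
    then show ?thesis by simp
  qed
  then show ?thesis by (rule that)
qed

text \<open>A common bound and convergence at every point are what dominated convergence asks for
  when indicators of boxes are approximated by tensor products.\<close>

lemma test1_indicator_approx:
  assumes "a < b"
  obtains \<xi> where "\<And>n. test1 a b (\<xi> n)" "\<And>n x. \<bar>\<xi> n x\<bar> \<le> 1"
    "\<And>x. (\<lambda>n. \<xi> n x) \<longlonglongrightarrow> indicator {a<..<b} x"
proof -
  \<comment> \<open>The bound \<open>5 * \<delta> n \<le> b - a\<close> keeps the layers between
    \<open>a + \<delta> n\<close> and \<open>a + 2 * \<delta> n\<close> and between
    \<open>b - 2 * \<delta> n\<close> and \<open>b - \<delta> n\<close> disjoint; the difference of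
    two steps then rises to 1 and falls back to 0.\<close>
  define \<delta> where "\<delta> n = (b - a) / (real n + 5)" for n :: nat
  have \<delta>: "\<delta> n > 0" "5 * \<delta> n \<le> b - a" for n
  proof -
    have "(b - a) * 5 \<le> (b - a) * (real n + 5)" using assms by (intro mult_left_mono) auto
    then show "5 * \<delta> n \<le> b - a" by (simp add: \<delta>_def divide_le_eq mult.commute)
  qed (use assms in \<open>auto simp: \<delta>_def\<close>)
  have "\<forall>n. \<exists>\<xi>. test1 a b \<xi> \<and> (\<forall>x. \<bar>\<xi> x\<bar> \<le> 1) \<and> (\<forall>x\<in>{a + 2 * \<delta> n..b - 2 * \<delta> n}. \<xi> x = 1)"
  proof
    fix n
    obtain \<sigma> where s: "smooth \<sigma>" "\<And>x. x \<le> a + \<delta> n \<Longrightarrow> \<sigma> x = 0" "\<And>x. x \<ge> a + 2 * \<delta> n \<Longrightarrow> \<sigma> x = 1"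
      "\<And>x. 0 \<le> \<sigma> x" "\<And>x. \<sigma> x \<le> 1"
      using smooth_step[of "a + \<delta> n" "a + 2 * \<delta> n"] \<delta>(1)[of n] by auto
    obtain \<tau> where t: "smooth \<tau>" "\<And>x. x \<le> b - 2 * \<delta> n \<Longrightarrow> \<tau> x = 0" "\<And>x. x \<ge> b - \<delta> n \<Longrightarrow> \<tau> x = 1"
      "\<And>x. 0 \<le> \<tau> x" "\<And>x. \<tau> x \<le> 1"
      using smooth_step[of "b - 2 * \<delta> n" "b - \<delta> n"] \<delta>(1)[of n] by auto
    have "test1 a b (\<lambda>x. \<sigma> x - \<tau> x)"
      unfolding test1_def using \<delta>[of n] s t
      by (intro conjI smooth_diff exI[of _ "a + \<delta> n"] exI[of _ "b - \<delta> n"]) auto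
    moreover have "\<bar>\<sigma> x - \<tau> x\<bar> \<le> 1" for x
      using s(4,5)[of x] t(4,5)[of x] by (auto simp: abs_le_iff) 
    moreover have "\<sigma> x - \<tau> x = 1" if "x \<in> {a + 2 * \<delta> n..b - 2 * \<delta> n}" for x
      using that s(3) t(2) by simp
    ultimately show "\<exists>\<xi>. test1 a b \<xi> \<and> (\<forall>x. \<bar>\<xi> x\<bar> \<le> 1) \<and> (\<forall>x\<in>{a + 2 * \<delta> n..b - 2 * \<delta> n}. \<xi> x = 1)"
      by blast
  qed
  then obtain \<xi> where \<xi>: "\<And>n. test1 a b (\<xi> n)" "\<And>n x. \<bar>\<xi> n x\<bar> \<le> 1"
    "\<And>n x. x \<in> {a + 2 * \<delta> n..b - 2 * \<delta> n} \<Longrightarrow> \<xi> n x = 1"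
    by metis
  have lim: "(\<lambda>n. \<xi> n x) \<longlonglongrightarrow> indicator {a<..<b} x" for x
  proof (cases "x \<in> {a<..<b}")
    case True
    have d0: "\<delta> \<longlonglongrightarrow> 0" unfolding \<delta>_def by real_asymp
    have "(\<lambda>n. a + 2 * \<delta> n) \<longlonglongrightarrow> a + 2 * 0" "(\<lambda>n. b - 2 * \<delta> n) \<longlonglongrightarrow> b - 2 * 0"
      by (intro tendsto_intros d0)+
    then have "\<forall>\<^sub>F n in sequentially. a + 2 * \<delta> n < x" "\<forall>\<^sub>F n in sequentially. x < b - 2 * \<delta> n"
      using True by (auto intro: order_tendstoD)
    then have "\<forall>\<^sub>F n in sequentially. \<xi> n x = indicator {a<..<b} x"
      by eventually_elim (use True \<xi>(3) in auto)
    then show ?thesis by (rule tendsto_eventually)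
  next
    case False
    then show ?thesis using test1_zero[OF \<xi>(1)] by simp
  qed
  show ?thesis using that[OF \<xi>(1,2) lim] .
qed

section \<open>Integration on rectangles\<close>

lemma borel_real_pair: "borel \<Otimes>\<^sub>M borel = (borel :: (real \<times> real) measure)"
  by (rule borel_prod)

lemma borel_slice:
  assumes "f \<in> borel_measurable (borel :: (real \<times> real) measure)"
  shows "(\<lambda>y. f (x, y)) \<in> borel_measurable borel" "(\<lambda>x. f (x, y)) \<in> borel_measurable borel"
  using assms unfolding borel_real_pair[symmetric] by measurable

lemma lb_rect: "lb_on ({a..b} \<times> {c..d :: real}) = lb_on {a..b :: real} \<Otimes>\<^sub>M lb_on {c..d}"
  by (rule lb_on_Times) auto

lemma pair_sigma_finite_lb: "pair_sigma_finite (lb_on {a..b :: real}) (lb_on {c..d :: real})"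
proof -
  interpret A: finite_measure "lb_on {a..b}" by simp
  interpret B: finite_measure "lb_on {c..d}" by simp
  show ?thesis by standard
qed

lemma rect_borel [simp, measurable]: "{a..b} \<times> {c..d} \<in> sets (borel :: (real \<times> real) measure)"
  by (intro borel_closed closed_Times) auto

lemma finite_measure_rect [simp]:
  fixes a b c d :: real
  shows "finite_measure (lb_on ({a..b} \<times> {c..d}))"
  by (rule finite_measure_lb_on) (auto intro: bounded_Times)

context
  fixes a b c d :: real and f :: "real \<times> real \<Rightarrow> real"
  assumes f: "integrable (lb_on ({a..b} \<times> {c..d})) f"
begin

interpretation P: pair_sigma_finite "lb_on {a..b}" "lb_on {c..d}"
  by (rule pair_sigma_finite_lb)

lemma rect_integral_xy:
  "integral\<^sup>L (lb_on ({a..b} \<times> {c..d})) f = (\<integral>x. (\<integral>y. f (x, y) \<partial>lb_on {c..d}) \<partial>lb_on {a..b})"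
  using P.integral_fst'[of f] f by (simp add: lb_rect)

lemma rect_integral_yx:
  "integral\<^sup>L (lb_on ({a..b} \<times> {c..d})) f = (\<integral>y. (\<integral>x. f (x, y) \<partial>lb_on {a..b}) \<partial>lb_on {c..d})"
  using P.integral_snd[of "\<lambda>x y. f (x, y)"] f by (simp add: lb_rect)

lemma rect_AE_integrable_y: "AE x in lb_on {a..b}. integrable (lb_on {c..d}) (\<lambda>y. f (x, y))"
  using P.AE_integrable_fst'[of f] f by (simp add: lb_rect)

lemma rect_AE_integrable_x: "AE y in lb_on {c..d}. integrable (lb_on {a..b}) (\<lambda>x. f (x, y))"
  using P.AE_integrable_snd[of "\<lambda>x y. f (x, y)"] f by (simp add: lb_rect)

lemma rect_integrable_x: "integrable (lb_on {a..b}) (\<lambda>x. \<integral>y. f (x, y) \<partial>lb_on {c..d})"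
  using P.integrable_fst'[of f] f by (simp add: lb_rect)

lemma rect_integrable_y: "integrable (lb_on {c..d}) (\<lambda>y. \<integral>x. f (x, y) \<partial>lb_on {a..b})"
  using P.integrable_snd[of "\<lambda>x y. f (x, y)"] f by (simp add: lb_rect)

end

lemma rect_AE_xy:
  fixes a b c d :: real
  assumes "AE z in lb_on ({a..b} \<times> {c..d :: real}). P z"
  shows "AE x in lb_on {a..b :: real}. AE y in lb_on {c..d}. P (x, y)"
proof -
  interpret P: pair_sigma_finite "lb_on {a..b}" "lb_on {c..d}" by (rule pair_sigma_finite_lb)
  show ?thesis using assms P.AE_pair[of P] unfolding lb_rect by blast
qed

lemma rect_AE_swap:
  "(AE z in lb_on ({a..b} \<times> {c..d}). P z) \<longleftrightarrow> (AE z in lb_on ({c..d} \<times> {a..b}). P (snd z, fst z))"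
  for a b c d :: real
proof -
  interpret Q: pair_sigma_finite "lb_on {c..d}" "lb_on {a..b}" by (rule pair_sigma_finite_lb)
  interpret P: pair_sigma_finite "lb_on {a..b}" "lb_on {c..d}" by (rule pair_sigma_finite_lb)
  have 1: "AE z in lb_on ({c..d} \<times> {a..b}). P (snd z, fst z)"
    if "AE z in lb_on ({a..b} \<times> {c..d}). P z" for P and a b c d :: real
  proof -
    interpret P: pair_sigma_finite "lb_on {a..b}" "lb_on {c..d}" by (rule pair_sigma_finite_lb)
    have "AE z in distr (lb_on {c..d} \<Otimes>\<^sub>M lb_on {a..b}) (lb_on {a..b} \<Otimes>\<^sub>M lb_on {c..d}) (\<lambda>(x, y). (y, x)). P z"
      using that unfolding lb_rect by (subst (asm) P.distr_pair_swap)
    then have "AE z in lb_on {c..d} \<Otimes>\<^sub>M lb_on {a..b}. P (case z of (x, y) \<Rightarrow> (y, x))"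
      by (rule AE_distrD[OF measurable_pair_swap'])
    then show ?thesis unfolding lb_rect by (simp add: case_prod_unfold)
  qed
  from 1[where P = P and a = a and b = b and c = c and d = d]
    1[where P = "\<lambda>z. P (snd z, fst z)" and a = c and b = d and c = a and d = b]
  show ?thesis by auto
qed

lemma rect_AE_yx:
  fixes a b c d :: real
  assumes "AE z in lb_on ({a..b} \<times> {c..d :: real}). P z"
  shows "AE y in lb_on {c..d}. AE x in lb_on {a..b :: real}. P (x, y)"
  using rect_AE_xy[of "\<lambda>z. P (snd z, fst z)" c d a b] assms rect_AE_swap[of P a b c d] by simp

lemma rect_integrableI:
  fixes a b c d :: real
  assumes "f \<in> borel_measurable borel"
    and "integrable (lb_on {a..b}) (\<lambda>x. \<integral>y. \<bar>f (x, y)\<bar> \<partial>lb_on {c..d})"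
    and "AE x in lb_on {a..b}. integrable (lb_on {c..d}) (\<lambda>y. f (x, y))"
  shows "integrable (lb_on ({a..b} \<times> {c..d})) (f :: real \<times> real \<Rightarrow> real)"
proof -
  interpret P: pair_sigma_finite "lb_on {a..b}" "lb_on {c..d}" by (rule pair_sigma_finite_lb)
  have "f \<in> borel_measurable (lb_on ({a..b} \<times> {c..d}))" using assms(1) by simp
  then show ?thesis unfolding lb_rect by (rule P.Fubini_integrable) (use assms(2,3) in simp_all)
qed

lemma rect_integrable_fst:
  fixes a b c d :: real
  assumes h: "integrable (lb_on {a..b}) h"
  shows "integrable (lb_on ({a..b} \<times> {c..d :: real})) (\<lambda>z. h (fst z) :: real)"
proof (rule rect_integrableI)
  have "h \<in> borel_measurable borel" using borel_measurable_integrable[OF h] by simp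
  then show "(\<lambda>z. h (fst z)) \<in> borel_measurable (borel :: (real \<times> real) measure)"
    unfolding borel_real_pair[symmetric] by measurable
  show "AE x in lb_on {a..b}. integrable (lb_on {c..d}) (\<lambda>y. h (fst (x, y)))"
    by (rule AE_I2) (simp add: finite_measure.integrable_const)
qed (use h in simp)

lemma rect_integrable_swap:
  "integrable (lb_on ({c..d} \<times> {a..b})) (\<lambda>z. f (snd z, fst z) :: real) \<longleftrightarrow>
    integrable (lb_on ({a..b} \<times> {c..d})) f" for a b c d :: real
proof -
  interpret P: pair_sigma_finite "lb_on {a..b}" "lb_on {c..d}" by (rule pair_sigma_finite_lb)
  show ?thesis using P.integrable_product_swap_iff[of f] by (simp add: lb_rect case_prod_unfold)
qed

lemma rect_integral_swap:
  fixes a b c d :: real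
  assumes "f \<in> borel_measurable borel"
  shows "(\<integral>z. f (snd z, fst z) \<partial>lb_on ({c..d} \<times> {a..b})) = (integral\<^sup>L (lb_on ({a..b} \<times> {c..d})) f :: real)"
proof -
  interpret P: pair_sigma_finite "lb_on {a..b}" "lb_on {c..d}" by (rule pair_sigma_finite_lb)
  have "f \<in> borel_measurable (lb_on ({a..b} \<times> {c..d}))" using assms by simp
  then show ?thesis using P.integral_product_swap[of f] by (simp add: lb_rect case_prod_unfold)
qed

lemma rect_integrable_snd:
  fixes a b c d :: real
  assumes h: "integrable (lb_on {c..d}) h"
  shows "integrable (lb_on ({a..b :: real} \<times> {c..d})) (\<lambda>z. h (snd z) :: real)"
  using rect_integrable_fst[OF h, of a b] rect_integrable_swap[of a b c d "\<lambda>z. h (fst z)"] by simp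

text \<open>Vertical lines are null sets. Together with the horizontal case this makes closed and
  open cells interchangeable under integrals.\<close>

lemma AE_fst_neq: "AE z in (lborel :: (real \<times> real) measure). fst z \<noteq> p"
proof -
  have "negligible {z :: real \<times> real. z \<bullet> (1, 0) = p}"
    by (rule negligible_standard_hyperplane) (auto simp: Basis_prod_def)
  then have "{z :: real \<times> real. fst z = p} \<in> null_sets lebesgue"
    by (simp add: negligible_iff_null_sets inner_prod_def)
  then have "AE z in lebesgue. z \<notin> {z :: real \<times> real. fst z = p}" by (rule AE_not_in)
  then show ?thesis by (simp add: AE_completion_iff)
qed

lemma AE_snd_neq: "AE z in (lborel :: (real \<times> real) measure). snd z \<noteq> p"
proof -
  have "negligible {z :: real \<times> real. z \<bullet> (0, 1) = p}"
    by (rule negligible_standard_hyperplane) (auto simp: Basis_prod_def)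
  then have "{z :: real \<times> real. snd z = p} \<in> null_sets lebesgue"
    by (simp add: negligible_iff_null_sets inner_prod_def)
  then have "AE z in lebesgue. z \<notin> {z :: real \<times> real. snd z = p}" by (rule AE_not_in)
  then show ?thesis by (simp add: AE_completion_iff)
qed

section \<open>The fundamental lemma and primitives of weak derivatives\<close>

lemma integrable_mult_bounded:
  assumes "integrable M f" "g \<in> borel_measurable M" "AE x in M. \<bar>g x\<bar> \<le> B"
  shows "integrable M (\<lambda>x. f x * g x :: real)"
proof (rule Bochner_Integration.integrable_bound)
  show "integrable M (\<lambda>x. B * f x)" using assms(1) by simp
  show "AE x in M. norm (f x * g x) \<le> norm (B * f x)"
    using assms(3)
  proof eventually_elim
    case (elim x)
    have "\<bar>f x\<bar> * \<bar>g x\<bar> \<le> \<bar>f x\<bar> * \<bar>B\<bar>" using elim by (intro mult_left_mono) auto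
    then show ?case by (simp add: abs_mult mult.commute)
  qed
qed (use assms in simp)

lemma borel_fst_snd:
  assumes "g \<in> borel_measurable (borel :: real measure)"
  shows "(\<lambda>z :: real \<times> real. g (fst z)) \<in> borel_measurable borel"
    "(\<lambda>z :: real \<times> real. g (snd z)) \<in> borel_measurable borel"
  using assms unfolding borel_real_pair[symmetric] by measurable

lemma test1_tensor_integrable:
  assumes "integrable (lb_on ({a..b} \<times> {c..d})) f" "test1 p q \<psi>\<^sub>1" "test1 r s \<psi>\<^sub>2"
  shows "integrable (lb_on ({a..b} \<times> {c..d})) (\<lambda>z. f z * (\<psi>\<^sub>1 (fst z) * \<psi>\<^sub>2 (snd z)))"
proof -
  obtain B\<^sub>1 where B1: "\<And>x. \<bar>\<psi>\<^sub>1 x\<bar> \<le> B\<^sub>1" using test1_bounded[OF assms(2)] by blast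
  obtain B\<^sub>2 where B2: "\<And>x. \<bar>\<psi>\<^sub>2 x\<bar> \<le> B\<^sub>2" using test1_bounded[OF assms(3)] by blast
  have "\<psi>\<^sub>1 \<in> borel_measurable borel" "\<psi>\<^sub>2 \<in> borel_measurable borel"
    using assms smooth_borel by (auto simp: test1_def)
  then have [measurable]: "(\<lambda>z :: real \<times> real. \<psi>\<^sub>1 (fst z)) \<in> borel_measurable borel"
    "(\<lambda>z :: real \<times> real. \<psi>\<^sub>2 (snd z)) \<in> borel_measurable borel"
    by (simp_all add: borel_fst_snd)
  have "\<bar>\<psi>\<^sub>1 x * \<psi>\<^sub>2 y\<bar> \<le> B\<^sub>1 * B\<^sub>2" for x y
    unfolding abs_mult using B1[of x] B2[of y] by (intro mult_mono) auto
  then show ?thesis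
    by (intro integrable_mult_bounded[OF assms(1), where B = "B\<^sub>1 * B\<^sub>2"]) simp_all
qed

text \<open>Only tensor products are used as test functions. They approximate indicators of boxes,
  so \<open>f\<close> integrates to zero over every box, and Lebesgue differentiation recovers
  \<open>f\<close> from such integrals.\<close>

lemma fundamental_lemma:
  fixes f :: "real \<times> real \<Rightarrow> real"
  assumes f: "integrable (lb_on ({a..b} \<times> {c..d})) f"
    and orth: "\<And>\<psi>\<^sub>1 \<psi>\<^sub>2. test1 a b \<psi>\<^sub>1 \<Longrightarrow> test1 c d \<psi>\<^sub>2 \<Longrightarrow>
      (\<integral>z. f z * (\<psi>\<^sub>1 (fst z) * \<psi>\<^sub>2 (snd z)) \<partial>lb_on ({a..b} \<times> {c..d})) = 0"
  shows "AE z in lb_on ({a..b} \<times> {c..d}). f z = 0"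
proof -
  let ?K = "{a..b} \<times> {c..d}" and ?M = "lb_on ({a..b} \<times> {c..d})"
  have fm [measurable]: "f \<in> borel_measurable borel" using borel_measurable_integrable[OF f] by simp
  have box: "(\<integral>z. f z * (indicator {p<..<q} (fst z) * indicator {r<..<s} (snd z)) \<partial>?M) = 0"
    if "a \<le> p" "q \<le> b" "c \<le> r" "s \<le> d" for p q r s
  proof (cases "p < q \<and> r < s")
    case False
    then have "{p<..<q} = {} \<or> {r<..<s} = {}" by auto
    then show ?thesis by auto
  next
    case True
    obtain \<xi> where x: "\<And>n. test1 p q (\<xi> n)" "\<And>n x. \<bar>\<xi> n x\<bar> \<le> 1"
      "\<And>x. (\<lambda>n. \<xi> n x) \<longlonglongrightarrow> indicator {p<..<q} x"
      using test1_indicator_approx[of p q] True by metis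
    obtain \<eta> where y: "\<And>n. test1 r s (\<eta> n)" "\<And>n x. \<bar>\<eta> n x\<bar> \<le> 1"
      "\<And>x. (\<lambda>n. \<eta> n x) \<longlonglongrightarrow> indicator {r<..<s} x"
      using test1_indicator_approx[of r s] True by metis
    have "\<xi> n \<in> borel_measurable borel" "\<eta> n \<in> borel_measurable borel" for n
      using x(1) y(1) smooth_borel by (auto simp: test1_def)
    then have [measurable]: "(\<lambda>z :: real \<times> real. \<xi> n (fst z)) \<in> borel_measurable borel"
      "(\<lambda>z :: real \<times> real. \<eta> n (snd z)) \<in> borel_measurable borel" for n
      by (simp_all add: borel_fst_snd)
    have [measurable]: "(\<lambda>z :: real \<times> real. indicator {p<..<q} (fst z) :: real) \<in> borel_measurable borel"
      "(\<lambda>z :: real \<times> real. indicator {r<..<s} (snd z) :: real) \<in> borel_measurable borel"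
      by (simp_all add: borel_fst_snd)
    have "(\<lambda>n. \<integral>z. f z * (\<xi> n (fst z) * \<eta> n (snd z)) \<partial>?M) \<longlonglongrightarrow>
        (\<integral>z. f z * (indicator {p<..<q} (fst z) * indicator {r<..<s} (snd z)) \<partial>?M)"
    proof (rule integral_dominated_convergence[where w = "\<lambda>z. \<bar>f z\<bar>"])
      show "AE z in ?M. (\<lambda>n. f z * (\<xi> n (fst z) * \<eta> n (snd z))) \<longlonglongrightarrow>
          f z * (indicator {p<..<q} (fst z) * indicator {r<..<s} (snd z))"
        by (intro AE_I2 tendsto_intros x y)
      have "\<bar>f z\<bar> * (\<bar>\<xi> n (fst z)\<bar> * \<bar>\<eta> n (snd z)\<bar>) \<le> \<bar>f z\<bar> * (1 * 1)" for n z
        using x(2) y(2) by (intro mult_left_mono mult_mono) auto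
      then show "AE z in ?M. norm (f z * (\<xi> n (fst z) * \<eta> n (snd z))) \<le> \<bar>f z\<bar>" for n
        by (simp add: abs_mult)
      show "integrable ?M (\<lambda>z. \<bar>f z\<bar>)" using f by simp
    qed simp_all
    moreover have "(\<integral>z. f z * (\<xi> n (fst z) * \<eta> n (snd z)) \<partial>?M) = 0" for n
      using that by (intro orth test1_mono[OF x(1)] test1_mono[OF y(1)])
    ultimately show ?thesis by (simp add: LIMSEQ_const_iff)
  qed
  \<comment> \<open>Extended by zero, the function has vanishing integrals over all boxes of the
    plane, as the differentiation theorem requires.\<close>
  define g where "g z = indicator ?K z * f z" for z
  have gi: "integrable lborel g" unfolding g_def using f by (simp add: integrable_lb_on)
  have gs: "set_integrable lborel (cbox u v) g" for u v
    unfolding set_integrable_def using gi by (intro integrable_mult_indicator) auto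
  have g0: "integral (cbox u v) g = 0" for u v
  proof -
    obtain u1 u2 v1 v2 where uv: "u = (u1, u2)" "v = (v1, v2)" by (cases u, cases v)
    \<comment> \<open>The corners of the intersection with the cell; open sides are allowed because
      the edges are null.\<close>
    let ?p = "max a u1" and ?q = "min b v1" and ?r = "max c u2" and ?s = "min d v2"
    have [measurable]: "(\<lambda>z :: real \<times> real. indicator {?p<..<?q} (fst z) :: real) \<in> borel_measurable borel"
        "(\<lambda>z :: real \<times> real. indicator {?r<..<?s} (snd z) :: real) \<in> borel_measurable borel"
      by (simp_all add: borel_fst_snd)
    have "integral (cbox u v) g = (\<integral>z. indicator (cbox u v) z * g z \<partial>lborel)"
      using set_borel_integral_eq_integral(2)[OF gs, of u v] by (simp add: set_lebesgue_integral_def)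
    also have "\<dots> = (\<integral>z. indicator ?K z * (f z * (indicator {?p<..<?q} (fst z) * indicator {?r<..<?s} (snd z))) \<partial>lborel)"
    proof (rule integral_cong_AE)
      show "AE z in lborel. indicator (cbox u v) z * g z =
        indicator ?K z * (f z * (indicator {?p<..<?q} (fst z) * indicator {?r<..<?s} (snd z)))"
        using AE_fst_neq[of a] AE_fst_neq[of b] AE_fst_neq[of u1] AE_fst_neq[of v1]
          AE_snd_neq[of c] AE_snd_neq[of d] AE_snd_neq[of u2] AE_snd_neq[of v2]
        by eventually_elim (auto simp: uv g_def indicator_def cbox_Pair_eq)
      show "(\<lambda>z. indicator (cbox u v) z * g z) \<in> borel_measurable lborel"
        using gi by simp
      show "(\<lambda>z. indicator ?K z * (f z * (indicator {?p<..<?q} (fst z) * indicator {?r<..<?s} (snd z))))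
        \<in> borel_measurable lborel" by simp
    qed
    also have "\<dots> = (\<integral>z. f z * (indicator {?p<..<?q} (fst z) * indicator {?r<..<?s} (snd z)) \<partial>?M)"
      by (rule integral_lb_on[symmetric]) simp_all
    also have "\<dots> = 0" by (rule box) auto
    finally show ?thesis .
  qed
  have "g integrable_on cbox u v" for u v
    using gs by (rule set_borel_integral_eq_integral(1))
  \<comment> \<open>Outside a null set \<open>g x\<close> is the limit of averages over cubes with
    corner \<open>x\<close>, and all these averages are zero.\<close>
  then obtain N where N: "negligible N" "\<And>x e. \<lbrakk>x \<notin> N; 0 < e\<rbrakk> \<Longrightarrow>
      \<exists>d>0. \<forall>h. 0 < h \<and> h < d \<longrightarrow>
        norm (integral (cbox x (x + h *\<^sub>R One)) g /\<^sub>R h ^ DIM(real \<times> real) - g x) < e"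
    using integrable_ccontinuous_explicit[of g] by blast
  have "g z = 0" if zN: "z \<notin> N" for z
  proof (rule ccontr)
    assume "g z \<noteq> 0"
    then have "0 < \<bar>g z\<bar>" by simp
    from N(2)[OF zN this] obtain \<delta> :: real where \<delta>: "\<delta> > 0"
      "\<forall>h. 0 < h \<and> h < \<delta> \<longrightarrow> norm (0 - g z) < \<bar>g z\<bar>"
      unfolding g0 scaleR_zero_right by blast
    from \<delta>(2)[rule_format, of "\<delta> / 2"] \<delta>(1) show False by simp
  qed
  moreover have "AE z in lebesgue. z \<notin> N"
    using N(1) by (simp add: negligible_iff_null_sets AE_not_in)
  ultimately have "AE z in lebesgue. g z = 0" by (auto elim!: eventually_mono)
  then have "AE z in lborel. g z = 0" by (simp add: AE_completion_iff)
  then show ?thesis by (auto simp: AE_lb_on g_def indicator_def elim!: eventually_mono split: if_splits)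
qed

text \<open>Absolute continuity along almost every horizontal line, as an integral equation. Since
  the primitive starts at 0, \<open>A\<close> is the trace on the left edge; traces on edges are
  thus available without a trace theorem.\<close>

definition acx :: "real \<Rightarrow> real \<Rightarrow> real \<Rightarrow> real \<Rightarrow> sfield \<Rightarrow> sfield \<Rightarrow> bool" where
  "acx a b c d f f' \<longleftrightarrow> (\<exists>A. integrable (lb_on {c..d}) A \<and>
     (AE z in lb_on ({a..b} \<times> {c..d}). f z = A (snd z) + prim a b (\<lambda>t. f' (t, snd z)) (fst z)))"

definition acy :: "real \<Rightarrow> real \<Rightarrow> real \<Rightarrow> real \<Rightarrow> sfield \<Rightarrow> sfield \<Rightarrow> bool" where
  "acy a b c d f f' \<longleftrightarrow> (\<exists>A. integrable (lb_on {a..b}) A \<and>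
     (AE z in lb_on ({a..b} \<times> {c..d}). f z = A (fst z) + prim c d (\<lambda>s. f' (fst z, s)) (snd z)))"

lemma acy_iff_acx: "acy a b c d f f' \<longleftrightarrow> acx c d a b (\<lambda>z. f (snd z, fst z)) (\<lambda>z. f' (snd z, fst z))"
  unfolding acx_def acy_def by (subst rect_AE_swap) simp

lemma prim_x_borel:
  assumes "f' \<in> borel_measurable (borel :: (real \<times> real) measure)"
  shows "(\<lambda>z. prim a b (\<lambda>t. f' (t, snd z)) (fst z)) \<in> borel_measurable (borel :: (real \<times> real) measure)"
proof (rule prim_measurable)
  show "(\<lambda>(z :: real \<times> real, t). f' (t, snd z)) \<in> borel_measurable (borel \<Otimes>\<^sub>M borel)"
    using assms unfolding borel_real_pair[symmetric] by measurable
  show "fst \<in> borel_measurable (borel :: (real \<times> real) measure)"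
    unfolding borel_real_pair[symmetric] by measurable
qed

lemma prim_y_borel:
  assumes "f' \<in> borel_measurable (borel :: (real \<times> real) measure)"
  shows "(\<lambda>z. prim c d (\<lambda>s. f' (fst z, s)) (snd z)) \<in> borel_measurable (borel :: (real \<times> real) measure)"
proof (rule prim_measurable)
  show "(\<lambda>(z :: real \<times> real, t). f' (fst z, t)) \<in> borel_measurable (borel \<Otimes>\<^sub>M borel)"
    using assms unfolding borel_real_pair[symmetric] by measurable
  show "snd \<in> borel_measurable (borel :: (real \<times> real) measure)"
    unfolding borel_real_pair[symmetric] by measurable
qed

lemma prim_x_integrable:
  fixes f' :: sfield
  assumes f': "integrable (lb_on ({a..b} \<times> {c..d})) f'"
  shows "integrable (lb_on ({a..b} \<times> {c..d})) (\<lambda>z. prim a b (\<lambda>t. f' (t, snd z)) (fst z))"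
proof (rule Bochner_Integration.integrable_bound)
  have fm: "f' \<in> borel_measurable borel" using borel_measurable_integrable[OF f'] by simp
  have "integrable (lb_on ({a..b} \<times> {c..d})) (\<lambda>z. \<bar>f' z\<bar>)" using f' by simp
  from rect_integrable_snd[OF rect_integrable_y[OF this]]
  show "integrable (lb_on ({a..b} \<times> {c..d})) (\<lambda>z. \<integral>t. \<bar>f' (t, snd z)\<bar> \<partial>lb_on {a..b})" by simp
  show "(\<lambda>z. prim a b (\<lambda>t. f' (t, snd z)) (fst z)) \<in> borel_measurable (lb_on ({a..b} \<times> {c..d}))"
    using prim_x_borel[OF fm] by simp
  have "AE z in lb_on ({c..d} \<times> {a..b}). integrable (lb_on {a..b}) (\<lambda>x. f' (x, fst z))"
  proof -
    interpret P: pair_sigma_finite "lb_on {c..d}" "lb_on {a..b}" by (rule pair_sigma_finite_lb)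
    have "AE z in distr (lb_on {c..d} \<Otimes>\<^sub>M lb_on {a..b}) (lb_on {c..d}) fst. integrable (lb_on {a..b}) (\<lambda>x. f' (x, z))"
    proof -
      \<comment> \<open>An exceptional set that is null in one variable has a null preimage in the
        product, so the statement on slices can be read on the whole cell.\<close>
      have "absolutely_continuous (lb_on {c..d}) (distr (lb_on {c..d} \<Otimes>\<^sub>M lb_on {a..b}) (lb_on {c..d}) fst)"
        unfolding absolutely_continuous_def
      proof
        fix N assume N: "N \<in> null_sets (lb_on {c..d})"
        then have "emeasure (lb_on {c..d} \<Otimes>\<^sub>M lb_on {a..b}) (N \<times> UNIV) = 0"
          using P.M2.emeasure_pair_measure_Times[of N "lb_on {c..d}" UNIV] null_setsD1[OF N] null_setsD2[OF N]
          by simp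
        moreover have "fst -` N \<inter> space (lb_on {c..d} \<Otimes>\<^sub>M lb_on {a..b}) = N \<times> UNIV"
          by (auto simp: space_pair_measure)
        ultimately show "N \<in> null_sets (distr (lb_on {c..d} \<Otimes>\<^sub>M lb_on {a..b}) (lb_on {c..d}) fst)"
          using N by (auto simp: null_sets_def emeasure_distr)
      qed
      from absolutely_continuous_AE[OF _ this rect_AE_integrable_x[OF f']] show ?thesis by simp
    qed
    then show ?thesis unfolding lb_rect by (rule AE_distrD[OF measurable_fst])
  qed
  then have "AE z in lb_on ({a..b} \<times> {c..d}). integrable (lb_on {a..b}) (\<lambda>x. f' (x, snd z))"
    by (subst rect_AE_swap) simp
  then show "AE z in lb_on ({a..b} \<times> {c..d}). norm (prim a b (\<lambda>t. f' (t, snd z)) (fst z))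
      \<le> norm (\<integral>t. \<bar>f' (t, snd z)\<bar> \<partial>lb_on {a..b})"
    by eventually_elim (use prim_abs_le in fastforce)
qed

lemma test1_prim_deriv:
  assumes "test1 a b \<psi>" "x \<in> {a..b}"
  shows "prim a b (deriv \<psi>) x = \<psi> x" "(\<integral>t. deriv \<psi> t \<partial>lb_on {a..b}) = 0"
proof -
  have s: "smooth \<psi>" using assms by (simp add: test1_def)
  have p: "prim a b (deriv \<psi>) y = \<psi> y - \<psi> a" if "y \<in> {a..b}" for y
    using smooth_deriv[OF s] that by (intro prim_derivative smooth_continuous) auto
  show "prim a b (deriv \<psi>) x = \<psi> x" using p[OF assms(2)] test1_zero[OF assms(1), of a] by simp
  have "(\<integral>t. deriv \<psi> t \<partial>lb_on {a..b}) = prim a b (deriv \<psi>) b"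
    using prim_right[of b b "deriv \<psi>" a] smooth_borel[OF smooth_deriv(2)[OF s]] by simp
  then show "(\<integral>t. deriv \<psi> t \<partial>lb_on {a..b}) = 0"
    using p[of b] assms(2) test1_zero[OF assms(1), of a] test1_zero[OF assms(1), of b] by simp
qed

lemma test1_integrable: "test1 a b \<psi> \<Longrightarrow> integrable (lb_on {p..q}) \<psi>"
  by (rule integrable_continuous_lb_on) (auto simp: test1_def intro: smooth_continuous smooth_borel)

text \<open>The derivative of a smooth step: its integral is the height of the step.\<close>

lemma test1_mollifier:
  assumes "a < b"
  obtains \<rho> where "test1 a b \<rho>" "(\<integral>t. \<rho> t \<partial>lb_on {a..b}) = 1"
proof -
  let ?p = "a + (b - a) / 3" and ?q = "a + 2 * (b - a) / 3"
  have pq: "a < ?p" "?p < ?q" "?q < b" using assms by (auto simp: field_simps)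
  obtain \<sigma> where s: "smooth \<sigma>" "\<And>x. x \<le> ?p \<Longrightarrow> \<sigma> x = 0" "\<And>x. x \<ge> ?q \<Longrightarrow> \<sigma> x = 1"
    using smooth_step[OF pq(2)] by metis
  have "deriv \<sigma> x = 0" if "x \<notin> {?p..?q}" for x
  proof -
    consider "x < ?p" | "x > ?q" using \<open>x \<notin> {?p..?q}\<close> by fastforce
    then show ?thesis
    proof cases
      case 1
      have "((\<lambda>_. 0) has_real_derivative 0) (at x)" by simp
      then have "(\<sigma> has_real_derivative 0) (at x)"
        by (rule has_field_derivative_transform_within_open[where S = "{..<?p}"]) (use 1 s in auto)
      then show ?thesis by (rule DERIV_imp_deriv)
    next
      case 2
      have "((\<lambda>_. 1) has_real_derivative 0) (at x)" by simp
      then have "(\<sigma> has_real_derivative 0) (at x)"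
        by (rule has_field_derivative_transform_within_open[where S = "{?q<..}"]) (use 2 s in auto)
      then show ?thesis by (rule DERIV_imp_deriv)
    qed
  qed
  then have t: "test1 a b (deriv \<sigma>)"
    unfolding test1_def using smooth_deriv(2)[OF s(1)] pq by (meson less_imp_le)
  have "(\<integral>t. deriv \<sigma> t \<partial>lb_on {a..b}) = prim a b (deriv \<sigma>) b"
    using prim_right[of b b "deriv \<sigma>" a] smooth_borel[OF smooth_deriv(2)[OF s(1)]] by simp
  also have "\<dots> = \<sigma> b - \<sigma> a"
    using smooth_deriv[OF s(1)] assms by (intro prim_derivative smooth_continuous) auto
  finally have "(\<integral>t. deriv \<sigma> t \<partial>lb_on {a..b}) = 1" using s(2)[of a] s(3)[of b] pq by simp
  with t show ?thesis by (rule that)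
qed

text \<open>Zero mean is what makes the antiderivative vanish to the right of the support as
  well.\<close>

lemma test1_antideriv:
  assumes "test1 a b \<phi>" "a < b" "(\<integral>t. \<phi> t \<partial>lb_on {a..b}) = 0"
  obtains \<Psi> where "test1 a b \<Psi>" "deriv \<Psi> = \<phi>"
proof -
  obtain p q where pq: "smooth \<phi>" "a < p" "p \<le> q" "q < b" "\<And>x. x \<notin> {p..q} \<Longrightarrow> \<phi> x = 0"
    using assms by (auto simp: test1_def)
  obtain F where F: "smooth F" "\<And>x. (F has_real_derivative \<phi> x) (at x)"
    "\<And>x. x \<le> p \<Longrightarrow> F x = 0" "\<And>x. x \<ge> q \<Longrightarrow> F x = F q"
    using smooth_compact_antideriv[OF pq(1,5)] by metis
  have "(\<integral>t. \<phi> t \<partial>lb_on {a..b}) = prim a b \<phi> b"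
    using prim_right[of b b \<phi> a] smooth_borel[OF pq(1)] by simp
  also have "\<dots> = F b - F a"
    using F(2) assms(2) smooth_continuous[OF pq(1)] by (intro prim_derivative) auto
  finally have "F b = 0" using assms(3) F(3)[of a] pq by simp
  then have "F q = 0" using F(4)[of b] pq by simp
  then have "F x = 0" if "x \<notin> {p..q}" for x using F(3)[of x] F(4)[of x] that by (cases "x \<le> p") auto
  then have "test1 a b F" unfolding test1_def using F(1) pq(2-4) by blast
  moreover have "deriv F = \<phi>" using F(2) by (auto simp: fun_eq_iff intro: DERIV_imp_deriv)
  ultimately show ?thesis by (rule that)
qed

lemma test1_lincomb: 
  assumes "test1 a b \<phi>" "test1 a b \<psi>"
  shows "test1 a b (\<lambda>x. \<phi> x - k * \<psi> x)"
proof -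
  obtain p q where 1: "smooth \<phi>" "a < p" "p \<le> q" "q < b" "\<And>x. x \<notin> {p..q} \<Longrightarrow> \<phi> x = 0"
    using assms by (auto simp: test1_def)
  obtain r s where 2: "smooth \<psi>" "a < r" "r \<le> s" "s < b" "\<And>x. x \<notin> {r..s} \<Longrightarrow> \<psi> x = 0"
    using assms by (auto simp: test1_def)
  have "\<phi> x - k * \<psi> x = 0" if "x \<notin> {min p r..max q s}" for x
  proof -
    have "x \<notin> {p..q}" "x \<notin> {r..s}" using that by auto
    then show ?thesis using 1(5) 2(5) by simp
  qed
  moreover have "a < min p r" "min p r \<le> max q s" "max q s < b" using 1 2 by auto
  moreover have "smooth (\<lambda>x. \<phi> x - k * \<psi> x)" by (intro smooth_diff smooth_mult smooth_const 1 2)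
  ultimately show ?thesis unfolding test1_def by blast
qed

text \<open>A function with weak derivative zero in \<open>x\<close> does not depend on \<open>x\<close>: every test function
  is a derivative up to a multiple of a fixed one.\<close>

lemma acxI:
  assumes ab: "a < b" and f: "integrable (lb_on ({a..b} \<times> {c..d})) f"
    and f': "integrable (lb_on ({a..b} \<times> {c..d})) f'"
    and weak: "\<And>\<psi>\<^sub>1 \<psi>\<^sub>2. test1 a b \<psi>\<^sub>1 \<Longrightarrow> test1 c d \<psi>\<^sub>2 \<Longrightarrow>
      (\<integral>z. f z * (deriv \<psi>\<^sub>1 (fst z) * \<psi>\<^sub>2 (snd z)) \<partial>lb_on ({a..b} \<times> {c..d})) =
      - (\<integral>z. f' z * (\<psi>\<^sub>1 (fst z) * \<psi>\<^sub>2 (snd z)) \<partial>lb_on ({a..b} \<times> {c..d}))"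
  shows "acx a b c d f f'"
proof -
  let ?M = "lb_on ({a..b} \<times> {c..d})" and ?X = "lb_on {a..b}" and ?Y = "lb_on {c..d}"
  \<comment> \<open>\<open>F\<close> has weak derivative \<open>f'\<close> by integration by parts
    on each line; what remains is that the difference \<open>D\<close> has weak derivative
    zero.\<close>
  define F where "F z = prim a b (\<lambda>t. f' (t, snd z)) (fst z)" for z
  have Fi: "integrable ?M F" unfolding F_def by (rule prim_x_integrable[OF f'])
  define D where "D z = f z - F z" for z
  have Di: "integrable ?M D" unfolding D_def using f Fi by simp
  have F_weak: "(\<integral>z. F z * (deriv \<psi>\<^sub>1 (fst z) * \<psi>\<^sub>2 (snd z)) \<partial>?M) = - (\<integral>z. f' z * (\<psi>\<^sub>1 (fst z) * \<psi>\<^sub>2 (snd z)) \<partial>?M)"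
    if t: "test1 a b \<psi>\<^sub>1" "test1 c d \<psi>\<^sub>2" for \<psi>\<^sub>1 \<psi>\<^sub>2
  proof -
    note i1 = test1_tensor_integrable[OF Fi test1_deriv[OF t(1)] t(2)]
    note i2 = test1_tensor_integrable[OF f' t]
    have "(\<integral>z. F z * (deriv \<psi>\<^sub>1 (fst z) * \<psi>\<^sub>2 (snd z)) \<partial>?M)
        = (\<integral>y. (\<integral>x. F (x, y) * deriv \<psi>\<^sub>1 x \<partial>?X) * \<psi>\<^sub>2 y \<partial>?Y)"
      by (subst rect_integral_yx[OF i1]) (simp add: mult.assoc[symmetric])
    also have "\<dots> = (\<integral>y. - (\<integral>x. f' (x, y) * \<psi>\<^sub>1 x \<partial>?X) * \<psi>\<^sub>2 y \<partial>?Y)"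
    proof (rule integral_cong_AE)
      show "AE y in ?Y. (\<integral>x. F (x, y) * deriv \<psi>\<^sub>1 x \<partial>?X) * \<psi>\<^sub>2 y = - (\<integral>x. f' (x, y) * \<psi>\<^sub>1 x \<partial>?X) * \<psi>\<^sub>2 y"
        using rect_AE_integrable_x[OF f']
      proof eventually_elim
        case (elim y)
        have "(\<integral>x. prim a b (\<lambda>t. f' (t, y)) x * deriv \<psi>\<^sub>1 x \<partial>?X) + (\<integral>x. f' (x, y) * prim a b (deriv \<psi>\<^sub>1) x \<partial>?X) = 0"
          using prim_integration_by_parts[OF elim test1_integrable[OF test1_deriv[OF t(1)]]]
            test1_prim_deriv(2)[OF t(1), of a] ab by simp
        moreover have "(\<integral>x. f' (x, y) * prim a b (deriv \<psi>\<^sub>1) x \<partial>?X) = (\<integral>x. f' (x, y) * \<psi>\<^sub>1 x \<partial>?X)"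
        proof (rule integral_cong_AE)
          show "AE x in ?X. f' (x, y) * prim a b (deriv \<psi>\<^sub>1) x = f' (x, y) * \<psi>\<^sub>1 x"
            using AE_lb_on_in[of "{a..b}", OF borel_closed[OF closed_atLeastAtMost]]
            by eventually_elim (simp only: test1_prim_deriv(1)[OF t(1)])
          have "(\<lambda>x. f' (x, y)) \<in> borel_measurable borel"
            using borel_measurable_integrable[OF elim] by simp
          moreover have "\<psi>\<^sub>1 \<in> borel_measurable borel" "deriv \<psi>\<^sub>1 \<in> borel_measurable borel"
            using t(1) test1_deriv[OF t(1)] smooth_borel by (auto simp: test1_def)
          ultimately show "(\<lambda>x. f' (x, y) * prim a b (deriv \<psi>\<^sub>1) x) \<in> borel_measurable ?X"
            "(\<lambda>x. f' (x, y) * \<psi>\<^sub>1 x) \<in> borel_measurable ?X"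
            using prim_borel[of "deriv \<psi>\<^sub>1" a b] by simp_all
        qed
        ultimately have "(\<integral>x. prim a b (\<lambda>t. f' (t, y)) x * deriv \<psi>\<^sub>1 x \<partial>?X) = - (\<integral>x. f' (x, y) * \<psi>\<^sub>1 x \<partial>?X)"
          by linarith
        then show ?case by (simp add: F_def)
      qed
      have "integrable ?Y (\<lambda>y. (\<integral>x. F (x, y) * deriv \<psi>\<^sub>1 x \<partial>?X) * \<psi>\<^sub>2 y)"
        using rect_integrable_y[OF i1] by (simp add: mult.assoc[symmetric])
      then show "(\<lambda>y. (\<integral>x. F (x, y) * deriv \<psi>\<^sub>1 x \<partial>?X) * \<psi>\<^sub>2 y) \<in> borel_measurable ?Y" by simp
      have "integrable ?Y (\<lambda>y. - ((\<integral>x. f' (x, y) * \<psi>\<^sub>1 x \<partial>?X) * \<psi>\<^sub>2 y))"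
        using rect_integrable_y[OF i2] by (simp add: mult.assoc[symmetric])
      then show "(\<lambda>y. - (\<integral>x. f' (x, y) * \<psi>\<^sub>1 x \<partial>?X) * \<psi>\<^sub>2 y) \<in> borel_measurable ?Y" by simp
    qed
    also have "\<dots> = - (\<integral>z. f' z * (\<psi>\<^sub>1 (fst z) * \<psi>\<^sub>2 (snd z)) \<partial>?M)"
      by (subst rect_integral_yx[OF i2]) (simp add: mult.assoc[symmetric])
    finally show ?thesis .
  qed
  have D_weak: "(\<integral>z. D z * (deriv \<psi>\<^sub>1 (fst z) * \<psi>\<^sub>2 (snd z)) \<partial>?M) = 0"
    if t: "test1 a b \<psi>\<^sub>1" "test1 c d \<psi>\<^sub>2" for \<psi>\<^sub>1 \<psi>\<^sub>2
    using F_weak[OF t] weak[OF t] test1_tensor_integrable[OF Fi test1_deriv[OF t(1)] t(2)]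
      test1_tensor_integrable[OF f test1_deriv[OF t(1)] t(2)]
    by (simp add: D_def left_diff_distrib)
  obtain \<rho> where r: "test1 a b \<rho>" "(\<integral>t. \<rho> t \<partial>?X) = 1" using test1_mollifier[OF ab] by blast
  \<comment> \<open>If \<open>D\<close> does not depend on \<open>x\<close>, any average over
    \<open>x\<close> with total weight 1 recovers it.\<close>
  define A where "A y = (\<integral>t. D (t, y) * \<rho> t \<partial>?X)" for y
  obtain B where B: "\<And>x. \<bar>\<rho> x\<bar> \<le> B" using test1_bounded[OF r(1)] by blast
  have rm: "\<rho> \<in> borel_measurable borel" using r smooth_borel by (simp add: test1_def)
  have Dr: "integrable ?M (\<lambda>z. D z * \<rho> (fst z))"
    by (rule integrable_mult_bounded[OF Di, where B = B]) (use B borel_fst_snd[OF rm] in auto)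
  have Ai: "integrable ?Y A" using rect_integrable_y[OF Dr] by (simp add: A_def[abs_def])
  have "AE z in ?M. D z - A (snd z) = 0"
  proof (rule fundamental_lemma)
    have AiM: "integrable ?M (\<lambda>z. A (snd z))" by (rule rect_integrable_snd[OF Ai])
    then show "integrable ?M (\<lambda>z. D z - A (snd z))" using Di by simp
    fix \<psi>\<^sub>1 \<psi>\<^sub>2 assume t: "test1 a b \<psi>\<^sub>1" "test1 c d \<psi>\<^sub>2"
    define k where "k = (\<integral>x. \<psi>\<^sub>1 x \<partial>?X)"
    have "(\<integral>x. \<psi>\<^sub>1 x - k * \<rho> x \<partial>?X) = 0"
      using test1_integrable[OF t(1), of a b] test1_integrable[OF r(1), of a b] r(2) by (simp add: k_def)
    \<comment> \<open>After subtracting \<open>k * \<rho>\<close> the test function has mean zero,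
      hence is a derivative, against which \<open>D\<close> integrates to zero.\<close>
    then obtain \<Psi> where P: "test1 a b \<Psi>" "deriv \<Psi> = (\<lambda>x. \<psi>\<^sub>1 x - k * \<rho> x)"
      using test1_antideriv[OF test1_lincomb[OF t(1) r(1)] ab] by metis
    note j1 = test1_tensor_integrable[OF Di t] and j2 = test1_tensor_integrable[OF Di r(1) t(2)]
      and j3 = test1_tensor_integrable[OF AiM t]
    have "0 = (\<integral>z. D z * (\<psi>\<^sub>1 (fst z) * \<psi>\<^sub>2 (snd z)) - k * (D z * (\<rho> (fst z) * \<psi>\<^sub>2 (snd z))) \<partial>?M)"
      using D_weak[OF P(1) t(2)] by (simp add: P(2) algebra_simps)
    also have "\<dots> = (\<integral>z. D z * (\<psi>\<^sub>1 (fst z) * \<psi>\<^sub>2 (snd z)) \<partial>?M) - k * (\<integral>z. D z * (\<rho> (fst z) * \<psi>\<^sub>2 (snd z)) \<partial>?M)"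
      using j1 j2 by simp
    also have "(\<integral>z. D z * (\<rho> (fst z) * \<psi>\<^sub>2 (snd z)) \<partial>?M) = (\<integral>y. A y * \<psi>\<^sub>2 y \<partial>?Y)"
      by (subst rect_integral_yx[OF j2]) (simp add: A_def mult.assoc[symmetric])
    also have "k * (\<integral>y. A y * \<psi>\<^sub>2 y \<partial>?Y) = (\<integral>y. (\<integral>x. A y * (\<psi>\<^sub>1 x * \<psi>\<^sub>2 y) \<partial>?X) \<partial>?Y)"
    proof -
      have "(\<integral>x. A y * (\<psi>\<^sub>1 x * \<psi>\<^sub>2 y) \<partial>?X) = k * (A y * \<psi>\<^sub>2 y)" for y
        by (simp add: k_def)
      then show ?thesis by (simp only: integral_mult_right_zero)
    qed
    also have "\<dots> = (\<integral>z. A (snd z) * (\<psi>\<^sub>1 (fst z) * \<psi>\<^sub>2 (snd z)) \<partial>?M)"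
      by (subst rect_integral_yx[OF j3]) simp
    finally show "(\<integral>z. (D z - A (snd z)) * (\<psi>\<^sub>1 (fst z) * \<psi>\<^sub>2 (snd z)) \<partial>?M) = 0"
      using j1 j3 by (simp add: left_diff_distrib)
  qed
  then have "AE z in ?M. f z = A (snd z) + prim a b (\<lambda>t. f' (t, snd z)) (fst z)"
    by eventually_elim (simp add: D_def F_def)
  then show ?thesis unfolding acx_def using Ai by blast
qed

section \<open>Operators acting in the second variable\<close>

text \<open>Like \<open>Ry\<close>, this operator sees only the \<open>y\<close>-interval
  \<open>[c, d]\<close>. It is therefore the same on horizontally adjacent cells and on the box
  joining them.\<close>

definition Jy :: "real \<Rightarrow> real \<Rightarrow> sfield \<Rightarrow> sfield" where
  "Jy c d f z = prim c d (\<lambda>s. f (fst z, s)) (snd z)"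

definition Ry :: "real \<Rightarrow> real \<Rightarrow> nat \<Rightarrow> sfield \<Rightarrow> sfield" where
  "Ry c d n f z = resid c d n (\<lambda>s. f (fst z, s)) (snd z)"

lemma Jy_borel:
  assumes "f \<in> borel_measurable borel"
  shows "Jy c d f \<in> borel_measurable borel"
  using prim_y_borel[OF assms] by (simp add: Jy_def[abs_def])

lemma borel_integral_y:
  fixes f :: sfield
  assumes "f \<in> borel_measurable borel"
  shows "(\<lambda>x. \<integral>y. f (x, y) \<partial>lb_on {c..d}) \<in> borel_measurable borel"
proof -
  interpret finite_measure "lb_on {c..d}" by simp
  have "f \<in> borel_measurable (borel \<Otimes>\<^sub>M lb_on {c..d})"
  proof -
    have "borel_measurable (borel \<Otimes>\<^sub>M lb_on {c..d})
        = (borel_measurable ((borel :: real measure) \<Otimes>\<^sub>M (borel :: real measure)) :: sfield set)"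
      by (rule measurable_cong_sets) (auto intro: sets_pair_measure_cong)
    also have "\<dots> = borel_measurable borel" by (simp only: borel_real_pair)
    finally show ?thesis using assms by blast
  qed
  then show ?thesis by (intro borel_measurable_lebesgue_integral) simp
qed

lemma Ry_eq: "Ry c d n f z = f z - (\<Sum>i<n. (\<integral>s. poly (obasis c d n i) s * f (fst z, s) \<partial>lb_on {c..d})
    * poly (obasis c d n i) (snd z))"
  by (simp add: Ry_def resid_def proj_def poly_sum)

lemma Ry_borel:
  assumes [measurable]: "f \<in> borel_measurable borel"
  shows "Ry c d n f \<in> borel_measurable borel"
proof -
  have "(\<lambda>x. \<integral>s. poly (obasis c d n i) s * f (x, s) \<partial>lb_on {c..d}) \<in> borel_measurable borel" for i
    using borel_integral_y[of "\<lambda>z. poly (obasis c d n i) (snd z) * f z" c d]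
      borel_fst_snd(2)[OF poly_borel, of "obasis c d n i"] by simp
  then have "(\<lambda>z :: real \<times> real. \<integral>s. poly (obasis c d n i) s * f (fst z, s) \<partial>lb_on {c..d}) \<in> borel_measurable borel" for i
    by (rule borel_fst_snd(1))
  moreover have "(\<lambda>z :: real \<times> real. poly (obasis c d n i) (snd z)) \<in> borel_measurable borel" for i
    by (rule borel_fst_snd(2)[OF poly_borel])
  ultimately have "(\<lambda>z. f z - (\<Sum>i<n. (\<integral>s. poly (obasis c d n i) s * f (fst z, s) \<partial>lb_on {c..d})
    * poly (obasis c d n i) (snd z))) \<in> borel_measurable borel"
    by (intro borel_measurable_diff borel_measurable_sum borel_measurable_times assms)
  then show ?thesis unfolding Ry_eq[abs_def] .
qed

text \<open>Passes an estimate on slices to the cell by Fubini's theorem. The implication under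
  \<open>AE\<close> reflects that a slice of \<open>f\<close> is square integrable only for almost
  every \<open>x\<close>.\<close>

lemma slice_bound:
  fixes f g :: sfield
  assumes f: "sqi (lb_on ({a..b} \<times> {c..d})) f" and g: "g \<in> borel_measurable borel"
    and le: "AE x in lb_on {a..b}. sqi (lb_on {c..d}) (\<lambda>y. f (x, y)) \<longrightarrow> sqi (lb_on {c..d}) (\<lambda>y. g (x, y)) \<and>
      (\<integral>y. (g (x, y))\<^sup>2 \<partial>lb_on {c..d}) \<le> C * (\<integral>y. (f (x, y))\<^sup>2 \<partial>lb_on {c..d})"
  shows "sqi (lb_on ({a..b} \<times> {c..d})) g"
    and "(\<integral>z. (g z)\<^sup>2 \<partial>lb_on ({a..b} \<times> {c..d})) \<le> C * (\<integral>z. (f z)\<^sup>2 \<partial>lb_on ({a..b} \<times> {c..d}))"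
proof -
  let ?M = "lb_on ({a..b} \<times> {c..d})" and ?X = "lb_on {a..b}" and ?Y = "lb_on {c..d}"
  have fm: "f \<in> borel_measurable borel" and f2: "integrable ?M (\<lambda>z. (f z)\<^sup>2)"
    using f by (auto simp: sqi_def)
  have g2m: "(\<lambda>z. (g z)\<^sup>2) \<in> borel_measurable borel" using g by simp
  have "AE x in ?X. sqi ?Y (\<lambda>y. f (x, y))"
    using rect_AE_integrable_y[OF f2] by (auto simp: sqi_def borel_slice[OF fm])
  with le have ae: "AE x in ?X. sqi ?Y (\<lambda>y. g (x, y)) \<and>
      (\<integral>y. (g (x, y))\<^sup>2 \<partial>?Y) \<le> C * (\<integral>y. (f (x, y))\<^sup>2 \<partial>?Y)"
    by eventually_elim blast
  have ifx: "integrable ?X (\<lambda>x. C * (\<integral>y. (f (x, y))\<^sup>2 \<partial>?Y))"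
    using rect_integrable_x[OF f2] by simp
  have igx: "integrable ?X (\<lambda>x. \<integral>y. (g (x, y))\<^sup>2 \<partial>?Y)"
  proof (rule Bochner_Integration.integrable_bound[OF ifx])
    show "(\<lambda>x. \<integral>y. (g (x, y))\<^sup>2 \<partial>?Y) \<in> borel_measurable ?X"
      using borel_integral_y[OF g2m] by simp
    show "AE x in ?X. norm (\<integral>y. (g (x, y))\<^sup>2 \<partial>?Y) \<le> norm (C * (\<integral>y. (f (x, y))\<^sup>2 \<partial>?Y))"
      using ae by eventually_elim (auto intro: order_trans)
  qed
  have g2: "integrable ?M (\<lambda>z. (g z)\<^sup>2)"
  proof (rule rect_integrableI[OF g2m])
    show "integrable ?X (\<lambda>x. \<integral>y. \<bar>(g (x, y))\<^sup>2\<bar> \<partial>?Y)" using igx by simp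
    show "AE x in ?X. integrable ?Y (\<lambda>y. (g (x, y))\<^sup>2)" using ae by (auto simp: sqi_def)
  qed
  then show "sqi ?M g" using g by (simp add: sqi_def)
  have "(\<integral>z. (g z)\<^sup>2 \<partial>?M) = (\<integral>x. (\<integral>y. (g (x, y))\<^sup>2 \<partial>?Y) \<partial>?X)"
    by (rule rect_integral_xy[OF g2])
  also have "\<dots> \<le> (\<integral>x. C * (\<integral>y. (f (x, y))\<^sup>2 \<partial>?Y) \<partial>?X)"
    using ae by (intro integral_mono_AE igx ifx) (auto elim: eventually_mono)
  also have "\<dots> = C * (\<integral>z. (f z)\<^sup>2 \<partial>?M)" by (simp add: rect_integral_xy[OF f2])
  finally show "(\<integral>z. (g z)\<^sup>2 \<partial>?M) \<le> C * (\<integral>z. (f z)\<^sup>2 \<partial>?M)" .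
qed

lemma sqi_Jy:
  assumes "c \<le> d" and f: "sqi (lb_on ({a..b} \<times> {c..d})) f"
  shows "sqi (lb_on ({a..b} \<times> {c..d})) (Jy c d f)"
    and "(\<integral>z. (Jy c d f z)\<^sup>2 \<partial>lb_on ({a..b} \<times> {c..d})) \<le> (d - c)\<^sup>2 * (\<integral>z. (f z)\<^sup>2 \<partial>lb_on ({a..b} \<times> {c..d}))"
proof -
  have "f \<in> borel_measurable borel" using f by (simp add: sqi_def)
  moreover have "AE x in lb_on {a..b}. sqi (lb_on {c..d}) (\<lambda>y. f (x, y)) \<longrightarrow> sqi (lb_on {c..d}) (\<lambda>y. Jy c d f (x, y)) \<and>
      (\<integral>y. (Jy c d f (x, y))\<^sup>2 \<partial>lb_on {c..d}) \<le> (d - c)\<^sup>2 * (\<integral>y. (f (x, y))\<^sup>2 \<partial>lb_on {c..d})"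
    using sqi_prim[OF assms(1)] by (simp add: Jy_def)
  ultimately show "sqi (lb_on ({a..b} \<times> {c..d})) (Jy c d f)"
    "(\<integral>z. (Jy c d f z)\<^sup>2 \<partial>lb_on ({a..b} \<times> {c..d})) \<le> (d - c)\<^sup>2 * (\<integral>z. (f z)\<^sup>2 \<partial>lb_on ({a..b} \<times> {c..d}))"
    using slice_bound[OF f Jy_borel] by blast+
qed

text \<open>An orthogonal projection does not enlarge norms, and neither does passing to its
  residual; slice by slice this bounds \<open>Ry\<close> by 1.\<close>

lemma sqi_Ry:
  assumes "c < d" and f: "sqi (lb_on ({a..b} \<times> {c..d})) f"
  shows "sqi (lb_on ({a..b} \<times> {c..d})) (Ry c d n f)"
proof -
  let ?Y = "lb_on {c..d}"
  have "f \<in> borel_measurable borel" using f by (simp add: sqi_def)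
  moreover have "sqi ?Y (resid c d n h) \<and> (\<integral>y. (resid c d n h y)\<^sup>2 \<partial>?Y) \<le> 1 * (\<integral>y. (h y)\<^sup>2 \<partial>?Y)"
    if h: "sqi ?Y h" for h
  proof -
    let ?\<psi> = "resid c d n h"
    have hi: "integrable ?Y h" by (rule sqi_imp_integrable[OF _ h]) simp
    have s: "sqi ?Y ?\<psi>" by (rule sqi_resid[OF h])
    define R where "R = (\<integral>y. (?\<psi> y)\<^sup>2 \<partial>?Y)"
    have "(\<integral>y. ?\<psi> y * poly (proj c d n h) y \<partial>?Y) = 0"
      using orth_resid[OF assms(1) hi] deg_lt_proj[OF assms(1)] by (simp add: orth_def)
    moreover have "R = (\<integral>y. h y * ?\<psi> y - ?\<psi> y * poly (proj c d n h) y \<partial>?Y)"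
      unfolding R_def by (rule Bochner_Integration.integral_cong)
        (auto simp: resid_def power2_eq_square algebra_simps)
    ultimately have "R = (\<integral>y. h y * ?\<psi> y \<partial>?Y)"
      using sqi_mult_integrable[OF h s] sqi_mult_integrable[OF s sqi_poly] by simp
    then have "R\<^sup>2 \<le> (\<integral>y. (h y)\<^sup>2 \<partial>?Y) * R"
      using Cauchy_Schwarz_integral[OF h s] by (simp add: R_def)
    moreover have "R \<ge> 0" "(\<integral>y. (h y)\<^sup>2 \<partial>?Y) \<ge> 0" by (auto simp: R_def)
    ultimately have "R \<le> (\<integral>y. (h y)\<^sup>2 \<partial>?Y)"
      by (cases "R = 0") (auto simp: power2_eq_square)
    then show ?thesis using s by (simp add: R_def)
  qed
  then have "AE x in lb_on {a..b}. sqi ?Y (\<lambda>y. f (x, y)) \<longrightarrow> sqi ?Y (\<lambda>y. Ry c d n f (x, y)) \<and>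
      (\<integral>y. (Ry c d n f (x, y))\<^sup>2 \<partial>?Y) \<le> 1 * (\<integral>y. (f (x, y))\<^sup>2 \<partial>?Y)"
    by (simp add: Ry_def)
  ultimately show ?thesis using slice_bound(1)[OF f Ry_borel] by blast
qed

lemma Ry_bound:
  assumes "c < d" and w: "\<And>j. j \<le> n \<Longrightarrow> sqi (lb_on ({a..b} \<times> {c..d})) (w j)"
    and ac: "\<And>j. j < n \<Longrightarrow> acy a b c d (w j) (w (Suc j))"
  shows "(\<integral>z. (Ry c d n (w 0) z)\<^sup>2 \<partial>lb_on ({a..b} \<times> {c..d}))
    \<le> (d - c) ^ (2 * n) * (\<integral>z. (w n z)\<^sup>2 \<partial>lb_on ({a..b} \<times> {c..d}))"
proof (rule slice_bound(2)[OF w[of n]])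
  let ?M = "lb_on ({a..b} \<times> {c..d})" and ?X = "lb_on {a..b}" and ?Y = "lb_on {c..d}"
  have wm: "w j \<in> borel_measurable borel" if "j \<le> n" for j using w[OF that] by (simp add: sqi_def)
  show "Ry c d n (w 0) \<in> borel_measurable borel" by (rule Ry_borel) (use wm in simp)
  \<comment> \<open>Finitely many exceptional null sets, one for each derivative, are united so that
    a single slice satisfies all hypotheses of \<open>resid_bound\<close>.\<close>
  have "AE x in ?X. \<forall>j\<in>{..n}. sqi ?Y (\<lambda>y. w j (x, y))"
  proof (rule AE_finite_allI)
    fix j assume "j \<in> {..n}"
    then have "integrable ?M (\<lambda>z. (w j z)\<^sup>2)" using w by (simp add: sqi_def)
    from rect_AE_integrable_y[OF this] show "AE x in ?X. sqi ?Y (\<lambda>y. w j (x, y))"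
      using borel_slice(1)[OF wm] \<open>j \<in> {..n}\<close> by (auto simp: sqi_def)
  qed simp
  moreover have "AE x in ?X. \<forall>j\<in>{..<n}. \<exists>A. AE y in ?Y. w j (x, y) = A + prim c d (\<lambda>s. w (Suc j) (x, s)) y"
  proof (rule AE_finite_allI)
    fix j assume "j \<in> {..<n}"
    then obtain A where "AE z in ?M. w j z = A (fst z) + prim c d (\<lambda>s. w (Suc j) (fst z, s)) (snd z)"
      using ac[of j] by (auto simp: acy_def)
    from rect_AE_xy[OF this]
    show "AE x in ?X. \<exists>A. AE y in ?Y. w j (x, y) = A + prim c d (\<lambda>s. w (Suc j) (x, s)) y"
      by eventually_elim auto
  qed simp
  ultimately show "AE x in ?X. sqi ?Y (\<lambda>y. w n (x, y)) \<longrightarrow> sqi ?Y (\<lambda>y. Ry c d n (w 0) (x, y)) \<and>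
      (\<integral>y. (Ry c d n (w 0) (x, y))\<^sup>2 \<partial>?Y) \<le> (d - c) ^ (2 * n) * (\<integral>y. (w n (x, y))\<^sup>2 \<partial>?Y)"
  proof eventually_elim
    case (elim x)
    have "(\<integral>y. (resid c d n (\<lambda>s. w 0 (x, s)) y)\<^sup>2 \<partial>?Y) \<le> (d - c) ^ (2 * n) * (\<integral>y. (w n (x, y))\<^sup>2 \<partial>?Y)"
      using resid_bound[OF assms(1), of n "\<lambda>j s. w j (x, s)"] elim by auto
    moreover have "sqi ?Y (resid c d n (\<lambda>s. w 0 (x, s)))" using elim by (intro sqi_resid) auto
    ultimately show ?case by (simp add: Ry_def)
  qed
qed simp

text \<open>A primitive in \<open>y\<close> is an integral against the indicator of a half plane, so
  it commutes with integration in \<open>x\<close>.\<close>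

lemma rect_prim_Fubini:
  fixes H :: sfield
  assumes H: "integrable (lb_on ({a..b} \<times> {c..d})) H"
  shows "integrable (lb_on {a..b}) (\<lambda>x. prim c d (\<lambda>s. H (x, s)) y)"
    and "(\<integral>x. prim c d (\<lambda>s. H (x, s)) y \<partial>lb_on {a..b}) = prim c d (\<lambda>s. \<integral>x. H (x, s) \<partial>lb_on {a..b}) y"
proof -
  have [measurable]: "(\<lambda>z :: real \<times> real. indicator {..y} (snd z) :: real) \<in> borel_measurable borel"
    by (rule borel_fst_snd(2)) simp
  have "integrable (lb_on ({a..b} \<times> {c..d})) (\<lambda>z. H z * indicator {..y} (snd z))"
    by (rule integrable_mult_bounded[OF H, where B = 1]) (auto split: split_indicator)
  then have i: "integrable (lb_on ({a..b} \<times> {c..d})) (\<lambda>z. indicator {..y} (snd z) * H z)"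
    by (simp add: mult.commute)
  show "integrable (lb_on {a..b}) (\<lambda>x. prim c d (\<lambda>s. H (x, s)) y)"
    using rect_integrable_x[OF i] by (simp add: prim_def)
  show "(\<integral>x. prim c d (\<lambda>s. H (x, s)) y \<partial>lb_on {a..b}) = prim c d (\<lambda>s. \<integral>x. H (x, s) \<partial>lb_on {a..b}) y"
    using rect_integral_xy[OF i] rect_integral_yx[OF i] by (simp add: prim_def)
qed

lemma prim_cmult: "prim c d (\<lambda>s. f s * k) y = prim c d f y * k"
proof -
  have "prim c d (\<lambda>s. f s * k) y = (\<integral>s. (indicator {..y} s * f s) * k \<partial>lb_on {c..d})"
    unfolding prim_def by (simp add: mult.assoc)
  then show ?thesis unfolding prim_def by simp
qed

lemma rect_mult_poly:
  fixes f :: sfield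
  assumes "integrable (lb_on ({a..b} \<times> {c..d})) f"
  shows "integrable (lb_on ({a..b} \<times> {c..d})) (\<lambda>z. f z * poly p (fst z))"
    "integrable (lb_on ({a..b} \<times> {c..d})) (\<lambda>z. f z * poly p (snd z))"
proof -
  obtain B where B: "\<forall>x\<in>{a..b}. \<bar>poly p x\<bar> \<le> B"
    using compact_continuous_image[OF continuous_on_poly_real[of "{a..b}" p]] compact_imp_bounded
    by (fastforce simp: bounded_iff)
  have "AE z in lb_on ({a..b} \<times> {c..d}). \<bar>poly p (fst z)\<bar> \<le> B"
    using B by (auto simp: AE_lb_on)
  then show "integrable (lb_on ({a..b} \<times> {c..d})) (\<lambda>z. f z * poly p (fst z))"
    by (intro integrable_mult_bounded[OF assms]) (use borel_fst_snd[OF poly_borel, of p] in auto)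
  obtain B where B: "\<forall>x\<in>{c..d}. \<bar>poly p x\<bar> \<le> B"
    using compact_continuous_image[OF continuous_on_poly_real[of "{c..d}" p]] compact_imp_bounded
    by (fastforce simp: bounded_iff)
  have "AE z in lb_on ({a..b} \<times> {c..d}). \<bar>poly p (snd z)\<bar> \<le> B"
    using B by (auto simp: AE_lb_on)
  then show "integrable (lb_on ({a..b} \<times> {c..d})) (\<lambda>z. f z * poly p (snd z))"
    by (intro integrable_mult_bounded[OF assms]) (use borel_fst_snd[OF poly_borel, of p] in auto)
qed

text \<open>A bridge to the gauge integral, whose continuous dependence on a parameter is used for
  the moments of a continuous function.\<close>

lemma lb_on_integral_continuous:
  fixes f :: "real \<Rightarrow> real"
  assumes "continuous_on {a..b} f"
  shows "(\<integral>x. indicator {a..b} x * f x \<partial>lb_on {a..b}) = integral {a..b} f"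
proof -
  have m: "(\<lambda>x. indicator {a..b} x * f x) \<in> borel_measurable borel"
    using borel_measurable_continuous_on_indicator[OF _ assms] by simp
  have s: "set_integrable lborel {a..b} f"
    unfolding set_integrable_def by (rule borel_integrable_compact[OF compact_Icc assms])
  have "(\<integral>x. indicator {a..b} x * f x \<partial>lb_on {a..b}) = (\<integral>x. indicator {a..b} x * (indicator {a..b} x * f x) \<partial>lborel)"
    by (rule integral_lb_on) (use m in auto)
  also have "\<dots> = (\<integral>x. indicator {a..b} x *\<^sub>R f x \<partial>lborel)"
    by (rule Bochner_Integration.integral_cong) (auto split: split_indicator)
  also have "\<dots> = integral {a..b} f"
    using set_borel_integral_eq_integral(2)[OF s] by (simp add: set_lebesgue_integral_def)
  finally show ?thesis .
qed

lemma continuous_on_slice_x: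
  assumes "continuous_on (A \<times> B) G" "y \<in> B"
  shows "continuous_on A (\<lambda>x. G (x, y))"
  by (rule continuous_on_compose2[OF assms(1)]) (use assms(2) in \<open>auto intro!: continuous_intros\<close>)

lemma continuous_on_slice_y:
  assumes "continuous_on (A \<times> B) G" "x \<in> A"
  shows "continuous_on B (\<lambda>y. G (x, y))"
  by (rule continuous_on_compose2[OF assms(1)]) (use assms(2) in \<open>auto intro!: continuous_intros\<close>)

lemma continuous_on_integral_x:
  fixes G :: sfield
  assumes G: "continuous_on ({a..b} \<times> {c..d}) G" "G \<in> borel_measurable borel"
  shows "continuous_on {c..d} (\<lambda>y. \<integral>x. G (x, y) * poly p x \<partial>lb_on {a..b})"
proof -
  have cx: "continuous_on {a..b} (\<lambda>x. G (x, y) * poly p x)" if "y \<in> {c..d}" for y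
    by (intro continuous_intros continuous_on_slice_x[OF G(1) that])
  have eq: "(\<integral>x. G (x, y) * poly p x \<partial>lb_on {a..b}) = integral {a..b} (\<lambda>x. G (x, y) * poly p x)"
    if "y \<in> {c..d}" for y
  proof -
    have [measurable]: "(\<lambda>x. G (x, y)) \<in> borel_measurable borel" by (rule borel_slice[OF G(2)])
    have "(\<integral>x. G (x, y) * poly p x \<partial>lb_on {a..b}) = (\<integral>x. indicator {a..b} x * (G (x, y) * poly p x) \<partial>lb_on {a..b})"
    proof (rule integral_cong_AE)
      show "AE x in lb_on {a..b}. G (x, y) * poly p x = indicator {a..b} x * (G (x, y) * poly p x)"
        using AE_lb_on_in[of "{a..b}", OF borel_closed[OF closed_atLeastAtMost]] by eventually_elim simp
    qed simp_all
    then show ?thesis using lb_on_integral_continuous[OF cx[OF that]] by simp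
  qed
  have "continuous_on {c..d} (\<lambda>y. integral (cbox a b) (\<lambda>x. G (x, y) * poly p x))"
  proof (rule integral_continuous_on_param)
    have "continuous_on ({c..d} \<times> cbox a b) (\<lambda>z. G (snd z, fst z))"
      by (rule continuous_on_compose2[OF G(1)]) (auto intro!: continuous_intros)
    then show "continuous_on ({c..d} \<times> cbox a b) (\<lambda>(y, x). G (x, y) * poly p x)"
      unfolding case_prod_unfold by (intro continuous_intros)
  qed
  then show ?thesis by (rule continuous_on_eq) (use eq in simp)
qed

section \<open>The interpolation error on a cell\<close>

lemma deg_lt_pderiv: "deg_lt n p \<Longrightarrow> deg_lt (n - 1) (pderiv p)"
  by (auto simp: deg_lt_def coeff_pderiv)

text \<open>\<open>G\<close> plays the role of the interpolation error, \<open>E\<^sub>1\<close> of its \<open>x\<close>-derivative and \<open>E\<^sub>2\<close> of its mixed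
  derivative. Tested against polynomials \<open>\<alpha>\<close> in \<open>x\<close>, the difference of \<open>E\<^sub>1\<close> and
  \<open>Jy c d (Ry c d l E\<^sub>2)\<close> is a polynomial of degree at most \<open>l\<close> in \<open>y\<close>; it vanishes at the end points
  and is orthogonal to polynomials of degree at most \<open>l - 2\<close>, hence it is zero.\<close>

lemma cell_identity:
  fixes G E\<^sub>1 E\<^sub>2 :: sfield
  assumes ab: "a < b" and cd: "c < d" and l: "1 \<le> l"
    and G: "continuous_on ({a..b} \<times> {c..d}) G" "G \<in> borel_measurable borel"
    and E1: "integrable (lb_on ({a..b} \<times> {c..d})) E\<^sub>1" and E2: "integrable (lb_on ({a..b} \<times> {c..d})) E\<^sub>2"
    and acx: "acx a b c d G E\<^sub>1" and acy: "acy a b c d E\<^sub>1 E\<^sub>2"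
    and Ri: "integrable (lb_on ({a..b} \<times> {c..d})) (Ry c d l E\<^sub>2)"
    and vertices: "\<And>x y. x \<in> {a, b} \<Longrightarrow> y \<in> {c, d} \<Longrightarrow> G (x, y) = 0"
    and hor: "\<And>y r. y \<in> {c, d} \<Longrightarrow> deg_lt (m - 1) r \<Longrightarrow> (\<integral>x. G (x, y) * poly r x \<partial>lb_on {a..b}) = 0"
    and ver: "\<And>x r. x \<in> {a, b} \<Longrightarrow> deg_lt (l - 1) r \<Longrightarrow> (\<integral>y. G (x, y) * poly r y \<partial>lb_on {c..d}) = 0"
    and int: "\<And>r s. deg_lt (m - 1) r \<Longrightarrow> deg_lt (l - 1) s \<Longrightarrow>
      (\<integral>z. G z * (poly r (fst z) * poly s (snd z)) \<partial>lb_on ({a..b} \<times> {c..d})) = 0"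
    and \<alpha>: "deg_lt m \<alpha>"
  shows "(\<integral>z. (E\<^sub>1 z - Jy c d (Ry c d l E\<^sub>2) z) * (poly \<alpha> (fst z) * poly \<beta> (snd z)) \<partial>lb_on ({a..b} \<times> {c..d})) = 0"
proof -
  let ?M = "lb_on ({a..b} \<times> {c..d})" and ?X = "lb_on {a..b}" and ?Y = "lb_on {c..d}"
  let ?K = "{a..b} \<times> {c..d}"
  let ?\<zeta> = "Ry c d l E\<^sub>2"
  let ?\<alpha>' = "pderiv \<alpha>"
  have sY: "AE y in ?Y. y \<in> {c..d}" and sX: "AE x in ?X. x \<in> {a..b}"
    by (rule AE_lb_on_in; simp)+
  have E1m: "E\<^sub>1 \<in> borel_measurable borel" and E2m: "E\<^sub>2 \<in> borel_measurable borel"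
    using borel_measurable_integrable[OF E1] borel_measurable_integrable[OF E2] by auto
  have Gi: "integrable ?M G"
  proof -
    have "bounded (G ` ?K)"
      by (intro compact_imp_bounded compact_continuous_image G compact_Times) auto
    then obtain B where "\<forall>z\<in>?K. \<bar>G z\<bar> \<le> B" by (auto simp: bounded_iff)
    then have "AE z in ?M. \<bar>G z\<bar> \<le> B" by (auto simp: AE_lb_on)
    then have "sqi ?M G" by (intro sqi_bounded[where B = B]) (use G(2) in simp_all)
    then show ?thesis by (rule sqi_imp_integrable[rotated]) simp
  qed
  \<comment> \<open>This is the moment of \<open>E\<^sub>1\<close> with \<open>\<alpha>\<close>
    after integration by parts in \<open>x\<close>. It involves only values of \<open>G\<close>, so
    it is continuous in \<open>y\<close> and accessible to the interpolation conditions.\<close>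
  define \<mu>\<^sub>0 where "\<mu>\<^sub>0 y = G (b, y) * poly \<alpha> b - G (a, y) * poly \<alpha> a - (\<integral>x. G (x, y) * poly ?\<alpha>' x \<partial>?X)" for y
  have m_cont: "continuous_on {c..d} \<mu>\<^sub>0"
    unfolding \<mu>\<^sub>0_def using ab
    by (intro continuous_intros continuous_on_slice_y[OF G(1)] continuous_on_integral_x[OF G]) auto
  have S1: "AE y in ?Y. \<mu>\<^sub>0 y = (\<integral>x. E\<^sub>1 (x, y) * poly \<alpha> x \<partial>?X)"
  proof -
    obtain A where A: "AE z in ?M. G z = A (snd z) + prim a b (\<lambda>t. E\<^sub>1 (t, snd z)) (fst z)"
      using acx by (auto simp: acx_def)
    show ?thesis using rect_AE_yx[OF A] rect_AE_integrable_x[OF E1] sY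
    proof eventually_elim
      case (elim y)
      let ?e = "\<lambda>x. E\<^sub>1 (x, y)"
      have eq: "G (x, y) = A y + prim a b ?e x" if "x \<in> {a..b}" for x
      proof (rule continuous_on_AE_eq[OF ab _ _ _ that])
        show "continuous_on {a..b} (\<lambda>x. G (x, y))" by (rule continuous_on_slice_x[OF G(1) elim(3)])
        show "continuous_on {a..b} (\<lambda>x. A y + prim a b ?e x)"
          by (intro continuous_intros continuous_on_subset[OF prim_continuous[OF elim(2)]]) simp
      qed (use elim(1) in simp)
      have e_m [measurable]: "?e \<in> borel_measurable borel" and g_m [measurable]: "(\<lambda>x. G (x, y)) \<in> borel_measurable borel"
        using borel_slice(2)[OF E1m] borel_slice(2)[OF G(2)] by auto
      have [measurable]: "prim a b ?e \<in> borel_measurable borel" "prim a b (poly ?\<alpha>') \<in> borel_measurable borel"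
        by (intro prim_borel; simp)+
      have A0: "A y = G (a, y)" using eq[of a] ab by simp
      have pe: "prim a b ?e x = G (x, y) - G (a, y)" if "x \<in> {a..b}" for x
        using eq[OF that] A0 by linarith
      have e_tot: "(\<integral>x. ?e x \<partial>?X) = G (b, y) - G (a, y)"
        using pe[of b] prim_right[of b b ?e a] ab e_m by simp
      have a_tot: "(\<integral>x. poly ?\<alpha>' x \<partial>?X) = poly \<alpha> b - poly \<alpha> a"
        using prim_poly[of b a b \<alpha>] prim_right[of b b "poly ?\<alpha>'" a] ab by simp
      have gi: "integrable ?X (\<lambda>x. G (x, y))"
        by (rule integrable_continuous_lb_on[OF continuous_on_slice_x[OF G(1) elim(3)] g_m])
      have "(\<integral>x. prim a b ?e x * poly ?\<alpha>' x \<partial>?X) = (\<integral>x. G (x, y) * poly ?\<alpha>' x - G (a, y) * poly ?\<alpha>' x \<partial>?X)"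
      proof (rule integral_cong_AE)
        show "AE x in ?X. prim a b ?e x * poly ?\<alpha>' x = G (x, y) * poly ?\<alpha>' x - G (a, y) * poly ?\<alpha>' x"
          using sX by eventually_elim (simp only: pe left_diff_distrib)
      qed simp_all
      also have "\<dots> = (\<integral>x. G (x, y) * poly ?\<alpha>' x \<partial>?X) - G (a, y) * (poly \<alpha> b - poly \<alpha> a)"
        using integrable_mult_poly[OF gi, of ?\<alpha>'] integrable_poly[of a b ?\<alpha>'] a_tot by simp
      finally have 1: "(\<integral>x. prim a b ?e x * poly ?\<alpha>' x \<partial>?X)
        = (\<integral>x. G (x, y) * poly ?\<alpha>' x \<partial>?X) - G (a, y) * (poly \<alpha> b - poly \<alpha> a)" .
      have "(\<integral>x. ?e x * prim a b (poly ?\<alpha>') x \<partial>?X) = (\<integral>x. ?e x * poly \<alpha> x - poly \<alpha> a * ?e x \<partial>?X)"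
      proof (rule integral_cong_AE)
        show "AE x in ?X. ?e x * prim a b (poly ?\<alpha>') x = ?e x * poly \<alpha> x - poly \<alpha> a * ?e x"
          using sX by eventually_elim (simp add: prim_poly[of _ a b \<alpha>] algebra_simps)
      qed simp_all
      also have "\<dots> = (\<integral>x. ?e x * poly \<alpha> x \<partial>?X) - poly \<alpha> a * (G (b, y) - G (a, y))"
        using integrable_mult_poly[OF elim(2), of \<alpha>] elim(2) e_tot by simp
      finally have 2: "(\<integral>x. ?e x * prim a b (poly ?\<alpha>') x \<partial>?X)
        = (\<integral>x. ?e x * poly \<alpha> x \<partial>?X) - poly \<alpha> a * (G (b, y) - G (a, y))" .
      show ?case
        using prim_integration_by_parts[OF elim(2) integrable_poly[of a b ?\<alpha>']] 1 2 e_tot a_tot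
        by (simp add: \<mu>\<^sub>0_def algebra_simps)
    qed
  qed
  define \<mu> where "\<mu> s = (\<integral>x. E\<^sub>2 (x, s) * poly \<alpha> x \<partial>?X)" for s
  define \<nu> where "\<nu> s = (\<integral>x. ?\<zeta> (x, s) * poly \<alpha> x \<partial>?X)" for s
  note E2a = rect_mult_poly(1)[OF E2, of \<alpha>] and Ra = rect_mult_poly(1)[OF Ri, of \<alpha>]
  have mui: "integrable ?Y \<mu>" and nui: "integrable ?Y \<nu>"
    using rect_integrable_y[OF E2a] rect_integrable_y[OF Ra] by (simp_all add: \<mu>_def[abs_def] \<nu>_def[abs_def])
  \<comment> \<open>The moment in \<open>x\<close> of a function that is absolutely continuous in
    \<open>y\<close> is a constant plus a primitive; the constant is the moment of the bottom
    trace.\<close>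
  have S2: "\<exists>k. AE y in ?Y. (\<integral>x. E\<^sub>1 (x, y) * poly \<alpha> x \<partial>?X) = k + prim c d \<mu> y"
  proof -
    obtain B where B: "integrable ?X B" "AE z in ?M. E\<^sub>1 z = B (fst z) + prim c d (\<lambda>s. E\<^sub>2 (fst z, s)) (snd z)"
      using acy by (auto simp: acy_def)
    have "AE y in ?Y. (\<integral>x. E\<^sub>1 (x, y) * poly \<alpha> x \<partial>?X) = (\<integral>x. B x * poly \<alpha> x \<partial>?X) + prim c d \<mu> y"
      using rect_AE_yx[OF B(2)] rect_AE_integrable_x[OF E1]
    proof eventually_elim
      case (elim y)
      have p: "(\<lambda>x. prim c d (\<lambda>s. E\<^sub>2 (x, s)) y * poly \<alpha> x) = (\<lambda>x. prim c d (\<lambda>s. E\<^sub>2 (x, s) * poly \<alpha> x) y)"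
        by (simp add: prim_cmult)
      have pi: "integrable ?X (\<lambda>x. prim c d (\<lambda>s. E\<^sub>2 (x, s)) y * poly \<alpha> x)"
        unfolding p using rect_prim_Fubini(1)[OF E2a, of y] by simp
      have "(\<integral>x. E\<^sub>1 (x, y) * poly \<alpha> x \<partial>?X) = (\<integral>x. B x * poly \<alpha> x + prim c d (\<lambda>s. E\<^sub>2 (x, s)) y * poly \<alpha> x \<partial>?X)"
      proof (rule integral_cong_AE)
        show "AE x in ?X. E\<^sub>1 (x, y) * poly \<alpha> x = B x * poly \<alpha> x + prim c d (\<lambda>s. E\<^sub>2 (x, s)) y * poly \<alpha> x"
          using elim(1) by eventually_elim (simp add: algebra_simps)
        show "(\<lambda>x. E\<^sub>1 (x, y) * poly \<alpha> x) \<in> borel_measurable ?X"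
          using integrable_mult_poly[OF elim(2), of \<alpha>] by (rule borel_measurable_integrable)
        show "(\<lambda>x. B x * poly \<alpha> x + prim c d (\<lambda>s. E\<^sub>2 (x, s)) y * poly \<alpha> x) \<in> borel_measurable ?X"
          by (intro borel_measurable_add borel_measurable_integrable pi integrable_mult_poly B)
      qed
      also have "\<dots> = (\<integral>x. B x * poly \<alpha> x \<partial>?X) + (\<integral>x. prim c d (\<lambda>s. E\<^sub>2 (x, s)) y * poly \<alpha> x \<partial>?X)"
        by (intro Bochner_Integration.integral_add pi integrable_mult_poly B)
      also have "(\<integral>x. prim c d (\<lambda>s. E\<^sub>2 (x, s)) y * poly \<alpha> x \<partial>?X) = prim c d \<mu> y"
        unfolding p using rect_prim_Fubini(2)[OF E2a, of y] by (simp add: \<mu>_def[abs_def])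
      finally show ?case .
    qed
    then show ?thesis by blast
  qed
  then obtain k where k: "AE y in ?Y. (\<integral>x. E\<^sub>1 (x, y) * poly \<alpha> x \<partial>?X) = k + prim c d \<mu> y" by blast
  have S3: "(\<integral>x. Jy c d ?\<zeta> (x, y) * poly \<alpha> x \<partial>?X) = prim c d \<nu> y"
    and S3i: "integrable ?X (\<lambda>x. Jy c d ?\<zeta> (x, y) * poly \<alpha> x)" for y
  proof -
    have p: "(\<lambda>x. Jy c d ?\<zeta> (x, y) * poly \<alpha> x) = (\<lambda>x. prim c d (\<lambda>s. ?\<zeta> (x, s) * poly \<alpha> x) y)"
      by (simp add: Jy_def prim_cmult)
    show "(\<integral>x. Jy c d ?\<zeta> (x, y) * poly \<alpha> x \<partial>?X) = prim c d \<nu> y"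
      unfolding p using rect_prim_Fubini(2)[OF Ra, of y] by (simp add: \<nu>_def[abs_def])
    show "integrable ?X (\<lambda>x. Jy c d ?\<zeta> (x, y) * poly \<alpha> x)"
      unfolding p using rect_prim_Fubini(1)[OF Ra, of y] by simp
  qed
  let ?e = "obasis c d l"
  define W where "W i x = (\<integral>s. poly (?e i) s * E\<^sub>2 (x, s) \<partial>?Y)" for i x
  have Wi: "integrable ?X (W i)" for i
    using rect_integrable_x[OF rect_mult_poly(2)[OF E2, of "?e i"]]
    by (simp add: W_def[abs_def] mult.commute)
  define P where "P = (\<Sum>i<l. smult (\<integral>x. W i x * poly \<alpha> x \<partial>?X) (?e i))"
  have Pd: "deg_lt l P" unfolding P_def by (intro deg_lt_sum deg_lt_smult obasis(1)[OF cd]) auto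
  \<comment> \<open>\<open>E\<^sub>2\<close> minus its residual is the projection, a polynomial in
    \<open>y\<close> on each slice; the moment in \<open>x\<close> acts on its coefficients
    only.\<close>
  have S4: "AE s in ?Y. \<mu> s - \<nu> s = poly P s"
    using rect_AE_integrable_x[OF E2a] rect_AE_integrable_x[OF Ra]
  proof eventually_elim
    case (elim s)
    have "\<mu> s - \<nu> s = (\<integral>x. E\<^sub>2 (x, s) * poly \<alpha> x - ?\<zeta> (x, s) * poly \<alpha> x \<partial>?X)"
      using elim by (simp add: \<mu>_def \<nu>_def)
    also have "\<dots> = (\<integral>x. (\<Sum>i<l. (W i x * poly \<alpha> x) * poly (?e i) s) \<partial>?X)"
      by (rule Bochner_Integration.integral_cong)
        (auto simp: Ry_eq W_def left_diff_distrib right_diff_distrib sum_distrib_right sum_distrib_left ac_simps)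
    also have "\<dots> = (\<Sum>i<l. (\<integral>x. W i x * poly \<alpha> x \<partial>?X) * poly (?e i) s)"
      using integrable_mult_poly[OF Wi] by (subst Bochner_Integration.integral_sum) auto
    finally show ?case by (simp add: P_def poly_sum)
  qed
  obtain R where R: "pderiv R = P" "deg_lt (Suc l) R" using poly_antiderivative[of P] Pd by metis
  have numY: "\<mu> \<in> borel_measurable borel" "\<nu> \<in> borel_measurable borel"
    using borel_measurable_integrable[OF mui] borel_measurable_integrable[OF nui] by auto
  have prim_R: "prim c d \<mu> y - prim c d \<nu> y = poly R y - poly R c" if "y \<in> {c..d}" for y
  proof -
    have "prim c d \<mu> y - prim c d \<nu> y = prim c d (\<lambda>s. \<mu> s - \<nu> s) y"
      by (rule prim_diff[OF mui nui, symmetric])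
    also have "\<dots> = prim c d (poly P) y"
      by (rule prim_cong_AE[OF S4]) (use numY in auto)
    finally show ?thesis using prim_poly[OF that, of R] R(1) by simp
  qed
  \<comment> \<open>The polynomial to be shown zero: an antiderivative of \<open>P\<close> with the
    constant fixed by the value \<open>k\<close> at \<open>y = c\<close>.\<close>
  define Q where "Q = R + [:k - poly R c:]"
  have Qd: "deg_lt (Suc l) Q"
    unfolding Q_def by (intro deg_lt_add R) (rule deg_lt_degree, simp)
  have Q: "\<mu>\<^sub>0 y - prim c d \<nu> y = poly Q y" if "y \<in> {c..d}" for y
  proof (rule continuous_on_AE_eq[OF cd _ continuous_on_poly_real _ that])
    show "continuous_on {c..d} (\<lambda>y. \<mu>\<^sub>0 y - prim c d \<nu> y)"
      by (intro continuous_intros m_cont continuous_on_subset[OF prim_continuous[OF nui]]) simp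
    show "AE y in ?Y. \<mu>\<^sub>0 y - prim c d \<nu> y = poly Q y"
      using S1 k sY by eventually_elim (use prim_R in \<open>force simp: Q_def\<close>)
  qed
  \<comment> \<open>The residual is orthogonal on almost every slice, and Fubini's theorem hands
    this on to its moment in \<open>x\<close>.\<close>
  have o: "orth c d l \<nu>"
    unfolding orth_def
  proof (intro allI impI)
    fix r assume r: "deg_lt l r"
    have i: "integrable ?M (\<lambda>z. ?\<zeta> z * poly \<alpha> (fst z) * poly r (snd z))"
      by (rule rect_mult_poly(2)[OF Ra])
    have "(\<integral>s. \<nu> s * poly r s \<partial>?Y) = (\<integral>z. ?\<zeta> z * poly \<alpha> (fst z) * poly r (snd z) \<partial>?M)"
      by (subst rect_integral_yx[OF i]) (simp add: \<nu>_def)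
    also have "\<dots> = (\<integral>x. (\<integral>s. ?\<zeta> (x, s) * poly r s \<partial>?Y) * poly \<alpha> x \<partial>?X)"
    proof -
      have eq: "(\<lambda>z. ?\<zeta> z * poly \<alpha> (fst z) * poly r (snd z)) = (\<lambda>z. ?\<zeta> z * poly r (snd z) * poly \<alpha> (fst z))"
        by (simp add: ac_simps)
      show ?thesis using rect_integral_xy[OF i[unfolded eq]] by (simp add: eq)
    qed
    also have "\<dots> = 0"
    proof (rule integral_eq_zero_AE)
      show "AE x in ?X. (\<integral>s. ?\<zeta> (x, s) * poly r s \<partial>?Y) * poly \<alpha> x = 0"
        using rect_AE_integrable_y[OF E2]
      proof eventually_elim
        case (elim x)
        then show ?case using orth_resid[OF cd elim, of l] r by (simp add: orth_def Ry_def)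
      qed
    qed
    finally show "(\<integral>s. \<nu> s * poly r s \<partial>?Y) = 0" .
  qed
  have "orth c d (Suc (l - 1)) \<nu>" using o l by simp
  note o' = orth_prim[OF nui this]
  \<comment> \<open>On the horizontal edges the vertex values remove the end terms, and the edge
    moments remove the integral, because \<open>pderiv \<alpha>\<close> has one degree less than
    \<open>\<alpha>\<close>.\<close>
  have m0: "\<mu>\<^sub>0 y = 0" if "y \<in> {c, d}" for y
    using vertices[of a y] vertices[of b y] hor[OF that deg_lt_pderiv[OF \<alpha>]] that by (simp add: \<mu>\<^sub>0_def)
  have nd: "prim c d \<nu> d = 0" using prim_right[of d d \<nu> c] numY o'(2) by simp
  have "Q = 0"
  proof (rule poly_eq_0_if_orth[OF cd])
    show "deg_lt (l - 1 + 2) Q" using Qd l by simp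
    show "poly Q c = 0" using Q[of c] m0[of c] cd by simp
    show "poly Q d = 0" using Q[of d] m0[of d] nd cd by simp
    \<comment> \<open>The end terms of \<open>\<mu>\<^sub>0\<close> vanish by the moments on the
      vertical edges, the integral by the moments over the cell. Two end values and
      \<open>l - 1\<close> moments match the \<open>l + 1\<close> coefficients of
      \<open>Q\<close>.\<close>
    fix r assume r: "deg_lt (l - 1) r"
    have Gx: "integrable ?Y (\<lambda>y. G (x, y) * poly r y)" if "x \<in> {a..b}" for x
      by (intro integrable_mult_poly integrable_continuous_lb_on continuous_on_slice_y[OF G(1) that] borel_slice[OF G(2)])
    have i: "integrable ?M (\<lambda>z. G z * poly ?\<alpha>' (fst z) * poly r (snd z))"
      by (intro rect_mult_poly Gi)
    have iy: "integrable ?Y (\<lambda>y. (\<integral>x. G (x, y) * poly ?\<alpha>' x \<partial>?X) * poly r y)"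
      using rect_integrable_y[OF i] by simp
    have "(\<integral>y. (\<integral>x. G (x, y) * poly ?\<alpha>' x \<partial>?X) * poly r y \<partial>?Y) = (\<integral>z. G z * poly ?\<alpha>' (fst z) * poly r (snd z) \<partial>?M)"
      by (subst rect_integral_yx[OF i]) simp
    also have "\<dots> = 0" using int[OF deg_lt_pderiv[OF \<alpha>] r] by (simp add: mult.assoc)
    finally have z: "(\<integral>y. (\<integral>x. G (x, y) * poly ?\<alpha>' x \<partial>?X) * poly r y \<partial>?Y) = 0" .
    have mi: "integrable ?Y (\<lambda>y. \<mu>\<^sub>0 y * poly r y)" and m0r: "(\<integral>y. \<mu>\<^sub>0 y * poly r y \<partial>?Y) = 0"
    proof -
      have eq: "(\<lambda>y. \<mu>\<^sub>0 y * poly r y) = (\<lambda>y. poly \<alpha> b * (G (b, y) * poly r y) - poly \<alpha> a * (G (a, y) * poly r y)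
        - (\<integral>x. G (x, y) * poly ?\<alpha>' x \<partial>?X) * poly r y)"
        by (simp add: \<mu>\<^sub>0_def algebra_simps)
      have i1: "integrable ?Y (\<lambda>y. G (b, y) * poly r y)" "integrable ?Y (\<lambda>y. G (a, y) * poly r y)"
        using Gx[of a] Gx[of b] ab by auto
      show "integrable ?Y (\<lambda>y. \<mu>\<^sub>0 y * poly r y)"
        unfolding eq by (intro Bochner_Integration.integrable_diff integrable_mult_right iy i1)
      show "(\<integral>y. \<mu>\<^sub>0 y * poly r y \<partial>?Y) = 0"
        unfolding eq using i1 iy z ver[of a r] ver[of b r] r by simp
    qed
    have pn: "integrable ?Y (\<lambda>y. prim c d \<nu> y * poly r y)" "(\<integral>y. prim c d \<nu> y * poly r y \<partial>?Y) = 0"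
    proof -
      have "integrable ?Y (prim c d \<nu>)"
        by (intro integrable_continuous_lb_on continuous_on_subset[OF prim_continuous[OF nui]] prim_borel numY) simp
      then show "integrable ?Y (\<lambda>y. prim c d \<nu> y * poly r y)" by (rule integrable_mult_poly)
      show "(\<integral>y. prim c d \<nu> y * poly r y \<partial>?Y) = 0" using o'(1) r by (simp add: orth_def)
    qed
    have "(\<integral>y. poly Q y * poly r y \<partial>?Y) = (\<integral>y. \<mu>\<^sub>0 y * poly r y - prim c d \<nu> y * poly r y \<partial>?Y)"
    proof (rule integral_cong_AE)
      show "AE y in ?Y. poly Q y * poly r y = \<mu>\<^sub>0 y * poly r y - prim c d \<nu> y * poly r y"
        using sY by eventually_elim (simp add: Q[symmetric] left_diff_distrib)
    qed (use mi pn in simp_all)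
    also have "\<dots> = 0" using mi pn m0r by simp
    finally show "(\<integral>y. poly Q y * poly r y \<partial>?Y) = 0" .
  qed
  \<comment> \<open>The moment in \<open>x\<close> of \<open>E\<^sub>1 - Jy c d ?\<zeta>\<close>
    vanishes for almost every \<open>y\<close>, so the factor \<open>\<beta>\<close> in
    \<open>y\<close> may be arbitrary.\<close>
  then have mn: "\<mu>\<^sub>0 y = prim c d \<nu> y" if "y \<in> {c..d}" for y using Q[OF that] by simp
  have Zi: "integrable ?M (Jy c d ?\<zeta>)"
  proof -
    have "integrable (lb_on ({c..d} \<times> {a..b})) (\<lambda>z. ?\<zeta> (snd z, fst z))"
      using Ri by (subst rect_integrable_swap)
    from prim_x_integrable[OF this] have "integrable (lb_on ({c..d} \<times> {a..b})) (\<lambda>z. Jy c d ?\<zeta> (snd z, fst z))"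
      by (simp add: Jy_def)
    then show ?thesis by (subst (asm) rect_integrable_swap)
  qed
  have Ei: "integrable ?M (\<lambda>z. (E\<^sub>1 z - Jy c d ?\<zeta> z) * poly \<alpha> (fst z) * poly \<beta> (snd z))"
    by (intro rect_mult_poly Bochner_Integration.integrable_diff E1 Zi)
  have "(\<integral>z. (E\<^sub>1 z - Jy c d ?\<zeta> z) * poly \<alpha> (fst z) * poly \<beta> (snd z) \<partial>?M)
    = (\<integral>y. (\<integral>x. (E\<^sub>1 (x, y) - Jy c d ?\<zeta> (x, y)) * poly \<alpha> x \<partial>?X) * poly \<beta> y \<partial>?Y)"
    by (subst rect_integral_yx[OF Ei]) simp
  also have "\<dots> = 0"
  proof (rule integral_eq_zero_AE)
    show "AE y in ?Y. (\<integral>x. (E\<^sub>1 (x, y) - Jy c d ?\<zeta> (x, y)) * poly \<alpha> x \<partial>?X) * poly \<beta> y = 0"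
      using S1 sY rect_AE_integrable_x[OF E1]
    proof eventually_elim
      case (elim y)
      have "(\<integral>x. (E\<^sub>1 (x, y) - Jy c d ?\<zeta> (x, y)) * poly \<alpha> x \<partial>?X) = \<mu>\<^sub>0 y - prim c d \<nu> y"
        using integrable_mult_poly[OF elim(3), of \<alpha>] S3i[of y] elim(1) S3[of y]
        by (simp add: left_diff_distrib)
      then show ?case using mn[OF elim(2)] by simp
    qed
  qed
  finally show ?thesis by (simp add: mult.assoc)
qed

section \<open>Commutation of the operators with derivatives in the first variable\<close>

lemma rect_AE_fst:
  fixes a b c d :: real
  assumes "AE x in lb_on {a..b}. P x"
  shows "AE z in lb_on ({a..b} \<times> {c..d}). P (fst z)"
proof -
  interpret P: pair_sigma_finite "lb_on {a..b}" "lb_on {c..d}" by (rule pair_sigma_finite_lb)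
  have "absolutely_continuous (lb_on {a..b}) (distr (lb_on {a..b} \<Otimes>\<^sub>M lb_on {c..d}) (lb_on {a..b}) fst)"
    unfolding absolutely_continuous_def
  proof
    fix N assume N: "N \<in> null_sets (lb_on {a..b})"
    then have "emeasure (lb_on {a..b} \<Otimes>\<^sub>M lb_on {c..d}) (N \<times> UNIV) = 0"
      using P.M2.emeasure_pair_measure_Times[of N "lb_on {a..b}" UNIV] null_setsD1[OF N] null_setsD2[OF N]
      by simp
    moreover have "fst -` N \<inter> space (lb_on {a..b} \<Otimes>\<^sub>M lb_on {c..d}) = N \<times> UNIV"
      by (auto simp: space_pair_measure)
    ultimately show "N \<in> null_sets (distr (lb_on {a..b} \<Otimes>\<^sub>M lb_on {c..d}) (lb_on {a..b}) fst)"
      using N by (auto simp: null_sets_def emeasure_distr)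
  qed
  from absolutely_continuous_AE[OF _ this assms]
  have "AE z in distr (lb_on {a..b} \<Otimes>\<^sub>M lb_on {c..d}) (lb_on {a..b}) fst. P z" by simp
  then show ?thesis unfolding lb_rect by (rule AE_distrD[OF measurable_fst])
qed

lemma rect_AE_snd:
  fixes a b c d :: real
  assumes "AE y in lb_on {c..d}. P y"
  shows "AE z in lb_on ({a..b} \<times> {c..d}). P (snd z)"
  using rect_AE_fst[OF assms, of a b] by (subst rect_AE_swap) simp

text \<open>A nondegenerate interval is not a null set; the proposition is encoded as a constant
  function so that \<open>continuous_on_AE_eq\<close> applies.\<close>

lemma AE_Icc_const:
  assumes "a < (b :: real)" "AE x in lb_on {a..b}. P"
  shows P
proof -
  have "AE x in lb_on {a..b}. (if P then 0 else 1 :: real) = 0" using assms(2) by eventually_elim simp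
  then have "(if P then 0 else 1 :: real) = 0"
    by (rule continuous_on_AE_eq[OF assms(1) continuous_on_const continuous_on_const, where x = a]) (use assms(1) in simp)
  then show ?thesis by (simp split: if_splits)
qed

lemma rect_kernel_Fubini:
  fixes f' :: sfield
  assumes f': "integrable (lb_on ({a..b} \<times> {c..d})) f'"
    and k: "k \<in> borel_measurable borel" "AE s in lb_on {c..d}. \<bar>k s\<bar> \<le> B"
  shows "integrable (lb_on {c..d}) (\<lambda>s. k s * prim a b (\<lambda>t. f' (t, s)) x)"
    and "(\<integral>s. k s * prim a b (\<lambda>t. f' (t, s)) x \<partial>lb_on {c..d})
      = prim a b (\<lambda>t. \<integral>s. k s * f' (t, s) \<partial>lb_on {c..d}) x"
proof -
  have "integrable (lb_on ({a..b} \<times> {c..d})) (\<lambda>z. f' z * k (snd z))"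
    by (rule integrable_mult_bounded[OF f' _ rect_AE_snd[OF k(2)]]) (use borel_fst_snd(2)[OF k(1)] in simp)
  then have "integrable (lb_on ({a..b} \<times> {c..d})) (\<lambda>z. k (snd z) * f' z)" by (simp add: mult.commute)
  then have H: "integrable (lb_on ({c..d} \<times> {a..b})) (\<lambda>z. k (fst z) * f' (snd z, fst z))"
    by (subst (asm) rect_integrable_swap[symmetric]) simp
  have p: "k s * prim a b (\<lambda>t. f' (t, s)) x = prim a b (\<lambda>t. k s * f' (t, s)) x" for s
    using prim_cmult[of a b "\<lambda>t. f' (t, s)" "k s" x] by (simp add: mult.commute)
  show "integrable (lb_on {c..d}) (\<lambda>s. k s * prim a b (\<lambda>t. f' (t, s)) x)"
    "(\<integral>s. k s * prim a b (\<lambda>t. f' (t, s)) x \<partial>lb_on {c..d})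
      = prim a b (\<lambda>t. \<integral>s. k s * f' (t, s) \<partial>lb_on {c..d}) x"
    using rect_prim_Fubini[OF H, of x] by (simp_all add: p)
qed

text \<open>Covers both operators at once: \<open>Jy\<close> and the projection are integral
  operators in \<open>y\<close> with bounded kernels. Fubini's theorem exchanges the kernel with the
  primitive in \<open>x\<close>.\<close>

lemma acx_kernel:
  fixes f f' k :: sfield
  assumes f: "f \<in> borel_measurable borel" and f': "integrable (lb_on ({a..b} \<times> {c..d})) f'" and ac: "acx a b c d f f'"
    and k: "k \<in> borel_measurable borel" "\<And>y s. y \<in> {c..d} \<Longrightarrow> s \<in> {c..d} \<Longrightarrow> \<bar>k (y, s)\<bar> \<le> B"
  shows "acx a b c d (\<lambda>z. \<integral>s. k (snd z, s) * f (fst z, s) \<partial>lb_on {c..d})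
    (\<lambda>z. \<integral>s. k (snd z, s) * f' (fst z, s) \<partial>lb_on {c..d})"
proof -
  let ?M = "lb_on ({a..b} \<times> {c..d})" and ?X = "lb_on {a..b}" and ?Y = "lb_on {c..d}"
  obtain A where A: "integrable ?Y A" "AE z in ?M. f z = A (snd z) + prim a b (\<lambda>t. f' (t, snd z)) (fst z)"
    using ac by (auto simp: acx_def)
  have sY: "AE s in ?Y. s \<in> {c..d}" by (rule AE_lb_on_in) simp
  have kb: "AE s in ?Y. \<bar>k (y, s)\<bar> \<le> B" if "y \<in> {c..d}" for y
    using sY by eventually_elim (use k(2) that in blast)
  have km: "(\<lambda>s. k (y, s)) \<in> borel_measurable borel" for y by (rule borel_slice[OF k(1)])
  have Am: "A \<in> borel_measurable borel" using borel_measurable_integrable[OF A(1)] by simp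
  have kA: "integrable ?Y (\<lambda>s. k (y, s) * A s)" if "y \<in> {c..d}" for y
    using integrable_mult_bounded[OF A(1) _ kb[OF that]] km by (simp add: mult.commute)
  \<comment> \<open>The kernel also acts on the left trace; boundedness of the kernel keeps the
    result integrable.\<close>
  define A' where "A' y = (\<integral>s. k (y, s) * A s \<partial>?Y)" for y
  have "A' \<in> borel_measurable borel"
    using borel_integral_y[of "\<lambda>z. k z * A (snd z)" c d] k(1) borel_fst_snd(2)[OF Am]
    by (simp add: A'_def[abs_def])
  moreover have "AE y in ?Y. \<bar>A' y\<bar> \<le> B * (\<integral>s. \<bar>A s\<bar> \<partial>?Y)"
    using sY
  proof eventually_elim
    case (elim y)
    have "\<bar>A' y\<bar> \<le> (\<integral>s. \<bar>k (y, s) * A s\<bar> \<partial>?Y)" unfolding A'_def by (rule integral_abs_bound)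
    also have "\<dots> \<le> (\<integral>s. B * \<bar>A s\<bar> \<partial>?Y)"
    proof (rule integral_mono_AE)
      show "AE s in ?Y. \<bar>k (y, s) * A s\<bar> \<le> B * \<bar>A s\<bar>"
        using kb[OF elim] by eventually_elim (simp add: abs_mult mult_right_mono)
    qed (use kA[OF elim] A(1) in auto)
    finally show ?case by simp
  qed
  ultimately have "sqi ?Y A'" by (intro sqi_bounded) simp_all
  then have A'i: "integrable ?Y A'" by (rule sqi_imp_integrable[rotated]) simp
  \<comment> \<open>The exceptional set of \<open>x\<close> comes from \<open>f\<close> alone and is
    fixed before \<open>y\<close>, so one slice serves all \<open>y\<close>.\<close>
  have "AE x in ?X. \<forall>y\<in>{c..d}. (\<integral>s. k (y, s) * f (x, s) \<partial>?Y)
      = A' y + prim a b (\<lambda>t. \<integral>s. k (y, s) * f' (t, s) \<partial>?Y) x"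
    using rect_AE_xy[OF A(2)]
  proof eventually_elim
    case (elim x)
    show ?case
    proof
      fix y assume y: "y \<in> {c..d}"
      note F = rect_kernel_Fubini[OF f' km kb[OF y], of x]
      have "(\<integral>s. k (y, s) * f (x, s) \<partial>?Y) = (\<integral>s. k (y, s) * A s + k (y, s) * prim a b (\<lambda>t. f' (t, s)) x \<partial>?Y)"
      proof (rule integral_cong_AE)
        show "AE s in ?Y. k (y, s) * f (x, s) = k (y, s) * A s + k (y, s) * prim a b (\<lambda>t. f' (t, s)) x"
          using elim by eventually_elim (simp add: distrib_left)
        show "(\<lambda>s. k (y, s) * f (x, s)) \<in> borel_measurable ?Y" using km borel_slice(1)[OF f] by simp
        show "(\<lambda>s. k (y, s) * A s + k (y, s) * prim a b (\<lambda>t. f' (t, s)) x) \<in> borel_measurable ?Y"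
          by (intro borel_measurable_add borel_measurable_integrable kA[OF y] F(1))
      qed
      also have "\<dots> = A' y + (\<integral>s. k (y, s) * prim a b (\<lambda>t. f' (t, s)) x \<partial>?Y)"
        unfolding A'_def by (rule Bochner_Integration.integral_add[OF kA[OF y] F(1)])
      finally show "(\<integral>s. k (y, s) * f (x, s) \<partial>?Y) = A' y + prim a b (\<lambda>t. \<integral>s. k (y, s) * f' (t, s) \<partial>?Y) x"
        using F(2) by simp
    qed
  qed
  from rect_AE_fst[OF this] rect_AE_snd[OF sY]
  have "AE z in ?M. (\<integral>s. k (snd z, s) * f (fst z, s) \<partial>?Y)
      = A' (snd z) + prim a b (\<lambda>t. \<integral>s. k (snd z, s) * f' (t, s) \<partial>?Y) (fst z)"
    by eventually_elim blast
  then show ?thesis unfolding acx_def using A'i by auto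
qed

lemma acx_Jy:
  assumes f: "f \<in> borel_measurable borel" and f': "integrable (lb_on ({a..b} \<times> {c..d})) f'" and ac: "acx a b c d f f'"
  shows "acx a b c d (Jy c d f) (Jy c d f')"
proof -
  let ?k = "\<lambda>(y, s). indicator {..y :: real} s :: real"
  have "?k = (\<lambda>z. if snd z \<le> fst z then 1 else 0)" by (auto simp: fun_eq_iff)
  moreover have "(\<lambda>z. if snd z \<le> fst z then 1 else 0 :: real) \<in> borel_measurable ((borel :: real measure) \<Otimes>\<^sub>M borel)"
    by measurable
  ultimately have "?k \<in> borel_measurable borel" by (simp add: borel_real_pair)
  from acx_kernel[OF f f' ac this, of 1] show ?thesis
    by (simp add: Jy_def[abs_def] prim_def split: split_indicator)
qed

lemma acx_diff:
  assumes f': "integrable (lb_on ({a..b} \<times> {c..d})) f'" and g': "integrable (lb_on ({a..b} \<times> {c..d})) g'"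
    and "acx a b c d f f'" "acx a b c d g g'"
  shows "acx a b c d (\<lambda>z. f z - g z) (\<lambda>z. f' z - g' z)"
proof -
  let ?M = "lb_on ({a..b} \<times> {c..d})"
  obtain A where A: "integrable (lb_on {c..d}) A" "AE z in ?M. f z = A (snd z) + prim a b (\<lambda>t. f' (t, snd z)) (fst z)"
    using assms(3) by (auto simp: acx_def)
  obtain B where B: "integrable (lb_on {c..d}) B" "AE z in ?M. g z = B (snd z) + prim a b (\<lambda>t. g' (t, snd z)) (fst z)"
    using assms(4) by (auto simp: acx_def)
  have "AE z in ?M. f z - g z = (A (snd z) - B (snd z)) + prim a b (\<lambda>t. f' (t, snd z) - g' (t, snd z)) (fst z)"
    using A(2) B(2) rect_AE_snd[OF rect_AE_integrable_x[OF f']] rect_AE_snd[OF rect_AE_integrable_x[OF g']]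
    by eventually_elim (simp add: prim_diff)
  then show ?thesis unfolding acx_def using A(1) B(1)
    by (intro exI[of _ "\<lambda>y. A y - B y"]) auto
qed

text \<open>The projection has the reproducing kernel of the polynomials, a finite sum of products
  of basis elements and hence bounded on the square; the residual follows by subtraction.\<close>

lemma acx_Ry:
  assumes f: "f \<in> borel_measurable borel" and f': "integrable (lb_on ({a..b} \<times> {c..d})) f'" and ac: "acx a b c d f f'"
    and Pf': "integrable (lb_on ({a..b} \<times> {c..d})) (Ry c d n f')"
    and ff: "integrable (lb_on ({a..b} \<times> {c..d})) f"
  shows "acx a b c d (Ry c d n f) (Ry c d n f')"
proof -
  let ?M = "lb_on ({a..b} \<times> {c..d})" and ?Y = "lb_on {c..d}"
  let ?k = "\<lambda>z. \<Sum>i<n. poly (obasis c d n i) (fst z) * poly (obasis c d n i) (snd z)"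
  have km: "?k \<in> borel_measurable borel"
    by (intro borel_measurable_sum borel_measurable_times borel_fst_snd[OF poly_borel])
  have "bounded (?k ` ({c..d} \<times> {c..d}))"
    by (intro compact_imp_bounded compact_continuous_image compact_Times continuous_intros) auto
  then obtain B where B: "\<forall>z\<in>{c..d} \<times> {c..d}. \<bar>?k z\<bar> \<le> B" by (auto simp: bounded_iff)
  have eq: "(\<integral>s. ?k (y, s) * g s \<partial>?Y) = g y - resid c d n g y" if "integrable ?Y g" for g y
  proof -
    have "(\<integral>s. ?k (y, s) * g s \<partial>?Y)
        = (\<integral>s. (\<Sum>i<n. poly (obasis c d n i) y * (poly (obasis c d n i) s * g s)) \<partial>?Y)"
      by (simp add: sum_distrib_right mult.assoc)
    also have "\<dots> = (\<Sum>i<n. poly (obasis c d n i) y * (\<integral>s. poly (obasis c d n i) s * g s \<partial>?Y))"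
      using integrable_mult_poly[OF that]
      by (subst Bochner_Integration.integral_sum) (auto simp: mult.commute)
    finally show ?thesis by (simp add: resid_def proj_def poly_sum mult.commute)
  qed
  have ac': "acx a b c d (\<lambda>z. \<integral>s. ?k (snd z, s) * f (fst z, s) \<partial>?Y) (\<lambda>z. \<integral>s. ?k (snd z, s) * f' (fst z, s) \<partial>?Y)"
    by (rule acx_kernel[OF f f' ac km, where B = B]) (use B in auto)
  obtain A where A: "integrable ?Y A" "AE z in ?M. (\<integral>s. ?k (snd z, s) * f (fst z, s) \<partial>?Y)
      = A (snd z) + prim a b (\<lambda>t. \<integral>s. ?k (snd z, s) * f' (t, s) \<partial>?Y) (fst z)"
    using ac' by (auto simp: acx_def)
  have f'm: "f' \<in> borel_measurable borel" using borel_measurable_integrable[OF f'] by simp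
  have sl: "AE x in lb_on {a..b}. \<forall>y. (\<integral>s. ?k (y, s) * f' (x, s) \<partial>?Y) = f' (x, y) - Ry c d n f' (x, y)"
    using rect_AE_integrable_y[OF f']
  proof eventually_elim
    case (elim x)
    show ?case using eq[OF elim] by (simp add: Ry_def)
  qed
  have pr: "prim a b (\<lambda>t. \<integral>s. ?k (y, s) * f' (t, s) \<partial>?Y) x = prim a b (\<lambda>t. f' (t, y) - Ry c d n f' (t, y)) x" for x y
  proof (rule prim_cong_AE)
    show "AE t in lb_on {a..b}. (\<integral>s. ?k (y, s) * f' (t, s) \<partial>?Y) = f' (t, y) - Ry c d n f' (t, y)"
      using sl by eventually_elim blast
    have "(\<lambda>z. ?k (y, snd z) * f' z) \<in> borel_measurable borel"
      by (intro borel_measurable_times f'm borel_fst_snd(2) borel_slice(1)[OF km])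
    from borel_integral_y[OF this]
    show "(\<lambda>t. \<integral>s. ?k (y, s) * f' (t, s) \<partial>?Y) \<in> borel_measurable borel" by simp
    show "(\<lambda>t. f' (t, y) - Ry c d n f' (t, y)) \<in> borel_measurable borel"
      by (intro borel_measurable_diff borel_slice f'm Ry_borel)
  qed
  have "AE z in ?M. f z - Ry c d n f z
      = A (snd z) + prim a b (\<lambda>t. f' (t, snd z) - Ry c d n f' (t, snd z)) (fst z)"
    using A(2) rect_AE_fst[OF rect_AE_integrable_y[OF ff]]
  proof eventually_elim
    case (elim z)
    have "(\<integral>s. ?k (snd z, s) * f (fst z, s) \<partial>?Y) = f z - Ry c d n f z"
      using eq[OF elim(2), of "snd z"] by (simp add: Ry_def)
    then show ?case using elim(1) pr[of "snd z" "fst z"] by simp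
  qed
  then have "acx a b c d (\<lambda>z. f z - Ry c d n f z) (\<lambda>z. f' z - Ry c d n f' z)"
    unfolding acx_def using A(1) by auto
  from acx_diff[OF f' Bochner_Integration.integrable_diff[OF f' Pf'] ac this] show ?thesis by simp
qed

lemma prim_split_left:
  assumes "a \<le> b" "b \<le> b'" "x \<le> b" and f: "f \<in> borel_measurable borel"
  shows "prim a b' f x = prim a b f x"
proof -
  have "prim a b' f x = (\<integral>s. indicator {a..b'} s * (indicator {..x} s * f s) \<partial>lborel)"
    unfolding prim_def by (rule integral_lb_on) (use f in simp_all)
  also have "\<dots> = (\<integral>s. indicator {a..b} s * (indicator {..x} s * f s) \<partial>lborel)"
    by (rule Bochner_Integration.integral_cong) (use assms in \<open>auto split: split_indicator\<close>)
  also have "\<dots> = prim a b f x"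
    unfolding prim_def by (rule integral_lb_on[symmetric]) (use f in simp_all)
  finally show ?thesis .
qed

lemma prim_split_right:
  assumes "a \<le> b" "b \<le> x" "x \<le> b'" and f: "integrable (lb_on {a..b'}) f"
  shows "prim a b' f x = (\<integral>s. f s \<partial>lb_on {a..b}) + prim b b' f x"
proof -
  have [measurable]: "f \<in> borel_measurable borel" using borel_measurable_integrable[OF f] by simp
  have "integrable lborel (\<lambda>s. indicator {a..b'} s * f s)" using f by (simp add: integrable_lb_on)
  from integrable_mult_indicator[OF _ this]
  have i: "integrable lborel (\<lambda>s. indicator S s * (indicator {a..b'} s * f s))" if "S \<in> sets borel" for S
    using that by simp
  have i1: "integrable lborel (\<lambda>s. indicator {a..b} s * f s)"
  proof -
    have "(\<lambda>s. indicator {a..b} s * f s) = (\<lambda>s. indicator {a..b} s * (indicator {a..b'} s * f s))"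
      using assms by (auto simp: fun_eq_iff split: split_indicator)
    then show ?thesis using i by simp
  qed
  have i2: "integrable lborel (\<lambda>s. indicator {b..b'} s * (indicator {..x} s * f s))"
  proof -
    have "(\<lambda>s. indicator {b..b'} s * (indicator {..x} s * f s)) = (\<lambda>s. indicator {b..x} s * (indicator {a..b'} s * f s))"
      using assms by (auto simp: fun_eq_iff split: split_indicator)
    then show ?thesis using i by simp
  qed
  have "prim a b' f x = (\<integral>s. indicator {a..b'} s * (indicator {..x} s * f s) \<partial>lborel)"
    unfolding prim_def by (rule integral_lb_on) simp_all
  also have "\<dots> = (\<integral>s. indicator {a..b} s * f s + indicator {b..b'} s * (indicator {..x} s * f s) \<partial>lborel)"
  proof (rule integral_cong_AE)
    show "AE s in lborel. indicator {a..b'} s * (indicator {..x} s * f s)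
      = indicator {a..b} s * f s + indicator {b..b'} s * (indicator {..x} s * f s)"
      using AE_lborel_singleton[of b] by eventually_elim (use assms in \<open>auto split: split_indicator\<close>)
  qed simp_all
  also have "\<dots> = (\<integral>s. indicator {a..b} s * f s \<partial>lborel) + (\<integral>s. indicator {b..b'} s * (indicator {..x} s * f s) \<partial>lborel)"
    by (rule Bochner_Integration.integral_add[OF i1 i2])
  also have "\<dots> = (\<integral>s. f s \<partial>lb_on {a..b}) + prim b b' f x"
    unfolding prim_def by (subst (1 2) integral_lb_on) simp_all
  finally show ?thesis .
qed

section \<open>Grids and functions defined cell by cell\<close>

fun cell ocell :: "real \<times> real \<times> real \<times> real \<Rightarrow> (real \<times> real) set" where
  "cell (a, b, c, d) = {a..b} \<times> {c..d}"
| "ocell (a, b, c, d) = {a<..<b} \<times> {c<..<d}"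

lemma cell_borel [simp, measurable]: "cell q \<in> sets borel"
  by (cases q) simp

lemma ocell_borel [simp, measurable]: "ocell q \<in> sets borel"
  by (cases q) (simp add: open_Times)

lemma AE_cell_ocell: "AE z in lborel. z \<in> cell q \<longrightarrow> z \<in> ocell q"
proof (cases q)
  case (fields a b c d)
  show ?thesis
    using AE_fst_neq[of a] AE_fst_neq[of b] AE_snd_neq[of c] AE_snd_neq[of d]
    by eventually_elim (auto simp: fields)
qed

text \<open>What integration by parts in \<open>x\<close> asks of a grid: behind each vertical edge
  lies a cell with the same edge, or else the open edge lies outside the domain. The asymmetry is
  intended: across horizontal edges the glued functions will have zero trace.\<close>

locale xgrid =
  fixes \<Omega> :: "(real \<times> real) set" and Q :: "(real \<times> real \<times> real \<times> real) set" and h :: real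
  assumes op: "open \<Omega>" and fin: "finite Q"
    and pos: "(a, b, c, d) \<in> Q \<Longrightarrow> a < b \<and> c < d \<and> b - a \<le> h \<and> d - c \<le> h"
    and sub: "q \<in> Q \<Longrightarrow> ocell q \<subseteq> \<Omega>"
    and cover: "\<Omega> \<subseteq> (\<Union>q\<in>Q. cell q)"
    and disj: "q \<in> Q \<Longrightarrow> q' \<in> Q \<Longrightarrow> q \<noteq> q' \<Longrightarrow> ocell q \<inter> ocell q' = {}"
    and right: "(a, b, c, d) \<in> Q \<Longrightarrow> (\<exists>b'. (b, b', c, d) \<in> Q) \<or> (\<forall>y\<in>{c<..<d}. (b, y) \<notin> \<Omega>)"
    and left: "(a, b, c, d) \<in> Q \<Longrightarrow> (\<exists>a'. (a', a, c, d) \<in> Q) \<or> (\<forall>y\<in>{c<..<d}. (a, y) \<notin> \<Omega>)"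
begin

lemma \<Omega>_borel [simp, measurable]: "\<Omega> \<in> sets borel"
  using op by simp

lemma AE_in_ocell: "AE z in lborel. \<forall>q\<in>Q. z \<in> cell q \<longrightarrow> z \<in> ocell q"
  by (rule AE_finite_allI[OF fin AE_cell_ocell])

text \<open>Off the edges every point of the domain lies in exactly one cell, which makes integrals
  over the domain sums over cells.\<close>

lemma AE_indicator: "AE z in lborel. indicator \<Omega> z = (\<Sum>q\<in>Q. indicator (cell q) z :: real)"
  using AE_in_ocell
proof eventually_elim
  case (elim z)
  show ?case
  proof (cases "z \<in> \<Omega>")
    case True
    then obtain q where q: "q \<in> Q" "z \<in> cell q" using cover by blast
    have "z \<notin> cell q'" if "q' \<in> Q" "q' \<noteq> q" for q'
      using disj[OF q(1) that(1)] elim q that by blast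
    then have "(\<Sum>q'\<in>Q. indicator (cell q') z :: real) = (\<Sum>q'\<in>{q}. indicator (cell q') z)"
      using q fin by (intro sum.mono_neutral_right) auto
    then show ?thesis using True q by simp
  next
    case False
    then have "z \<notin> cell q" if "q \<in> Q" for q using elim sub[OF that] that by blast
    then show ?thesis using False by simp
  qed
qed

lemma AE_grid: "(AE z in lb_on \<Omega>. P z) \<longleftrightarrow> (\<forall>q\<in>Q. AE z in lb_on (cell q). P z)"
proof
  assume "AE z in lb_on \<Omega>. P z"
  then have *: "AE z in lborel. z \<in> \<Omega> \<longrightarrow> P z" by (simp add: AE_lb_on)
  show "\<forall>q\<in>Q. AE z in lb_on (cell q). P z"
  proof
    fix q assume q: "q \<in> Q"
    have "AE z in lborel. z \<in> cell q \<longrightarrow> P z"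
      using * AE_in_ocell by eventually_elim (use sub[OF q] q in blast)
    then show "AE z in lb_on (cell q). P z" by (simp add: AE_lb_on)
  qed
next
  assume "\<forall>q\<in>Q. AE z in lb_on (cell q). P z"
  then have "\<forall>q\<in>Q. AE z in lborel. z \<in> cell q \<longrightarrow> P z" by (simp add: AE_lb_on)
  then have "AE z in lborel. \<forall>q\<in>Q. z \<in> cell q \<longrightarrow> P z" by (intro AE_finite_allI[OF fin]) auto
  then have "AE z in lborel. z \<in> \<Omega> \<longrightarrow> P z"
    by eventually_elim (use cover in blast)
  then show "AE z in lb_on \<Omega>. P z" by (simp add: AE_lb_on)
qed

lemma grid_integrableD:
  fixes F :: sfield
  assumes F: "integrable (lb_on \<Omega>) F" and q: "q \<in> Q"
  shows "integrable (lb_on (cell q)) F"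
proof -
  have [measurable]: "F \<in> borel_measurable borel" using borel_measurable_integrable[OF F] by simp
  have i: "integrable lborel (\<lambda>z. indicator \<Omega> z * F z)" using F by (simp add: integrable_lb_on)
  have "integrable lborel (\<lambda>z. indicator (cell q) z * F z)"
  proof (rule Bochner_Integration.integrable_bound[OF i])
    show "AE z in lborel. norm (indicator (cell q) z * F z) \<le> norm (indicator \<Omega> z * F z)"
      using AE_in_ocell by eventually_elim (use sub[OF q] q in \<open>auto split: split_indicator\<close>)
  qed simp
  then show ?thesis by (simp add: integrable_lb_on)
qed

lemma
  fixes F :: sfield
  assumes F: "\<And>q. q \<in> Q \<Longrightarrow> integrable (lb_on (cell q)) F" and Fm: "F \<in> borel_measurable borel"
  shows grid_integrableI: "integrable (lb_on \<Omega>) F"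
    and grid_integral: "integral\<^sup>L (lb_on \<Omega>) F = (\<Sum>q\<in>Q. integral\<^sup>L (lb_on (cell q)) F)"
proof -
  note [measurable] = Fm
  have i: "integrable lborel (\<lambda>z. indicator (cell q) z * F z)" if "q \<in> Q" for q
    using F[OF that] by (simp add: integrable_lb_on)
  have ae: "AE z in lborel. indicator \<Omega> z * F z = (\<Sum>q\<in>Q. indicator (cell q) z * F z)"
    using AE_indicator by eventually_elim (simp add: sum_distrib_right)
  have s: "integrable lborel (\<lambda>z. \<Sum>q\<in>Q. indicator (cell q) z * F z)"
    using i by (intro Bochner_Integration.integrable_sum) auto
  have "integrable lborel (\<lambda>z. indicator \<Omega> z * F z)"
    using integrable_cong_AE[of "\<lambda>z. indicator \<Omega> z * F z" lborel, OF _ _ ae] s by simp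
  then show "integrable (lb_on \<Omega>) F" by (simp add: integrable_lb_on)
  have "integral\<^sup>L (lb_on \<Omega>) F = (\<integral>z. indicator \<Omega> z * F z \<partial>lborel)" by (rule integral_lb_on) simp_all
  also have "\<dots> = (\<integral>z. (\<Sum>q\<in>Q. indicator (cell q) z * F z) \<partial>lborel)"
    by (rule integral_cong_AE[OF _ _ ae]) simp_all
  also have "\<dots> = (\<Sum>q\<in>Q. (\<integral>z. indicator (cell q) z * F z \<partial>lborel))"
    using i by (intro Bochner_Integration.integral_sum) auto
  also have "\<dots> = (\<Sum>q\<in>Q. integral\<^sup>L (lb_on (cell q)) F)"
    by (intro sum.cong refl integral_lb_on[symmetric]) simp_all
  finally show "integral\<^sup>L (lb_on \<Omega>) F = (\<Sum>q\<in>Q. integral\<^sup>L (lb_on (cell q)) F)" .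
qed

text \<open>Glues cell functions. \<open>Z\<close> receives only the \<open>y\<close>-interval, so
  both sides of a vertical edge use one formula; open cells make the summands disjoint.\<close>

definition glob :: "(real \<Rightarrow> real \<Rightarrow> sfield) \<Rightarrow> sfield" where
  "glob Z z = (\<Sum>q\<in>Q. indicator (ocell q) z * (case q of (a, b, c, d) \<Rightarrow> Z c d z))"

lemma glob_borel:
  assumes "\<And>a b c d. (a, b, c, d) \<in> Q \<Longrightarrow> Z c d \<in> borel_measurable borel"
  shows "glob Z \<in> borel_measurable borel"
  unfolding glob_def
proof (intro borel_measurable_sum borel_measurable_times)
  fix q assume "q \<in> Q"
  then show "(\<lambda>z. case q of (a, b, c, d) \<Rightarrow> Z c d z) \<in> borel_measurable borel"
    using assms by (cases q) auto
qed simp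

lemma glob_cell:
  assumes q: "(a, b, c, d) \<in> Q"
  shows "AE z in lb_on ({a..b} \<times> {c..d}). glob Z z = Z c d z"
proof -
  have "AE z in lborel. z \<in> cell (a, b, c, d) \<longrightarrow> glob Z z = Z c d z"
    using AE_in_ocell
  proof eventually_elim
    case (elim z)
    show ?case
    proof
      assume z: "z \<in> cell (a, b, c, d)"
      then have zo: "z \<in> ocell (a, b, c, d)" using elim q by blast
      have "z \<notin> ocell q'" if "q' \<in> Q" "q' \<noteq> (a, b, c, d)" for q'
        using disj[OF q that(1)] that zo by blast
      then have "glob Z z = (\<Sum>q\<in>{(a, b, c, d)}. indicator (ocell q) z * (case q of (a, b, c, d) \<Rightarrow> Z c d z))"
        unfolding glob_def using q fin by (intro sum.mono_neutral_right) auto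
      then show "glob Z z = Z c d z" using zo by simp
    qed
  qed
  then show ?thesis by (simp add: AE_lb_on)
qed

lemma sqi_glob:
  assumes Z: "\<And>a b c d. (a, b, c, d) \<in> Q \<Longrightarrow> sqi (lb_on ({a..b} \<times> {c..d})) (Z c d)"
  shows "sqi (lb_on \<Omega>) (glob Z)"
    and "(\<integral>z. (glob Z z)\<^sup>2 \<partial>lb_on \<Omega>) = (\<Sum>(a, b, c, d)\<in>Q. \<integral>z. (Z c d z)\<^sup>2 \<partial>lb_on ({a..b} \<times> {c..d}))"
proof -
  have gm: "glob Z \<in> borel_measurable borel"
    by (rule glob_borel) (use Z in \<open>auto simp: sqi_def\<close>)
  have Zm: "Z c d \<in> borel_measurable borel" if "(a, b, c, d) \<in> Q" for a b c d
    using Z[OF that] by (simp add: sqi_def)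
  have ae: "AE z in lb_on ({a..b} \<times> {c..d}). (glob Z z)\<^sup>2 = (Z c d z)\<^sup>2" if "(a, b, c, d) \<in> Q" for a b c d
    using glob_cell[OF that, of Z] by eventually_elim simp
  have i: "integrable (lb_on (cell q)) (\<lambda>z. (glob Z z)\<^sup>2)" if "q \<in> Q" for q
  proof (cases q)
    case (fields a b c d)
    then have q: "(a, b, c, d) \<in> Q" using that by simp
    have "integrable (lb_on ({a..b} \<times> {c..d})) (\<lambda>z. (glob Z z)\<^sup>2)"
      using integrable_cong_AE[OF _ _ ae[OF q]] Z[OF q] gm Zm[OF q] by (simp add: sqi_def)
    then show ?thesis by (simp add: fields)
  qed
  then have "integrable (lb_on \<Omega>) (\<lambda>z. (glob Z z)\<^sup>2)"
    by (rule grid_integrableI) (use gm in simp_all)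
  then show "sqi (lb_on \<Omega>) (glob Z)" using gm by (simp add: sqi_def)
  have "(\<integral>z. (glob Z z)\<^sup>2 \<partial>lb_on \<Omega>) = (\<Sum>q\<in>Q. \<integral>z. (glob Z z)\<^sup>2 \<partial>lb_on (cell q))"
    by (rule grid_integral[OF i]) (use gm in simp_all)
  also have "\<dots> = (\<Sum>(a, b, c, d)\<in>Q. \<integral>z. (Z c d z)\<^sup>2 \<partial>lb_on ({a..b} \<times> {c..d}))"
  proof (rule sum.cong[OF refl])
    fix q assume "q \<in> Q"
    obtain a b c d where e: "q = (a, b, c, d)" by (cases q)
    then have q: "(a, b, c, d) \<in> Q" using \<open>q \<in> Q\<close> by simp
    show "(\<integral>z. (glob Z z)\<^sup>2 \<partial>lb_on (cell q))
      = (case q of (a, b, c, d) \<Rightarrow> \<integral>z. (Z c d z)\<^sup>2 \<partial>lb_on ({a..b} \<times> {c..d}))"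
      using integral_cong_AE[OF _ _ ae[OF q]] gm Zm[OF q] by (simp add: e)
  qed
  finally show "(\<integral>z. (glob Z z)\<^sup>2 \<partial>lb_on \<Omega>) = (\<Sum>(a, b, c, d)\<in>Q. \<integral>z. (Z c d z)\<^sup>2 \<partial>lb_on ({a..b} \<times> {c..d}))" .
qed

lemma right_unique:
  assumes "(b, b', c, d) \<in> Q" "(b, b'', c, d) \<in> Q"
  shows "b' = b''"
proof (rule ccontr)
  assume "b' \<noteq> b''"
  then have "ocell (b, b', c, d) \<inter> ocell (b, b'', c, d) = {}" by (intro disj assms) simp
  moreover have "((b + min b' b'') / 2, (c + d) / 2) \<in> ocell (b, b', c, d) \<inter> ocell (b, b'', c, d)"
    using pos[OF assms(1)] pos[OF assms(2)] by (auto simp: field_simps min_def)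
  ultimately show False by blast
qed

lemma left_unique:
  assumes "(a', a, c, d) \<in> Q" "(a'', a, c, d) \<in> Q"
  shows "a' = a''"
proof (rule ccontr)
  assume "a' \<noteq> a''"
  then have "ocell (a', a, c, d) \<inter> ocell (a'', a, c, d) = {}" by (intro disj assms) simp
  moreover have "((a + max a' a'') / 2, (c + d) / 2) \<in> ocell (a', a, c, d) \<inter> ocell (a'', a, c, d)"
    using pos[OF assms(1)] pos[OF assms(2)] by (auto simp: field_simps max_def)
  ultimately show False by blast
qed

text \<open>A discrete telescoping: each right edge is paired with the left edge of the neighbour,
  and edges without a neighbour contribute nothing.\<close>

lemma edge_sum_cancel:
  fixes L R :: "real \<times> real \<times> real \<times> real \<Rightarrow> real"
  assumes match: "\<And>a b b' c d. (a, b, c, d) \<in> Q \<Longrightarrow> (b, b', c, d) \<in> Q \<Longrightarrow> R (a, b, c, d) = L (b, b', c, d)"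
    and R0: "\<And>a b c d. (a, b, c, d) \<in> Q \<Longrightarrow> (\<forall>y\<in>{c<..<d}. (b, y) \<notin> \<Omega>) \<Longrightarrow> R (a, b, c, d) = 0"
    and L0: "\<And>a b c d. (a, b, c, d) \<in> Q \<Longrightarrow> (\<forall>y\<in>{c<..<d}. (a, y) \<notin> \<Omega>) \<Longrightarrow> L (a, b, c, d) = 0"
  shows "(\<Sum>q\<in>Q. R q) = (\<Sum>q\<in>Q. L q)"
proof -
  let ?S = "{q \<in> Q. \<exists>a b c d b'. q = (a, b, c, d) \<and> (b, b', c, d) \<in> Q}"
  let ?S' = "{q \<in> Q. \<exists>a b c d a'. q = (a, b, c, d) \<and> (a', a, c, d) \<in> Q}"
  have "(\<Sum>q\<in>Q. R q) = (\<Sum>q\<in>?S. R q)"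
  proof (rule sum.mono_neutral_right[OF fin])
    show "\<forall>q\<in>Q - ?S. R q = 0"
    proof
      fix q assume q: "q \<in> Q - ?S"
      obtain a b c d where e: "q = (a, b, c, d)" by (cases q)
      then show "R q = 0" using right[of a b c d] R0[of a b c d] q by blast
    qed
  qed auto
  also have "\<dots> = (\<Sum>q\<in>?S'. L q)"
  \<comment> \<open>Passing to the right neighbour and to the left neighbour are inverse to each
    other, because disjointness of the open cells makes neighbours unique.\<close>
  proof (rule sum.reindex_bij_witness[where
        i = "\<lambda>(b, b', c, d). (THE a. (a, b, c, d) \<in> Q, b, c, d)" and
        j = "\<lambda>(a, b, c, d). (b, THE b'. (b, b', c, d) \<in> Q, c, d)"])
    have the_r: "(THE b'. (b, b', c, d) \<in> Q) = b'" if "(b, b', c, d) \<in> Q" for b b' c d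
      using that right_unique by (intro the_equality) auto
    have the_l: "(THE a. (a, b, c, d) \<in> Q) = a" if "(a, b, c, d) \<in> Q" for a b c d
      using that left_unique by (intro the_equality) auto
    fix q
    {
      assume "q \<in> ?S"
      then obtain a b c d b' where q: "q = (a, b, c, d)" "(a, b, c, d) \<in> Q" "(b, b', c, d) \<in> Q" by blast
      show "(case case q of (a, b, c, d) \<Rightarrow> (b, THE b'. (b, b', c, d) \<in> Q, c, d) of
          (b, b', c, d) \<Rightarrow> (THE a. (a, b, c, d) \<in> Q, b, c, d)) = q"
        using q the_l[OF q(2)] by simp
      show "(case q of (a, b, c, d) \<Rightarrow> (b, THE b'. (b, b', c, d) \<in> Q, c, d)) \<in> ?S'"
        using q the_r[OF q(3)] by auto
      show "L (case q of (a, b, c, d) \<Rightarrow> (b, THE b'. (b, b', c, d) \<in> Q, c, d)) = R q"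
        using q the_r[OF q(3)] match by simp
    next
      assume "q \<in> ?S'"
      then obtain a b c d a' where q: "q = (a, b, c, d)" "(a, b, c, d) \<in> Q" "(a', a, c, d) \<in> Q" by blast
      show "(case case q of (b, b', c, d) \<Rightarrow> (THE a. (a, b, c, d) \<in> Q, b, c, d) of
          (a, b, c, d) \<Rightarrow> (b, THE b'. (b, b', c, d) \<in> Q, c, d)) = q"
        using q the_r[OF q(2)] by simp
      show "(case q of (b, b', c, d) \<Rightarrow> (THE a. (a, b, c, d) \<in> Q, b, c, d)) \<in> ?S"
        using q the_l[OF q(3)] by auto
    }
  qed
  also have "\<dots> = (\<Sum>q\<in>Q. L q)"
  proof (rule sum.mono_neutral_left[OF fin])
    show "\<forall>q\<in>Q - ?S'. L q = 0"
    proof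
      fix q assume q: "q \<in> Q - ?S'"
      obtain a b c d where e: "q = (a, b, c, d)" by (cases q)
      then show "L q = 0" using left[of a b c d] L0[of a b c d] q by blast
    qed
  qed auto
  finally show ?thesis .
qed

end

lemma acx_restrict_left:
  fixes f f' :: sfield
  assumes ac: "AE z in lb_on ({a..b'} \<times> {c..d}). f z = A (snd z) + prim a b' (\<lambda>t. f' (t, snd z)) (fst z)"
    and "a \<le> b" "b \<le> b'" and f': "f' \<in> borel_measurable borel"
  shows "AE z in lb_on ({a..b} \<times> {c..d}). f z = A (snd z) + prim a b (\<lambda>t. f' (t, snd z)) (fst z)"
proof -
  have "AE z in lb_on ({a..b} \<times> {c..d}). f z = A (snd z) + prim a b' (\<lambda>t. f' (t, snd z)) (fst z)"
    by (rule AE_lb_on_mono[OF ac]) (use assms in auto)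
  moreover have "AE z in lb_on ({a..b} \<times> {c..d}). z \<in> {a..b} \<times> {c..d}" by (rule AE_lb_on_in) simp
  ultimately show ?thesis
  proof eventually_elim
    case (elim z)
    have "prim a b' (\<lambda>t. f' (t, snd z)) (fst z) = prim a b (\<lambda>t. f' (t, snd z)) (fst z)"
      by (rule prim_split_left) (use assms elim(2) borel_slice(2)[OF f'] in auto)
    then show ?case using elim(1) by simp
  qed
qed

text \<open>On the right part the trace becomes the value reached at \<open>b\<close> from the left:
  this expresses that a function represented on the joined box has no jump there.\<close>

lemma acx_restrict_right:
  fixes f f' :: sfield
  assumes ac: "AE z in lb_on ({a..b'} \<times> {c..d}). f z = A (snd z) + prim a b' (\<lambda>t. f' (t, snd z)) (fst z)"
    and "a \<le> b" "b \<le> b'" and f': "integrable (lb_on ({a..b'} \<times> {c..d})) f'"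
  shows "AE z in lb_on ({b..b'} \<times> {c..d}). f z = (A (snd z) + (\<integral>t. f' (t, snd z) \<partial>lb_on {a..b}))
    + prim b b' (\<lambda>t. f' (t, snd z)) (fst z)"
proof -
  have "AE z in lb_on ({b..b'} \<times> {c..d}). f z = A (snd z) + prim a b' (\<lambda>t. f' (t, snd z)) (fst z)"
    by (rule AE_lb_on_mono[OF ac]) (use assms in auto)
  moreover have "AE z in lb_on ({b..b'} \<times> {c..d}). z \<in> {b..b'} \<times> {c..d}" by (rule AE_lb_on_in) simp
  moreover have "AE z in lb_on ({b..b'} \<times> {c..d}). integrable (lb_on {a..b'}) (\<lambda>t. f' (t, snd z))"
    by (rule rect_AE_snd[OF rect_AE_integrable_x[OF f']])
  ultimately show ?thesis
  proof eventually_elim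
    case (elim z)
    have "prim a b' (\<lambda>t. f' (t, snd z)) (fst z)
      = (\<integral>t. f' (t, snd z) \<partial>lb_on {a..b}) + prim b b' (\<lambda>t. f' (t, snd z)) (fst z)"
      by (rule prim_split_right) (use assms elim(2,3) in auto)
    then show ?case using elim(1) by simp
  qed
qed

text \<open>The trace is determined almost everywhere: subtracting the primitive leaves functions of
  \<open>y\<close> that agree on a cell of positive width.\<close>

lemma acx_unique:
  fixes a b c d :: real
  assumes "a < b" "AE z in lb_on ({a..b} \<times> {c..d}). f z = A (snd z) + p z"
    "AE z in lb_on ({a..b} \<times> {c..d}). f z = B (snd z) + p z"
  shows "AE y in lb_on {c..d}. A y = (B y :: real)"
proof -
  have "AE z in lb_on ({a..b} \<times> {c..d}). A (snd z) = B (snd z)"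
    using assms(2,3) by eventually_elim simp
  from rect_AE_yx[OF this] show ?thesis
  proof eventually_elim
    case (elim y)
    show ?case by (rule AE_Icc_const[OF assms(1) elim[unfolded snd_conv]])
  qed
qed

section \<open>Weak derivatives of cellwise primitives\<close>

lemma rect_mult_continuous:
  fixes f \<phi> :: sfield
  assumes "integrable (lb_on ({a..b} \<times> {c..d})) f" and \<phi>: "continuous_on UNIV \<phi>"
  shows "integrable (lb_on ({a..b} \<times> {c..d})) (\<lambda>z. f z * \<phi> z)"
proof -
  have "bounded (\<phi> ` ({a..b} \<times> {c..d}))"
    by (intro compact_imp_bounded compact_continuous_image compact_Times continuous_on_subset[OF \<phi>]) auto
  then obtain B where "\<forall>z\<in>{a..b} \<times> {c..d}. \<bar>\<phi> z\<bar> \<le> B" by (auto simp: bounded_iff)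
  then have "AE z in lb_on ({a..b} \<times> {c..d}). \<bar>\<phi> z\<bar> \<le> B" by (auto simp: AE_lb_on)
  then show ?thesis
    by (rule integrable_mult_bounded[OF assms(1), rotated])
      (use borel_measurable_continuous_onI[OF \<phi>] in simp)
qed

lemma continuous_slice:
  assumes "continuous_on UNIV (\<phi> :: sfield)"
  shows "continuous_on S (\<lambda>x. \<phi> (x, y))" "continuous_on S (\<lambda>y. \<phi> (x, y))"
  by (rule continuous_on_compose2[OF assms]; auto intro!: continuous_intros)+

lemma integrable_mult_continuous:
  assumes f: "integrable (lb_on {a..b}) f" and \<phi>: "continuous_on UNIV (\<phi> :: real \<Rightarrow> real)"
  shows "integrable (lb_on {a..b}) (\<lambda>x. f x * \<phi> x)"
proof -
  obtain B where "AE x in lb_on {a..b}. \<bar>\<phi> x\<bar> \<le> B"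
    using AE_bounded_continuous[OF continuous_on_subset[OF \<phi>], of a b] by blast
  then show ?thesis
    by (rule integrable_mult_bounded[OF f, rotated]) (use borel_measurable_continuous_onI[OF \<phi>] in simp)
qed

text \<open>The boundary values of \<open>w\<close> are its traces \<open>A\<close> and
  \<open>A + (\<integral>x. f x \<partial>lb_on {a..b})\<close>. Writing \<open>\<phi>\<close> as
  its value at \<open>a\<close> plus the primitive of \<open>\<phi>'\<close> reduces the claim to
  \<open>prim_integration_by_parts\<close>.\<close>

lemma parts_1d:
  assumes "a \<le> b" and f: "integrable (lb_on {a..b}) f" and z: "AE x in lb_on {a..b}. w x = A + prim a b f x"
    and w: "w \<in> borel_measurable borel"
    and \<phi>: "\<And>x. (\<phi> has_real_derivative \<phi>' x) (at x)" "continuous_on UNIV \<phi>'"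
  shows "(\<integral>x. w x * \<phi>' x \<partial>lb_on {a..b}) + (\<integral>x. f x * \<phi> x \<partial>lb_on {a..b})
    = (A + (\<integral>x. f x \<partial>lb_on {a..b})) * \<phi> b - A * \<phi> a"
proof -
  let ?X = "lb_on {a..b}"
  have sX: "AE x in ?X. x \<in> {a..b}" by (rule AE_lb_on_in) simp
  have [measurable]: "f \<in> borel_measurable borel" using borel_measurable_integrable[OF f] by simp
  have [measurable]: "\<phi>' \<in> borel_measurable borel" using borel_measurable_continuous_onI[OF \<phi>(2)] .
  have \<phi>c: "continuous_on UNIV \<phi>" using \<phi>(1) DERIV_isCont continuous_at_imp_continuous_on by blast
  have [measurable]: "\<phi> \<in> borel_measurable borel" using borel_measurable_continuous_onI[OF \<phi>c] .
  note [measurable] = w prim_borel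
  have \<phi>'i: "integrable ?X \<phi>'"
    by (rule integrable_continuous_lb_on[OF continuous_on_subset[OF \<phi>(2)]]) simp_all
  have tot: "(\<integral>x. \<phi>' x \<partial>?X) = \<phi> b - \<phi> a"
    using prim_derivative[OF \<phi>, of b a b] prim_right[of b b \<phi>' a] assms(1) by simp
  have pi: "integrable ?X (\<lambda>x. prim a b f x * \<phi>' x)"
    by (intro integrable_mult_continuous[OF _ \<phi>(2)] integrable_continuous_lb_on
        continuous_on_subset[OF prim_continuous[OF f]]) simp_all
  have "(\<integral>x. w x * \<phi>' x \<partial>?X) = (\<integral>x. A * \<phi>' x + prim a b f x * \<phi>' x \<partial>?X)"
  proof (rule integral_cong_AE)
    show "AE x in ?X. w x * \<phi>' x = A * \<phi>' x + prim a b f x * \<phi>' x"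
      using z by eventually_elim (simp add: distrib_right)
  qed simp_all
  also have "\<dots> = A * (\<phi> b - \<phi> a) + (\<integral>x. prim a b f x * \<phi>' x \<partial>?X)"
    using \<phi>'i pi tot by simp
  finally have 1: "(\<integral>x. w x * \<phi>' x \<partial>?X) = A * (\<phi> b - \<phi> a) + (\<integral>x. prim a b f x * \<phi>' x \<partial>?X)" .
  have fi: "integrable ?X (\<lambda>x. f x * prim a b \<phi>' x)"
    by (intro integrable_mult_continuous[OF f] prim_continuous \<phi>'i)
  have "(\<integral>x. f x * \<phi> x \<partial>?X) = (\<integral>x. \<phi> a * f x + f x * prim a b \<phi>' x \<partial>?X)"
  proof (rule integral_cong_AE)
    show "AE x in ?X. f x * \<phi> x = \<phi> a * f x + f x * prim a b \<phi>' x"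
      using sX by eventually_elim (simp add: prim_derivative[OF \<phi>] algebra_simps)
  qed simp_all
  also have "\<dots> = \<phi> a * (\<integral>x. f x \<partial>?X) + (\<integral>x. f x * prim a b \<phi>' x \<partial>?X)"
    using f fi by simp
  finally have 2: "(\<integral>x. f x * \<phi> x \<partial>?X) = \<phi> a * (\<integral>x. f x \<partial>?X) + (\<integral>x. f x * prim a b \<phi>' x \<partial>?X)" .
  show ?thesis using prim_integration_by_parts[OF f \<phi>'i] 1 2 tot by (simp add: algebra_simps)
qed

lemma cell_parts_x:
  fixes Z Z' \<phi> \<phi>x :: sfield
  assumes ab: "a < b" and Z: "integrable (lb_on ({a..b} \<times> {c..d})) Z" and Z': "integrable (lb_on ({a..b} \<times> {c..d})) Z'"
    and A: "integrable (lb_on {c..d}) A" "AE z in lb_on ({a..b} \<times> {c..d}). Z z = A (snd z) + prim a b (\<lambda>t. Z' (t, snd z)) (fst z)"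
    and \<phi>: "continuous_on UNIV \<phi>" "continuous_on UNIV \<phi>x" "\<And>x y. ((\<lambda>t. \<phi> (t, y)) has_real_derivative \<phi>x (x, y)) (at x)"
  shows "(\<integral>z. Z z * \<phi>x z \<partial>lb_on ({a..b} \<times> {c..d})) + (\<integral>z. Z' z * \<phi> z \<partial>lb_on ({a..b} \<times> {c..d}))
    = (\<integral>y. (A y + (\<integral>t. Z' (t, y) \<partial>lb_on {a..b})) * \<phi> (b, y) \<partial>lb_on {c..d}) - (\<integral>y. A y * \<phi> (a, y) \<partial>lb_on {c..d})"
proof -
  let ?M = "lb_on ({a..b} \<times> {c..d})" and ?X = "lb_on {a..b}" and ?Y = "lb_on {c..d}"
  have Zm: "Z \<in> borel_measurable borel" using borel_measurable_integrable[OF Z] by simp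
  note i1 = rect_mult_continuous[OF Z \<phi>(2)] and i2 = rect_mult_continuous[OF Z' \<phi>(1)]
  have j1: "integrable ?Y (\<lambda>y. (A y + (\<integral>t. Z' (t, y) \<partial>?X)) * \<phi> (b, y))"
    by (intro integrable_mult_continuous continuous_slice[OF \<phi>(1)] Bochner_Integration.integrable_add A rect_integrable_y[OF Z'])
  have j2: "integrable ?Y (\<lambda>y. A y * \<phi> (a, y))"
    by (intro integrable_mult_continuous continuous_slice[OF \<phi>(1)] A)
  have "(\<integral>z. Z z * \<phi>x z \<partial>?M) + (\<integral>z. Z' z * \<phi> z \<partial>?M)
    = (\<integral>y. (\<integral>x. Z (x, y) * \<phi>x (x, y) \<partial>?X) + (\<integral>x. Z' (x, y) * \<phi> (x, y) \<partial>?X) \<partial>?Y)"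
    using rect_integral_yx[OF i1] rect_integral_yx[OF i2] rect_integrable_y[OF i1] rect_integrable_y[OF i2] by simp
  also have "\<dots> = (\<integral>y. (A y + (\<integral>t. Z' (t, y) \<partial>?X)) * \<phi> (b, y) - A y * \<phi> (a, y) \<partial>?Y)"
  proof (rule integral_cong_AE)
    show "AE y in ?Y. (\<integral>x. Z (x, y) * \<phi>x (x, y) \<partial>?X) + (\<integral>x. Z' (x, y) * \<phi> (x, y) \<partial>?X)
      = (A y + (\<integral>t. Z' (t, y) \<partial>?X)) * \<phi> (b, y) - A y * \<phi> (a, y)"
      using rect_AE_yx[OF A(2)] rect_AE_integrable_x[OF Z']
    proof eventually_elim
      case (elim y)
      show ?case
        by (rule parts_1d) (use ab elim borel_slice(2)[OF Zm] \<phi>(3) continuous_slice(1)[OF \<phi>(2)] in auto)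
    qed
    show "(\<lambda>y. (\<integral>x. Z (x, y) * \<phi>x (x, y) \<partial>?X) + (\<integral>x. Z' (x, y) * \<phi> (x, y) \<partial>?X)) \<in> borel_measurable ?Y"
      by (intro borel_measurable_add borel_measurable_integrable rect_integrable_y[OF i1] rect_integrable_y[OF i2])
    show "(\<lambda>y. (A y + (\<integral>t. Z' (t, y) \<partial>?X)) * \<phi> (b, y) - A y * \<phi> (a, y)) \<in> borel_measurable ?Y"
      by (intro borel_measurable_diff borel_measurable_integrable j1 j2)
  qed
  also have "\<dots> = (\<integral>y. (A y + (\<integral>t. Z' (t, y) \<partial>?X)) * \<phi> (b, y) \<partial>?Y) - (\<integral>y. A y * \<phi> (a, y) \<partial>?Y)"
    by (rule Bochner_Integration.integral_diff[OF j1 j2])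
  finally show ?thesis .
qed

text \<open>The primitive vanishes at the bottom by construction and at the top because
  \<open>Z'\<close> has zero mean on almost every slice, hence the absence of edge terms.\<close>

lemma cell_parts_y:
  fixes Z Z' \<phi> \<phi>y :: sfield
  assumes cd: "c < d" and Z': "integrable (lb_on ({a..b} \<times> {c..d})) Z'"
    and Z: "integrable (lb_on ({a..b} \<times> {c..d})) (Jy c d Z')"
    and z: "AE x in lb_on {a..b}. (\<integral>y. Z' (x, y) \<partial>lb_on {c..d}) = 0"
    and \<phi>: "continuous_on UNIV \<phi>" "continuous_on UNIV \<phi>y" "\<And>x y. ((\<lambda>t. \<phi> (x, t)) has_real_derivative \<phi>y (x, y)) (at y)"
  shows "(\<integral>z. Jy c d Z' z * \<phi>y z \<partial>lb_on ({a..b} \<times> {c..d})) = - (\<integral>z. Z' z * \<phi> z \<partial>lb_on ({a..b} \<times> {c..d}))"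
proof -
  let ?M = "lb_on ({a..b} \<times> {c..d})" and ?X = "lb_on {a..b}" and ?Y = "lb_on {c..d}"
  have Z'm: "Z' \<in> borel_measurable borel" using borel_measurable_integrable[OF Z'] by simp
  note i1 = rect_mult_continuous[OF Z \<phi>(2)] and i2 = rect_mult_continuous[OF Z' \<phi>(1)]
  have "(\<integral>z. Jy c d Z' z * \<phi>y z \<partial>?M) + (\<integral>z. Z' z * \<phi> z \<partial>?M)
    = (\<integral>x. (\<integral>y. Jy c d Z' (x, y) * \<phi>y (x, y) \<partial>?Y) + (\<integral>y. Z' (x, y) * \<phi> (x, y) \<partial>?Y) \<partial>?X)"
    using rect_integral_xy[OF i1] rect_integral_xy[OF i2] rect_integrable_x[OF i1] rect_integrable_x[OF i2] by simp
  also have "\<dots> = 0"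
  proof (rule integral_eq_zero_AE)
    show "AE x in ?X. (\<integral>y. Jy c d Z' (x, y) * \<phi>y (x, y) \<partial>?Y) + (\<integral>y. Z' (x, y) * \<phi> (x, y) \<partial>?Y) = 0"
      using z rect_AE_integrable_y[OF Z']
    proof eventually_elim
      case (elim x)
      have "(\<integral>y. Jy c d Z' (x, y) * \<phi>y (x, y) \<partial>?Y) + (\<integral>y. Z' (x, y) * \<phi> (x, y) \<partial>?Y)
        = (0 + (\<integral>y. Z' (x, y) \<partial>?Y)) * \<phi> (x, d) - 0 * \<phi> (x, c)"
        by (rule parts_1d) (use cd elim borel_slice(1)[OF Jy_borel[OF Z'm]] \<phi>(3) continuous_slice(2)[OF \<phi>(2)]
            in \<open>auto simp: Jy_def\<close>)
      then show ?case using elim(1) by simp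
    qed
  qed
  finally show ?thesis by simp
qed

context xgrid
begin

lemma glob_mult_integral:
  fixes \<phi> :: sfield
  assumes Z: "\<And>a b c d. (a, b, c, d) \<in> Q \<Longrightarrow> integrable (lb_on ({a..b} \<times> {c..d})) (Z c d)"
    and \<phi>: "continuous_on UNIV \<phi>"
  shows "(\<integral>z. glob Z z * \<phi> z \<partial>lb_on \<Omega>) = (\<Sum>(a, b, c, d)\<in>Q. \<integral>z. Z c d z * \<phi> z \<partial>lb_on ({a..b} \<times> {c..d}))"
proof -
  have Zm: "Z c d \<in> borel_measurable borel" if "(a, b, c, d) \<in> Q" for a b c d
    using borel_measurable_integrable[OF Z[OF that]] by simp
  have \<phi>m: "\<phi> \<in> borel_measurable borel" by (rule borel_measurable_continuous_onI[OF \<phi>])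
  have gm: "(\<lambda>z. glob Z z * \<phi> z) \<in> borel_measurable borel"
    by (intro borel_measurable_times glob_borel Zm \<phi>m)
  have ae: "AE z in lb_on ({a..b} \<times> {c..d}). glob Z z * \<phi> z = Z c d z * \<phi> z" if "(a, b, c, d) \<in> Q" for a b c d
    using glob_cell[OF that, of Z] by eventually_elim simp
  have zm: "(\<lambda>z. Z c d z * \<phi> z) \<in> borel_measurable borel" if "(a, b, c, d) \<in> Q" for a b c d
    by (intro borel_measurable_times Zm[OF that] \<phi>m)
  have i: "integrable (lb_on (cell q)) (\<lambda>z. glob Z z * \<phi> z)" if "q \<in> Q" for q
  proof -
    obtain a b c d where e: "q = (a, b, c, d)" by (cases q)
    then have q: "(a, b, c, d) \<in> Q" using that by simp
    show ?thesis
      using integrable_cong_AE[OF _ _ ae[OF q]] gm zm[OF q] rect_mult_continuous[OF Z[OF q] \<phi>] by (simp add: e)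
  qed
  have "(\<integral>z. glob Z z * \<phi> z \<partial>lb_on \<Omega>) = (\<Sum>q\<in>Q. \<integral>z. glob Z z * \<phi> z \<partial>lb_on (cell q))"
    by (rule grid_integral[OF i gm])
  also have "\<dots> = (\<Sum>(a, b, c, d)\<in>Q. \<integral>z. Z c d z * \<phi> z \<partial>lb_on ({a..b} \<times> {c..d}))"
  proof (rule sum.cong[OF refl])
    fix q assume "q \<in> Q"
    obtain a b c d where e: "q = (a, b, c, d)" by (cases q)
    then have q: "(a, b, c, d) \<in> Q" using \<open>q \<in> Q\<close> by simp
    show "(\<integral>z. glob Z z * \<phi> z \<partial>lb_on (cell q))
      = (case q of (a, b, c, d) \<Rightarrow> \<integral>z. Z c d z * \<phi> z \<partial>lb_on ({a..b} \<times> {c..d}))"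
      using integral_cong_AE[OF _ _ ae[OF q]] gm zm[OF q] by (simp add: e)
  qed
  finally show ?thesis .
qed

text \<open>A cell, or two horizontal neighbours joined. On the joined box one absolutely continuous
  representation crosses the common edge, and the traces from both sides can be compared.\<close>

definition box_ok :: "real \<Rightarrow> real \<Rightarrow> real \<Rightarrow> real \<Rightarrow> bool" where
  "box_ok a b c d \<longleftrightarrow> (a, b, c, d) \<in> Q \<or> (\<exists>e. (a, e, c, d) \<in> Q \<and> (e, b, c, d) \<in> Q)"

text \<open>Integration by parts on each cell leaves edge integrals. At a common edge both traces
  equal that of the representation on the joined box; the other edges lie outside the domain, where
  \<open>\<phi>\<close> vanishes.\<close>

lemma glob_weak_x:
  fixes \<phi> \<phi>x :: sfield
  assumes Z: "\<And>a b c d. box_ok a b c d \<Longrightarrow> integrable (lb_on ({a..b} \<times> {c..d})) (Z c d)"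
    and Z': "\<And>a b c d. box_ok a b c d \<Longrightarrow> integrable (lb_on ({a..b} \<times> {c..d})) (Z' c d)"
    and ac: "\<And>a b c d. box_ok a b c d \<Longrightarrow> acx a b c d (Z c d) (Z' c d)"
    and \<phi>: "continuous_on UNIV \<phi>" "continuous_on UNIV \<phi>x" "\<And>x y. ((\<lambda>t. \<phi> (t, y)) has_real_derivative \<phi>x (x, y)) (at x)"
    and \<phi>0: "\<And>z. z \<notin> \<Omega> \<Longrightarrow> \<phi> z = 0"
  shows "(\<integral>z. glob Z z * \<phi>x z \<partial>lb_on \<Omega>) = - (\<integral>z. glob Z' z * \<phi> z \<partial>lb_on \<Omega>)"
proof -
  have ok: "box_ok a b c d" if "(a, b, c, d) \<in> Q" for a b c d using that by (simp add: box_ok_def)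
  define trace where "trace = (\<lambda>(a, b, c, d) A. integrable (lb_on {c..d}) A \<and>
     (AE z in lb_on ({a..b} \<times> {c..d}). Z c d z = A (snd z) + prim a b (\<lambda>t. Z' c d (t, snd z)) (fst z)))"
  have "\<exists>A. trace q A" if "q \<in> Q" for q
  proof -
    obtain a b c d where e: "q = (a, b, c, d)" by (cases q)
    show ?thesis using ac[OF ok, of a b c d] that unfolding e trace_def acx_def by simp
  qed
  then obtain A where "\<forall>q\<in>Q. trace q (A q)" using bchoice[of Q trace] by blast
  then have A': "trace (a, b, c, d) (A (a, b, c, d))" if "(a, b, c, d) \<in> Q" for a b c d
    using that by blast
  have Ai: "integrable (lb_on {c..d}) (A (a, b, c, d))" and
    Az: "AE z in lb_on ({a..b} \<times> {c..d}). Z c d z = A (a, b, c, d) (snd z) + prim a b (\<lambda>t. Z' c d (t, snd z)) (fst z)"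
    if "(a, b, c, d) \<in> Q" for a b c d
    using A'[OF that] by (simp_all add: trace_def)
  \<comment> \<open>\<open>R\<close> collects the traces on right edges, \<open>L\<close> those on
    left edges, both weighted with \<open>\<phi>\<close>.\<close>
  define R where "R = (\<lambda>q. case q of (a, b, c, d) \<Rightarrow>
    \<integral>y. (A q y + (\<integral>t. Z' c d (t, y) \<partial>lb_on {a..b})) * \<phi> (b, y) \<partial>lb_on {c..d})"
  define L where "L = (\<lambda>q. case q of (a, b, c, d) \<Rightarrow> \<integral>y. A q y * \<phi> (a, y) \<partial>lb_on {c..d})"
  have eq: "(\<Sum>q\<in>Q. R q) = (\<Sum>q\<in>Q. L q)"
  proof (rule edge_sum_cancel)
    fix a b b' c d assume q: "(a, b, c, d) \<in> Q" and q': "(b, b', c, d) \<in> Q"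
    have bb: "box_ok a b' c d" using q q' by (auto simp: box_ok_def)
    have lt: "a < b" "b < b'" using pos[OF q] pos[OF q'] by auto
    obtain B where B: "integrable (lb_on {c..d}) B"
      "AE z in lb_on ({a..b'} \<times> {c..d}). Z c d z = B (snd z) + prim a b' (\<lambda>t. Z' c d (t, snd z)) (fst z)"
      using ac[OF bb] by (auto simp: acx_def)
    have Z'm: "Z' c d \<in> borel_measurable borel" using borel_measurable_integrable[OF Z'[OF bb]] by simp
    have u1: "AE y in lb_on {c..d}. A (a, b, c, d) y = B y"
      by (rule acx_unique[OF lt(1) Az[OF q] acx_restrict_left[OF B(2)]]) (use lt Z'm in auto)
    have u2: "AE y in lb_on {c..d}. A (b, b', c, d) y = B y + (\<integral>t. Z' c d (t, y) \<partial>lb_on {a..b})"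
      by (rule acx_unique[OF lt(2) Az[OF q'] acx_restrict_right[OF B(2) _ _ Z'[OF bb]]]) (use lt in auto)
    have "AE y in lb_on {c..d}. (A (a, b, c, d) y + (\<integral>t. Z' c d (t, y) \<partial>lb_on {a..b})) * \<phi> (b, y)
      = A (b, b', c, d) y * \<phi> (b, y)"
      using u1 u2 by eventually_elim simp
    then show "R (a, b, c, d) = L (b, b', c, d)"
      unfolding R_def L_def prod.case
    proof (rule integral_cong_AE[rotated 2])
      show "(\<lambda>y. (A (a, b, c, d) y + (\<integral>t. Z' c d (t, y) \<partial>lb_on {a..b})) * \<phi> (b, y)) \<in> borel_measurable (lb_on {c..d})"
        by (intro borel_measurable_integrable integrable_mult_continuous continuous_slice[OF \<phi>(1)]
            Bochner_Integration.integrable_add Ai[OF q] rect_integrable_y[OF Z'[OF ok[OF q]]])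
      show "(\<lambda>y. A (b, b', c, d) y * \<phi> (b, y)) \<in> borel_measurable (lb_on {c..d})"
        by (intro borel_measurable_integrable integrable_mult_continuous continuous_slice[OF \<phi>(1)] Ai[OF q'])
    qed
  next
    fix a b c d assume q: "(a, b, c, d) \<in> Q"
    \<comment> \<open>The end points of an edge may belong to the domain, but they are a null set on
      the edge.\<close>
    have oY: "AE y in lb_on {c..d}. y \<in> {c<..<d}"
    proof -
      have "AE y in lborel. y \<noteq> c" "AE y in lborel. y \<noteq> d" by (rule AE_lborel_singleton)+
      then have "AE y in lborel. y \<in> {c..d} \<longrightarrow> y \<in> {c<..<d}" by eventually_elim auto
      then show ?thesis unfolding AE_lb_on[OF borel_closed[OF closed_atLeastAtMost]] .
    qed
    {
      assume z0: "\<forall>y\<in>{c<..<d}. (b, y) \<notin> \<Omega>"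
      have "AE y in lb_on {c..d}. (A (a, b, c, d) y + (\<integral>t. Z' c d (t, y) \<partial>lb_on {a..b})) * \<phi> (b, y) = 0"
        using oY by eventually_elim (use z0 \<phi>0 in simp)
      then show "R (a, b, c, d) = 0" unfolding R_def prod.case by (rule integral_eq_zero_AE)
    next
      assume z0: "\<forall>y\<in>{c<..<d}. (a, y) \<notin> \<Omega>"
      have "AE y in lb_on {c..d}. A (a, b, c, d) y * \<phi> (a, y) = 0"
        using oY by eventually_elim (use z0 \<phi>0 in simp)
      then show "L (a, b, c, d) = 0" unfolding L_def prod.case by (rule integral_eq_zero_AE)
    }
  qed
  have "(\<integral>z. glob Z z * \<phi>x z \<partial>lb_on \<Omega>) + (\<integral>z. glob Z' z * \<phi> z \<partial>lb_on \<Omega>)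
    = (\<Sum>(a, b, c, d)\<in>Q. (\<integral>z. Z c d z * \<phi>x z \<partial>lb_on ({a..b} \<times> {c..d})) + (\<integral>z. Z' c d z * \<phi> z \<partial>lb_on ({a..b} \<times> {c..d})))"
    using glob_mult_integral[OF Z[OF ok] \<phi>(2)] glob_mult_integral[OF Z'[OF ok] \<phi>(1)]
    by (simp add: sum.distrib case_prod_unfold)
  also have "\<dots> = (\<Sum>q\<in>Q. R q - L q)"
  proof (rule sum.cong[OF refl])
    fix q assume "q \<in> Q"
    obtain a b c d where e: "q = (a, b, c, d)" by (cases q)
    then have q: "(a, b, c, d) \<in> Q" using \<open>q \<in> Q\<close> by simp
    show "(case q of (a, b, c, d) \<Rightarrow> (\<integral>z. Z c d z * \<phi>x z \<partial>lb_on ({a..b} \<times> {c..d})) + (\<integral>z. Z' c d z * \<phi> z \<partial>lb_on ({a..b} \<times> {c..d})))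
      = R q - L q"
      using cell_parts_x[OF _ Z[OF ok[OF q]] Z'[OF ok[OF q]] Ai[OF q] Az[OF q] \<phi>] pos[OF q]
      by (simp add: e R_def L_def)
  qed
  also have "\<dots> = 0" using eq by (simp add: sum_subtractf)
  finally show ?thesis by simp
qed

lemma glob_weak_y:
  fixes \<phi> \<phi>y :: sfield
  assumes Z: "\<And>a b c d. (a, b, c, d) \<in> Q \<Longrightarrow> integrable (lb_on ({a..b} \<times> {c..d})) (Jy c d (Z' c d))"
    and Z': "\<And>a b c d. (a, b, c, d) \<in> Q \<Longrightarrow> integrable (lb_on ({a..b} \<times> {c..d})) (Z' c d)"
    and z: "\<And>a b c d. (a, b, c, d) \<in> Q \<Longrightarrow> AE x in lb_on {a..b}. (\<integral>y. Z' c d (x, y) \<partial>lb_on {c..d}) = 0"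
    and \<phi>: "continuous_on UNIV \<phi>" "continuous_on UNIV \<phi>y" "\<And>x y. ((\<lambda>t. \<phi> (x, t)) has_real_derivative \<phi>y (x, y)) (at y)"
  shows "(\<integral>z. glob (\<lambda>c d. Jy c d (Z' c d)) z * \<phi>y z \<partial>lb_on \<Omega>) = - (\<integral>z. glob Z' z * \<phi> z \<partial>lb_on \<Omega>)"
proof -
  have "(\<integral>z. glob (\<lambda>c d. Jy c d (Z' c d)) z * \<phi>y z \<partial>lb_on \<Omega>)
    = (\<Sum>(a, b, c, d)\<in>Q. \<integral>z. Jy c d (Z' c d) z * \<phi>y z \<partial>lb_on ({a..b} \<times> {c..d}))"
    by (rule glob_mult_integral[OF Z \<phi>(2)])
  also have "\<dots> = (\<Sum>(a, b, c, d)\<in>Q. - (\<integral>z. Z' c d z * \<phi> z \<partial>lb_on ({a..b} \<times> {c..d})))"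
  proof (rule sum.cong[OF refl])
    fix q assume "q \<in> Q"
    obtain a b c d where e: "q = (a, b, c, d)" by (cases q)
    then have q: "(a, b, c, d) \<in> Q" using \<open>q \<in> Q\<close> by simp
    show "(case q of (a, b, c, d) \<Rightarrow> \<integral>z. Jy c d (Z' c d) z * \<phi>y z \<partial>lb_on ({a..b} \<times> {c..d}))
      = (case q of (a, b, c, d) \<Rightarrow> - (\<integral>z. Z' c d z * \<phi> z \<partial>lb_on ({a..b} \<times> {c..d})))"
      using cell_parts_y[OF _ Z'[OF q] Z[OF q] z[OF q] \<phi>] pos[OF q] by (simp add: e)
  qed
  also have "\<dots> = - (\<integral>z. glob Z' z * \<phi> z \<partial>lb_on \<Omega>)"
    using glob_mult_integral[OF Z' \<phi>(1)] by (simp add: sum_negf case_prod_unfold)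
  finally show ?thesis .
qed

end

section \<open>Error identities on a grid\<close>

text \<open>Polynomials given by coefficients, so that differentiation and the exchange of variables
  become operations on coefficients; entries beyond the degrees have no effect.\<close>

definition qpol :: "nat \<Rightarrow> nat \<Rightarrow> (nat \<Rightarrow> nat \<Rightarrow> real) \<Rightarrow> sfield" where
  "qpol m l cf z = (\<Sum>i\<le>m. \<Sum>j\<le>l. cf i j * fst z ^ i * snd z ^ j)"

definition dxc :: "(nat \<Rightarrow> nat \<Rightarrow> real) \<Rightarrow> nat \<Rightarrow> nat \<Rightarrow> real" where
  "dxc cf i j = of_nat (Suc i) * cf (Suc i) j"

definition dyc :: "(nat \<Rightarrow> nat \<Rightarrow> real) \<Rightarrow> nat \<Rightarrow> nat \<Rightarrow> real" where
  "dyc cf i j = of_nat (Suc j) * cf i (Suc j)"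

lemma qpol_swap: "qpol m l cf (y, x) = qpol l m (\<lambda>i j. cf j i) (x, y)"
  unfolding qpol_def by (subst sum.swap) (simp add: ac_simps)

lemma qpol_continuous: "continuous_on S (qpol m l cf)"
  unfolding qpol_def by (intro continuous_intros)

lemma qpol_borel [measurable]: "qpol m l cf \<in> borel_measurable borel"
  by (rule borel_measurable_continuous_onI[OF qpol_continuous])

lemma sum_pow_deriv:
  "((\<lambda>t :: real. \<Sum>i\<le>Suc m. g i * t ^ i) has_real_derivative (\<Sum>i\<le>m. of_nat (Suc i) * g (Suc i) * x ^ i)) (at x)"
proof -
  have "((\<lambda>t :: real. \<Sum>i\<le>Suc m. g i * t ^ i) has_real_derivative (\<Sum>i\<le>Suc m. g i * (of_nat i * x ^ (i - Suc 0)))) (at x)"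
    by (intro DERIV_sum DERIV_cmult DERIV_pow)
  also have "(\<Sum>i\<le>Suc m. g i * (of_nat i * x ^ (i - Suc 0))) = (\<Sum>i\<le>m. of_nat (Suc i) * g (Suc i) * x ^ i)"
    by (subst sum.atMost_Suc_shift) (simp add: ac_simps)
  finally show ?thesis .
qed

lemma qpol_dx: "((\<lambda>t. qpol (Suc m) l cf (t, y)) has_real_derivative qpol m l (dxc cf) (x, y)) (at x)"
  using sum_pow_deriv[of "\<lambda>i. \<Sum>j\<le>l. cf i j * y ^ j" m x]
  by (simp add: qpol_def dxc_def sum_distrib_left sum_distrib_right ac_simps del: sum.atMost_Suc of_nat_Suc)

lemma qpol_dy: "((\<lambda>t. qpol m (Suc l) cf (x, t)) has_real_derivative qpol m l (dyc cf) (x, y)) (at y)"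
proof -
  have "dxc (\<lambda>i j. cf j i) = (\<lambda>i j. dyc cf j i)" by (auto simp: fun_eq_iff dxc_def dyc_def)
  then show ?thesis using qpol_dx[of l m "\<lambda>i j. cf j i" x y]
    by (simp only: qpol_swap[of m "Suc l" cf x] qpol_swap[of m l "dyc cf" x])
qed

lemma qpol_slice_y: "\<exists>p. deg_lt (Suc l) p \<and> (\<forall>y. qpol m l cf (x, y) = poly p y)"
proof (intro exI conjI allI)
  let ?p = "\<Sum>j\<le>l. monom (\<Sum>i\<le>m. cf i j * x ^ i) j"
  show "deg_lt (Suc l) ?p" by (intro deg_lt_sum) (auto simp: deg_lt_def)
  show "qpol m l cf (x, y) = poly ?p y" for y
    unfolding qpol_def by (subst sum.swap) (simp add: poly_sum poly_monom sum_distrib_right)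
qed

lemma rect_sqi_continuous:
  fixes f :: sfield
  assumes "continuous_on UNIV f"
  shows "sqi (lb_on ({a..b} \<times> {c..d})) f"
proof -
  have "bounded (f ` ({a..b} \<times> {c..d}))"
    by (intro compact_imp_bounded compact_continuous_image compact_Times continuous_on_subset[OF assms]) auto
  then obtain B where "\<forall>z\<in>{a..b} \<times> {c..d}. \<bar>f z\<bar> \<le> B" by (auto simp: bounded_iff)
  then have "AE z in lb_on ({a..b} \<times> {c..d}). \<bar>f z\<bar> \<le> B" by (auto simp: AE_lb_on)
  then show ?thesis
    by (intro sqi_bounded[where B = B]) (use borel_measurable_continuous_onI[OF assms] in simp_all)
qed

lemma acx_smooth:
  fixes f f' :: sfield
  assumes "continuous_on UNIV f" "continuous_on UNIV f'" "\<And>x y. ((\<lambda>t. f (t, y)) has_real_derivative f' (x, y)) (at x)"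
  shows "acx a b c d f f'"
  unfolding acx_def
proof (intro exI conjI)
  show "integrable (lb_on {c..d}) (\<lambda>y. f (a, y))"
    by (rule integrable_continuous_lb_on[OF continuous_slice(2)[OF assms(1)]
          borel_measurable_continuous_onI[OF continuous_slice(2)[OF assms(1)]]])
  have "AE z in lb_on ({a..b} \<times> {c..d}). z \<in> {a..b} \<times> {c..d}" by (rule AE_lb_on_in) simp
  then show "AE z in lb_on ({a..b} \<times> {c..d}). f z = f (a, snd z) + prim a b (\<lambda>t. f' (t, snd z)) (fst z)"
  proof eventually_elim
    case (elim z)
    have "prim a b (\<lambda>t. f' (t, snd z)) (fst z) = f (fst z, snd z) - f (a, snd z)"
      by (rule prim_derivative) (use assms(3) continuous_slice(1)[OF assms(2)] elim in auto)
    then show ?case by simp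
  qed
qed

lemma acy_smooth:
  fixes f f' :: sfield
  assumes "continuous_on UNIV f" "continuous_on UNIV f'" "\<And>x y. ((\<lambda>t. f (x, t)) has_real_derivative f' (x, y)) (at y)"
  shows "acy a b c d f f'"
  unfolding acy_iff_acx
  by (rule acx_smooth) (use assms in \<open>auto intro!: continuous_on_compose2[OF assms(1)] continuous_on_compose2[OF assms(2)] continuous_intros\<close>)

lemma acy_diff:
  fixes f f' g g' :: sfield
  assumes f': "integrable (lb_on ({a..b} \<times> {c..d})) f'" and g': "integrable (lb_on ({a..b} \<times> {c..d})) g'"
    and "acy a b c d f f'" "acy a b c d g g'"
  shows "acy a b c d (\<lambda>z. f z - g z) (\<lambda>z. f' z - g' z)"
  unfolding acy_iff_acx
  by (rule acx_diff) (use assms rect_integrable_swap[of c d a b] in \<open>simp_all add: acy_iff_acx\<close>)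

lemma resid_poly:
  assumes cd: "c < d" and p: "deg_lt n p"
  shows "resid c d n (poly p) y = 0"
proof -
  let ?Y = "lb_on {c..d}" and ?e = "obasis c d n"
  obtain t where t: "p = (\<Sum>i<n. smult (t i) (?e i))" using obasis(3)[OF cd p] by blast
  have "(\<integral>s. poly (?e j) s * poly p s \<partial>?Y) = t j" if "j < n" for j
  proof -
    have "(\<integral>s. poly (?e j) s * poly p s \<partial>?Y) = (\<integral>s. (\<Sum>i<n. t i * (poly (?e j) s * poly (?e i) s)) \<partial>?Y)"
      by (simp add: t poly_sum sum_distrib_left ac_simps)
    also have "\<dots> = (\<Sum>i<n. t i * (\<integral>s. poly (?e j) s * poly (?e i) s \<partial>?Y))"
      using integrable_mult_poly[OF integrable_poly] by (subst Bochner_Integration.integral_sum) auto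
    also have "\<dots> = (\<Sum>i<n. if i = j then t i else 0)"
      by (rule sum.cong) (use obasis(2)[OF cd] that in auto)
    finally show ?thesis using that by simp
  qed
  then have "proj c d n (poly p) = (\<Sum>i<n. smult (t i) (?e i))"
    unfolding proj_def by (intro sum.cong refl) simp
  then have "proj c d n (poly p) = p" using t by simp
  then show ?thesis by (simp add: resid_def)
qed

lemma resid_diff:
  assumes f: "integrable (lb_on {c..d}) f" and g: "integrable (lb_on {c..d}) g"
  shows "resid c d n (\<lambda>s. f s - g s) y = resid c d n f y - resid c d n g y"
proof -
  have "(\<integral>s. poly p s * (f s - g s) \<partial>lb_on {c..d}) = (\<integral>s. poly p s * f s \<partial>lb_on {c..d}) - (\<integral>s. poly p s * g s \<partial>lb_on {c..d})" for p
    using integrable_mult_poly[OF f, of p] integrable_mult_poly[OF g, of p]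
    by (simp add: right_diff_distrib mult.commute)
  then show ?thesis
    by (simp add: resid_def proj_def poly_sum left_diff_distrib sum_subtractf)
qed

text \<open>The predicate \<open>interpolates_on\<close> with Borel integrals and the interpolant given by its
  coefficients; for \<open>m \<ge> 2\<close>, \<open>deg_lt (m - 1)\<close> means degree at most \<open>m - 2\<close>.\<close>

definition interp :: "nat \<Rightarrow> nat \<Rightarrow> real \<Rightarrow> real \<Rightarrow> real \<Rightarrow> real \<Rightarrow> sfield \<Rightarrow> (nat \<Rightarrow> nat \<Rightarrow> real) \<Rightarrow> bool" where
  "interp m l a b c d g cf \<longleftrightarrow>
    (\<forall>x\<in>{a, b}. \<forall>y\<in>{c, d}. g (x, y) = qpol m l cf (x, y)) \<and>
    (\<forall>y\<in>{c, d}. \<forall>r. deg_lt (m - 1) r \<longrightarrow> (\<integral>x. (g (x, y) - qpol m l cf (x, y)) * poly r x \<partial>lb_on {a..b}) = 0) \<and>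
    (\<forall>x\<in>{a, b}. \<forall>r. deg_lt (l - 1) r \<longrightarrow> (\<integral>y. (g (x, y) - qpol m l cf (x, y)) * poly r y \<partial>lb_on {c..d}) = 0) \<and>
    (\<forall>r s. deg_lt (m - 1) r \<longrightarrow> deg_lt (l - 1) s \<longrightarrow>
      (\<integral>z. (g z - qpol m l cf z) * (poly r (fst z) * poly s (snd z)) \<partial>lb_on ({a..b} \<times> {c..d})) = 0)"

lemma interp_swap:
  assumes "interp m l a b c d g cf" and g: "g \<in> borel_measurable borel"
  shows "interp l m c d a b (\<lambda>z. g (snd z, fst z)) (\<lambda>i j. cf j i)"
proof -
  have "(\<integral>z. (g (snd z, fst z) - qpol l m (\<lambda>i j. cf j i) z) * (poly r (fst z) * poly s (snd z)) \<partial>lb_on ({c..d} \<times> {a..b})) = 0"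
    if "deg_lt (l - 1) r" "deg_lt (m - 1) s" for r s
  proof -
    let ?f = "\<lambda>z. (g z - qpol m l cf z) * (poly s (fst z) * poly r (snd z))"
    have "?f \<in> borel_measurable borel"
      by (intro borel_measurable_times borel_measurable_diff g qpol_borel borel_fst_snd[OF poly_borel])
    from rect_integral_swap[OF this, of c d a b]
    have "(\<integral>z. ?f (snd z, fst z) \<partial>lb_on ({c..d} \<times> {a..b})) = integral\<^sup>L (lb_on ({a..b} \<times> {c..d})) ?f" .
    also have "\<dots> = 0" using assms(1) that by (simp add: interp_def)
    finally show ?thesis by (simp add: qpol_swap[of m l cf] mult.commute[of "poly s _"])
  qed
  then show ?thesis using assms(1) by (auto simp: interp_def qpol_swap[of m l cf, symmetric])
qed

text \<open>\<open>cell_identity\<close> for the interpolation error itself. The mixed derivative of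
  the interpolant has degree at most \<open>l\<close> in \<open>y\<close>, so the residual
  annihilates it and the right-hand side depends on \<open>u\<close> alone.\<close>

lemma cell_identity_qpol:
  fixes g D\<^sub>1 D\<^sub>2 :: sfield
  assumes ab: "a < b" and cd: "c < d"
    and g: "continuous_on ({a..b} \<times> {c..d}) g" "g \<in> borel_measurable borel"
    and D1: "sqi (lb_on ({a..b} \<times> {c..d})) D\<^sub>1" and D2: "sqi (lb_on ({a..b} \<times> {c..d})) D\<^sub>2"
    and acx: "acx a b c d g D\<^sub>1" and acy: "acy a b c d D\<^sub>1 D\<^sub>2"
    and ip: "interp (Suc m) (Suc l) a b c d g cf"
  shows "(\<integral>z. (D\<^sub>1 z - qpol m (Suc l) (dxc cf) z - Jy c d (Ry c d (Suc l) D\<^sub>2) z) * qpol m n r z \<partial>lb_on ({a..b} \<times> {c..d})) = 0"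
proof -
  let ?M = "lb_on ({a..b} \<times> {c..d})" and ?Y = "lb_on {c..d}"
  let ?q = "qpol (Suc m) (Suc l) cf" and ?qx = "qpol m (Suc l) (dxc cf)" and ?qxy = "qpol m l (dyc (dxc cf))"
  let ?G = "\<lambda>z. g z - ?q z" and ?E1 = "\<lambda>z. D\<^sub>1 z - ?qx z" and ?E2 = "\<lambda>z. D\<^sub>2 z - ?qxy z"
  have qs: "sqi ?M (qpol m' l' cf')" for m' l' cf' by (rule rect_sqi_continuous[OF qpol_continuous])
  have si: "integrable ?M f" if "sqi ?M f" for f by (rule sqi_imp_integrable[OF _ that]) simp
  have E1: "sqi ?M ?E1" and E2: "sqi ?M ?E2" by (intro sqi_diff D1 D2 qs)+
  have aG: "acx a b c d ?G ?E1"
    by (rule acx_diff[OF si[OF D1] si[OF qs] acx]) (rule acx_smooth[OF qpol_continuous qpol_continuous qpol_dx])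
  have aE: "acy a b c d ?E1 ?E2"
    by (rule acy_diff[OF si[OF D2] si[OF qs] acy]) (rule acy_smooth[OF qpol_continuous qpol_continuous qpol_dy])
  \<comment> \<open>The polynomial part of \<open>?E2\<close> is reproduced by the projection onto
    degree less than \<open>Suc l\<close> and leaves no residual.\<close>
  have R: "Ry c d (Suc l) ?E2 (x, y) = Ry c d (Suc l) D\<^sub>2 (x, y)"
    if "integrable ?Y (\<lambda>y. D\<^sub>2 (x, y))" for x y
  proof -
    obtain p where p: "deg_lt (Suc l) p" "\<forall>y. ?qxy (x, y) = poly p y" using qpol_slice_y by blast
    show ?thesis using resid_diff[OF that integrable_poly[of c d p], of "Suc l" y] resid_poly[OF cd p(1), of y] p(2)
      by (simp add: Ry_def)
  qed
  have JR: "AE z in ?M. Jy c d (Ry c d (Suc l) ?E2) z = Jy c d (Ry c d (Suc l) D\<^sub>2) z"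
    using rect_AE_fst[OF rect_AE_integrable_y[OF si[OF D2]]] by eventually_elim (simp add: Jy_def R)
  have E1m: "?E1 \<in> borel_measurable borel" and D2m: "D\<^sub>2 \<in> borel_measurable borel" and E2m: "?E2 \<in> borel_measurable borel"
    using E1 D2 E2 by (auto simp: sqi_def)
  note [measurable] = Jy_borel[OF Ry_borel[OF D2m]] Jy_borel[OF Ry_borel[OF E2m]] E1m
  have ipd: "?G (x, y) = 0" if "x \<in> {a, b}" "y \<in> {c, d}" for x y
    using ip that unfolding interp_def by auto
  have mono: "(\<integral>z. (?E1 z - Jy c d (Ry c d (Suc l) ?E2) z) * (poly \<alpha> (fst z) * poly \<beta> (snd z)) \<partial>?M) = 0"
    if "deg_lt (Suc m) \<alpha>" for \<alpha> \<beta>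
  proof (rule cell_identity[OF ab cd _ _ _ si[OF E1] si[OF E2] aG aE si[OF sqi_Ry[OF cd E2]], where m = "Suc m"])
    show "continuous_on ({a..b} \<times> {c..d}) ?G" by (intro continuous_intros g qpol_continuous)
    show "?G \<in> borel_measurable borel" by (intro borel_measurable_diff g qpol_borel)
  qed (use ip ipd that in \<open>auto simp: interp_def\<close>)
  have s2: "sqi ?M (\<lambda>z. ?E1 z - Jy c d (Ry c d (Suc l) ?E2) z)"
    by (intro sqi_diff[OF E1] sqi_Jy(1) sqi_Ry cd E2) (use cd in simp)
  have im: "integrable ?M (\<lambda>z. (?E1 z - Jy c d (Ry c d (Suc l) ?E2) z) * (fst z ^ i * snd z ^ j))" for i j
    by (intro rect_mult_continuous si s2 continuous_intros)
  \<comment> \<open>\<open>cell_identity\<close> handles products of a polynomial in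
    \<open>x\<close> and one in \<open>y\<close>; the test polynomial is therefore split into
    monomials.\<close>
  have lin: "w * qpol m n r z = (\<Sum>i\<le>m. \<Sum>j\<le>n. r i j * (w * (fst z ^ i * snd z ^ j)))" for w z
    by (simp add: qpol_def sum_distrib_left ac_simps)
  have "(\<integral>z. (?E1 z - Jy c d (Ry c d (Suc l) D\<^sub>2) z) * qpol m n r z \<partial>?M)
    = (\<integral>z. (\<Sum>i\<le>m. \<Sum>j\<le>n. r i j * ((?E1 z - Jy c d (Ry c d (Suc l) ?E2) z) * (fst z ^ i * snd z ^ j))) \<partial>?M)"
  proof (rule integral_cong_AE)
    show "AE z in ?M. (?E1 z - Jy c d (Ry c d (Suc l) D\<^sub>2) z) * qpol m n r z
      = (\<Sum>i\<le>m. \<Sum>j\<le>n. r i j * ((?E1 z - Jy c d (Ry c d (Suc l) ?E2) z) * (fst z ^ i * snd z ^ j)))"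
      using JR by eventually_elim (simp only: lin)
    show "(\<lambda>z. (?E1 z - Jy c d (Ry c d (Suc l) D\<^sub>2) z) * qpol m n r z) \<in> borel_measurable ?M" by simp
    show "(\<lambda>z. \<Sum>i\<le>m. \<Sum>j\<le>n. r i j * ((?E1 z - Jy c d (Ry c d (Suc l) ?E2) z) * (fst z ^ i * snd z ^ j))) \<in> borel_measurable ?M"
      by (intro borel_measurable_sum borel_measurable_times[OF borel_measurable_const] borel_measurable_integrable im)
  qed
  also have "\<dots> = (\<Sum>i\<le>m. \<Sum>j\<le>n. r i j * (\<integral>z. (?E1 z - Jy c d (Ry c d (Suc l) ?E2) z) * (fst z ^ i * snd z ^ j) \<partial>?M))"
    using im by (simp add: Bochner_Integration.integral_sum)
  also have "\<dots> = 0"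
  proof (intro sum.neutral ballI)
    fix i j assume "i \<in> {..m}"
    then have "deg_lt (Suc m) (monom 1 i)" by (auto simp: deg_lt_def)
    from mono[OF this, of "monom 1 j"]
    show "r i j * (\<integral>z. (?E1 z - Jy c d (Ry c d (Suc l) ?E2) z) * (fst z ^ i * snd z ^ j) \<partial>?M) = 0"
      by (simp add: poly_monom)
  qed
  finally show ?thesis .
qed

context xgrid
begin

section \<open>Bounds for the glued functions and their weak derivatives\<close>

lemma box_AE:
  assumes "box_ok a b c d"
  shows "AE z in lborel. z \<in> {a..b} \<times> {c..d} \<longrightarrow> z \<in> \<Omega>"
  using AE_in_ocell
proof eventually_elim
  case (elim z)
  show ?case
  proof
    assume z: "z \<in> {a..b} \<times> {c..d}"
    from assms consider "(a, b, c, d) \<in> Q" | e where "(a, e, c, d) \<in> Q" "(e, b, c, d) \<in> Q"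
      by (auto simp: box_ok_def)
    then obtain q where "q \<in> Q" "z \<in> cell q"
    proof cases
      case 1
      then show ?thesis using that[of "(a, b, c, d)"] z by simp
    next
      case 2
      show ?thesis
      proof (cases "fst z \<le> e")
        case True
        then show ?thesis using that[of "(a, e, c, d)"] 2 z by (cases z) auto
      next
        case False
        then show ?thesis using that[of "(e, b, c, d)"] 2 z by (cases z) auto
      qed
    qed
    then show "z \<in> \<Omega>" using elim sub by blast
  qed
qed

lemma box_sqi:
  fixes f :: sfield
  assumes "box_ok a b c d" "sqi (lb_on \<Omega>) f"
  shows "sqi (lb_on ({a..b} \<times> {c..d})) f"
proof -
  have [measurable]: "f \<in> borel_measurable borel" using assms(2) by (simp add: sqi_def)
  have i: "integrable lborel (\<lambda>z. indicator \<Omega> z * (f z)\<^sup>2)" using assms(2) by (simp add: sqi_def integrable_lb_on)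
  have "integrable lborel (\<lambda>z. indicator ({a..b} \<times> {c..d}) z * (f z)\<^sup>2)"
  proof (rule Bochner_Integration.integrable_bound[OF i])
    show "AE z in lborel. norm (indicator ({a..b} \<times> {c..d}) z * (f z)\<^sup>2) \<le> norm (indicator \<Omega> z * (f z)\<^sup>2)"
      using box_AE[OF assms(1)] by eventually_elim (auto split: split_indicator)
  qed simp
  then show ?thesis by (simp add: sqi_def integrable_lb_on)
qed

lemma cell_ok: "(a, b, c, d) \<in> Q \<Longrightarrow> box_ok a b c d"
  by (simp add: box_ok_def)

lemma box_ok_lt: "box_ok a b c d \<Longrightarrow> a < b \<and> c < d"
  unfolding box_ok_def by (auto dest!: pos)

lemma sum_cells_bound:
  fixes f :: sfield
  assumes f: "sqi (lb_on \<Omega>) f"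
    and le: "\<And>a b c d. (a, b, c, d) \<in> Q \<Longrightarrow> (\<integral>z. (Z c d z)\<^sup>2 \<partial>lb_on ({a..b} \<times> {c..d}))
      \<le> (d - c) ^ n * (\<integral>z. (f z)\<^sup>2 \<partial>lb_on ({a..b} \<times> {c..d}))"
    and Z: "\<And>a b c d. (a, b, c, d) \<in> Q \<Longrightarrow> sqi (lb_on ({a..b} \<times> {c..d})) (Z c d)"
  shows "(\<integral>z. (glob Z z)\<^sup>2 \<partial>lb_on \<Omega>) \<le> h ^ n * (\<integral>z. (f z)\<^sup>2 \<partial>lb_on \<Omega>)"
proof -
  have fi: "integrable (lb_on \<Omega>) (\<lambda>z. (f z)\<^sup>2)" using f by (simp add: sqi_def)
  have "(\<integral>z. (glob Z z)\<^sup>2 \<partial>lb_on \<Omega>) = (\<Sum>(a, b, c, d)\<in>Q. \<integral>z. (Z c d z)\<^sup>2 \<partial>lb_on ({a..b} \<times> {c..d}))"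
    by (rule sqi_glob(2)[OF Z])
  also have "\<dots> \<le> (\<Sum>q\<in>Q. h ^ n * (\<integral>z. (f z)\<^sup>2 \<partial>lb_on (cell q)))"
  proof (rule sum_mono)
    fix q assume "q \<in> Q"
    obtain a b c d where e: "q = (a, b, c, d)" by (cases q)
    then have q: "(a, b, c, d) \<in> Q" using \<open>q \<in> Q\<close> by simp
    have "(d - c) ^ n \<le> h ^ n" using pos[OF q] by (intro power_mono) auto
    then have "(d - c) ^ n * (\<integral>z. (f z)\<^sup>2 \<partial>lb_on ({a..b} \<times> {c..d})) \<le> h ^ n * (\<integral>z. (f z)\<^sup>2 \<partial>lb_on ({a..b} \<times> {c..d}))"
      by (rule mult_right_mono) simp
    then show "(case q of (a, b, c, d) \<Rightarrow> \<integral>z. (Z c d z)\<^sup>2 \<partial>lb_on ({a..b} \<times> {c..d})) \<le> h ^ n * (\<integral>z. (f z)\<^sup>2 \<partial>lb_on (cell q))"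
      using le[OF q] by (simp add: e)
  qed
  also have "\<dots> = h ^ n * (\<integral>z. (f z)\<^sup>2 \<partial>lb_on \<Omega>)"
    using grid_integral[OF grid_integrableD[OF fi] borel_measurable_integrable[OF fi, simplified]]
    by (simp add: sum_distrib_left)
  finally show ?thesis .
qed

text \<open>The residual gains \<open>l\<close> powers of the cell size and the primitive one more;
  the exponent is doubled because squared norms are compared.\<close>

lemma direct_bound:
  assumes sq: "\<And>j. j \<le> l \<Longrightarrow> sqi (lb_on \<Omega>) (w j)"
    and ac: "\<And>a b c d j. (a, b, c, d) \<in> Q \<Longrightarrow> j < l \<Longrightarrow> acy a b c d (w j) (w (Suc j))"
  shows "sqi (lb_on \<Omega>) (glob (\<lambda>c d. Jy c d (Ry c d l (w 0))))"
    and "(\<integral>z. (glob (\<lambda>c d. Jy c d (Ry c d l (w 0))) z)\<^sup>2 \<partial>lb_on \<Omega>) \<le> h ^ (2 * (l + 1)) * (\<integral>z. (w l z)\<^sup>2 \<partial>lb_on \<Omega>)"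
proof -
  have Rs: "sqi (lb_on ({a..b} \<times> {c..d})) (Ry c d l (w 0))" if "(a, b, c, d) \<in> Q" for a b c d
    using that pos[OF that] by (intro sqi_Ry box_sqi[OF cell_ok] sq) auto
  have Js: "sqi (lb_on ({a..b} \<times> {c..d})) (Jy c d (Ry c d l (w 0)))" if "(a, b, c, d) \<in> Q" for a b c d
    using pos[OF that] by (intro sqi_Jy(1) Rs[OF that]) auto
  show "sqi (lb_on \<Omega>) (glob (\<lambda>c d. Jy c d (Ry c d l (w 0))))" by (rule sqi_glob(1)[OF Js])
  show "(\<integral>z. (glob (\<lambda>c d. Jy c d (Ry c d l (w 0))) z)\<^sup>2 \<partial>lb_on \<Omega>) \<le> h ^ (2 * (l + 1)) * (\<integral>z. (w l z)\<^sup>2 \<partial>lb_on \<Omega>)"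
  proof (rule sum_cells_bound[OF sq[OF order_refl] _ Js])
    fix a b c d assume q: "(a, b, c, d) \<in> Q"
    let ?M = "lb_on ({a..b} \<times> {c..d})"
    have cd: "c < d" using pos[OF q] by simp
    have "(\<integral>z. (Jy c d (Ry c d l (w 0)) z)\<^sup>2 \<partial>?M) \<le> (d - c)\<^sup>2 * (\<integral>z. (Ry c d l (w 0) z)\<^sup>2 \<partial>?M)"
      by (rule sqi_Jy(2)) (use cd Rs[OF q] in auto)
    also have "\<dots> \<le> (d - c)\<^sup>2 * ((d - c) ^ (2 * l) * (\<integral>z. (w l z)\<^sup>2 \<partial>?M))"
      by (intro mult_left_mono Ry_bound[OF cd] box_sqi[OF cell_ok[OF q]] sq ac[OF q]) auto
    finally show "(\<integral>z. (Jy c d (Ry c d l (w 0)) z)\<^sup>2 \<partial>?M) \<le> (d - c) ^ (2 * (l + 1)) * (\<integral>z. (w l z)\<^sup>2 \<partial>?M)"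
      by (simp add: power2_eq_square power_add algebra_simps)
  qed
qed

text \<open>The same count with a second primitive. It is applied later with \<open>w 0\<close>
  carrying one more \<open>x\<close>-derivative.\<close>

lemma super_bound:
  assumes sq: "\<And>j. j \<le> l \<Longrightarrow> sqi (lb_on \<Omega>) (w j)"
    and ac: "\<And>a b c d j. (a, b, c, d) \<in> Q \<Longrightarrow> j < l \<Longrightarrow> acy a b c d (w j) (w (Suc j))"
  shows "sqi (lb_on \<Omega>) (glob (\<lambda>c d. Jy c d (Jy c d (Ry c d l (w 0)))))"
    and "(\<integral>z. (glob (\<lambda>c d. Jy c d (Jy c d (Ry c d l (w 0)))) z)\<^sup>2 \<partial>lb_on \<Omega>) \<le> h ^ (2 * (l + 2)) * (\<integral>z. (w l z)\<^sup>2 \<partial>lb_on \<Omega>)"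
proof -
  have Rs: "sqi (lb_on ({a..b} \<times> {c..d})) (Ry c d l (w 0))" if "(a, b, c, d) \<in> Q" for a b c d
    using that pos[OF that] by (intro sqi_Ry box_sqi[OF cell_ok] sq) auto
  have Js: "sqi (lb_on ({a..b} \<times> {c..d})) (Jy c d (Ry c d l (w 0)))" if "(a, b, c, d) \<in> Q" for a b c d
    using pos[OF that] by (intro sqi_Jy(1) Rs[OF that]) auto
  have JJs: "sqi (lb_on ({a..b} \<times> {c..d})) (Jy c d (Jy c d (Ry c d l (w 0))))" if "(a, b, c, d) \<in> Q" for a b c d
    using pos[OF that] by (intro sqi_Jy(1) Js[OF that]) auto
  show "sqi (lb_on \<Omega>) (glob (\<lambda>c d. Jy c d (Jy c d (Ry c d l (w 0)))))" by (rule sqi_glob(1)[OF JJs])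
  show "(\<integral>z. (glob (\<lambda>c d. Jy c d (Jy c d (Ry c d l (w 0)))) z)\<^sup>2 \<partial>lb_on \<Omega>) \<le> h ^ (2 * (l + 2)) * (\<integral>z. (w l z)\<^sup>2 \<partial>lb_on \<Omega>)"
  proof (rule sum_cells_bound[OF sq[OF order_refl] _ JJs])
    fix a b c d assume q: "(a, b, c, d) \<in> Q"
    let ?M = "lb_on ({a..b} \<times> {c..d})"
    have cd: "c < d" using pos[OF q] by simp
    have "(\<integral>z. (Jy c d (Jy c d (Ry c d l (w 0))) z)\<^sup>2 \<partial>?M) \<le> (d - c)\<^sup>2 * (\<integral>z. (Jy c d (Ry c d l (w 0)) z)\<^sup>2 \<partial>?M)"
      by (rule sqi_Jy(2)) (use cd Js[OF q] in auto)
    also have "\<dots> \<le> (d - c)\<^sup>2 * ((d - c)\<^sup>2 * (\<integral>z. (Ry c d l (w 0) z)\<^sup>2 \<partial>?M))"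
      by (intro mult_left_mono sqi_Jy(2)) (use cd Rs[OF q] in auto)
    also have "\<dots> \<le> (d - c)\<^sup>2 * ((d - c)\<^sup>2 * ((d - c) ^ (2 * l) * (\<integral>z. (w l z)\<^sup>2 \<partial>?M)))"
      by (intro mult_left_mono Ry_bound[OF cd] box_sqi[OF cell_ok[OF q]] sq ac[OF q]) auto
    finally show "(\<integral>z. (Jy c d (Jy c d (Ry c d l (w 0))) z)\<^sup>2 \<partial>?M) \<le> (d - c) ^ (2 * (l + 2)) * (\<integral>z. (w l z)\<^sup>2 \<partial>?M)"
      by (simp add: power2_eq_square power_add algebra_simps)
  qed
qed

text \<open>The operators act in \<open>y\<close> only, so they commute with \<open>\<partial>\<^sub>x\<close>; in \<open>y\<close> there is no jump, because for
  \<open>l \<ge> 2\<close> the residual is orthogonal to affine functions and its second primitive vanishes at both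
  ends of the cell.\<close>

lemma super_weak:
  fixes f f' :: sfield
  assumes l: "2 \<le> l" and f: "sqi (lb_on \<Omega>) f" and f': "sqi (lb_on \<Omega>) f'"
    and ac: "\<And>a b c d. box_ok a b c d \<Longrightarrow> acx a b c d f f'"
    and \<phi>: "continuous_on UNIV \<phi>" and \<phi>0: "\<And>z. z \<notin> \<Omega> \<Longrightarrow> \<phi> z = 0"
  shows "continuous_on UNIV \<phi>x \<Longrightarrow> (\<And>x y. ((\<lambda>t. \<phi> (t, y)) has_real_derivative \<phi>x (x, y)) (at x)) \<Longrightarrow>
      (\<integral>z. glob (\<lambda>c d. Jy c d (Jy c d (Ry c d l f))) z * \<phi>x z \<partial>lb_on \<Omega>)
      = - (\<integral>z. glob (\<lambda>c d. Jy c d (Jy c d (Ry c d l f'))) z * \<phi> z \<partial>lb_on \<Omega>)"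
    and "continuous_on UNIV \<phi>y \<Longrightarrow> (\<And>x y. ((\<lambda>t. \<phi> (x, t)) has_real_derivative \<phi>y (x, y)) (at y)) \<Longrightarrow>
      (\<integral>z. glob (\<lambda>c d. Jy c d (Jy c d (Ry c d l f))) z * \<phi>y z \<partial>lb_on \<Omega>)
      = - (\<integral>z. glob (\<lambda>c d. Jy c d (Ry c d l f)) z * \<phi> z \<partial>lb_on \<Omega>)"
proof -
  have si: "integrable (lb_on ({a..b} \<times> {c..d :: real})) F" if "sqi (lb_on ({a..b} \<times> {c..d})) F" for a b c d :: real and F
    by (rule sqi_imp_integrable[OF _ that]) simp
  have R: "sqi (lb_on ({a..b} \<times> {c..d})) (Ry c d l F)" if "box_ok a b c d" "sqi (lb_on \<Omega>) F" for a b c d F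
    using box_ok_lt[OF that(1)] that by (intro sqi_Ry box_sqi) auto
  have J: "sqi (lb_on ({a..b} \<times> {c..d})) (Jy c d F)" if "box_ok a b c d" "sqi (lb_on ({a..b} \<times> {c..d})) F" for a b c d F
    using box_ok_lt[OF that(1)] that by (intro sqi_Jy(1)) auto
  have fm: "f \<in> borel_measurable borel" using f by (simp add: sqi_def)
  {
    assume \<phi>x: "continuous_on UNIV \<phi>x" "\<And>x y. ((\<lambda>t. \<phi> (t, y)) has_real_derivative \<phi>x (x, y)) (at x)"
    show "(\<integral>z. glob (\<lambda>c d. Jy c d (Jy c d (Ry c d l f))) z * \<phi>x z \<partial>lb_on \<Omega>)
      = - (\<integral>z. glob (\<lambda>c d. Jy c d (Jy c d (Ry c d l f'))) z * \<phi> z \<partial>lb_on \<Omega>)"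
    proof (rule glob_weak_x[OF _ _ _ \<phi> \<phi>x \<phi>0])
      fix a b c d assume ok: "box_ok a b c d"
      show "integrable (lb_on ({a..b} \<times> {c..d})) (Jy c d (Jy c d (Ry c d l f)))"
        "integrable (lb_on ({a..b} \<times> {c..d})) (Jy c d (Jy c d (Ry c d l f')))"
        by (intro si J[OF ok] R[OF ok] f f')+
      show "acx a b c d (Jy c d (Jy c d (Ry c d l f))) (Jy c d (Jy c d (Ry c d l f')))"
        by (intro acx_Jy Jy_borel Ry_borel fm acx_Ry si J[OF ok] R[OF ok] box_sqi[OF ok] ac[OF ok] f f')
    qed
  next
    assume \<phi>y: "continuous_on UNIV \<phi>y" "\<And>x y. ((\<lambda>t. \<phi> (x, t)) has_real_derivative \<phi>y (x, y)) (at y)"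
    show "(\<integral>z. glob (\<lambda>c d. Jy c d (Jy c d (Ry c d l f))) z * \<phi>y z \<partial>lb_on \<Omega>)
      = - (\<integral>z. glob (\<lambda>c d. Jy c d (Ry c d l f)) z * \<phi> z \<partial>lb_on \<Omega>)"
    proof (rule glob_weak_y[OF _ _ _ \<phi> \<phi>y])
      fix a b c d assume q: "(a, b, c, d) \<in> Q"
      note ok = cell_ok[OF q]
      show "integrable (lb_on ({a..b} \<times> {c..d})) (Jy c d (Jy c d (Ry c d l f)))"
        "integrable (lb_on ({a..b} \<times> {c..d})) (Jy c d (Ry c d l f))"
        by (intro si J[OF ok] R[OF ok] f)+
      show "AE x in lb_on {a..b}. (\<integral>y. Jy c d (Ry c d l f) (x, y) \<partial>lb_on {c..d}) = 0"
        using rect_AE_integrable_y[OF si[OF box_sqi[OF ok f]]]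
      proof eventually_elim
        case (elim x)
        have cd: "c < d" using box_ok_lt[OF ok] by simp
        let ?r = "resid c d l (\<lambda>s. f (x, s))"
        have ri: "integrable (lb_on {c..d}) ?r" by (rule integrable_resid[OF elim])
        \<comment> \<open>The first primitive keeps \<open>l - 1\<close> orders of orthogonality, at
          least one, so its mean is zero and the second primitive vanishes at the top.\<close>
        have "orth c d (Suc (l - 1)) ?r" using orth_resid[OF cd elim, of l] l by simp
        from orth_prim(1)[OF ri this] have "orth c d (Suc (l - 2)) (prim c d ?r)" using l
          by (metis Suc_diff_Suc Suc_1 Suc_le_lessD)
        moreover have "integrable (lb_on {c..d}) (prim c d ?r)"
          by (intro integrable_continuous_lb_on continuous_on_subset[OF prim_continuous[OF ri]] prim_borel)
            (use borel_measurable_integrable[OF ri] in simp_all)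
        ultimately show ?case using orth_prim(2)[of c d "prim c d ?r" "l - 2"] by (simp add: Jy_def Ry_def)
      qed
    qed
  }
qed

text \<open>\<open>D\<^sub>1\<close>, \<open>wx\<close> and \<open>vx\<close> stand for the
  \<open>x\<close>-derivatives of the solution, of its interpolant and of a discrete function.
  Differentiation lowers the degree of \<open>vx\<close> in \<open>x\<close> to \<open>m\<close>,
  the range in which the moments of the cell identity vanish.\<close>

lemma grid_identity:
  fixes g D\<^sub>1 D\<^sub>2 wx vx :: sfield
  assumes g: "\<And>a b c d. (a, b, c, d) \<in> Q \<Longrightarrow> continuous_on ({a..b} \<times> {c..d}) g" "g \<in> borel_measurable borel"
    and D1: "sqi (lb_on \<Omega>) D\<^sub>1" and D2: "sqi (lb_on \<Omega>) D\<^sub>2"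
    and acx: "\<And>a b c d. (a, b, c, d) \<in> Q \<Longrightarrow> acx a b c d g D\<^sub>1"
    and acy: "\<And>a b c d. (a, b, c, d) \<in> Q \<Longrightarrow> acy a b c d D\<^sub>1 D\<^sub>2"
    and wx: "sqi (lb_on \<Omega>) wx" and vx: "sqi (lb_on \<Omega>) vx"
    and ip: "\<And>a b c d. (a, b, c, d) \<in> Q \<Longrightarrow> \<exists>cf. interp (Suc m) (Suc l) a b c d g cf \<and>
      (AE z in lb_on ({a..b} \<times> {c..d}). wx z = qpol m (Suc l) (dxc cf) z)"
    and vp: "\<And>a b c d. (a, b, c, d) \<in> Q \<Longrightarrow> \<exists>r. AE z in lb_on ({a..b} \<times> {c..d}). vx z = qpol m (Suc l) r z"
  shows "(\<integral>z. (D\<^sub>1 z - wx z) * vx z \<partial>lb_on \<Omega>)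
    = (\<integral>z. glob (\<lambda>c d. Jy c d (Ry c d (Suc l) D\<^sub>2)) z * vx z \<partial>lb_on \<Omega>)"
proof -
  let ?Z = "\<lambda>c d. Jy c d (Ry c d (Suc l) D\<^sub>2)"
  have Zs: "sqi (lb_on ({a..b} \<times> {c..d})) (?Z c d)" if "(a, b, c, d) \<in> Q" for a b c d
    using pos[OF that] by (intro sqi_Jy(1) sqi_Ry box_sqi[OF cell_ok[OF that]] D2) auto
  have gs: "sqi (lb_on \<Omega>) (glob ?Z)" by (rule sqi_glob(1)[OF Zs])
  let ?F = "\<lambda>z. (D\<^sub>1 z - wx z - glob ?Z z) * vx z"
  have Fi: "integrable (lb_on \<Omega>) ?F"
    by (intro sqi_mult_integrable sqi_diff D1 wx gs vx)
  have Fm: "?F \<in> borel_measurable borel" using borel_measurable_integrable[OF Fi] by simp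
  have "integral\<^sup>L (lb_on \<Omega>) ?F = (\<Sum>q\<in>Q. integral\<^sup>L (lb_on (cell q)) ?F)"
    by (rule grid_integral[OF grid_integrableD[OF Fi] Fm])
  also have "\<dots> = 0"
  proof (rule sum.neutral, rule ballI)
    fix q assume "q \<in> Q"
    obtain a b c d where e: "q = (a, b, c, d)" by (cases q)
    then have q: "(a, b, c, d) \<in> Q" using \<open>q \<in> Q\<close> by simp
    let ?M = "lb_on ({a..b} \<times> {c..d})"
    note bs = box_sqi[OF cell_ok[OF q]]
    obtain cf where cf: "interp (Suc m) (Suc l) a b c d g cf" "AE z in ?M. wx z = qpol m (Suc l) (dxc cf) z"
      using ip[OF q] by blast
    obtain r where r: "AE z in ?M. vx z = qpol m (Suc l) r z" using vp[OF q] by blast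
    have "integral\<^sup>L ?M ?F = (\<integral>z. (D\<^sub>1 z - qpol m (Suc l) (dxc cf) z - ?Z c d z) * qpol m (Suc l) r z \<partial>?M)"
    proof (rule integral_cong_AE)
      show "AE z in ?M. ?F z = (D\<^sub>1 z - qpol m (Suc l) (dxc cf) z - ?Z c d z) * qpol m (Suc l) r z"
        using cf(2) r glob_cell[OF q, of ?Z] by eventually_elim simp
      have "D\<^sub>1 \<in> borel_measurable borel" "?Z c d \<in> borel_measurable borel"
        using D1 Zs[OF q] by (auto simp: sqi_def)
      then show "(\<lambda>z. (D\<^sub>1 z - qpol m (Suc l) (dxc cf) z - ?Z c d z) * qpol m (Suc l) r z) \<in> borel_measurable ?M"
        by simp
    qed (use Fm in simp)
    also have "\<dots> = 0"
      by (rule cell_identity_qpol[OF _ _ g(1)[OF q] g(2) bs[OF D1] bs[OF D2] acx[OF q] acy[OF q] cf(1)])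
        (use pos[OF q] in auto)
    finally show "integral\<^sup>L (lb_on (cell q)) ?F = 0" by (simp add: e)
  qed
  finally have "(\<integral>z. (D\<^sub>1 z - wx z) * vx z - glob ?Z z * vx z \<partial>lb_on \<Omega>) = 0"
    by (simp add: left_diff_distrib)
  then show ?thesis
    using sqi_mult_integrable[OF sqi_diff[OF D1 wx] vx] sqi_mult_integrable[OF gs vx] by simp
qed

end

section \<open>Borel representatives\<close>

lemma AE_lebesgue_on_iff:
  fixes S :: "'a::euclidean_space set"
  assumes "S \<in> sets borel"
  shows "(AE z in lebesgue_on S. P z) \<longleftrightarrow> (AE z in lb_on S. P z)"
  using assms by (simp add: AE_restrict_space_iff AE_lb_on AE_completion_iff)

lemma borel_imp_lebesgue_on:
  fixes F :: "'a::euclidean_space \<Rightarrow> real"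
  assumes "F \<in> borel_measurable borel"
  shows "F \<in> borel_measurable (lebesgue_on S)"
  using assms by (intro measurable_restrict_space1 measurable_completion) simp

lemma lebesgue_on_integral:
  fixes F :: "'a::euclidean_space \<Rightarrow> real"
  assumes S: "S \<in> sets borel" and F: "F \<in> borel_measurable borel"
  shows "integral\<^sup>L (lebesgue_on S) F = integral\<^sup>L (lb_on S) F"
    and "integrable (lebesgue_on S) F \<longleftrightarrow> integrable (lb_on S) F"
proof -
  have S': "S \<inter> space lebesgue \<in> sets lebesgue" using S by simp
  have m: "(\<lambda>z. indicator S z *\<^sub>R F z) \<in> borel_measurable lborel" using S F by simp
  show "integral\<^sup>L (lebesgue_on S) F = integral\<^sup>L (lb_on S) F"
    unfolding integral_restrict_space[OF S'] integral_completion[OF m] integral_lb_on[OF S F] by simp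
  show "integrable (lebesgue_on S) F \<longleftrightarrow> integrable (lb_on S) F"
    unfolding integrable_restrict_space[OF S'] integrable_completion[OF m] integrable_lb_on[OF S F] by simp
qed

lemma lebesgue_on_integral_cong:
  fixes F F' :: "'a::euclidean_space \<Rightarrow> real"
  assumes S: "S \<in> sets borel" and F: "F \<in> borel_measurable (lebesgue_on S)" "F' \<in> borel_measurable borel"
    and ae: "AE z in lb_on S. F z = F' z"
  shows "integral\<^sup>L (lebesgue_on S) F = integral\<^sup>L (lb_on S) F'"
    and "integrable (lebesgue_on S) F \<longleftrightarrow> integrable (lb_on S) F'"
proof -
  have ae': "AE z in lebesgue_on S. F z = F' z" using ae S by (simp add: AE_lebesgue_on_iff)
  show "integral\<^sup>L (lebesgue_on S) F = integral\<^sup>L (lb_on S) F'"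
    using integral_cong_AE[OF F(1) borel_imp_lebesgue_on[OF F(2)] ae'] lebesgue_on_integral(1)[OF S F(2)] by simp
  show "integrable (lebesgue_on S) F \<longleftrightarrow> integrable (lb_on S) F'"
    using integrable_cong_AE[OF F(1) borel_imp_lebesgue_on[OF F(2)] ae'] lebesgue_on_integral(2)[OF S F(2)] by simp
qed

text \<open>Slices of a Lebesgue measurable function need not be measurable; a Borel function equal
  almost everywhere makes every slice usable.\<close>

lemma L2_borel_rep:
  assumes S: "S \<in> sets borel" and f: "f \<in> L2 S"
  obtains f' where "sqi (lb_on S) f'" "AE z in lb_on S. f z = f' z"
proof -
  have fm: "f \<in> borel_measurable (lebesgue_on S)" using f by (simp add: L2_def)
  have "(\<lambda>x. if x \<in> S then f x else 0) \<in> borel_measurable lebesgue"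
    using fm S by (subst borel_measurable_if) auto
  then obtain f' where f': "f' \<in> borel_measurable lborel" "AE x in lborel. (if x \<in> S then f x else 0) = f' x"
    using completion_ex_borel_measurable_real by blast
  have ae: "AE z in lb_on S. f z = f' z"
    using f'(2) S by (auto simp: AE_lb_on elim: eventually_mono)
  have ae2: "AE z in lb_on S. (f z)\<^sup>2 = (f' z)\<^sup>2" using ae by eventually_elim simp
  have "integrable (lb_on S) (\<lambda>z. (f' z)\<^sup>2)"
    using lebesgue_on_integral_cong(2)[OF S _ _ ae2] fm f f'(1) by (simp add: L2_def)
  then have "sqi (lb_on S) f'" using f'(1) by (simp add: sqi_def)
  then show ?thesis using ae by (rule that)
qed

lemma sqi_imp_L2:
  assumes S: "S \<in> sets borel" and f: "sqi (lb_on S) f"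
  shows "f \<in> L2 S"
proof -
  have fm: "f \<in> borel_measurable borel" and "integrable (lb_on S) (\<lambda>z. (f z)\<^sup>2)" using f by (auto simp: sqi_def)
  moreover have "(\<lambda>z. (f z)\<^sup>2) \<in> borel_measurable borel" using fm by simp
  ultimately have "integrable (lebesgue_on S) (\<lambda>z. (f z)\<^sup>2)" using lebesgue_on_integral(2)[OF S] by blast
  then show ?thesis using borel_imp_lebesgue_on[OF fm] by (simp add: L2_def)
qed

section \<open>Test functions\<close>

lemma Ck_SucD: "Ck (Suc n) f \<Longrightarrow> Ck n f"
proof (induction n arbitrary: f)
  case 0
  then show ?case by (simp add: differentiable_imp_continuous_on)
next
  case (Suc n)
  then show ?case by (metis Ck.simps(2))
qed

lemma has_derivative_frechet:
  assumes "Ck (Suc n) f"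
  shows "(f has_derivative frechet_derivative f (at z)) (at z)"
  using assms by (cases z) (auto simp: differentiable_on_eq_differentiable_at frechet_derivative_works[symmetric])

lemma pd_eq:
  assumes "(f has_derivative D) (at z)"
  shows "pdx f z = D (1, 0)" "pdy f z = D (0, 1)"
  using frechet_derivative_at[OF assms] by (simp_all add: pdx_def pdy_def)

lemma Ck_continuous: "Ck n f \<Longrightarrow> continuous_on UNIV f"
proof (induction n)
  case (Suc n)
  then show ?case using Ck_SucD by blast
qed simp

lemma pdx_DERIV:
  assumes "Ck (Suc n) f"
  shows "((\<lambda>t. f (t, y)) has_real_derivative pdx f (x, y)) (at x)"
proof -
  let ?D = "frechet_derivative f (at (x, y))"
  have D: "(f has_derivative ?D) (at (x, y))" by (rule has_derivative_frechet[OF assms])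
  have lin: "linear ?D" using D by (rule has_derivative_linear)
  have "((\<lambda>t. (t, y)) has_derivative (\<lambda>h. (h, 0))) (at x)"
    by (auto intro!: derivative_eq_intros)
  from has_derivative_compose[OF this D]
  have "((\<lambda>t. f (t, y)) has_derivative (\<lambda>h. ?D (h, 0))) (at x)" .
  moreover have "?D (h, 0) = pdx f (x, y) * h" for h
    using linear_scale[OF lin, of h "(1, 0)"] by (simp add: pdx_def)
  ultimately show ?thesis by (simp add: has_field_derivative_def mult.commute[of _ "pdx f (x, y)"])
qed

lemma pdy_DERIV:
  assumes "Ck (Suc n) f"
  shows "((\<lambda>t. f (x, t)) has_real_derivative pdy f (x, y)) (at y)"
proof -
  let ?D = "frechet_derivative f (at (x, y))"
  have D: "(f has_derivative ?D) (at (x, y))" by (rule has_derivative_frechet[OF assms])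
  have lin: "linear ?D" using D by (rule has_derivative_linear)
  have "((\<lambda>t. (x, t)) has_derivative (\<lambda>h. (0, h))) (at y)"
    by (auto intro!: derivative_eq_intros)
  from has_derivative_compose[OF this D]
  have "((\<lambda>t. f (x, t)) has_derivative (\<lambda>h. ?D (0, h))) (at y)" .
  moreover have "?D (0, h) = pdy f (x, y) * h" for h
    using linear_scale[OF lin, of h "(0, 1)"] by (simp add: pdy_def)
  ultimately show ?thesis by (simp add: has_field_derivative_def mult.commute[of _ "pdy f (x, y)"])
qed

lemma Ck_diff: "Ck n f \<Longrightarrow> Ck n g \<Longrightarrow> Ck n (\<lambda>z. f z - g z)"
proof (induction n arbitrary: f g)
  case 0
  then show ?case by (auto intro: continuous_on_diff)
next
  case (Suc n)
  have d: "((\<lambda>z. f z - g z) has_derivative (\<lambda>h. frechet_derivative f (at z) h - frechet_derivative g (at z) h)) (at z)" for z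
    by (intro has_derivative_diff has_derivative_frechet[OF Suc.prems(1)] has_derivative_frechet[OF Suc.prems(2)])
  have "pdx (\<lambda>z. f z - g z) = (\<lambda>z. pdx f z - pdx g z)" "pdy (\<lambda>z. f z - g z) = (\<lambda>z. pdy f z - pdy g z)"
    using pd_eq[OF d] by (auto simp: fun_eq_iff pdx_def pdy_def)
  moreover have "(\<lambda>z. f z - g z) differentiable_on UNIV"
    using d by (auto simp: differentiable_on_eq_differentiable_at differentiable_def)
  ultimately show ?case using Suc.IH Suc.prems by simp
qed

lemma tensor_derivative:
  assumes "smooth F" "smooth G"
  shows "((\<lambda>z. F (fst z) * G (snd z)) has_derivative
    (\<lambda>h. deriv F (fst z) * fst h * G (snd z) + F (fst z) * (deriv G (snd z) * snd h))) (at z)"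
proof -
  have "((\<lambda>z. F (fst z)) has_derivative (\<lambda>h. deriv F (fst z) * fst h)) (at z)"
    using has_derivative_compose[OF has_derivative_fst[OF has_derivative_ident], of F "times (deriv F (fst z))" z]
      smooth_deriv(1)[OF assms(1)] by (simp add: has_field_derivative_def)
  moreover have "((\<lambda>z. G (snd z)) has_derivative (\<lambda>h. deriv G (snd z) * snd h)) (at z)"
    using has_derivative_compose[OF has_derivative_snd[OF has_derivative_ident], of G "times (deriv G (snd z))" z]
      smooth_deriv(1)[OF assms(2)] by (simp add: has_field_derivative_def)
  ultimately show ?thesis by (auto intro!: derivative_eq_intros)
qed

lemma pd_tensor:
  assumes "smooth F" "smooth G"
  shows "pdx (\<lambda>z. F (fst z) * G (snd z)) = (\<lambda>z. deriv F (fst z) * G (snd z))"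
    and "pdy (\<lambda>z. F (fst z) * G (snd z)) = (\<lambda>z. F (fst z) * deriv G (snd z))"
  using pd_eq[OF tensor_derivative[OF assms]] by (auto simp: fun_eq_iff)

lemma Ck_tensor:
  assumes "smooth F" "smooth G"
  shows "Ck n (\<lambda>z. F (fst z) * G (snd z))"
  using assms
proof (induction n arbitrary: F G)
  case 0
  then show ?case
    by (auto intro!: continuous_intros continuous_on_compose2[OF smooth_continuous[of F UNIV]]
        continuous_on_compose2[OF smooth_continuous[of G UNIV]])
next
  case (Suc n)
  have "(\<lambda>z. F (fst z) * G (snd z)) differentiable_on UNIV"
    using tensor_derivative[OF Suc.prems] by (auto simp: differentiable_on_eq_differentiable_at differentiable_def)
  then show ?case using Suc.IH Suc.prems smooth_deriv(2) by (simp add: pd_tensor)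
qed

lemma smooth_deriv_iter: "smooth F \<Longrightarrow> smooth ((deriv ^^ n) F)"
  by (induction n) (auto intro: smooth_deriv)

lemma pd_iter_tensor:
  assumes "smooth F" "smooth G"
  shows "(pdx ^^ i) ((pdy ^^ j) (\<lambda>z. F (fst z) * G (snd z)))
    = (\<lambda>z. (deriv ^^ i) F (fst z) * (deriv ^^ j) G (snd z))"
proof -
  have 1: "(pdy ^^ j) (\<lambda>z. F (fst z) * G (snd z)) = (\<lambda>z. F (fst z) * (deriv ^^ j) G (snd z))"
    by (induction j) (simp_all add: pd_tensor[OF assms(1) smooth_deriv_iter[OF assms(2)]])
  have "(pdx ^^ i) (\<lambda>z. F (fst z) * H (snd z)) = (\<lambda>z. (deriv ^^ i) F (fst z) * H (snd z))" if "smooth H" for H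
    by (induction i) (simp_all add: pd_tensor[OF smooth_deriv_iter[OF assms(1)] that])
  then show ?thesis using 1 smooth_deriv_iter[OF assms(2)] by simp
qed

lemma compact_closed_subset:
  fixes S :: "'a::t2_space set"
  assumes "compact S" "closed T" "T \<subseteq> S"
  shows "compact T"
  using compact_Int_closed[OF assms(1,2)] assms(3) by (simp add: Int_absorb1)

text \<open>The supports of the factors bound the closure of the support by a closed rectangle
  inside the open cell.\<close>

lemma tensor_test_function:
  assumes "test1 a b \<psi>\<^sub>1" "test1 c d \<psi>\<^sub>2" "ocell (a, b, c, d) \<subseteq> \<Omega>"
  shows "(\<lambda>z. \<psi>\<^sub>1 (fst z) * \<psi>\<^sub>2 (snd z)) \<in> test_functions \<Omega>"
proof -
  obtain p q where 1: "smooth \<psi>\<^sub>1" "a < p" "q < b" "\<And>x. x \<notin> {p..q} \<Longrightarrow> \<psi>\<^sub>1 x = 0"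
    using assms(1) by (auto simp: test1_def)
  obtain r s where 2: "smooth \<psi>\<^sub>2" "c < r" "s < d" "\<And>x. x \<notin> {r..s} \<Longrightarrow> \<psi>\<^sub>2 x = 0"
    using assms(2) by (auto simp: test1_def)
  have "{z. \<psi>\<^sub>1 (fst z) * \<psi>\<^sub>2 (snd z) \<noteq> 0} \<subseteq> {p..q} \<times> {r..s}"
  proof
    fix z assume "z \<in> {z. \<psi>\<^sub>1 (fst z) * \<psi>\<^sub>2 (snd z) \<noteq> 0}"
    then have "fst z \<in> {p..q}" "snd z \<in> {r..s}" using 1(4)[of "fst z"] 2(4)[of "snd z"] by auto
    then show "z \<in> {p..q} \<times> {r..s}" by (cases z) simp
  qed
  then have c: "closure {z. \<psi>\<^sub>1 (fst z) * \<psi>\<^sub>2 (snd z) \<noteq> 0} \<subseteq> {p..q} \<times> {r..s}"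
    by (rule closure_minimal) (intro closed_Times, auto)
  have "compact (closure {z. \<psi>\<^sub>1 (fst z) * \<psi>\<^sub>2 (snd z) \<noteq> 0})"
    by (rule compact_closed_subset[OF _ closed_closure c]) (auto intro: compact_Times)
  moreover have "{p..q} \<times> {r..s} \<subseteq> ocell (a, b, c, d)" using 1 2 by auto
  ultimately show ?thesis
    unfolding test_functions_def using c assms(3) Ck_tensor[OF 1(1) 2(1)] by blast
qed

lemma test_function_zero:
  assumes "\<phi> \<in> test_functions \<Omega>" "z \<notin> \<Omega>"
  shows "\<phi> z = 0"
  using assms closure_subset[of "{z. \<phi> z \<noteq> 0}"] by (auto simp: test_functions_def)

lemma test_function_pd:
  assumes "\<phi> \<in> test_functions \<Omega>"
  shows "pdx \<phi> \<in> test_functions \<Omega>" "pdy \<phi> \<in> test_functions \<Omega>"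
proof -
  let ?S = "closure {z. \<phi> z \<noteq> 0}"
  have C: "Ck n \<phi>" "compact ?S" "?S \<subseteq> \<Omega>" for n using assms by (auto simp: test_functions_def)
  have z: "pdx \<phi> z = 0 \<and> pdy \<phi> z = 0" if "z \<notin> ?S" for z
  proof -
    have "((\<lambda>_. 0) has_derivative (\<lambda>_. 0)) (at z)" by simp
    then have "(\<phi> has_derivative (\<lambda>_. 0)) (at z)"
    proof (rule has_derivative_transform_within_open[where s = "- ?S"])
      show "\<And>x. x \<in> - ?S \<Longrightarrow> 0 = \<phi> x" using closure_subset[of "{z. \<phi> z \<noteq> 0}"] by auto
    qed (use that in auto)
    from pd_eq[OF this] show ?thesis by simp
  qed
  have "pdx \<phi> \<in> test_functions \<Omega> \<and> pdy \<phi> \<in> test_functions \<Omega>"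
  proof -
    have *: "closure {z. P z \<noteq> 0} \<subseteq> ?S" if "\<And>z. z \<notin> ?S \<Longrightarrow> P z = (0 :: real)" for P
      by (rule closure_minimal) (use that in auto)
    have "closure {z. pdx \<phi> z \<noteq> 0} \<subseteq> ?S" "closure {z. pdy \<phi> z \<noteq> 0} \<subseteq> ?S"
      using z by (auto intro!: *)
    moreover have "Ck n (pdx \<phi>)" "Ck n (pdy \<phi>)" for n using C(1)[of "Suc n"] by auto
    ultimately show ?thesis unfolding test_functions_def
      using C(2,3) compact_closed_subset[OF C(2) closed_closure] by blast
  qed
  then show "pdx \<phi> \<in> test_functions \<Omega>" "pdy \<phi> \<in> test_functions \<Omega>" by auto
qed

lemma test_function_pd_iter:
  assumes "\<phi> \<in> test_functions \<Omega>"
  shows "(pdx ^^ i) ((pdy ^^ j) \<phi>) \<in> test_functions \<Omega>"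
proof -
  have "(pdy ^^ j) \<phi> \<in> test_functions \<Omega>" by (induction j) (auto intro: assms test_function_pd)
  then show ?thesis by (induction i) (auto intro: test_function_pd)
qed

lemma test_function_continuous:
  assumes "\<phi> \<in> test_functions \<Omega>"
  shows "continuous_on UNIV \<phi>" "\<phi> \<in> borel_measurable borel"
proof -
  have "Ck 0 \<phi>" using assms by (auto simp: test_functions_def)
  then show "continuous_on UNIV \<phi>" by simp
  then show "\<phi> \<in> borel_measurable borel" by (rule borel_measurable_continuous_onI)
qed

lemma test_function_diff:
  assumes "\<phi> \<in> test_functions \<Omega>" "\<theta> \<in> test_functions \<Omega>"
  shows "(\<lambda>z. \<phi> z - \<theta> z) \<in> test_functions \<Omega>"
proof -
  let ?S = "closure {z. \<phi> z \<noteq> 0} \<union> closure {z. \<theta> z \<noteq> 0}"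
  have C: "Ck n \<phi>" "Ck n \<theta>" "compact ?S" "?S \<subseteq> \<Omega>" for n using assms by (auto simp: test_functions_def)
  have "{z. \<phi> z - \<theta> z \<noteq> 0} \<subseteq> {z. \<phi> z \<noteq> 0} \<union> {z. \<theta> z \<noteq> 0}" by auto
  also have "\<dots> \<subseteq> ?S" by (intro Un_mono closure_subset)
  finally have c: "closure {z. \<phi> z - \<theta> z \<noteq> 0} \<subseteq> ?S" by (rule closure_minimal) auto
  then show ?thesis unfolding test_functions_def
    using C(4) compact_closed_subset[OF C(3) closed_closure c] Ck_diff[OF C(1,2)] by blast
qed

lemma test_function_bounded:
  assumes "\<phi> \<in> test_functions \<Omega>"
  obtains B where "\<And>z. \<bar>\<phi> z\<bar> \<le> B"
proof -
  let ?S = "closure {z. \<phi> z \<noteq> 0}"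
  have "bounded (\<phi> ` ?S)"
    using assms continuous_on_subset[OF test_function_continuous(1)[OF assms]]
    by (intro compact_imp_bounded compact_continuous_image) (auto simp: test_functions_def)
  then obtain B where B: "\<forall>z\<in>?S. \<bar>\<phi> z\<bar> \<le> B" by (auto simp: bounded_iff)
  have "\<bar>\<phi> z\<bar> \<le> max B 0" for z
  proof (cases "z \<in> ?S")
    case True
    then show ?thesis using B by fastforce
  next
    case False
    then have "\<phi> z = 0" using closure_subset[of "{z. \<phi> z \<noteq> 0}"] by auto
    then show ?thesis by simp
  qed
  then show ?thesis by (rule that)
qed

section \<open>Weak derivatives on a gridded domain\<close>

text \<open>The square of half width \<open>B\<close> gives finite measure, a rectangle on which
  test functions can be integrated by parts after extension by zero, and the constant in Poincare's
  inequality.\<close>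

locale sgrid = xgrid +
  fixes B :: real
  assumes bnd: "\<Omega> \<subseteq> {-B<..<B} \<times> {-B<..<B}" and Bpos: "0 < B"
begin

lemma finite_measure_\<Omega> [simp]: "finite_measure (lb_on \<Omega>)"
proof (rule finite_measure_lb_on[OF \<Omega>_borel])
  have "bounded ({-B..B} \<times> {-B..B})" by (intro bounded_Times) auto
  then show "bounded \<Omega>" by (rule bounded_subset) (use bnd in auto)
qed

lemma sqi_test:
  assumes "\<phi> \<in> test_functions \<Omega>"
  shows "sqi (lb_on \<Omega>) \<phi>"
proof -
  obtain C where "\<And>z. \<bar>\<phi> z\<bar> \<le> C" using test_function_bounded[OF assms] by blast
  then show ?thesis
    by (intro sqi_bounded[where B = C]) (use test_function_continuous(2)[OF assms] in simp_all)
qed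

definition wd :: "nat \<Rightarrow> nat \<Rightarrow> sfield \<Rightarrow> sfield \<Rightarrow> bool" where
  "wd i j f g \<longleftrightarrow> (\<forall>\<phi>\<in>test_functions \<Omega>.
    (\<integral>z. f z * (pdx ^^ i) ((pdy ^^ j) \<phi>) z \<partial>lb_on \<Omega>) = (-1) ^ (i + j) * (\<integral>z. g z * \<phi> z \<partial>lb_on \<Omega>))"

lemma integral_test_rep:
  assumes f: "f \<in> borel_measurable (lebesgue_on \<Omega>)" and f': "f' \<in> borel_measurable borel"
    and ae: "AE z in lb_on \<Omega>. f z = f' z" and \<phi>: "\<phi> \<in> test_functions \<Omega>"
  shows "(\<integral>z. f z * \<phi> z \<partial>lebesgue_on \<Omega>) = (\<integral>z. f' z * \<phi> z \<partial>lb_on \<Omega>)"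
proof (rule lebesgue_on_integral_cong(1)[OF \<Omega>_borel])
  note \<phi>m = test_function_continuous(2)[OF \<phi>]
  show "(\<lambda>z. f z * \<phi> z) \<in> borel_measurable (lebesgue_on \<Omega>)"
    by (intro borel_measurable_times f borel_imp_lebesgue_on \<phi>m)
  show "(\<lambda>z. f' z * \<phi> z) \<in> borel_measurable borel" by (intro borel_measurable_times f' \<phi>m)
  show "AE z in lb_on \<Omega>. f z * \<phi> z = f' z * \<phi> z" using ae by eventually_elim simp
qed

lemma is_weak_deriv_iff_wd:
  assumes "f \<in> borel_measurable (lebesgue_on \<Omega>)" "f' \<in> borel_measurable borel" "AE z in lb_on \<Omega>. f z = f' z"
    and "g \<in> borel_measurable (lebesgue_on \<Omega>)" "g' \<in> borel_measurable borel" "AE z in lb_on \<Omega>. g z = g' z"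
  shows "is_weak_deriv \<Omega> i j f g \<longleftrightarrow> wd i j f' g'"
  unfolding is_weak_deriv_def wd_def
  using integral_test_rep[OF assms(1-3) test_function_pd_iter] integral_test_rep[OF assms(4-6)] by simp

lemma subbox_sqi:
  fixes f :: sfield
  assumes "ocell (a, b, c, d) \<subseteq> \<Omega>" "sqi (lb_on \<Omega>) f"
  shows "sqi (lb_on ({a..b} \<times> {c..d})) f"
proof -
  have [measurable]: "f \<in> borel_measurable borel" using assms(2) by (simp add: sqi_def)
  have i: "integrable lborel (\<lambda>z. indicator \<Omega> z * (f z)\<^sup>2)" using assms(2) by (simp add: sqi_def integrable_lb_on)
  have "integrable lborel (\<lambda>z. indicator ({a..b} \<times> {c..d}) z * (f z)\<^sup>2)"
  proof (rule Bochner_Integration.integrable_bound[OF i])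
    show "AE z in lborel. norm (indicator ({a..b} \<times> {c..d}) z * (f z)\<^sup>2) \<le> norm (indicator \<Omega> z * (f z)\<^sup>2)"
      using AE_cell_ocell[of "(a, b, c, d)"]
    proof eventually_elim
      case (elim z)
      then have "z \<in> {a..b} \<times> {c..d} \<Longrightarrow> z \<in> \<Omega>" using assms(1) by auto
      then show ?case by (auto split: split_indicator)
    qed
  qed simp
  then show ?thesis by (simp add: sqi_def integrable_lb_on)
qed

lemma subbox_integral:
  fixes F :: sfield
  assumes "ocell (a, b, c, d) \<subseteq> \<Omega>" "F \<in> borel_measurable borel" "test1 a b \<psi>\<^sub>1" "test1 c d \<psi>\<^sub>2"
  shows "(\<integral>z. F z * (\<psi>\<^sub>1 (fst z) * \<psi>\<^sub>2 (snd z)) \<partial>lb_on \<Omega>)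
    = (\<integral>z. F z * (\<psi>\<^sub>1 (fst z) * \<psi>\<^sub>2 (snd z)) \<partial>lb_on ({a..b} \<times> {c..d}))"
proof -
  have "\<psi>\<^sub>1 \<in> borel_measurable borel" "\<psi>\<^sub>2 \<in> borel_measurable borel"
    using assms smooth_borel by (auto simp: test1_def)
  then have [measurable]: "(\<lambda>z :: real \<times> real. \<psi>\<^sub>1 (fst z)) \<in> borel_measurable borel"
    "(\<lambda>z :: real \<times> real. \<psi>\<^sub>2 (snd z)) \<in> borel_measurable borel"
    by (simp_all add: borel_fst_snd)
  note [measurable] = assms(2)
  have eq: "indicator \<Omega> z * (F z * (\<psi>\<^sub>1 (fst z) * \<psi>\<^sub>2 (snd z)))
    = indicator ({a..b} \<times> {c..d}) z * (F z * (\<psi>\<^sub>1 (fst z) * \<psi>\<^sub>2 (snd z)))" for z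
  proof (cases "z \<in> ocell (a, b, c, d)")
    case True
    then have "z \<in> \<Omega>" "z \<in> {a..b} \<times> {c..d}" using assms(1) by auto
    then show ?thesis by simp
  next
    case False
    then have "fst z \<notin> {a<..<b} \<or> snd z \<notin> {c<..<d}" by (cases z) auto
    then have "\<psi>\<^sub>1 (fst z) * \<psi>\<^sub>2 (snd z) = 0" using test1_zero[OF assms(3)] test1_zero[OF assms(4)] by auto
    then show ?thesis by simp
  qed
  have m: "(\<lambda>z. F z * (\<psi>\<^sub>1 (fst z) * \<psi>\<^sub>2 (snd z))) \<in> borel_measurable borel" by simp
  show ?thesis unfolding integral_lb_on[OF \<Omega>_borel m] integral_lb_on[OF rect_borel m] eq ..
qed

text \<open>Localization: a tensor product supported in a box contained in the domain turns the
  global weak identity into one on that box.\<close>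

lemma wd_tensor:
  assumes "wd i j f g" "ocell (a, b, c, d) \<subseteq> \<Omega>" "f \<in> borel_measurable borel" "g \<in> borel_measurable borel"
    "test1 a b \<psi>\<^sub>1" "test1 c d \<psi>\<^sub>2"
  shows "(\<integral>z. f z * ((deriv ^^ i) \<psi>\<^sub>1 (fst z) * (deriv ^^ j) \<psi>\<^sub>2 (snd z)) \<partial>lb_on ({a..b} \<times> {c..d}))
    = (-1) ^ (i + j) * (\<integral>z. g z * (\<psi>\<^sub>1 (fst z) * \<psi>\<^sub>2 (snd z)) \<partial>lb_on ({a..b} \<times> {c..d}))"
proof -
  have s: "smooth \<psi>\<^sub>1" "smooth \<psi>\<^sub>2" using assms by (auto simp: test1_def)
  have t: "test1 a b ((deriv ^^ i) \<psi>\<^sub>1)" "test1 c d ((deriv ^^ j) \<psi>\<^sub>2)"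
  proof -
    show "test1 a b ((deriv ^^ i) \<psi>\<^sub>1)" using assms(5) by (induction i) (auto intro: test1_deriv)
    show "test1 c d ((deriv ^^ j) \<psi>\<^sub>2)" using assms(6) by (induction j) (auto intro: test1_deriv)
  qed
  have "(\<integral>z. f z * (pdx ^^ i) ((pdy ^^ j) (\<lambda>z. \<psi>\<^sub>1 (fst z) * \<psi>\<^sub>2 (snd z))) z \<partial>lb_on \<Omega>)
    = (-1) ^ (i + j) * (\<integral>z. g z * (\<psi>\<^sub>1 (fst z) * \<psi>\<^sub>2 (snd z)) \<partial>lb_on \<Omega>)"
    using assms(1) tensor_test_function[OF assms(5,6,2)] by (simp add: wd_def)
  then show ?thesis
    unfolding pd_iter_tensor[OF s] subbox_integral[OF assms(2,3) t] subbox_integral[OF assms(2,4-6)] .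
qed

lemma subbox_integrable:
  fixes f :: sfield
  assumes "ocell (a, b, c, d) \<subseteq> \<Omega>" "sqi (lb_on \<Omega>) f"
  shows "integrable (lb_on ({a..b} \<times> {c..d})) f"
  by (rule sqi_imp_integrable[OF _ subbox_sqi[OF assms]]) simp

text \<open>The cells cover the domain and each carries its own tensor products, so uniqueness
  reduces to the fundamental lemma on one cell.\<close>

lemma tensor_unique:
  assumes g: "sqi (lb_on \<Omega>) g" and g': "sqi (lb_on \<Omega>) g'"
    and eq: "\<And>\<psi>\<^sub>1 \<psi>\<^sub>2. smooth \<psi>\<^sub>1 \<Longrightarrow> smooth \<psi>\<^sub>2 \<Longrightarrow> (\<lambda>z. \<psi>\<^sub>1 (fst z) * \<psi>\<^sub>2 (snd z)) \<in> test_functions \<Omega> \<Longrightarrow>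
      (\<integral>z. g z * (\<psi>\<^sub>1 (fst z) * \<psi>\<^sub>2 (snd z)) \<partial>lb_on \<Omega>) = (\<integral>z. g' z * (\<psi>\<^sub>1 (fst z) * \<psi>\<^sub>2 (snd z)) \<partial>lb_on \<Omega>)"
  shows "AE z in lb_on \<Omega>. g z = g' z"
  unfolding AE_grid
proof
  fix q assume "q \<in> Q"
  obtain a b c d where e: "q = (a, b, c, d)" by (cases q)
  then have q: "(a, b, c, d) \<in> Q" using \<open>q \<in> Q\<close> by simp
  note s = sub[OF q]
  have gm: "g \<in> borel_measurable borel" "g' \<in> borel_measurable borel" using g g' by (auto simp: sqi_def)
  have "AE z in lb_on ({a..b} \<times> {c..d}). g z - g' z = 0"
  proof (rule fundamental_lemma)
    note i = subbox_integrable[OF s g] subbox_integrable[OF s g']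
    show "integrable (lb_on ({a..b} \<times> {c..d})) (\<lambda>z. g z - g' z)" using i by simp
    fix \<psi>\<^sub>1 \<psi>\<^sub>2 assume t: "test1 a b \<psi>\<^sub>1" "test1 c d \<psi>\<^sub>2"
    have "(\<integral>z. g z * (\<psi>\<^sub>1 (fst z) * \<psi>\<^sub>2 (snd z)) \<partial>lb_on ({a..b} \<times> {c..d}))
      = (\<integral>z. g' z * (\<psi>\<^sub>1 (fst z) * \<psi>\<^sub>2 (snd z)) \<partial>lb_on ({a..b} \<times> {c..d}))"
      using eq[OF _ _ tensor_test_function[OF t s]] t
      unfolding subbox_integral[OF s gm(1) t] subbox_integral[OF s gm(2) t] by (simp add: test1_def)
    then show "(\<integral>z. (g z - g' z) * (\<psi>\<^sub>1 (fst z) * \<psi>\<^sub>2 (snd z)) \<partial>lb_on ({a..b} \<times> {c..d})) = 0"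
      using test1_tensor_integrable[OF i(1) t] test1_tensor_integrable[OF i(2) t] by (simp add: left_diff_distrib)
  qed
  then show "AE z in lb_on (cell q). g z = g' z" unfolding e cell.simps by eventually_elim simp
qed

lemma wd_unique:
  assumes "sqi (lb_on \<Omega>) g" "sqi (lb_on \<Omega>) g'" "wd i j f g" "wd i j f g'"
  shows "AE z in lb_on \<Omega>. g z = g' z"
proof (rule tensor_unique[OF assms(1,2)])
  fix \<psi>\<^sub>1 \<psi>\<^sub>2 assume t: "(\<lambda>z. \<psi>\<^sub>1 (fst z) * \<psi>\<^sub>2 (snd z)) \<in> test_functions \<Omega>"
  have "(-1) ^ (i + j) * (\<integral>z. g z * (\<psi>\<^sub>1 (fst z) * \<psi>\<^sub>2 (snd z)) \<partial>lb_on \<Omega>)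
      = (-1) ^ (i + j) * (\<integral>z. g' z * (\<psi>\<^sub>1 (fst z) * \<psi>\<^sub>2 (snd z)) \<partial>lb_on \<Omega>)"
    by (rule trans[OF sym[OF bspec[OF assms(3)[unfolded wd_def] t]] bspec[OF assms(4)[unfolded wd_def] t]])
  then show "(\<integral>z. g z * (\<psi>\<^sub>1 (fst z) * \<psi>\<^sub>2 (snd z)) \<partial>lb_on \<Omega>) = (\<integral>z. g' z * (\<psi>\<^sub>1 (fst z) * \<psi>\<^sub>2 (snd z)) \<partial>lb_on \<Omega>)"
    by simp
qed

section \<open>Borel representatives of weak derivatives\<close>

definition brep :: "sfield \<Rightarrow> sfield" where
  "brep f = (SOME f'. sqi (lb_on \<Omega>) f' \<and> (AE z in lb_on \<Omega>. f z = f' z))"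

lemma brep:
  assumes "f \<in> L2 \<Omega>"
  shows "sqi (lb_on \<Omega>) (brep f)" "AE z in lb_on \<Omega>. f z = brep f z"
proof -
  have "\<exists>f'. sqi (lb_on \<Omega>) f' \<and> (AE z in lb_on \<Omega>. f z = f' z)"
    using L2_borel_rep[OF \<Omega>_borel assms] by blast
  from someI_ex[OF this] show "sqi (lb_on \<Omega>) (brep f)" "AE z in lb_on \<Omega>. f z = brep f z"
    unfolding brep_def by blast+
qed

text \<open>\<open>weak_deriv\<close> is a choice among Lebesgue measurable functions; all later
  arguments use this Borel version.\<close>

definition dv :: "nat \<Rightarrow> nat \<Rightarrow> sfield \<Rightarrow> sfield" where
  "dv i j f = brep (weak_deriv \<Omega> i j f)"

lemma weak_deriv_L2:
  assumes "f \<in> Hspace m \<Omega>" "i + j \<le> m"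
  shows "weak_deriv \<Omega> i j f \<in> L2 \<Omega>" "is_weak_deriv \<Omega> i j f (weak_deriv \<Omega> i j f)"
proof -
  have "\<exists>g. g \<in> L2 \<Omega> \<and> is_weak_deriv \<Omega> i j f g" using assms by (auto simp: Hspace_def)
  from someI_ex[OF this] show "weak_deriv \<Omega> i j f \<in> L2 \<Omega>" "is_weak_deriv \<Omega> i j f (weak_deriv \<Omega> i j f)"
    unfolding weak_deriv_def by blast+
qed

lemma L2_measurable: "f \<in> L2 \<Omega> \<Longrightarrow> f \<in> borel_measurable (lebesgue_on \<Omega>)"
  by (simp add: L2_def)

lemma sqi_borel: "sqi (lb_on S) f \<Longrightarrow> f \<in> borel_measurable borel"
  by (simp add: sqi_def)

lemma dv_sqi:
  assumes "f \<in> Hspace m \<Omega>" "i + j \<le> m"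
  shows "sqi (lb_on \<Omega>) (dv i j f)" "AE z in lb_on \<Omega>. weak_deriv \<Omega> i j f z = dv i j f z"
  unfolding dv_def by (intro brep weak_deriv_L2[OF assms])+

text \<open>Even the derivative of order zero is an arbitrary choice, so it agrees with
  \<open>f\<close> only by uniqueness of weak derivatives.\<close>

lemma dv_00:
  assumes "f \<in> Hspace m \<Omega>"
  shows "AE z in lb_on \<Omega>. f z = dv 0 0 f z"
proof -
  have f: "f \<in> L2 \<Omega>" using assms by (simp add: Hspace_def)
  note w = weak_deriv_L2[OF assms, of 0 0, simplified]
  note b = brep[OF f] and d = dv_sqi[OF assms, of 0 0, simplified]
  have "wd 0 0 (brep f) (dv 0 0 f)"
    using w(2) is_weak_deriv_iff_wd[OF L2_measurable[OF f] sqi_borel[OF b(1)] b(2) L2_measurable[OF w(1)] sqi_borel[OF d(1)] d(2)]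
    by blast
  moreover have "wd 0 0 (brep f) (brep f)" by (simp add: wd_def)
  ultimately have "AE z in lb_on \<Omega>. brep f z = dv 0 0 f z"
    using wd_unique[OF b(1) d(1)] by blast
  with b(2) show ?thesis by eventually_elim simp
qed

lemma wd_dv:
  assumes "f \<in> Hspace m \<Omega>" "i + j \<le> m"
  shows "wd i j (dv 0 0 f) (dv i j f)"
proof -
  have f: "f \<in> L2 \<Omega>" using assms by (simp add: Hspace_def)
  note w = weak_deriv_L2[OF assms] and d = dv_sqi[OF assms]
  note d0 = dv_sqi[OF assms(1), of 0 0, simplified]
  show ?thesis
    using w(2) is_weak_deriv_iff_wd[OF L2_measurable[OF f] sqi_borel[OF d0(1)] dv_00[OF assms(1)]
        L2_measurable[OF w(1)] sqi_borel[OF d(1)] d(2)]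
    by blast
qed

lemma HspaceI:
  assumes f: "f \<in> L2 \<Omega>" and f': "sqi (lb_on \<Omega>) f'" "AE z in lb_on \<Omega>. f z = f' z"
    and ex: "\<And>i j. i + j \<le> m \<Longrightarrow> \<exists>g. sqi (lb_on \<Omega>) g \<and> wd i j f' g"
  shows "f \<in> Hspace m \<Omega>"
  unfolding Hspace_def
proof (intro CollectI conjI allI impI f)
  fix i j assume "i + j \<le> m"
  then obtain g where g: "sqi (lb_on \<Omega>) g" "wd i j f' g" using ex by blast
  have "g \<in> L2 \<Omega>" by (rule sqi_imp_L2[OF \<Omega>_borel g(1)])
  moreover have "is_weak_deriv \<Omega> i j f g"
    using is_weak_deriv_iff_wd[OF L2_measurable[OF f] sqi_borel[OF f'(1)] f'(2) L2_measurable[OF \<open>g \<in> L2 \<Omega>\<close>]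
        sqi_borel[OF g(1)], of i j] g(2) by simp
  ultimately show "\<exists>g\<in>L2 \<Omega>. is_weak_deriv \<Omega> i j f g" by blast
qed

text \<open>By uniqueness any explicit candidate identifies the chosen derivative almost
  everywhere.\<close>

lemma dv_eqI:
  assumes "f \<in> Hspace m \<Omega>" "i + j \<le> m" and f': "AE z in lb_on \<Omega>. f z = f' z" "f' \<in> borel_measurable borel"
    and g: "sqi (lb_on \<Omega>) g" "wd i j f' g"
  shows "AE z in lb_on \<Omega>. dv i j f z = g z"
proof (rule wd_unique[OF dv_sqi(1)[OF assms(1,2)] g(1) wd_dv[OF assms(1,2)]])
  note d0 = dv_sqi[OF assms(1), of 0 0, simplified]
  have d0m: "dv 0 0 f \<in> borel_measurable borel" by (rule sqi_borel[OF d0(1)])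
  have ae: "AE z in lb_on \<Omega>. dv 0 0 f z = f' z" using dv_00[OF assms(1)] f'(1) by eventually_elim simp
  show "wd i j (dv 0 0 f) g"
    unfolding wd_def
  proof
    fix \<phi> assume \<phi>: "\<phi> \<in> test_functions \<Omega>"
    note m = test_function_continuous(2)[OF test_function_pd_iter[OF \<phi>, of i j]]
    have "(\<integral>z. dv 0 0 f z * (pdx ^^ i) ((pdy ^^ j) \<phi>) z \<partial>lb_on \<Omega>) = (\<integral>z. f' z * (pdx ^^ i) ((pdy ^^ j) \<phi>) z \<partial>lb_on \<Omega>)"
    proof (rule integral_cong_AE)
      show "AE z in lb_on \<Omega>. dv 0 0 f z * (pdx ^^ i) ((pdy ^^ j) \<phi>) z = f' z * (pdx ^^ i) ((pdy ^^ j) \<phi>) z"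
        using ae by eventually_elim simp
    qed (use m d0m f'(2) in simp_all)
    then show "(\<integral>z. dv 0 0 f z * (pdx ^^ i) ((pdy ^^ j) \<phi>) z \<partial>lb_on \<Omega>) = (-1) ^ (i + j) * (\<integral>z. g z * \<phi> z \<partial>lb_on \<Omega>)"
      using g(2) \<phi> by (simp add: wd_def)
  qed
qed

lemma wd_diff:
  assumes "wd i j f g" "wd i j f' g'" and s: "sqi (lb_on \<Omega>) f" "sqi (lb_on \<Omega>) f'" "sqi (lb_on \<Omega>) g" "sqi (lb_on \<Omega>) g'"
  shows "wd i j (\<lambda>z. f z - f' z) (\<lambda>z. g z - g' z)"
  unfolding wd_def
proof
  fix \<phi> assume \<phi>: "\<phi> \<in> test_functions \<Omega>"
  note t = sqi_test[OF test_function_pd_iter[OF \<phi>, of i j]] and t0 = sqi_test[OF \<phi>]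
  show "(\<integral>z. (f z - f' z) * (pdx ^^ i) ((pdy ^^ j) \<phi>) z \<partial>lb_on \<Omega>) = (-1) ^ (i + j) * (\<integral>z. (g z - g' z) * \<phi> z \<partial>lb_on \<Omega>)"
    using assms(1,2) \<phi> sqi_mult_integrable[OF s(1) t] sqi_mult_integrable[OF s(2) t]
      sqi_mult_integrable[OF s(3) t0] sqi_mult_integrable[OF s(4) t0]
    by (simp add: wd_def left_diff_distrib right_diff_distrib)
qed

lemma L2_diff:
  assumes "f \<in> L2 \<Omega>" "g \<in> L2 \<Omega>"
  shows "(\<lambda>z. f z - g z) \<in> L2 \<Omega>"
  using sqi_diff[of "lebesgue_on \<Omega>" f g] assms by (simp add: L2_def sqi_def)

lemma Hspace_diff:
  assumes "f \<in> Hspace m \<Omega>" "g \<in> Hspace m \<Omega>"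
  shows "(\<lambda>z. f z - g z) \<in> Hspace m \<Omega>"
    and "i + j \<le> m \<Longrightarrow> AE z in lb_on \<Omega>. dv i j (\<lambda>z. f z - g z) z = dv i j f z - dv i j g z"
proof -
  note f0 = dv_sqi(1)[OF assms(1), of 0 0, simplified] and g0 = dv_sqi(1)[OF assms(2), of 0 0, simplified]
  have L: "(\<lambda>z. f z - g z) \<in> L2 \<Omega>" using assms by (intro L2_diff) (auto simp: Hspace_def)
  have ae: "AE z in lb_on \<Omega>. f z - g z = dv 0 0 f z - dv 0 0 g z"
    using dv_00[OF assms(1)] dv_00[OF assms(2)] by eventually_elim simp
  have w: "wd i j (\<lambda>z. dv 0 0 f z - dv 0 0 g z) (\<lambda>z. dv i j f z - dv i j g z)" if "i + j \<le> m" for i j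
    by (intro wd_diff wd_dv[OF assms(1) that] wd_dv[OF assms(2) that] f0 g0 dv_sqi(1)[OF assms(1) that] dv_sqi(1)[OF assms(2) that])
  have s: "sqi (lb_on \<Omega>) (\<lambda>z. dv i j f z - dv i j g z)" if "i + j \<le> m" for i j
    by (intro sqi_diff dv_sqi(1)[OF assms(1) that] dv_sqi(1)[OF assms(2) that])
  show H: "(\<lambda>z. f z - g z) \<in> Hspace m \<Omega>"
    by (rule HspaceI[OF L sqi_diff[OF f0 g0] ae]) (use w s in blast)
  show "AE z in lb_on \<Omega>. dv i j (\<lambda>z. f z - g z) z = dv i j f z - dv i j g z" if "i + j \<le> m"
    by (rule dv_eqI[OF H that ae sqi_borel[OF sqi_diff[OF f0 g0]] s[OF that] w[OF that]])
qed

lemma box_integral_\<Omega>: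
  fixes F :: sfield
  assumes "F \<in> borel_measurable borel" "\<And>z. z \<notin> \<Omega> \<Longrightarrow> F z = 0"
  shows "integral\<^sup>L (lb_on \<Omega>) F = integral\<^sup>L (lb_on ({-B..B} \<times> {-B..B})) F"
proof -
  have eq: "indicator \<Omega> z * F z = indicator ({-B..B} \<times> {-B..B}) z * F z" for z
  proof (cases "z \<in> \<Omega>")
    case True
    then have "z \<in> {-B..B} \<times> {-B..B}" using bnd by auto
    then show ?thesis using True by simp
  qed (simp add: assms)
  show ?thesis unfolding integral_lb_on[OF \<Omega>_borel assms(1)] integral_lb_on[OF rect_borel assms(1)] eq ..
qed

text \<open>Extended by zero, test functions live on the square of half width \<open>B\<close> and
  vanish on its sides. Integration by parts on this single rectangle has no boundary terms.\<close>

lemma test_parts: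
  assumes "\<phi> \<in> test_functions \<Omega>" "\<theta> \<in> test_functions \<Omega>"
  shows "(\<integral>z. \<phi> z * pdx \<theta> z \<partial>lb_on \<Omega>) = - (\<integral>z. pdx \<phi> z * \<theta> z \<partial>lb_on \<Omega>)"
    and "(\<integral>z. \<phi> z * pdy \<theta> z \<partial>lb_on \<Omega>) = - (\<integral>z. pdy \<phi> z * \<theta> z \<partial>lb_on \<Omega>)"
proof -
  let ?K = "{-B..B} \<times> {-B..B}"
  note c = test_function_continuous[OF assms(1)] test_function_continuous[OF assms(2)]
    test_function_continuous[OF test_function_pd(1)[OF assms(1)]] test_function_continuous[OF test_function_pd(2)[OF assms(1)]]
    test_function_continuous[OF test_function_pd(1)[OF assms(2)]] test_function_continuous[OF test_function_pd(2)[OF assms(2)]]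
  note z = test_function_zero[OF assms(1)] test_function_zero[OF assms(2)]
  have C: "Ck (Suc 0) \<phi>" "Ck (Suc 0) \<theta>" using assms by (auto simp: test_functions_def simp del: Ck.simps)
  note dx = pdx_DERIV[OF C(1)] pdx_DERIV[OF C(2)] and dy = pdy_DERIV[OF C(1)] pdy_DERIV[OF C(2)]
  have bz: "\<phi> (B, y) = 0" "\<theta> (B, y) = 0" "\<phi> (-B, y) = 0" "\<phi> (x, -B) = 0" "\<phi> (x, B) = 0" for x y
    by (rule z; use bnd in auto)+
  have i: "integrable (lb_on ?K) F" if "continuous_on UNIV F" for F :: sfield
    by (rule sqi_imp_integrable[OF _ rect_sqi_continuous[OF that]]) simp
  have "(\<integral>z. \<phi> z * pdx \<theta> z \<partial>lb_on ?K) + (\<integral>z. pdx \<phi> z * \<theta> z \<partial>lb_on ?K) = 0"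
  proof -
    have "AE z in lb_on ?K. \<phi> z = (\<lambda>_. 0) (snd z) + prim (-B) B (\<lambda>t. pdx \<phi> (t, snd z)) (fst z)"
      using AE_lb_on_in[of ?K, OF rect_borel]
    proof eventually_elim
      case (elim z)
      have "prim (-B) B (\<lambda>t. pdx \<phi> (t, snd z)) (fst z) = \<phi> (fst z, snd z) - \<phi> (-B, snd z)"
        by (rule prim_derivative) (use dx(1) continuous_slice(1)[OF c(5)] elim in auto)
      then show ?case using bz by simp
    qed
    from cell_parts_x[OF _ i[OF c(1)] i[OF c(5)] _ this c(3) c(9) dx(2)] Bpos
    show ?thesis by (simp add: bz)
  qed
  moreover have "(\<integral>z. \<phi> z * pdx \<theta> z \<partial>lb_on \<Omega>) = (\<integral>z. \<phi> z * pdx \<theta> z \<partial>lb_on ?K)"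
    "(\<integral>z. pdx \<phi> z * \<theta> z \<partial>lb_on \<Omega>) = (\<integral>z. pdx \<phi> z * \<theta> z \<partial>lb_on ?K)"
    using c z by (intro box_integral_\<Omega>; simp)+
  ultimately show "(\<integral>z. \<phi> z * pdx \<theta> z \<partial>lb_on \<Omega>) = - (\<integral>z. pdx \<phi> z * \<theta> z \<partial>lb_on \<Omega>)" by simp
  have J: "Jy (-B) B (pdy \<phi>) w = \<phi> w" if "w \<in> ?K" for w
  proof -
    have "prim (-B) B (\<lambda>t. pdy \<phi> (fst w, t)) (snd w) = \<phi> (fst w, snd w) - \<phi> (fst w, -B)"
      by (rule prim_derivative) (use dy(1) continuous_slice(2)[OF c(7)] that in auto)
    then show ?thesis using bz by (simp add: Jy_def)
  qed
  have Jae: "AE w in lb_on ?K. Jy (-B) B (pdy \<phi>) w = \<phi> w"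
    using AE_lb_on_in[of ?K, OF rect_borel] by eventually_elim (rule J)
  have "(\<integral>z. Jy (-B) B (pdy \<phi>) z * pdy \<theta> z \<partial>lb_on ?K) = - (\<integral>z. pdy \<phi> z * \<theta> z \<partial>lb_on ?K)"
  proof (rule cell_parts_y[OF _ i[OF c(7)] _ _ c(3) c(11) dy(2)])
    show "integrable (lb_on ?K) (Jy (-B) B (pdy \<phi>))"
      by (rule sqi_imp_integrable[OF _ sqi_Jy(1)[OF _ rect_sqi_continuous[OF c(7)]]]) (use Bpos in simp_all)
    have "(\<integral>y. pdy \<phi> (x, y) \<partial>lb_on {-B..B}) = 0" for x
    proof -
      have "(\<integral>y. pdy \<phi> (x, y) \<partial>lb_on {-B..B}) = prim (-B) B (\<lambda>y. pdy \<phi> (x, y)) B"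
        by (rule prim_right[symmetric]) (use borel_slice(1)[OF c(8)] in simp_all)
      also have "\<dots> = \<phi> (x, B) - \<phi> (x, -B)"
        by (rule prim_derivative) (use dy(1) continuous_slice(2)[OF c(7)] Bpos in auto)
      finally show ?thesis using bz by simp
    qed
    then show "AE x in lb_on {-B..B}. (\<integral>y. pdy \<phi> (x, y) \<partial>lb_on {-B..B}) = 0" by simp
  qed (use Bpos in simp)
  moreover have "(\<integral>z. Jy (-B) B (pdy \<phi>) z * pdy \<theta> z \<partial>lb_on ?K) = (\<integral>z. \<phi> z * pdy \<theta> z \<partial>lb_on ?K)"
  proof (rule integral_cong_AE)
    show "AE z in lb_on ?K. Jy (-B) B (pdy \<phi>) z * pdy \<theta> z = \<phi> z * pdy \<theta> z"
      using Jae by eventually_elim simp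
  qed (use c Jy_borel[OF c(8), of "-B" B] in simp_all)
  moreover have "(\<integral>z. \<phi> z * pdy \<theta> z \<partial>lb_on \<Omega>) = (\<integral>z. \<phi> z * pdy \<theta> z \<partial>lb_on ?K)"
    "(\<integral>z. pdy \<phi> z * \<theta> z \<partial>lb_on \<Omega>) = (\<integral>z. pdy \<phi> z * \<theta> z \<partial>lb_on ?K)"
    using c z by (intro box_integral_\<Omega>; simp)+
  ultimately show "(\<integral>z. \<phi> z * pdy \<theta> z \<partial>lb_on \<Omega>) = - (\<integral>z. pdy \<phi> z * \<theta> z \<partial>lb_on \<Omega>)" by simp
qed

text \<open>Symmetry of second derivatives by duality: for tensor products both orders are given by
  one formula, and two integrations by parts transfer this to \<open>\<phi>\<close>. Equality almost
  everywhere suffices under the integral.\<close>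

lemma pd_commute:
  assumes "\<phi> \<in> test_functions \<Omega>"
  shows "AE z in lb_on \<Omega>. pdx (pdy \<phi>) z = pdy (pdx \<phi>) z"
proof (rule tensor_unique)
  note t = test_function_pd[OF assms]
  show "sqi (lb_on \<Omega>) (pdx (pdy \<phi>))" "sqi (lb_on \<Omega>) (pdy (pdx \<phi>))"
    by (intro sqi_test test_function_pd t)+
  fix \<psi>\<^sub>1 \<psi>\<^sub>2 assume s: "smooth \<psi>\<^sub>1" "smooth \<psi>\<^sub>2"
  let ?\<theta> = "\<lambda>z :: real \<times> real. \<psi>\<^sub>1 (fst z) * \<psi>\<^sub>2 (snd z)"
  assume \<theta>: "?\<theta> \<in> test_functions \<Omega>"
  note \<theta>' = test_function_pd[OF \<theta>]
  have c: "pdy (pdx ?\<theta>) = pdx (pdy ?\<theta>)"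
    using s by (simp add: pd_tensor smooth_deriv(2))
  have "(\<integral>z. pdx (pdy \<phi>) z * ?\<theta> z \<partial>lb_on \<Omega>) = (\<integral>z. \<phi> z * pdy (pdx ?\<theta>) z \<partial>lb_on \<Omega>)"
    using test_parts(1)[OF t(2) \<theta>] test_parts(2)[OF assms \<theta>'(1)] by simp
  also have "\<dots> = (\<integral>z. pdy (pdx \<phi>) z * ?\<theta> z \<partial>lb_on \<Omega>)"
    unfolding c using test_parts(2)[OF t(1) \<theta>] test_parts(1)[OF assms \<theta>'(2)] by simp
  finally show "(\<integral>z. pdx (pdy \<phi>) z * ?\<theta> z \<partial>lb_on \<Omega>) = (\<integral>z. pdy (pdx \<phi>) z * ?\<theta> z \<partial>lb_on \<Omega>)" .
qed

end

section \<open>Norms, density of test functions, the exchange of derivatives and Poincare's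
  inequality\<close>

lemma L2_norm_triangle:
  assumes f: "sqi M f" and g: "sqi M g"
  shows "sqrt (\<integral>x. (f x + g x)\<^sup>2 \<partial>M) \<le> sqrt (\<integral>x. (f x)\<^sup>2 \<partial>M) + sqrt (\<integral>x. (g x)\<^sup>2 \<partial>M)"
proof -
  let ?a = "sqrt (\<integral>x. (f x)\<^sup>2 \<partial>M)" and ?b = "sqrt (\<integral>x. (g x)\<^sup>2 \<partial>M)"
  have "(\<integral>x. (f x + g x)\<^sup>2 \<partial>M) = (\<integral>x. (f x)\<^sup>2 + (g x)\<^sup>2 + 2 * (f x * g x) \<partial>M)"
    by (simp add: power2_sum mult.assoc)
  also have "\<dots> = (\<integral>x. (f x)\<^sup>2 \<partial>M) + (\<integral>x. (g x)\<^sup>2 \<partial>M) + 2 * (\<integral>x. f x * g x \<partial>M)"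
    using f g sqi_mult_integrable[OF f g] by (simp add: sqi_def)
  also have "\<dots> \<le> (\<integral>x. (f x)\<^sup>2 \<partial>M) + (\<integral>x. (g x)\<^sup>2 \<partial>M) + 2 * (?a * ?b)"
    using Cauchy_Schwarz_integral_sqrt[OF f g] by linarith
  also have "\<dots> = (?a + ?b)\<^sup>2" by (simp add: power2_sum)
  finally have "(\<integral>x. (f x + g x)\<^sup>2 \<partial>M) \<le> (?a + ?b)\<^sup>2" .
  then have "sqrt (\<integral>x. (f x + g x)\<^sup>2 \<partial>M) \<le> sqrt ((?a + ?b)\<^sup>2)" by (rule real_sqrt_le_mono)
  then show ?thesis by simp
qed

lemma minus_one_power_cancel:
  fixes x y :: real
  assumes "(-1) ^ n * x = - ((-1) ^ n * y)"
  shows "x = - y"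
  using assms by (cases "even n") auto

lemma L2_norm_cong_AE:
  assumes "sqi M f" "sqi M g" "AE x in M. f x = g x"
  shows "(\<integral>x. (f x)\<^sup>2 \<partial>M) = (\<integral>x. (g x)\<^sup>2 \<partial>M)"
proof (rule integral_cong_AE)
  show "AE x in M. (f x)\<^sup>2 = (g x)\<^sup>2" using assms(3) by eventually_elim simp
qed (use assms in \<open>auto simp: sqi_def\<close>)

context sgrid
begin

lemma test_wd:
  assumes "\<phi> \<in> test_functions \<Omega>"
  shows "wd 0 0 \<phi> \<phi>" "wd (Suc 0) 0 \<phi> (pdx \<phi>)" "wd 0 (Suc 0) \<phi> (pdy \<phi>)"
  using test_parts[OF assms] by (auto simp: wd_def)

lemma le_one_cases:
  assumes "i + j \<le> Suc 0"
  obtains "i = 0" "j = 0" | "i = Suc 0" "j = 0" | "i = 0" "j = Suc 0"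
  using assms by (cases i; cases j) auto

lemma test_Hspace:
  assumes "\<phi> \<in> test_functions \<Omega>"
  shows "\<phi> \<in> Hspace 1 \<Omega>"
proof (rule HspaceI[OF sqi_imp_L2[OF \<Omega>_borel sqi_test[OF assms]] sqi_test[OF assms]])
  fix i j :: nat assume "i + j \<le> 1"
  then have "i + j \<le> Suc 0" by simp
  then show "\<exists>g. sqi (lb_on \<Omega>) g \<and> wd i j \<phi> g"
    by (cases rule: le_one_cases) (use test_wd[OF assms] sqi_test[OF assms] sqi_test[OF test_function_pd(1)[OF assms]]
        sqi_test[OF test_function_pd(2)[OF assms]] in blast)+
qed simp

lemma dv_test:
  assumes "\<phi> \<in> test_functions \<Omega>"
  shows "AE z in lb_on \<Omega>. dv 0 0 \<phi> z = \<phi> z" "AE z in lb_on \<Omega>. dv 1 0 \<phi> z = pdx \<phi> z"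
    "AE z in lb_on \<Omega>. dv 0 1 \<phi> z = pdy \<phi> z"
  by (rule dv_eqI[OF test_Hspace[OF assms], where f' = \<phi>];
      use test_wd[OF assms] test_function_continuous(2)[OF assms] sqi_test[OF assms]
        sqi_test[OF test_function_pd(1)[OF assms]] sqi_test[OF test_function_pd(2)[OF assms]] in simp)+

lemma Hnorm_sq:
  assumes "f \<in> Hspace m \<Omega>"
  shows "(Hnorm m \<Omega> f)\<^sup>2 = (\<Sum>(i, j)\<in>{(i, j). i + j \<le> m}. \<integral>z. (dv i j f z)\<^sup>2 \<partial>lb_on \<Omega>)"
proof -
  have "(\<integral>z. (weak_deriv \<Omega> i j f z)\<^sup>2 \<partial>lebesgue_on \<Omega>) = (\<integral>z. (dv i j f z)\<^sup>2 \<partial>lb_on \<Omega>)" if "i + j \<le> m" for i j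
  proof (rule lebesgue_on_integral_cong(1)[OF \<Omega>_borel])
    show "(\<lambda>z. (weak_deriv \<Omega> i j f z)\<^sup>2) \<in> borel_measurable (lebesgue_on \<Omega>)"
      using L2_measurable[OF weak_deriv_L2(1)[OF assms that]] by simp
    show "(\<lambda>z. (dv i j f z)\<^sup>2) \<in> borel_measurable borel" using sqi_borel[OF dv_sqi(1)[OF assms that]] by simp
    show "AE z in lb_on \<Omega>. (weak_deriv \<Omega> i j f z)\<^sup>2 = (dv i j f z)\<^sup>2"
      using dv_sqi(2)[OF assms that] by eventually_elim simp
  qed
  then have "(\<Sum>(i, j)\<in>{(i, j). i + j \<le> m}. \<integral>z. (weak_deriv \<Omega> i j f z)\<^sup>2 \<partial>lebesgue_on \<Omega>)
    = (\<Sum>(i, j)\<in>{(i, j). i + j \<le> m}. \<integral>z. (dv i j f z)\<^sup>2 \<partial>lb_on \<Omega>)"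
    by (intro sum.cong) auto
  moreover have "0 \<le> (\<Sum>(i, j)\<in>{(i, j). i + j \<le> m}. \<integral>z. (weak_deriv \<Omega> i j f z)\<^sup>2 \<partial>lebesgue_on \<Omega>)"
    by (intro sum_nonneg) auto
  ultimately show ?thesis by (simp add: Hnorm_def)
qed

lemma Hnorm_nonneg: "0 \<le> Hnorm m \<Omega> f"
  unfolding Hnorm_def by (intro real_sqrt_ge_zero sum_nonneg) auto

lemma dv_le_Hnorm:
  assumes "f \<in> Hspace m \<Omega>" "i + j \<le> m"
  shows "sqrt (\<integral>z. (dv i j f z)\<^sup>2 \<partial>lb_on \<Omega>) \<le> Hnorm m \<Omega> f"
proof -
  have "finite {(i, j). i + j \<le> m}"
    by (rule finite_subset[of _ "{..m} \<times> {..m}"]) auto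
  then have "(\<integral>z. (dv i j f z)\<^sup>2 \<partial>lb_on \<Omega>) \<le> (Hnorm m \<Omega> f)\<^sup>2"
    unfolding Hnorm_sq[OF assms(1)]
    using member_le_sum[of "(i, j)" "{(i, j). i + j \<le> m}" "\<lambda>(i, j). \<integral>z. (dv i j f z)\<^sup>2 \<partial>lb_on \<Omega>"] assms(2)
    by auto
  then show ?thesis using Hnorm_nonneg by (intro real_le_lsqrt) auto
qed

lemma Hnorm_1_sq:
  assumes "f \<in> Hspace 1 \<Omega>"
  shows "(Hnorm 1 \<Omega> f)\<^sup>2 = (\<integral>z. (dv 0 0 f z)\<^sup>2 \<partial>lb_on \<Omega>) + (\<integral>z. (dv 1 0 f z)\<^sup>2 \<partial>lb_on \<Omega>) + (\<integral>z. (dv 0 1 f z)\<^sup>2 \<partial>lb_on \<Omega>)"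
proof -
  have "{(i, j). i + j \<le> (1 :: nat)} = {(0, 0), (1, 0), (0, 1)}" by (auto simp: le_Suc_eq)
  then show ?thesis unfolding Hnorm_sq[OF assms] by simp
qed

lemma H1_0_Hspace: "v \<in> H1_0 \<Omega> \<Longrightarrow> v \<in> Hspace 1 \<Omega>"
  by (simp add: H1_0_def)

text \<open>The approximation in the definition of \<open>H1_0\<close> as three estimates in
  \<open>L2\<close> with classical derivatives of the test function.\<close>

lemma H1_0_approx:
  assumes v: "v \<in> H1_0 \<Omega>" and e: "0 < e"
  obtains \<phi> where "\<phi> \<in> test_functions \<Omega>"
    "sqrt (\<integral>z. (dv 0 0 v z - \<phi> z)\<^sup>2 \<partial>lb_on \<Omega>) \<le> e"
    "sqrt (\<integral>z. (dv 1 0 v z - pdx \<phi> z)\<^sup>2 \<partial>lb_on \<Omega>) \<le> e"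
    "sqrt (\<integral>z. (dv 0 1 v z - pdy \<phi> z)\<^sup>2 \<partial>lb_on \<Omega>) \<le> e"
proof -
  obtain \<phi> where \<phi>: "\<phi> \<in> test_functions \<Omega>" "Hnorm 1 \<Omega> (\<lambda>z. v z - \<phi> z) < e"
    using v e by (auto simp: H1_0_def)
  have vH: "v \<in> Hspace 1 \<Omega>" by (rule H1_0_Hspace[OF v])
  note \<phi>H = test_Hspace[OF \<phi>(1)]
  note dH = Hspace_diff(1)[OF vH \<phi>H]
  have key: "sqrt (\<integral>z. (dv i j v z - P z)\<^sup>2 \<partial>lb_on \<Omega>) \<le> e"
    if ij: "i + j \<le> 1" and P: "sqi (lb_on \<Omega>) P" "AE z in lb_on \<Omega>. dv i j \<phi> z = P z" for i j P
  proof -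
    have "AE z in lb_on \<Omega>. dv i j v z - P z = dv i j (\<lambda>z. v z - \<phi> z) z"
      using Hspace_diff(2)[OF vH \<phi>H ij] P(2) by eventually_elim simp
    from L2_norm_cong_AE[OF sqi_diff[OF dv_sqi(1)[OF vH ij] P(1)] dv_sqi(1)[OF dH ij] this]
    have "sqrt (\<integral>z. (dv i j v z - P z)\<^sup>2 \<partial>lb_on \<Omega>) \<le> Hnorm 1 \<Omega> (\<lambda>z. v z - \<phi> z)"
      using dv_le_Hnorm[OF dH ij] by simp
    then show ?thesis using \<phi>(2) by simp
  qed
  show ?thesis
    by (rule that[OF \<phi>(1)]; rule key; use dv_test[OF \<phi>(1)] sqi_test[OF \<phi>(1)] sqi_test[OF test_function_pd(1)[OF \<phi>(1)]]
        sqi_test[OF test_function_pd(2)[OF \<phi>(1)]] in simp)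
qed

text \<open>A substitute for the triangle inequality with constant 2, which suffices for differences
  in \<open>H1_0\<close>.\<close>

lemma Hnorm_1_diff_le:
  assumes "f \<in> Hspace 1 \<Omega>" "g \<in> Hspace 1 \<Omega>"
  shows "(Hnorm 1 \<Omega> (\<lambda>z. f z - g z))\<^sup>2 \<le> 2 * (Hnorm 1 \<Omega> f)\<^sup>2 + 2 * (Hnorm 1 \<Omega> g)\<^sup>2"
proof -
  have "(\<integral>z. (dv i j (\<lambda>z. f z - g z) z)\<^sup>2 \<partial>lb_on \<Omega>) \<le> 2 * (\<integral>z. (dv i j f z)\<^sup>2 \<partial>lb_on \<Omega>) + 2 * (\<integral>z. (dv i j g z)\<^sup>2 \<partial>lb_on \<Omega>)"
    if ij: "i + j \<le> 1" for i j
  proof -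
    note s = dv_sqi(1)[OF assms(1) ij] dv_sqi(1)[OF assms(2) ij] dv_sqi(1)[OF Hspace_diff(1)[OF assms] ij]
    have "(\<integral>z. (dv i j (\<lambda>z. f z - g z) z)\<^sup>2 \<partial>lb_on \<Omega>) \<le> (\<integral>z. 2 * (dv i j f z)\<^sup>2 + 2 * (dv i j g z)\<^sup>2 \<partial>lb_on \<Omega>)"
    proof (rule integral_mono_AE)
      show "AE z in lb_on \<Omega>. (dv i j (\<lambda>z. f z - g z) z)\<^sup>2 \<le> 2 * (dv i j f z)\<^sup>2 + 2 * (dv i j g z)\<^sup>2"
        using Hspace_diff(2)[OF assms ij]
      proof eventually_elim
        case (elim z)
        have "0 \<le> (dv i j f z + dv i j g z)\<^sup>2" by simp
        then show ?case unfolding elim by (simp add: power2_eq_square algebra_simps)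
      qed
    qed (use s in \<open>simp_all add: sqi_def\<close>)
    also have "\<dots> = 2 * (\<integral>z. (dv i j f z)\<^sup>2 \<partial>lb_on \<Omega>) + 2 * (\<integral>z. (dv i j g z)\<^sup>2 \<partial>lb_on \<Omega>)"
      using s by (simp add: sqi_def)
    finally show ?thesis .
  qed
  from this[of 0 0] this[of 1 0] this[of 0 1] show ?thesis
    unfolding Hnorm_1_sq[OF Hspace_diff(1)[OF assms]] Hnorm_1_sq[OF assms(1)] Hnorm_1_sq[OF assms(2)] by simp
qed

lemma H1_0_diff:
  assumes "v \<in> H1_0 \<Omega>" "w \<in> H1_0 \<Omega>"
  shows "(\<lambda>z. v z - w z) \<in> H1_0 \<Omega>"
proof -
  note vH = H1_0_Hspace[OF assms(1)] and wH = H1_0_Hspace[OF assms(2)]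
  have "\<exists>\<eta>\<in>test_functions \<Omega>. Hnorm 1 \<Omega> (\<lambda>z. v z - w z - \<eta> z) < e" if "e > 0" for e
  proof -
    obtain \<phi> where \<phi>: "\<phi> \<in> test_functions \<Omega>" "Hnorm 1 \<Omega> (\<lambda>z. v z - \<phi> z) < e / 3"
      using assms(1) \<open>e > 0\<close> unfolding H1_0_def by (auto dest!: spec[of _ "e / 3"])
    obtain \<theta> where \<theta>: "\<theta> \<in> test_functions \<Omega>" "Hnorm 1 \<Omega> (\<lambda>z. w z - \<theta> z) < e / 3"
      using assms(2) \<open>e > 0\<close> unfolding H1_0_def by (auto dest!: spec[of _ "e / 3"])
    note f = Hspace_diff(1)[OF vH test_Hspace[OF \<phi>(1)]] and g = Hspace_diff(1)[OF wH test_Hspace[OF \<theta>(1)]]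
    have eq: "(\<lambda>z. v z - w z - (\<phi> z - \<theta> z)) = (\<lambda>z. (v z - \<phi> z) - (w z - \<theta> z))" by auto
    have "(Hnorm 1 \<Omega> (\<lambda>z. v z - w z - (\<phi> z - \<theta> z)))\<^sup>2 \<le> 2 * (Hnorm 1 \<Omega> (\<lambda>z. v z - \<phi> z))\<^sup>2 + 2 * (Hnorm 1 \<Omega> (\<lambda>z. w z - \<theta> z))\<^sup>2"
      unfolding eq by (rule Hnorm_1_diff_le[OF f g])
    also have "\<dots> \<le> 2 * (e / 3)\<^sup>2 + 2 * (e / 3)\<^sup>2"
      using \<phi>(2) \<theta>(2) Hnorm_nonneg by (intro add_mono mult_left_mono power_mono) (auto intro: less_imp_le)
    \<comment> \<open>With errors below \<open>e / 3\<close> the sum is four ninths of the square of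
      \<open>e\<close>.\<close>
    also have "\<dots> < e\<^sup>2" using \<open>e > 0\<close> by (simp add: power2_eq_square)
    finally have "Hnorm 1 \<Omega> (\<lambda>z. v z - w z - (\<phi> z - \<theta> z)) < e"
      using \<open>e > 0\<close> by (meson less_imp_le power2_less_imp_less)
    then show ?thesis using test_function_diff[OF \<phi>(1) \<theta>(1)] by (intro bexI[of _ "\<lambda>z. \<phi> z - \<theta> z"])
  qed
  then show ?thesis unfolding H1_0_def using Hspace_diff(1)[OF vH wH] by simp
qed

text \<open>For a test function both sides equal minus the integral of \<open>Z\<close> against the
  mixed derivative; density extends this to \<open>H1_0\<close>. It trades the
  \<open>x\<close>-derivative of \<open>v\<close> for its \<open>y\<close>-derivative without
  boundary terms.\<close>

lemma curl_identity:
  assumes v: "v \<in> H1_0 \<Omega>" and Z: "sqi (lb_on \<Omega>) Z" "sqi (lb_on \<Omega>) Z\<^sub>1" "sqi (lb_on \<Omega>) Z\<^sub>2"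
    and x: "\<And>\<phi>. \<phi> \<in> test_functions \<Omega> \<Longrightarrow> (\<integral>z. Z z * pdx \<phi> z \<partial>lb_on \<Omega>) = - (\<integral>z. Z\<^sub>1 z * \<phi> z \<partial>lb_on \<Omega>)"
    and y: "\<And>\<phi>. \<phi> \<in> test_functions \<Omega> \<Longrightarrow> (\<integral>z. Z z * pdy \<phi> z \<partial>lb_on \<Omega>) = - (\<integral>z. Z\<^sub>2 z * \<phi> z \<partial>lb_on \<Omega>)"
  shows "(\<integral>z. Z\<^sub>2 z * dv 1 0 v z \<partial>lb_on \<Omega>) = (\<integral>z. Z\<^sub>1 z * dv 0 1 v z \<partial>lb_on \<Omega>)"
proof -
  let ?n = "\<lambda>f. sqrt (\<integral>z. (f z)\<^sup>2 \<partial>lb_on \<Omega>)"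
  let ?d = "(\<integral>z. Z\<^sub>2 z * dv 1 0 v z \<partial>lb_on \<Omega>) - (\<integral>z. Z\<^sub>1 z * dv 0 1 v z \<partial>lb_on \<Omega>)"
  note vH = H1_0_Hspace[OF v]
  have vx: "sqi (lb_on \<Omega>) (dv 1 0 v)" and vy: "sqi (lb_on \<Omega>) (dv 0 1 v)" by (rule dv_sqi(1)[OF vH]; simp)+
  have "\<bar>?d\<bar> \<le> 0 + e" if "e > 0" for e
  proof -
    \<comment> \<open>The added 1 keeps the denominator positive when both norms vanish.\<close>
    define e' where "e' = e / (?n Z\<^sub>2 + ?n Z\<^sub>1 + 1)"
    have nn: "0 \<le> ?n f" for f by simp
    have pos: "0 < ?n Z\<^sub>2 + ?n Z\<^sub>1 + 1" using nn[of Z\<^sub>1] nn[of Z\<^sub>2] by linarith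
    have e': "0 < e'" using pos \<open>e > 0\<close> by (simp add: e'_def)
    obtain \<phi> where app: "\<phi> \<in> test_functions \<Omega>" "?n (\<lambda>z. dv 0 0 v z - \<phi> z) \<le> e'"
      "?n (\<lambda>z. dv 1 0 v z - pdx \<phi> z) \<le> e'" "?n (\<lambda>z. dv 0 1 v z - pdy \<phi> z) \<le> e'"
      by (rule H1_0_approx[OF v e'])
    note \<phi> = app(1,3,4)
    note t = test_function_pd[OF \<phi>(1)]
    note tx = sqi_test[OF t(1)] and ty = sqi_test[OF t(2)]
    have "(\<integral>z. Z z * pdy (pdx \<phi>) z \<partial>lb_on \<Omega>) = (\<integral>z. Z z * pdx (pdy \<phi>) z \<partial>lb_on \<Omega>)"
    proof (rule integral_cong_AE)
      show "AE z in lb_on \<Omega>. Z z * pdy (pdx \<phi>) z = Z z * pdx (pdy \<phi>) z"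
        using pd_commute[OF \<phi>(1)] by eventually_elim simp
    qed (use sqi_borel[OF Z(1)] test_function_continuous(2)[OF test_function_pd(2)[OF t(1)]]
        test_function_continuous(2)[OF test_function_pd(1)[OF t(2)]] in simp_all)
    then have eq: "(\<integral>z. Z\<^sub>2 z * pdx \<phi> z \<partial>lb_on \<Omega>) = (\<integral>z. Z\<^sub>1 z * pdy \<phi> z \<partial>lb_on \<Omega>)"
      using x[OF t(2)] y[OF t(1)] by simp
    have "?d = (\<integral>z. Z\<^sub>2 z * (dv 1 0 v z - pdx \<phi> z) \<partial>lb_on \<Omega>) - (\<integral>z. Z\<^sub>1 z * (dv 0 1 v z - pdy \<phi> z) \<partial>lb_on \<Omega>)"
      using sqi_mult_integrable[OF Z(3) vx] sqi_mult_integrable[OF Z(3) tx]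
        sqi_mult_integrable[OF Z(2) vy] sqi_mult_integrable[OF Z(2) ty] eq
      by (simp add: right_diff_distrib)
    moreover have "\<bar>\<integral>z. Z\<^sub>2 z * (dv 1 0 v z - pdx \<phi> z) \<partial>lb_on \<Omega>\<bar> \<le> ?n Z\<^sub>2 * e'"
      using Cauchy_Schwarz_integral_sqrt[OF Z(3) sqi_diff[OF vx tx]] mult_left_mono[OF \<phi>(2) nn[of Z\<^sub>2]] by linarith
    moreover have "\<bar>\<integral>z. Z\<^sub>1 z * (dv 0 1 v z - pdy \<phi> z) \<partial>lb_on \<Omega>\<bar> \<le> ?n Z\<^sub>1 * e'"
      using Cauchy_Schwarz_integral_sqrt[OF Z(2) sqi_diff[OF vy ty]] mult_left_mono[OF \<phi>(3) nn[of Z\<^sub>1]] by linarith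
    ultimately have "\<bar>?d\<bar> \<le> ?n Z\<^sub>2 * e' + ?n Z\<^sub>1 * e'" by linarith
    also have "\<dots> \<le> (?n Z\<^sub>2 + ?n Z\<^sub>1 + 1) * e'" using e' by (simp add: algebra_simps)
    also have "\<dots> = e" using pos by (simp add: e'_def)
    finally show ?thesis by simp
  qed
  then have "\<bar>?d\<bar> \<le> 0" by (rule field_le_epsilon)
  then show ?thesis by simp
qed

text \<open>A test function is the primitive in \<open>y\<close> of its derivative from the bottom
  of the square, over an interval of length \<open>2 * B\<close>; density does the rest.\<close>

lemma poincare:
  assumes v: "v \<in> H1_0 \<Omega>"
  shows "sqrt (\<integral>z. (dv 0 0 v z)\<^sup>2 \<partial>lb_on \<Omega>) \<le> 2 * B * sqrt (\<integral>z. (dv 0 1 v z)\<^sup>2 \<partial>lb_on \<Omega>)"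
proof (rule field_le_epsilon)
  let ?n = "\<lambda>f. sqrt (\<integral>z. (f z)\<^sup>2 \<partial>lb_on \<Omega>)"
  let ?K = "{-B..B} \<times> {-B..B}"
  note vH = H1_0_Hspace[OF v]
  have v0: "sqi (lb_on \<Omega>) (dv 0 0 v)" and vy: "sqi (lb_on \<Omega>) (dv 0 1 v)" by (rule dv_sqi(1)[OF vH]; simp)+
  fix e :: real assume "e > 0"
  \<comment> \<open>One \<open>e'\<close> for the error of the function and \<open>2 * B\<close>
    times \<open>e'\<close> for that of the derivative add up to \<open>e\<close>.\<close>
  define e' where "e' = e / (1 + 2 * B)"
  have e': "0 < e'" using \<open>e > 0\<close> Bpos by (simp add: e'_def)
    obtain \<phi> where app: "\<phi> \<in> test_functions \<Omega>" "?n (\<lambda>z. dv 0 0 v z - \<phi> z) \<le> e'"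
      "?n (\<lambda>z. dv 1 0 v z - pdx \<phi> z) \<le> e'" "?n (\<lambda>z. dv 0 1 v z - pdy \<phi> z) \<le> e'"
      by (rule H1_0_approx[OF v e'])
    note \<phi> = app(1,2,4)
  note t = test_function_pd(2)[OF \<phi>(1)]
  note c = test_function_continuous[OF \<phi>(1)] test_function_continuous[OF t]
  note s = sqi_test[OF \<phi>(1)] sqi_test[OF t]
  have C: "Ck (Suc 0) \<phi>" using \<phi>(1) by (auto simp: test_functions_def simp del: Ck.simps)
  have "(\<integral>z. (\<phi> z)\<^sup>2 \<partial>lb_on \<Omega>) = (\<integral>z. (\<phi> z)\<^sup>2 \<partial>lb_on ?K)"
    by (rule box_integral_\<Omega>) (use c test_function_zero[OF \<phi>(1)] in simp_all)
  also have "\<dots> = (\<integral>z. (Jy (-B) B (pdy \<phi>) z)\<^sup>2 \<partial>lb_on ?K)"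
  proof (rule L2_norm_cong_AE[OF rect_sqi_continuous[OF c(1)] sqi_Jy(1)[OF _ rect_sqi_continuous[OF c(3)]]])
    show "AE z in lb_on ?K. \<phi> z = Jy (-B) B (pdy \<phi>) z"
      using AE_lb_on_in[of ?K, OF rect_borel]
    proof eventually_elim
      case (elim z)
      have "prim (-B) B (\<lambda>t. pdy \<phi> (fst z, t)) (snd z) = \<phi> (fst z, snd z) - \<phi> (fst z, -B)"
        by (rule prim_derivative) (use pdy_DERIV[OF C] continuous_slice(2)[OF c(3)] elim in auto)
      moreover have "\<phi> (fst z, -B) = 0" by (rule test_function_zero[OF \<phi>(1)]) (use bnd in auto)
      ultimately show ?case by (simp add: Jy_def)
    qed
  qed (use Bpos in simp)
  also have "\<dots> \<le> (B - (-B))\<^sup>2 * (\<integral>z. (pdy \<phi> z)\<^sup>2 \<partial>lb_on ?K)"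
    by (rule sqi_Jy(2)[OF _ rect_sqi_continuous[OF c(3)]]) (use Bpos in simp)
  also have "(\<integral>z. (pdy \<phi> z)\<^sup>2 \<partial>lb_on ?K) = (\<integral>z. (pdy \<phi> z)\<^sup>2 \<partial>lb_on \<Omega>)"
    by (rule box_integral_\<Omega>[symmetric]) (use c test_function_zero[OF t] in simp_all)
  finally have "?n \<phi> \<le> sqrt ((2 * B)\<^sup>2 * (\<integral>z. (pdy \<phi> z)\<^sup>2 \<partial>lb_on \<Omega>))"
    by (intro real_sqrt_le_mono) simp
  also have "\<dots> = 2 * B * ?n (pdy \<phi>)" using Bpos by (simp add: real_sqrt_mult)
  finally have 1: "?n \<phi> \<le> 2 * B * ?n (pdy \<phi>)" .
  have "?n (dv 0 0 v) \<le> ?n (\<lambda>z. dv 0 0 v z - \<phi> z) + ?n \<phi>"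
    using L2_norm_triangle[OF sqi_diff[OF v0 s(1)] s(1)] by simp
  moreover have "?n (pdy \<phi>) \<le> ?n (\<lambda>z. pdy \<phi> z - dv 0 1 v z) + ?n (dv 0 1 v)"
    using L2_norm_triangle[OF sqi_diff[OF s(2) vy] vy] by simp
  moreover have "?n (\<lambda>z. pdy \<phi> z - dv 0 1 v z) = ?n (\<lambda>z. dv 0 1 v z - pdy \<phi> z)"
    by (simp add: power2_commute)
  ultimately have 2: "?n (dv 0 0 v) \<le> e' + ?n \<phi>" and "?n (pdy \<phi>) \<le> e' + ?n (dv 0 1 v)" using \<phi>(2,3) by linarith+
  then have "2 * B * ?n (pdy \<phi>) \<le> 2 * B * (e' + ?n (dv 0 1 v))" using Bpos by (intro mult_left_mono) auto
  then have "?n (dv 0 0 v) \<le> e' + 2 * B * (e' + ?n (dv 0 1 v))" using 1 2 by linarith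
  also have "\<dots> = 2 * B * ?n (dv 0 1 v) + e' * (1 + 2 * B)" by (simp add: algebra_simps)
  also have "e' * (1 + 2 * B) = e" using Bpos by (simp add: e'_def)
  finally show "?n (dv 0 0 v) \<le> 2 * B * ?n (dv 0 1 v) + e" .
qed

text \<open>Testing with \<open>deriv \<psi>\<^sub>1\<close> and with \<open>\<psi>\<^sub>1\<close>
  leads to the same iterated derivative on \<open>f\<close>, with signs that differ by one factor
  -1. The box may cross edges of the grid as long as its interior lies in the domain.\<close>

lemma dv_acx:
  assumes f: "f \<in> Hspace m \<Omega>" and ij: "Suc i + j \<le> m" and ab: "a < b" and s: "ocell (a, b, c, d) \<subseteq> \<Omega>"
  shows "acx a b c d (dv i j f) (dv (Suc i) j f)"
proof (rule acxI[OF ab])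
  have ij': "i + j \<le> m" using ij by simp
  note q = dv_sqi(1)[OF f ij'] dv_sqi(1)[OF f ij] dv_sqi(1)[OF f, of 0 0, simplified]
  show "integrable (lb_on ({a..b} \<times> {c..d})) (dv i j f)" "integrable (lb_on ({a..b} \<times> {c..d})) (dv (Suc i) j f)"
    by (intro subbox_integrable[OF s] q)+
  fix \<psi>\<^sub>1 \<psi>\<^sub>2 assume t: "test1 a b \<psi>\<^sub>1" "test1 c d \<psi>\<^sub>2"
  have "(-1) ^ (i + j) * (\<integral>z. dv i j f z * (deriv \<psi>\<^sub>1 (fst z) * \<psi>\<^sub>2 (snd z)) \<partial>lb_on ({a..b} \<times> {c..d})) =
      - ((-1) ^ (i + j) * (\<integral>z. dv (Suc i) j f z * (\<psi>\<^sub>1 (fst z) * \<psi>\<^sub>2 (snd z)) \<partial>lb_on ({a..b} \<times> {c..d})))"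
    using wd_tensor[OF wd_dv[OF f ij'] s sqi_borel[OF q(3)] sqi_borel[OF q(1)] test1_deriv[OF t(1)] t(2)]
      wd_tensor[OF wd_dv[OF f ij] s sqi_borel[OF q(3)] sqi_borel[OF q(2)] t]
    by (simp add: funpow_swap1)
  then show "(\<integral>z. dv i j f z * (deriv \<psi>\<^sub>1 (fst z) * \<psi>\<^sub>2 (snd z)) \<partial>lb_on ({a..b} \<times> {c..d})) =
      - (\<integral>z. dv (Suc i) j f z * (\<psi>\<^sub>1 (fst z) * \<psi>\<^sub>2 (snd z)) \<partial>lb_on ({a..b} \<times> {c..d}))"
    by (rule minus_one_power_cancel)
qed

lemma dv_acy:
  assumes f: "f \<in> Hspace m \<Omega>" and ij: "i + Suc j \<le> m" and cd: "c < d" and s: "ocell (a, b, c, d) \<subseteq> \<Omega>"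
  shows "acy a b c d (dv i j f) (dv i (Suc j) f)"
  unfolding acy_iff_acx
proof (rule acxI[OF cd])
  have ij': "i + j \<le> m" using ij by simp
  note q = dv_sqi(1)[OF f ij'] dv_sqi(1)[OF f ij] dv_sqi(1)[OF f, of 0 0, simplified]
  show "integrable (lb_on ({c..d} \<times> {a..b})) (\<lambda>z. dv i j f (snd z, fst z))"
    "integrable (lb_on ({c..d} \<times> {a..b})) (\<lambda>z. dv i (Suc j) f (snd z, fst z))"
    unfolding rect_integrable_swap by (intro subbox_integrable[OF s] q)+
  fix \<psi>\<^sub>1 \<psi>\<^sub>2 assume t: "test1 c d \<psi>\<^sub>1" "test1 a b \<psi>\<^sub>2"
  have sw: "(\<integral>z. F (snd z, fst z) * (\<alpha> (fst z) * \<beta> (snd z)) \<partial>lb_on ({c..d} \<times> {a..b}))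
      = (\<integral>z. F z * (\<beta> (fst z) * \<alpha> (snd z)) \<partial>lb_on ({a..b} \<times> {c..d}))"
    if "F \<in> borel_measurable borel" "\<alpha> \<in> borel_measurable borel" "\<beta> \<in> borel_measurable borel" for F :: sfield and \<alpha> \<beta>
  proof -
    have "(\<lambda>z. F z * (\<beta> (fst z) * \<alpha> (snd z))) \<in> borel_measurable borel"
      using that borel_fst_snd by (intro borel_measurable_times) auto
    from rect_integral_swap[OF this, of c d a b] show ?thesis by (simp add: mult.commute[of "\<beta> _"])
  qed
  have m: "\<psi>\<^sub>1 \<in> borel_measurable borel" "\<psi>\<^sub>2 \<in> borel_measurable borel" "deriv \<psi>\<^sub>1 \<in> borel_measurable borel"
    using t test1_deriv[OF t(1)] smooth_borel by (auto simp: test1_def)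
  have "(-1) ^ (i + j) * (\<integral>z. dv i j f z * (\<psi>\<^sub>2 (fst z) * deriv \<psi>\<^sub>1 (snd z)) \<partial>lb_on ({a..b} \<times> {c..d})) =
      - ((-1) ^ (i + j) * (\<integral>z. dv i (Suc j) f z * (\<psi>\<^sub>2 (fst z) * \<psi>\<^sub>1 (snd z)) \<partial>lb_on ({a..b} \<times> {c..d})))"
    using wd_tensor[OF wd_dv[OF f ij'] s sqi_borel[OF q(3)] sqi_borel[OF q(1)] t(2) test1_deriv[OF t(1)]]
      wd_tensor[OF wd_dv[OF f ij] s sqi_borel[OF q(3)] sqi_borel[OF q(2)] t(2,1)]
    by (simp add: funpow_swap1)
  then show "(\<integral>z. dv i j f (snd z, fst z) * (deriv \<psi>\<^sub>1 (fst z) * \<psi>\<^sub>2 (snd z)) \<partial>lb_on ({c..d} \<times> {a..b})) =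
      - (\<integral>z. dv i (Suc j) f (snd z, fst z) * (\<psi>\<^sub>1 (fst z) * \<psi>\<^sub>2 (snd z)) \<partial>lb_on ({c..d} \<times> {a..b}))"
    unfolding sw[OF sqi_borel[OF q(1)] m(3,2)] sw[OF sqi_borel[OF q(2)] m(1,2)]
    by (rule minus_one_power_cancel)
qed

end

lemma smooth_parts_x:
  fixes f f' :: sfield
  assumes ab: "a < b" and f: "continuous_on UNIV f" "continuous_on UNIV f'" "\<And>x y. ((\<lambda>t. f (t, y)) has_real_derivative f' (x, y)) (at x)"
    and t: "test1 a b \<psi>\<^sub>1" "test1 c d \<psi>\<^sub>2"
  shows "(\<integral>z. f z * (deriv \<psi>\<^sub>1 (fst z) * \<psi>\<^sub>2 (snd z)) \<partial>lb_on ({a..b} \<times> {c..d}))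
    = - (\<integral>z. f' z * (\<psi>\<^sub>1 (fst z) * \<psi>\<^sub>2 (snd z)) \<partial>lb_on ({a..b} \<times> {c..d}))"
proof -
  let ?\<phi> = "\<lambda>z. \<psi>\<^sub>1 (fst z) * \<psi>\<^sub>2 (snd z)" and ?\<phi>x = "\<lambda>z. deriv \<psi>\<^sub>1 (fst z) * \<psi>\<^sub>2 (snd z)"
  have s: "smooth \<psi>\<^sub>1" "smooth \<psi>\<^sub>2" using t by (auto simp: test1_def)
  note C = Ck_tensor[OF s, of "Suc 0"]
  have c: "continuous_on UNIV ?\<phi>" "continuous_on UNIV ?\<phi>x"
    by (rule Ck_continuous[OF Ck_tensor]; use s smooth_deriv(2) in blast)+
  have d: "((\<lambda>t. ?\<phi> (t, y)) has_real_derivative ?\<phi>x (x, y)) (at x)" for x y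
    using pdx_DERIV[OF C, of y x] by (simp add: pd_tensor[OF s])
  obtain A where A: "integrable (lb_on {c..d}) A" "AE z in lb_on ({a..b} \<times> {c..d}). f z = A (snd z) + prim a b (\<lambda>t. f' (t, snd z)) (fst z)"
    using acx_smooth[OF f, of a b c d] by (auto simp: acx_def)
  have i: "integrable (lb_on ({a..b} \<times> {c..d})) F" if "continuous_on UNIV F" for F :: sfield
    by (rule sqi_imp_integrable[OF _ rect_sqi_continuous[OF that]]) simp
  have "(\<integral>z. f z * ?\<phi>x z \<partial>lb_on ({a..b} \<times> {c..d})) + (\<integral>z. f' z * ?\<phi> z \<partial>lb_on ({a..b} \<times> {c..d})) = 0"
    using cell_parts_x[OF ab i[OF f(1)] i[OF f(2)] A c d] test1_zero[OF t(1), of a] test1_zero[OF t(1), of b] by simp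
  then show ?thesis by linarith
qed

context sgrid
begin

text \<open>A finite element function is a polynomial on a cell only up to a null set; uniqueness
  there identifies the global weak derivative with the classical one.\<close>

lemma dv_local_x:
  assumes v: "v \<in> Hspace 1 \<Omega>" and q: "(a, b, c, d) \<in> Q"
    and loc: "AE z in lb_on ({a..b} \<times> {c..d}). v z = qpol (Suc m) l cf z"
  shows "AE z in lb_on ({a..b} \<times> {c..d}). dv 1 0 v z = qpol m l (dxc cf) z"
proof -
  let ?M = "lb_on ({a..b} \<times> {c..d})"
  note s = sub[OF q]
  have d0: "sqi (lb_on \<Omega>) (dv 0 0 v)" and d1: "sqi (lb_on \<Omega>) (dv 1 0 v)" by (rule dv_sqi(1)[OF v]; simp)+
  have ae: "AE z in ?M. dv 0 0 v z = qpol (Suc m) l cf z"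
  proof -
    have "AE z in ?M. v z = dv 0 0 v z" using bspec[OF AE_grid[THEN iffD1, OF dv_00[OF v]] q] unfolding cell.simps .
    with loc show ?thesis by eventually_elim simp
  qed
  have qi: "integrable ?M (qpol m l (dxc cf))"
    by (rule sqi_imp_integrable[OF _ rect_sqi_continuous[OF qpol_continuous]]) simp
  have "AE z in ?M. dv 1 0 v z - qpol m l (dxc cf) z = 0"
  proof (rule fundamental_lemma)
    show "integrable ?M (\<lambda>z. dv 1 0 v z - qpol m l (dxc cf) z)" using subbox_integrable[OF s d1] qi by simp
    fix \<psi>\<^sub>1 \<psi>\<^sub>2 assume t: "test1 a b \<psi>\<^sub>1" "test1 c d \<psi>\<^sub>2"
    have m: "\<psi>\<^sub>2 \<in> borel_measurable borel" "deriv \<psi>\<^sub>1 \<in> borel_measurable borel"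
      using t test1_deriv[OF t(1)] smooth_borel by (auto simp: test1_def)
    have "(\<integral>z. dv 1 0 v z * (\<psi>\<^sub>1 (fst z) * \<psi>\<^sub>2 (snd z)) \<partial>?M) = - (\<integral>z. dv 0 0 v z * (deriv \<psi>\<^sub>1 (fst z) * \<psi>\<^sub>2 (snd z)) \<partial>?M)"
      using wd_tensor[OF wd_dv[OF v, of "Suc 0" 0] s sqi_borel[OF d0] sqi_borel[OF d1[simplified]] t] by simp
    also have "(\<integral>z. dv 0 0 v z * (deriv \<psi>\<^sub>1 (fst z) * \<psi>\<^sub>2 (snd z)) \<partial>?M)
      = (\<integral>z. qpol (Suc m) l cf z * (deriv \<psi>\<^sub>1 (fst z) * \<psi>\<^sub>2 (snd z)) \<partial>?M)"
    proof (rule integral_cong_AE)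
      show "AE z in ?M. dv 0 0 v z * (deriv \<psi>\<^sub>1 (fst z) * \<psi>\<^sub>2 (snd z)) = qpol (Suc m) l cf z * (deriv \<psi>\<^sub>1 (fst z) * \<psi>\<^sub>2 (snd z))"
        using ae by eventually_elim simp
    qed (use sqi_borel[OF d0] borel_fst_snd(2)[OF m(1)] borel_fst_snd(1)[OF m(2)] in simp_all)
    also have "\<dots> = - (\<integral>z. qpol m l (dxc cf) z * (\<psi>\<^sub>1 (fst z) * \<psi>\<^sub>2 (snd z)) \<partial>?M)"
      by (rule smooth_parts_x[OF _ qpol_continuous qpol_continuous qpol_dx t]) (use pos[OF q] in simp)
    finally show "(\<integral>z. (dv 1 0 v z - qpol m l (dxc cf) z) * (\<psi>\<^sub>1 (fst z) * \<psi>\<^sub>2 (snd z)) \<partial>?M) = 0"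
      using test1_tensor_integrable[OF subbox_integrable[OF s d1] t] test1_tensor_integrable[OF qi t]
      by (simp add: left_diff_distrib)
  qed
  then show ?thesis by eventually_elim simp
qed

end

context sgrid
begin

lemma dv_local_y:
  assumes v: "v \<in> Hspace 1 \<Omega>" and q: "(a, b, c, d) \<in> Q"
    and loc: "AE z in lb_on ({a..b} \<times> {c..d}). v z = qpol m (Suc l) cf z"
  shows "AE z in lb_on ({a..b} \<times> {c..d}). dv 0 1 v z = qpol m l (dyc cf) z"
proof -
  let ?M = "lb_on ({a..b} \<times> {c..d})"
  note s = sub[OF q]
  have d0: "sqi (lb_on \<Omega>) (dv 0 0 v)" and d1: "sqi (lb_on \<Omega>) (dv 0 1 v)" by (rule dv_sqi(1)[OF v]; simp)+
  have ae: "AE z in ?M. dv 0 0 v z = qpol m (Suc l) cf z"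
  proof -
    have "AE z in ?M. v z = dv 0 0 v z" using bspec[OF AE_grid[THEN iffD1, OF dv_00[OF v]] q] unfolding cell.simps .
    with loc show ?thesis by eventually_elim simp
  qed
  have qi: "integrable ?M (qpol m l (dyc cf))"
    by (rule sqi_imp_integrable[OF _ rect_sqi_continuous[OF qpol_continuous]]) simp
  have "AE z in ?M. dv 0 1 v z - qpol m l (dyc cf) z = 0"
  proof (rule fundamental_lemma)
    show "integrable ?M (\<lambda>z. dv 0 1 v z - qpol m l (dyc cf) z)" using subbox_integrable[OF s d1] qi by simp
    fix \<psi>\<^sub>1 \<psi>\<^sub>2 assume t: "test1 a b \<psi>\<^sub>1" "test1 c d \<psi>\<^sub>2"
    have m: "\<psi>\<^sub>1 \<in> borel_measurable borel" "\<psi>\<^sub>2 \<in> borel_measurable borel" "deriv \<psi>\<^sub>2 \<in> borel_measurable borel"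
      using t test1_deriv[OF t(2)] smooth_borel by (auto simp: test1_def)
    have sw: "(\<integral>z. qpol m' l' cf' z * (\<beta> (fst z) * \<alpha> (snd z)) \<partial>?M)
      = (\<integral>z. qpol m' l' cf' (snd z, fst z) * (\<alpha> (fst z) * \<beta> (snd z)) \<partial>lb_on ({c..d} \<times> {a..b}))"
      if "\<alpha> \<in> borel_measurable borel" "\<beta> \<in> borel_measurable borel" for m' l' cf' \<alpha> \<beta>
    proof -
      have "(\<lambda>z. qpol m' l' cf' z * (\<beta> (fst z) * \<alpha> (snd z))) \<in> borel_measurable borel"
        using that borel_fst_snd by (intro borel_measurable_times) auto
      from rect_integral_swap[OF this, of c d a b] show ?thesis by (simp add: mult.commute[of "\<beta> _"])
    qed
    have qs: "continuous_on UNIV (\<lambda>z. qpol m' l' cf' (snd z, fst z))" for m' l' cf'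
      using qpol_continuous[of UNIV m' l' cf'] by (intro continuous_on_compose2[OF qpol_continuous[of UNIV]] continuous_intros) auto
    have "(\<integral>z. dv 0 1 v z * (\<psi>\<^sub>1 (fst z) * \<psi>\<^sub>2 (snd z)) \<partial>?M) = - (\<integral>z. dv 0 0 v z * (\<psi>\<^sub>1 (fst z) * deriv \<psi>\<^sub>2 (snd z)) \<partial>?M)"
      using wd_tensor[OF wd_dv[OF v, of 0 "Suc 0"] s sqi_borel[OF d0] sqi_borel[OF d1[simplified]] t] by simp
    also have "(\<integral>z. dv 0 0 v z * (\<psi>\<^sub>1 (fst z) * deriv \<psi>\<^sub>2 (snd z)) \<partial>?M)
      = (\<integral>z. qpol m (Suc l) cf z * (\<psi>\<^sub>1 (fst z) * deriv \<psi>\<^sub>2 (snd z)) \<partial>?M)"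
    proof (rule integral_cong_AE)
      show "AE z in ?M. dv 0 0 v z * (\<psi>\<^sub>1 (fst z) * deriv \<psi>\<^sub>2 (snd z)) = qpol m (Suc l) cf z * (\<psi>\<^sub>1 (fst z) * deriv \<psi>\<^sub>2 (snd z))"
        using ae by eventually_elim simp
    qed (use sqi_borel[OF d0] borel_fst_snd(1)[OF m(1)] borel_fst_snd(2)[OF m(3)] in simp_all)
    also have "\<dots> = - (\<integral>z. qpol m l (dyc cf) z * (\<psi>\<^sub>1 (fst z) * \<psi>\<^sub>2 (snd z)) \<partial>?M)"
      unfolding sw[OF m(3,1)] sw[OF m(2,1)]
      by (rule smooth_parts_x[OF _ qs qs _ t(2,1)]) (use pos[OF q] qpol_dy in simp_all)
    finally show "(\<integral>z. (dv 0 1 v z - qpol m l (dyc cf) z) * (\<psi>\<^sub>1 (fst z) * \<psi>\<^sub>2 (snd z)) \<partial>?M) = 0"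
      using test1_tensor_integrable[OF subbox_integrable[OF s d1] t] test1_tensor_integrable[OF qi t]
      by (simp add: left_diff_distrib)
  qed
  then show ?thesis by eventually_elim simp
qed

end

section \<open>Error terms of one partial derivative\<close>

lemma sqrt_le_power_mult:
  fixes h :: real
  assumes "0 \<le> h" "X \<le> h ^ (2 * n) * Y"
  shows "sqrt X \<le> h ^ n * sqrt Y"
proof -
  have "sqrt X \<le> sqrt ((h ^ n)\<^sup>2 * Y)" using assms by (simp add: power_mult[symmetric] mult.commute)
  also have "\<dots> = h ^ n * sqrt Y" using assms(1) by (simp add: real_sqrt_mult)
  finally show ?thesis .
qed

context xgrid
begin

text \<open>\<open>w 0\<close> is the mixed derivative of the solution and \<open>w j\<close> its
  further \<open>y\<close>-derivatives; the bound needs them up to order \<open>Suc l\<close>, the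
  degree of the interpolant in \<open>y\<close>.\<close>

lemma direct_term:
  fixes g D wx vx :: sfield and w :: "nat \<Rightarrow> sfield"
  assumes h: "0 \<le> h" and g: "\<And>a b c d. (a, b, c, d) \<in> Q \<Longrightarrow> continuous_on ({a..b} \<times> {c..d}) g" "g \<in> borel_measurable borel"
    and D: "sqi (lb_on \<Omega>) D" and w: "\<And>j. j \<le> Suc l \<Longrightarrow> sqi (lb_on \<Omega>) (w j)"
    and acx: "\<And>a b c d. (a, b, c, d) \<in> Q \<Longrightarrow> acx a b c d g D"
    and acy: "\<And>a b c d. (a, b, c, d) \<in> Q \<Longrightarrow> acy a b c d D (w 0)"
    and acw: "\<And>a b c d j. (a, b, c, d) \<in> Q \<Longrightarrow> j < Suc l \<Longrightarrow> acy a b c d (w j) (w (Suc j))"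
    and wx: "sqi (lb_on \<Omega>) wx" and vx: "sqi (lb_on \<Omega>) vx"
    and ip: "\<And>a b c d. (a, b, c, d) \<in> Q \<Longrightarrow> \<exists>cf. interp (Suc m) (Suc l) a b c d g cf \<and>
      (AE z in lb_on ({a..b} \<times> {c..d}). wx z = qpol m (Suc l) (dxc cf) z)"
    and vp: "\<And>a b c d. (a, b, c, d) \<in> Q \<Longrightarrow> \<exists>r. AE z in lb_on ({a..b} \<times> {c..d}). vx z = qpol m (Suc l) r z"
  shows "\<bar>\<integral>z. (D z - wx z) * vx z \<partial>lb_on \<Omega>\<bar>
    \<le> h ^ (l + 2) * sqrt (\<integral>z. (w (Suc l) z)\<^sup>2 \<partial>lb_on \<Omega>) * sqrt (\<integral>z. (vx z)\<^sup>2 \<partial>lb_on \<Omega>)"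
proof -
  let ?Z = "glob (\<lambda>c d. Jy c d (Ry c d (Suc l) (w 0)))"
  note db = direct_bound[where w = w, OF w acw]
  have "\<bar>\<integral>z. (D z - wx z) * vx z \<partial>lb_on \<Omega>\<bar> = \<bar>\<integral>z. ?Z z * vx z \<partial>lb_on \<Omega>\<bar>"
    using grid_identity[OF g D w[of 0, simplified] acx acy wx vx ip vp] by simp
  also have "\<dots> \<le> sqrt (\<integral>z. (?Z z)\<^sup>2 \<partial>lb_on \<Omega>) * sqrt (\<integral>z. (vx z)\<^sup>2 \<partial>lb_on \<Omega>)"
    by (rule Cauchy_Schwarz_integral_sqrt[OF db(1) vx])
  also have "\<dots> \<le> h ^ (Suc l + 1) * sqrt (\<integral>z. (w (Suc l) z)\<^sup>2 \<partial>lb_on \<Omega>) * sqrt (\<integral>z. (vx z)\<^sup>2 \<partial>lb_on \<Omega>)"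
    by (intro mult_right_mono sqrt_le_power_mult[OF h] db(2)) (auto intro: integral_nonneg_AE)
  finally show ?thesis by simp
qed

text \<open>The functions are handed out in place of a final bound: the exchange of derivatives uses
  density of test functions on the original domain, whereas this lemma also serves the reflected
  grid. \<open>Z\<^sub>1\<close> and \<open>Z\<^sub>2\<close> are the weak derivatives of
  \<open>Z\<close> in \<open>x\<close> and \<open>y\<close>.\<close>

lemma super_term:
  fixes g D wx vx :: sfield and w w' :: "nat \<Rightarrow> sfield"
  assumes h: "0 \<le> h" and l: "1 \<le> l"
    and g: "\<And>a b c d. (a, b, c, d) \<in> Q \<Longrightarrow> continuous_on ({a..b} \<times> {c..d}) g" "g \<in> borel_measurable borel"
    and D: "sqi (lb_on \<Omega>) D" and w: "\<And>j. j \<le> Suc l \<Longrightarrow> sqi (lb_on \<Omega>) (w j)"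
    and w': "\<And>j. j \<le> Suc l \<Longrightarrow> sqi (lb_on \<Omega>) (w' j)"
    and acx: "\<And>a b c d. (a, b, c, d) \<in> Q \<Longrightarrow> acx a b c d g D"
    and acy: "\<And>a b c d. (a, b, c, d) \<in> Q \<Longrightarrow> acy a b c d D (w 0)"
    and acw: "\<And>a b c d j. (a, b, c, d) \<in> Q \<Longrightarrow> j < Suc l \<Longrightarrow> acy a b c d (w j) (w (Suc j))"
    and acw': "\<And>a b c d j. (a, b, c, d) \<in> Q \<Longrightarrow> j < Suc l \<Longrightarrow> acy a b c d (w' j) (w' (Suc j))"
    and box: "\<And>a b c d. box_ok a b c d \<Longrightarrow> acx a b c d (w 0) (w' 0)"
    and wx: "sqi (lb_on \<Omega>) wx" and vx: "sqi (lb_on \<Omega>) vx"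
    and ip: "\<And>a b c d. (a, b, c, d) \<in> Q \<Longrightarrow> \<exists>cf. interp (Suc m) (Suc l) a b c d g cf \<and>
      (AE z in lb_on ({a..b} \<times> {c..d}). wx z = qpol m (Suc l) (dxc cf) z)"
    and vp: "\<And>a b c d. (a, b, c, d) \<in> Q \<Longrightarrow> \<exists>r. AE z in lb_on ({a..b} \<times> {c..d}). vx z = qpol m (Suc l) r z"
  obtains Z Z\<^sub>1 Z\<^sub>2 :: sfield where
    "sqi (lb_on \<Omega>) Z" "sqi (lb_on \<Omega>) Z\<^sub>1" "sqi (lb_on \<Omega>) Z\<^sub>2"
    "\<And>\<phi> \<phi>x. continuous_on UNIV \<phi> \<Longrightarrow> (\<And>z. z \<notin> \<Omega> \<Longrightarrow> \<phi> z = 0) \<Longrightarrow> continuous_on UNIV \<phi>x \<Longrightarrow>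
      (\<And>x y. ((\<lambda>t. \<phi> (t, y)) has_real_derivative \<phi>x (x, y)) (at x)) \<Longrightarrow>
      (\<integral>z. Z z * \<phi>x z \<partial>lb_on \<Omega>) = - (\<integral>z. Z\<^sub>1 z * \<phi> z \<partial>lb_on \<Omega>)"
    "\<And>\<phi> \<phi>y. continuous_on UNIV \<phi> \<Longrightarrow> (\<And>z. z \<notin> \<Omega> \<Longrightarrow> \<phi> z = 0) \<Longrightarrow> continuous_on UNIV \<phi>y \<Longrightarrow>
      (\<And>x y. ((\<lambda>t. \<phi> (x, t)) has_real_derivative \<phi>y (x, y)) (at y)) \<Longrightarrow>
      (\<integral>z. Z z * \<phi>y z \<partial>lb_on \<Omega>) = - (\<integral>z. Z\<^sub>2 z * \<phi> z \<partial>lb_on \<Omega>)"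
    "(\<integral>z. (D z - wx z) * vx z \<partial>lb_on \<Omega>) = (\<integral>z. Z\<^sub>2 z * vx z \<partial>lb_on \<Omega>)"
    "sqrt (\<integral>z. (Z\<^sub>1 z)\<^sup>2 \<partial>lb_on \<Omega>) \<le> h ^ (l + 3) * sqrt (\<integral>z. (w' (Suc l) z)\<^sup>2 \<partial>lb_on \<Omega>)"
proof
  note w0 = w[of 0, simplified] and w'0 = w'[of 0, simplified]
  have l2: "2 \<le> Suc l" using l by simp
  show "sqi (lb_on \<Omega>) (glob (\<lambda>c d. Jy c d (Jy c d (Ry c d (Suc l) (w 0)))))"
    by (rule super_bound(1)[where w = w, OF w acw])
  show "sqi (lb_on \<Omega>) (glob (\<lambda>c d. Jy c d (Jy c d (Ry c d (Suc l) (w' 0)))))"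
    by (rule super_bound(1)[where w = w', OF w' acw'])
  show "sqi (lb_on \<Omega>) (glob (\<lambda>c d. Jy c d (Ry c d (Suc l) (w 0))))"
    by (rule direct_bound(1)[where w = w, OF w acw])
  show "(\<integral>z. (D z - wx z) * vx z \<partial>lb_on \<Omega>) = (\<integral>z. glob (\<lambda>c d. Jy c d (Ry c d (Suc l) (w 0))) z * vx z \<partial>lb_on \<Omega>)"
    by (rule grid_identity[OF g D w0 acx acy wx vx ip vp])
  have "sqrt (\<integral>z. (glob (\<lambda>c d. Jy c d (Jy c d (Ry c d (Suc l) (w' 0)))) z)\<^sup>2 \<partial>lb_on \<Omega>)
    \<le> h ^ (Suc l + 2) * sqrt (\<integral>z. (w' (Suc l) z)\<^sup>2 \<partial>lb_on \<Omega>)"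
    by (rule sqrt_le_power_mult[OF h super_bound(2)[where w = w', OF w' acw']])
  then show "sqrt (\<integral>z. (glob (\<lambda>c d. Jy c d (Jy c d (Ry c d (Suc l) (w' 0)))) z)\<^sup>2 \<partial>lb_on \<Omega>)
    \<le> h ^ (l + 3) * sqrt (\<integral>z. (w' (Suc l) z)\<^sup>2 \<partial>lb_on \<Omega>)"
    by (simp add: numeral_3_eq_3)
  fix \<phi> :: sfield assume \<phi>: "continuous_on UNIV \<phi>" "\<And>z. z \<notin> \<Omega> \<Longrightarrow> \<phi> z = 0"
  show "(\<integral>z. glob (\<lambda>c d. Jy c d (Jy c d (Ry c d (Suc l) (w 0)))) z * \<phi>x z \<partial>lb_on \<Omega>)
      = - (\<integral>z. glob (\<lambda>c d. Jy c d (Jy c d (Ry c d (Suc l) (w' 0)))) z * \<phi> z \<partial>lb_on \<Omega>)"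
    if "continuous_on UNIV \<phi>x" "\<And>x y. ((\<lambda>t. \<phi> (t, y)) has_real_derivative \<phi>x (x, y)) (at x)" for \<phi>x
    by (rule super_weak(1)[OF l2 w0 w'0 box \<phi> that])
  show "(\<integral>z. glob (\<lambda>c d. Jy c d (Jy c d (Ry c d (Suc l) (w 0)))) z * \<phi>y z \<partial>lb_on \<Omega>)
      = - (\<integral>z. glob (\<lambda>c d. Jy c d (Ry c d (Suc l) (w 0))) z * \<phi> z \<partial>lb_on \<Omega>)"
    if "continuous_on UNIV \<phi>y" "\<And>x y. ((\<lambda>t. \<phi> (x, t)) has_real_derivative \<phi>y (x, y)) (at y)" for \<phi>y
    by (rule super_weak(2)[OF l2 w0 w'0 box \<phi> that])
qed

end

section \<open>Exchanging the coordinates\<close>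

lemma swap_borel:
  assumes "F \<in> borel_measurable borel"
  shows "(\<lambda>z :: real \<times> real. F (snd z, fst z) :: real) \<in> borel_measurable borel"
proof -
  have "continuous_on UNIV (\<lambda>z :: real \<times> real. (snd z, fst z))" by (intro continuous_intros)
  then have "(\<lambda>z :: real \<times> real. (snd z, fst z)) \<in> borel_measurable borel" by (rule borel_measurable_continuous_onI)
  from measurable_compose[OF this assms] show ?thesis .
qed

lemma swap_set_borel: "S \<in> sets borel \<Longrightarrow> {z :: real \<times> real. (snd z, fst z) \<in> S} \<in> sets borel"
proof -
  assume S: "S \<in> sets borel"
  have "continuous_on UNIV (\<lambda>z :: real \<times> real. (snd z, fst z))" by (intro continuous_intros)
  then have "(\<lambda>z :: real \<times> real. (snd z, fst z)) \<in> borel_measurable borel" by (rule borel_measurable_continuous_onI)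
  from measurable_sets[OF this S] show ?thesis by (simp add: vimage_def)
qed

lemma swap_integral:
  fixes F :: sfield
  assumes S: "S \<in> sets borel" and F: "F \<in> borel_measurable borel"
  shows "(\<integral>z. F (snd z, fst z) \<partial>lb_on {z. (snd z, fst z) \<in> S}) = (\<integral>z. F z \<partial>lb_on S)"
    and "integrable (lb_on {z. (snd z, fst z) \<in> S}) (\<lambda>z. F (snd z, fst z)) \<longleftrightarrow> integrable (lb_on S) F"
proof -
  let ?G = "\<lambda>z. indicator S z * F z"
  have G: "?G \<in> borel_measurable borel" using S F by simp
  have e: "indicator {z. (snd z, fst z) \<in> S} z * F (snd z, fst z) = ?G (snd z, fst z)" for z
    by (simp add: indicator_def)
  note S' = swap_set_borel[OF S] and F' = swap_borel[OF F]
  have "(\<integral>z. ?G (snd z, fst z) \<partial>lborel) = (\<integral>z. ?G z \<partial>lborel)"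
    using lborel_pair.integral_product_swap[of ?G] G by (simp add: lborel_prod case_prod_unfold)
  then show "(\<integral>z. F (snd z, fst z) \<partial>lb_on {z. (snd z, fst z) \<in> S}) = (\<integral>z. F z \<partial>lb_on S)"
    unfolding integral_lb_on[OF S F] integral_lb_on[OF S' F'] e .
  have "integrable lborel (\<lambda>z. ?G (snd z, fst z)) \<longleftrightarrow> integrable lborel ?G"
    using lborel_pair.integrable_product_swap_iff[of ?G] by (simp add: lborel_prod case_prod_unfold)
  then show "integrable (lb_on {z. (snd z, fst z) \<in> S}) (\<lambda>z. F (snd z, fst z)) \<longleftrightarrow> integrable (lb_on S) F"
    unfolding integrable_lb_on[OF S F] integrable_lb_on[OF S' F'] e .
qed

lemma swap_sqi:
  fixes F :: sfield
  assumes "S \<in> sets borel" "sqi (lb_on S) F"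
  shows "sqi (lb_on {z. (snd z, fst z) \<in> S}) (\<lambda>z. F (snd z, fst z))"
proof -
  have F: "F \<in> borel_measurable borel" "integrable (lb_on S) (\<lambda>z. (F z)\<^sup>2)" using assms(2) by (auto simp: sqi_def)
  then have "(\<lambda>z. (F z)\<^sup>2) \<in> borel_measurable borel" by simp
  from swap_integral(2)[OF assms(1) this] F swap_borel[OF F(1)] show ?thesis by (simp add: sqi_def)
qed

lemma acx_cong_AE:
  assumes "acx a b c d f f'" "AE z in lb_on ({a..b} \<times> {c..d}). g z = f z"
  shows "acx a b c d g f'"
proof -
  obtain A where A: "integrable (lb_on {c..d}) A"
    "AE z in lb_on ({a..b} \<times> {c..d}). f z = A (snd z) + prim a b (\<lambda>t. f' (t, snd z)) (fst z)"
    using assms(1) by (auto simp: acx_def)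
  have "AE z in lb_on ({a..b} \<times> {c..d}). g z = A (snd z) + prim a b (\<lambda>t. f' (t, snd z)) (fst z)"
    using A(2) assms(2) by eventually_elim simp
  with A(1) show ?thesis by (auto simp: acx_def)
qed

lemma acx_iff_acy: "acx a b c d f f' \<longleftrightarrow> acy c d a b (\<lambda>z. f (snd z, fst z)) (\<lambda>z. f' (snd z, fst z))"
  by (simp add: acy_iff_acx)

text \<open>The joined boxes of \<open>box_ok\<close> must not cross a slit of the domain.\<close>

locale dgrid = sgrid + S: xgrid "{z. (snd z, fst z) \<in> \<Omega>}" "{(c, d, a, b). (a, b, c, d) \<in> Q}" h +
  assumes h0: "0 \<le> h"
    and box: "box_ok a b c d \<Longrightarrow> ocell (a, b, c, d) \<subseteq> \<Omega>"
    and box': "S.box_ok c d a b \<Longrightarrow> ocell (a, b, c, d) \<subseteq> \<Omega>"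
begin

text \<open>The cell data of one component: \<open>g\<close> is a Borel version of \<open>u\<close>
  with meaningful point values on the closed cells, \<open>w\<close> its interpolant,
  \<open>v\<close> a discrete function with the same degrees.\<close>

definition fem :: "nat \<Rightarrow> nat \<Rightarrow> sfield \<Rightarrow> sfield \<Rightarrow> sfield \<Rightarrow> sfield \<Rightarrow> bool" where
  "fem m l g u w v \<longleftrightarrow> g \<in> borel_measurable borel \<and> (AE z in lb_on \<Omega>. g z = u z) \<and> w \<in> Hspace 1 \<Omega> \<and> v \<in> H1_0 \<Omega> \<and>
    (\<forall>a b c d. (a, b, c, d) \<in> Q \<longrightarrow> continuous_on ({a..b} \<times> {c..d}) g \<and>
      (\<exists>cf. interp m l a b c d g cf \<and> (AE z in lb_on ({a..b} \<times> {c..d}). w z = qpol m l cf z)) \<and>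
      (\<exists>r. AE z in lb_on ({a..b} \<times> {c..d}). v z = qpol m l r z))"

lemma femD:
  assumes "fem m l g u w v"
  shows "g \<in> borel_measurable borel" "AE z in lb_on \<Omega>. g z = u z" "w \<in> Hspace 1 \<Omega>" "v \<in> H1_0 \<Omega>"
    "(a, b, c, d) \<in> Q \<Longrightarrow> continuous_on ({a..b} \<times> {c..d}) g"
    "(a, b, c, d) \<in> Q \<Longrightarrow> \<exists>cf. interp m l a b c d g cf \<and> (AE z in lb_on ({a..b} \<times> {c..d}). w z = qpol m l cf z)"
    "(a, b, c, d) \<in> Q \<Longrightarrow> \<exists>r. AE z in lb_on ({a..b} \<times> {c..d}). v z = qpol m l r z"
  using assms by (auto simp: fem_def)

lemma fem_rep:
  assumes "fem m l g u w v" "u \<in> Hspace n \<Omega>" "(a, b, c, d) \<in> Q"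
  shows "AE z in lb_on ({a..b} \<times> {c..d}). g z = dv 0 0 u z"
proof -
  have "AE z in lb_on \<Omega>. g z = dv 0 0 u z"
    using femD(2)[OF assms(1)] dv_00[OF assms(2)] by eventually_elim simp
  from bspec[OF AE_grid[THEN iffD1, OF this] assms(3)] show ?thesis unfolding cell.simps .
qed

lemma fem_local_x:
  assumes "fem (Suc m) l g u w v" "(a, b, c, d) \<in> Q"
  shows "\<exists>cf. interp (Suc m) l a b c d g cf \<and> (AE z in lb_on ({a..b} \<times> {c..d}). dv 1 0 w z = qpol m l (dxc cf) z)"
    and "\<exists>r. AE z in lb_on ({a..b} \<times> {c..d}). dv 1 0 v z = qpol m l r z"
  using femD(6,7)[OF assms] dv_local_x[OF femD(3)[OF assms(1)] assms(2)]
    dv_local_x[OF H1_0_Hspace[OF femD(4)[OF assms(1)]] assms(2)] by blast+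

lemma swap_AE_qpol:
  assumes "AE z in lb_on ({a..b} \<times> {c..d}). F z = qpol l m cf z"
  shows "AE z in lb_on ({c..d} \<times> {a..b}). F (snd z, fst z) = qpol m l (\<lambda>i j. cf j i) z"
  using assms unfolding rect_AE_swap[of _ a b c d] by eventually_elim (simp add: qpol_swap[of l m cf])

lemma fem_local_y:
  assumes "fem l (Suc m) g u w v" "(a, b, c, d) \<in> Q"
  shows "\<exists>cf. interp (Suc m) l c d a b (\<lambda>z. g (snd z, fst z)) cf \<and>
      (AE z in lb_on ({c..d} \<times> {a..b}). dv 0 1 w (snd z, fst z) = qpol m l (dxc cf) z)"
    and "\<exists>r. AE z in lb_on ({c..d} \<times> {a..b}). dv 0 1 v (snd z, fst z) = qpol m l r z"
proof -
  obtain cf where cf: "interp l (Suc m) a b c d g cf" "AE z in lb_on ({a..b} \<times> {c..d}). w z = qpol l (Suc m) cf z"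
    using femD(6)[OF assms] by blast
  have "dxc (\<lambda>i j. cf j i) = (\<lambda>i j. dyc cf j i)" by (simp add: dxc_def dyc_def fun_eq_iff)
  moreover note interp_swap[OF cf(1) femD(1)[OF assms(1)]]
    swap_AE_qpol[OF dv_local_y[OF femD(3)[OF assms(1)] assms(2) cf(2)]]
  ultimately show "\<exists>cf. interp (Suc m) l c d a b (\<lambda>z. g (snd z, fst z)) cf \<and>
      (AE z in lb_on ({c..d} \<times> {a..b}). dv 0 1 w (snd z, fst z) = qpol m l (dxc cf) z)"
    by (intro exI[of _ "\<lambda>i j. cf j i"]) simp
  obtain r where r: "AE z in lb_on ({a..b} \<times> {c..d}). v z = qpol l (Suc m) r z"
    using femD(7)[OF assms] by blast
  from swap_AE_qpol[OF dv_local_y[OF H1_0_Hspace[OF femD(4)[OF assms(1)]] assms(2) r]]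
  show "\<exists>r. AE z in lb_on ({c..d} \<times> {a..b}). dv 0 1 v (snd z, fst z) = qpol m l r z" by blast
qed

lemma x_direct:
  assumes F: "fem (Suc m) (Suc l) g u w v" and u: "u \<in> Hspace (l + 3) \<Omega>"
  shows "\<bar>\<integral>z. (dv 1 0 u z - dv 1 0 w z) * dv 1 0 v z \<partial>lb_on \<Omega>\<bar>
    \<le> h ^ (l + 2) * sqrt (\<integral>z. (dv 1 (l + 2) u z)\<^sup>2 \<partial>lb_on \<Omega>) * sqrt (\<integral>z. (dv 1 0 v z)\<^sup>2 \<partial>lb_on \<Omega>)"
proof -
  note f = femD[OF F]
  have "\<bar>\<integral>z. (dv 1 0 u z - dv 1 0 w z) * dv 1 0 v z \<partial>lb_on \<Omega>\<bar>
    \<le> h ^ (l + 2) * sqrt (\<integral>z. (dv 1 (Suc (Suc l)) u z)\<^sup>2 \<partial>lb_on \<Omega>) * sqrt (\<integral>z. (dv 1 0 v z)\<^sup>2 \<partial>lb_on \<Omega>)"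
  proof (rule direct_term[where w = "\<lambda>j. dv 1 (Suc j) u", OF h0 f(5,1)])
    show "sqi (lb_on \<Omega>) (dv 1 0 u)" by (rule dv_sqi(1)[OF u]) simp
    show "sqi (lb_on \<Omega>) (dv 1 (Suc j) u)" if "j \<le> Suc l" for j by (rule dv_sqi(1)[OF u]) (use that in simp)
    show "sqi (lb_on \<Omega>) (dv 1 0 w)" by (rule dv_sqi(1)[OF f(3)]) simp
    show "sqi (lb_on \<Omega>) (dv 1 0 v)" by (rule dv_sqi(1)[OF H1_0_Hspace[OF f(4)]]) simp
    fix a b c d assume q: "(a, b, c, d) \<in> Q"
    note p = pos[OF q] and s = sub[OF q]
    have "acx a b c d (dv 0 0 u) (dv (Suc 0) 0 u)" by (rule dv_acx[OF u _ _ s]) (use p in simp_all)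
    from acx_cong_AE[OF this fem_rep[OF F u q]] show "acx a b c d g (dv 1 0 u)" by simp
    show "acy a b c d (dv 1 0 u) (dv 1 (Suc 0) u)" by (rule dv_acy[OF u _ _ s]) (use p in simp_all)
    show "acy a b c d (dv 1 (Suc j) u) (dv 1 (Suc (Suc j)) u)" if "j < Suc l" for j
      by (rule dv_acy[OF u _ _ s]) (use p that in simp_all)
    show "\<exists>cf. interp (Suc m) (Suc l) a b c d g cf \<and> (AE z in lb_on ({a..b} \<times> {c..d}). dv 1 0 w z = qpol m (Suc l) (dxc cf) z)"
      "\<exists>r. AE z in lb_on ({a..b} \<times> {c..d}). dv 1 0 v z = qpol m (Suc l) r z"
      by (rule fem_local_x[OF F q])+
  qed
  then show ?thesis by simp
qed

text \<open>Two \<open>x\<close>-derivatives and \<open>l + 2\<close> in \<open>y\<close> add up to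
  the order \<open>l + 4\<close> that is assumed. The right-hand side carries the other partial
  derivative of \<open>v\<close>.\<close>

lemma x_super:
  assumes F: "fem (Suc m) (Suc l) g u w v" and u: "u \<in> Hspace (l + 4) \<Omega>" and l: "1 \<le> l"
  shows "\<bar>\<integral>z. (dv 1 0 u z - dv 1 0 w z) * dv 1 0 v z \<partial>lb_on \<Omega>\<bar>
    \<le> h ^ (l + 3) * sqrt (\<integral>z. (dv 2 (l + 2) u z)\<^sup>2 \<partial>lb_on \<Omega>) * sqrt (\<integral>z. (dv 0 1 v z)\<^sup>2 \<partial>lb_on \<Omega>)"
proof (rule super_term[where m = m and l = l and w = "\<lambda>j. dv 1 (Suc j) u" and w' = "\<lambda>j. dv 2 (Suc j) u"
      and D = "dv 1 0 u" and wx = "dv 1 0 w" and vx = "dv 1 0 v", OF h0 l femD(5,1)[OF F]])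
  note f = femD[OF F]
  have vy: "sqi (lb_on \<Omega>) (dv 0 1 v)" by (rule dv_sqi(1)[OF H1_0_Hspace[OF f(4)]]) simp
  show "sqi (lb_on \<Omega>) (dv 1 0 u)" by (rule dv_sqi(1)[OF u]) simp
  show "sqi (lb_on \<Omega>) (dv 1 (Suc j) u)" if "j \<le> Suc l" for j by (rule dv_sqi(1)[OF u]) (use that in simp)
  show "sqi (lb_on \<Omega>) (dv 2 (Suc j) u)" if "j \<le> Suc l" for j by (rule dv_sqi(1)[OF u]) (use that in simp)
  show "sqi (lb_on \<Omega>) (dv 1 0 w)" by (rule dv_sqi(1)[OF f(3)]) simp
  show "sqi (lb_on \<Omega>) (dv 1 0 v)" by (rule dv_sqi(1)[OF H1_0_Hspace[OF f(4)]]) simp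
  show "acx a b c d (dv 1 (Suc 0) u) (dv 2 (Suc 0) u)" if "box_ok a b c d" for a b c d
    using dv_acx[OF u, of 1 "Suc 0" a b c d] box[OF that] box_ok_lt[OF that] by (simp add: numeral_2_eq_2)
  {
    fix a b c d assume q: "(a, b, c, d) \<in> Q"
    note p = pos[OF q] and s = sub[OF q]
    have "acx a b c d (dv 0 0 u) (dv (Suc 0) 0 u)" by (rule dv_acx[OF u _ _ s]) (use p in simp_all)
    from acx_cong_AE[OF this fem_rep[OF F u q]] show "acx a b c d g (dv 1 0 u)" by simp
    show "acy a b c d (dv 1 0 u) (dv 1 (Suc 0) u)" by (rule dv_acy[OF u _ _ s]) (use p in simp_all)
    show "acy a b c d (dv 1 (Suc j) u) (dv 1 (Suc (Suc j)) u)" if "j < Suc l" for j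
      by (rule dv_acy[OF u _ _ s]) (use p that in simp_all)
    show "acy a b c d (dv 2 (Suc j) u) (dv 2 (Suc (Suc j)) u)" if "j < Suc l" for j
      by (rule dv_acy[OF u _ _ s]) (use p that in simp_all)
    show "\<exists>cf. interp (Suc m) (Suc l) a b c d g cf \<and> (AE z in lb_on ({a..b} \<times> {c..d}). dv 1 0 w z = qpol m (Suc l) (dxc cf) z)"
      "\<exists>r. AE z in lb_on ({a..b} \<times> {c..d}). dv 1 0 v z = qpol m (Suc l) r z"
      by (rule fem_local_x[OF F q])+
  }
  fix Z Z\<^sub>1 Z\<^sub>2 :: sfield
  assume Z: "sqi (lb_on \<Omega>) Z" "sqi (lb_on \<Omega>) Z\<^sub>1" "sqi (lb_on \<Omega>) Z\<^sub>2"
    and zx: "\<And>\<phi> \<phi>x. continuous_on UNIV \<phi> \<Longrightarrow> (\<And>z. z \<notin> \<Omega> \<Longrightarrow> \<phi> z = 0) \<Longrightarrow> continuous_on UNIV \<phi>x \<Longrightarrow>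
      (\<And>x y. ((\<lambda>t. \<phi> (t, y)) has_real_derivative \<phi>x (x, y)) (at x)) \<Longrightarrow>
      (\<integral>z. Z z * \<phi>x z \<partial>lb_on \<Omega>) = - (\<integral>z. Z\<^sub>1 z * \<phi> z \<partial>lb_on \<Omega>)"
    and zy: "\<And>\<phi> \<phi>y. continuous_on UNIV \<phi> \<Longrightarrow> (\<And>z. z \<notin> \<Omega> \<Longrightarrow> \<phi> z = 0) \<Longrightarrow> continuous_on UNIV \<phi>y \<Longrightarrow>
      (\<And>x y. ((\<lambda>t. \<phi> (x, t)) has_real_derivative \<phi>y (x, y)) (at y)) \<Longrightarrow>
      (\<integral>z. Z z * \<phi>y z \<partial>lb_on \<Omega>) = - (\<integral>z. Z\<^sub>2 z * \<phi> z \<partial>lb_on \<Omega>)"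
    and eq: "(\<integral>z. (dv 1 0 u z - dv 1 0 w z) * dv 1 0 v z \<partial>lb_on \<Omega>) = (\<integral>z. Z\<^sub>2 z * dv 1 0 v z \<partial>lb_on \<Omega>)"
    and b: "sqrt (\<integral>z. (Z\<^sub>1 z)\<^sup>2 \<partial>lb_on \<Omega>) \<le> h ^ (l + 3) * sqrt (\<integral>z. (dv 2 (Suc (Suc l)) u z)\<^sup>2 \<partial>lb_on \<Omega>)"
  \<comment> \<open>Here a derivative of \<open>u\<close> is bought for a power of \<open>h\<close>:
    the factor \<open>Z\<^sub>1\<close> has two primitives where \<open>Z\<^sub>2\<close> has
    one.\<close>
  have "(\<integral>z. Z\<^sub>2 z * dv 1 0 v z \<partial>lb_on \<Omega>) = (\<integral>z. Z\<^sub>1 z * dv 0 1 v z \<partial>lb_on \<Omega>)"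
  proof (rule curl_identity[OF f(4) Z])
    fix \<phi> assume \<phi>: "\<phi> \<in> test_functions \<Omega>"
    then have C: "Ck (Suc 0) \<phi>" by (auto simp: test_functions_def simp del: Ck.simps)
    note c = test_function_continuous(1)[OF \<phi>] test_function_pd[OF \<phi>]
    show "(\<integral>z. Z z * pdx \<phi> z \<partial>lb_on \<Omega>) = - (\<integral>z. Z\<^sub>1 z * \<phi> z \<partial>lb_on \<Omega>)"
      by (rule zx[OF c(1) test_function_zero[OF \<phi>] test_function_continuous(1)[OF c(2)] pdx_DERIV[OF C]])
    show "(\<integral>z. Z z * pdy \<phi> z \<partial>lb_on \<Omega>) = - (\<integral>z. Z\<^sub>2 z * \<phi> z \<partial>lb_on \<Omega>)"
      by (rule zy[OF c(1) test_function_zero[OF \<phi>] test_function_continuous(1)[OF c(3)] pdy_DERIV[OF C]])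
  qed
  then have "\<bar>\<integral>z. (dv 1 0 u z - dv 1 0 w z) * dv 1 0 v z \<partial>lb_on \<Omega>\<bar> = \<bar>\<integral>z. Z\<^sub>1 z * dv 0 1 v z \<partial>lb_on \<Omega>\<bar>"
    using eq by simp
  also have "\<dots> \<le> sqrt (\<integral>z. (Z\<^sub>1 z)\<^sup>2 \<partial>lb_on \<Omega>) * sqrt (\<integral>z. (dv 0 1 v z)\<^sup>2 \<partial>lb_on \<Omega>)"
    by (rule Cauchy_Schwarz_integral_sqrt[OF Z(2) vy])
  also have "\<dots> \<le> h ^ (l + 3) * sqrt (\<integral>z. (dv 2 (l + 2) u z)\<^sup>2 \<partial>lb_on \<Omega>) * sqrt (\<integral>z. (dv 0 1 v z)\<^sup>2 \<partial>lb_on \<Omega>)"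
    using b by (intro mult_right_mono) (simp_all add: integral_nonneg_AE)
  finally show ?thesis .
qed

text \<open>On the grid reflected at the diagonal \<open>y\<close>-derivatives become
  \<open>x\<close>-derivatives; the integrals are pulled back at the end.\<close>

lemma y_direct:
  assumes F: "fem (Suc l) (Suc m) g u w v" and u: "u \<in> Hspace (l + 3) \<Omega>"
  shows "\<bar>\<integral>z. (dv 0 1 u z - dv 0 1 w z) * dv 0 1 v z \<partial>lb_on \<Omega>\<bar>
    \<le> h ^ (l + 2) * sqrt (\<integral>z. (dv (l + 2) 1 u z)\<^sup>2 \<partial>lb_on \<Omega>) * sqrt (\<integral>z. (dv 0 1 v z)\<^sup>2 \<partial>lb_on \<Omega>)"
proof -
  note f = femD[OF F]
  let ?\<Omega> = "{z. (snd z, fst z) \<in> \<Omega>}" and ?s = "\<lambda>(F :: sfield) z. F (snd z, fst z)"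
  have du: "sqi (lb_on \<Omega>) (dv 0 1 u)" and duj: "\<And>j. j \<le> Suc l \<Longrightarrow> sqi (lb_on \<Omega>) (dv (Suc j) 1 u)"
    by (rule dv_sqi(1)[OF u]; simp)+
  have dw: "sqi (lb_on \<Omega>) (dv 0 1 w)" by (rule dv_sqi(1)[OF f(3)]) simp
  have d_v: "sqi (lb_on \<Omega>) (dv 0 1 v)" by (rule dv_sqi(1)[OF H1_0_Hspace[OF f(4)]]) simp
  have "\<bar>\<integral>z. (?s (dv 0 1 u) z - ?s (dv 0 1 w) z) * ?s (dv 0 1 v) z \<partial>lb_on ?\<Omega>\<bar>
    \<le> h ^ (l + 2) * sqrt (\<integral>z. (?s (dv (Suc (Suc l)) 1 u) z)\<^sup>2 \<partial>lb_on ?\<Omega>) * sqrt (\<integral>z. (?s (dv 0 1 v) z)\<^sup>2 \<partial>lb_on ?\<Omega>)"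
  proof (rule S.direct_term[where w = "\<lambda>j. ?s (dv (Suc j) 1 u)" and g = "?s g" and m = m, OF h0 _ swap_borel[OF f(1)]])
    show "sqi (lb_on ?\<Omega>) (?s (dv 0 1 u))" by (rule swap_sqi[OF \<Omega>_borel du])
    show "sqi (lb_on ?\<Omega>) (?s (dv (Suc j) 1 u))" if "j \<le> Suc l" for j by (rule swap_sqi[OF \<Omega>_borel duj[OF that]])
    show "sqi (lb_on ?\<Omega>) (?s (dv 0 1 w))" by (rule swap_sqi[OF \<Omega>_borel dw])
    show "sqi (lb_on ?\<Omega>) (?s (dv 0 1 v))" by (rule swap_sqi[OF \<Omega>_borel d_v])
    fix c d a b assume q': "(c, d, a, b) \<in> {(c, d, a, b). (a, b, c, d) \<in> Q}"
    then have q: "(a, b, c, d) \<in> Q" by simp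
    note p = pos[OF q] and s = sub[OF q]
    show "continuous_on ({c..d} \<times> {a..b}) (?s g)"
      by (rule continuous_on_compose2[OF f(5)[OF q]]) (auto intro!: continuous_intros)
    have "acy a b c d (dv 0 0 u) (dv 0 (Suc 0) u)" by (rule dv_acy[OF u _ _ s]) (use p in simp_all)
    moreover have "AE z in lb_on ({c..d} \<times> {a..b}). ?s g z = ?s (dv 0 0 u) z"
      using fem_rep[OF F u q] unfolding rect_AE_swap[of _ a b c d] .
    ultimately show "acx c d a b (?s g) (?s (dv 0 1 u))" unfolding acy_iff_acx One_nat_def by (rule acx_cong_AE)
    show "acy c d a b (?s (dv 0 1 u)) (?s (dv (Suc 0) 1 u))"
      unfolding acx_iff_acy[symmetric] by (rule dv_acx[OF u _ _ s]) (use p in simp_all)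
    show "acy c d a b (?s (dv (Suc j) 1 u)) (?s (dv (Suc (Suc j)) 1 u))" if "j < Suc l" for j
      unfolding acx_iff_acy[symmetric] by (rule dv_acx[OF u _ _ s]) (use p that in simp_all)
    show "\<exists>cf. interp (Suc m) (Suc l) c d a b (?s g) cf \<and> (AE z in lb_on ({c..d} \<times> {a..b}). ?s (dv 0 1 w) z = qpol m (Suc l) (dxc cf) z)"
      "\<exists>r. AE z in lb_on ({c..d} \<times> {a..b}). ?s (dv 0 1 v) z = qpol m (Suc l) r z"
      by (rule fem_local_y[OF F q])+
  qed
  moreover note [measurable] = sqi_borel[OF du] sqi_borel[OF dw] sqi_borel[OF d_v] sqi_borel[OF duj[OF order_refl]]
  have "(\<lambda>z. (dv 0 1 u z - dv 0 1 w z) * dv 0 1 v z) \<in> borel_measurable borel"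
    "(\<lambda>z. (dv (Suc (Suc l)) 1 u z)\<^sup>2) \<in> borel_measurable borel" "(\<lambda>z. (dv 0 1 v z)\<^sup>2) \<in> borel_measurable borel"
    by measurable
  note this[THEN swap_integral(1)[OF \<Omega>_borel]]
  ultimately show ?thesis by simp
qed

lemma y_super:
  assumes F: "fem (Suc l) (Suc m) g u w v" and u: "u \<in> Hspace (l + 4) \<Omega>" and l: "1 \<le> l"
  shows "\<bar>\<integral>z. (dv 0 1 u z - dv 0 1 w z) * dv 0 1 v z \<partial>lb_on \<Omega>\<bar>
    \<le> h ^ (l + 3) * sqrt (\<integral>z. (dv (l + 2) 2 u z)\<^sup>2 \<partial>lb_on \<Omega>) * sqrt (\<integral>z. (dv 1 0 v z)\<^sup>2 \<partial>lb_on \<Omega>)"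
proof -
  note f = femD[OF F]
  let ?\<Omega> = "{z. (snd z, fst z) \<in> \<Omega>}" and ?s = "\<lambda>(F :: sfield) z. F (snd z, fst z)"
  have du: "sqi (lb_on \<Omega>) (dv 0 1 u)" and duj: "\<And>j. j \<le> Suc l \<Longrightarrow> sqi (lb_on \<Omega>) (dv (Suc j) 1 u)"
    and du2: "\<And>j. j \<le> Suc l \<Longrightarrow> sqi (lb_on \<Omega>) (dv (Suc j) 2 u)"
    by (rule dv_sqi(1)[OF u]; simp)+
  have dw: "sqi (lb_on \<Omega>) (dv 0 1 w)" by (rule dv_sqi(1)[OF f(3)]) simp
  have d_v: "sqi (lb_on \<Omega>) (dv 0 1 v)" and vx: "sqi (lb_on \<Omega>) (dv 1 0 v)"
    by (rule dv_sqi(1)[OF H1_0_Hspace[OF f(4)]]; simp)+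
  note sm = swap_integral(1)[OF \<Omega>_borel]
  note [measurable] = sqi_borel[OF du] sqi_borel[OF dw] sqi_borel[OF d_v] sqi_borel[OF du2[OF order_refl]]
  have m: "(\<lambda>z. (dv 0 1 u z - dv 0 1 w z) * dv 0 1 v z) \<in> borel_measurable borel"
    "(\<lambda>z. (dv (Suc (Suc l)) 2 u z)\<^sup>2) \<in> borel_measurable borel"
    by measurable
  show ?thesis
  proof (rule S.super_term[where m = m and l = l and w = "\<lambda>j. ?s (dv (Suc j) 1 u)" and w' = "\<lambda>j. ?s (dv (Suc j) 2 u)"
        and D = "?s (dv 0 1 u)" and wx = "?s (dv 0 1 w)" and vx = "?s (dv 0 1 v)" and g = "?s g", OF h0 l _ swap_borel[OF f(1)]])
    show "sqi (lb_on ?\<Omega>) (?s (dv 0 1 u))" by (rule swap_sqi[OF \<Omega>_borel du])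
    show "sqi (lb_on ?\<Omega>) (?s (dv (Suc j) 1 u))" if "j \<le> Suc l" for j by (rule swap_sqi[OF \<Omega>_borel duj[OF that]])
    show "sqi (lb_on ?\<Omega>) (?s (dv (Suc j) 2 u))" if "j \<le> Suc l" for j by (rule swap_sqi[OF \<Omega>_borel du2[OF that]])
    show "sqi (lb_on ?\<Omega>) (?s (dv 0 1 w))" by (rule swap_sqi[OF \<Omega>_borel dw])
    show "sqi (lb_on ?\<Omega>) (?s (dv 0 1 v))" by (rule swap_sqi[OF \<Omega>_borel d_v])
    show "acx c d a b (?s (dv (Suc 0) 1 u)) (?s (dv (Suc 0) 2 u))" if "S.box_ok c d a b" for a b c d
      unfolding acy_iff_acx[symmetric]
      using dv_acy[OF u, of "Suc 0" 1 c d a b] box'[OF that] S.box_ok_lt[OF that] by (simp add: numeral_2_eq_2)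
    {
      fix c d a b assume q': "(c, d, a, b) \<in> {(c, d, a, b). (a, b, c, d) \<in> Q}"
      then have q: "(a, b, c, d) \<in> Q" by simp
      note p = pos[OF q] and s = sub[OF q]
      show "continuous_on ({c..d} \<times> {a..b}) (?s g)"
        by (rule continuous_on_compose2[OF f(5)[OF q]]) (auto intro!: continuous_intros)
      have "acy a b c d (dv 0 0 u) (dv 0 (Suc 0) u)" by (rule dv_acy[OF u _ _ s]) (use p in simp_all)
      moreover have "AE z in lb_on ({c..d} \<times> {a..b}). ?s g z = ?s (dv 0 0 u) z"
        using fem_rep[OF F u q] unfolding rect_AE_swap[of _ a b c d] .
      ultimately show "acx c d a b (?s g) (?s (dv 0 1 u))" unfolding acy_iff_acx One_nat_def by (rule acx_cong_AE)
      show "acy c d a b (?s (dv 0 1 u)) (?s (dv (Suc 0) 1 u))"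
        unfolding acx_iff_acy[symmetric] by (rule dv_acx[OF u _ _ s]) (use p in simp_all)
      show "acy c d a b (?s (dv (Suc j) 1 u)) (?s (dv (Suc (Suc j)) 1 u))" if "j < Suc l" for j
        unfolding acx_iff_acy[symmetric] by (rule dv_acx[OF u _ _ s]) (use p that in simp_all)
      show "acy c d a b (?s (dv (Suc j) 2 u)) (?s (dv (Suc (Suc j)) 2 u))" if "j < Suc l" for j
        unfolding acx_iff_acy[symmetric] by (rule dv_acx[OF u _ _ s]) (use p that in simp_all)
      show "\<exists>cf. interp (Suc m) (Suc l) c d a b (?s g) cf \<and> (AE z in lb_on ({c..d} \<times> {a..b}). ?s (dv 0 1 w) z = qpol m (Suc l) (dxc cf) z)"
        "\<exists>r. AE z in lb_on ({c..d} \<times> {a..b}). ?s (dv 0 1 v) z = qpol m (Suc l) r z"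
        by (rule fem_local_y[OF F q])+
    }
    fix Z Z\<^sub>1 Z\<^sub>2 :: sfield
    assume Z: "sqi (lb_on ?\<Omega>) Z" "sqi (lb_on ?\<Omega>) Z\<^sub>1" "sqi (lb_on ?\<Omega>) Z\<^sub>2"
      and zx: "\<And>\<phi> \<phi>x. continuous_on UNIV \<phi> \<Longrightarrow> (\<And>z. z \<notin> ?\<Omega> \<Longrightarrow> \<phi> z = 0) \<Longrightarrow> continuous_on UNIV \<phi>x \<Longrightarrow>
        (\<And>x y. ((\<lambda>t. \<phi> (t, y)) has_real_derivative \<phi>x (x, y)) (at x)) \<Longrightarrow>
        (\<integral>z. Z z * \<phi>x z \<partial>lb_on ?\<Omega>) = - (\<integral>z. Z\<^sub>1 z * \<phi> z \<partial>lb_on ?\<Omega>)"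
      and zy: "\<And>\<phi> \<phi>y. continuous_on UNIV \<phi> \<Longrightarrow> (\<And>z. z \<notin> ?\<Omega> \<Longrightarrow> \<phi> z = 0) \<Longrightarrow> continuous_on UNIV \<phi>y \<Longrightarrow>
        (\<And>x y. ((\<lambda>t. \<phi> (x, t)) has_real_derivative \<phi>y (x, y)) (at y)) \<Longrightarrow>
        (\<integral>z. Z z * \<phi>y z \<partial>lb_on ?\<Omega>) = - (\<integral>z. Z\<^sub>2 z * \<phi> z \<partial>lb_on ?\<Omega>)"
      and eq: "(\<integral>z. (?s (dv 0 1 u) z - ?s (dv 0 1 w) z) * ?s (dv 0 1 v) z \<partial>lb_on ?\<Omega>) = (\<integral>z. Z\<^sub>2 z * ?s (dv 0 1 v) z \<partial>lb_on ?\<Omega>)"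
      and b: "sqrt (\<integral>z. (Z\<^sub>1 z)\<^sup>2 \<partial>lb_on ?\<Omega>) \<le> h ^ (l + 3) * sqrt (\<integral>z. (?s (dv (Suc (Suc l)) 2 u) z)\<^sup>2 \<partial>lb_on ?\<Omega>)"
    note Z' = Z[THEN swap_sqi[OF S.\<Omega>_borel], simplified]
    note [measurable] = sqi_borel[OF Z'(1)] sqi_borel[OF Z'(2)] sqi_borel[OF Z'(3)]
    have tr: "(\<integral>z. A z * ?s G z \<partial>lb_on ?\<Omega>) = (\<integral>z. ?s A z * G z \<partial>lb_on \<Omega>)"
      if "?s A \<in> borel_measurable borel" "G \<in> borel_measurable borel" for A G
      using sm[of "\<lambda>z. ?s A z * G z"] that by simp
    have "(\<integral>z. ?s Z\<^sub>1 z * dv 1 0 v z \<partial>lb_on \<Omega>) = (\<integral>z. ?s Z\<^sub>2 z * dv 0 1 v z \<partial>lb_on \<Omega>)"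
    \<comment> \<open>Reflection makes \<open>Z\<^sub>1\<close> a \<open>y\<close>-derivative and
      \<open>Z\<^sub>2\<close> an \<open>x\<close>-derivative, so they enter in exchanged
      order.\<close>
    proof (rule curl_identity[OF f(4) Z'(1,3,2)])
      fix \<phi> assume \<phi>: "\<phi> \<in> test_functions \<Omega>"
      then have C: "Ck (Suc 0) \<phi>" by (auto simp: test_functions_def simp del: Ck.simps)
      note t = test_function_pd[OF \<phi>]
      have sc: "continuous_on UNIV (?s G)" if "G \<in> test_functions \<Omega>" for G
        by (rule continuous_on_compose2[OF test_function_continuous(1)[OF that]]) (auto intro!: continuous_intros)
      have z: "?s \<phi> z = 0" if "z \<notin> ?\<Omega>" for z using test_function_zero[OF \<phi>] that by simp
      have "(\<integral>z. Z z * ?s (pdy \<phi>) z \<partial>lb_on ?\<Omega>) = - (\<integral>z. Z\<^sub>1 z * ?s \<phi> z \<partial>lb_on ?\<Omega>)"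
        by (rule zx[OF sc[OF \<phi>] z sc[OF t(2)]]) (use pdy_DERIV[OF C] in simp_all)
      then show "(\<integral>z. ?s Z z * pdy \<phi> z \<partial>lb_on \<Omega>) = - (\<integral>z. ?s Z\<^sub>1 z * \<phi> z \<partial>lb_on \<Omega>)"
        using tr[OF sqi_borel[OF Z'(1)] test_function_continuous(2)[OF t(2)]]
          tr[OF sqi_borel[OF Z'(2)] test_function_continuous(2)[OF \<phi>]] by simp
      have "(\<integral>z. Z z * ?s (pdx \<phi>) z \<partial>lb_on ?\<Omega>) = - (\<integral>z. Z\<^sub>2 z * ?s \<phi> z \<partial>lb_on ?\<Omega>)"
        by (rule zy[OF sc[OF \<phi>] z sc[OF t(1)]]) (use pdx_DERIV[OF C] in simp_all)
      then show "(\<integral>z. ?s Z z * pdx \<phi> z \<partial>lb_on \<Omega>) = - (\<integral>z. ?s Z\<^sub>2 z * \<phi> z \<partial>lb_on \<Omega>)"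
        using tr[OF sqi_borel[OF Z'(1)] test_function_continuous(2)[OF t(1)]]
          tr[OF sqi_borel[OF Z'(3)] test_function_continuous(2)[OF \<phi>]] by simp
    qed
    moreover have "(\<integral>z. (dv 0 1 u z - dv 0 1 w z) * dv 0 1 v z \<partial>lb_on \<Omega>) = (\<integral>z. ?s Z\<^sub>2 z * dv 0 1 v z \<partial>lb_on \<Omega>)"
      using eq sm[OF m(1)] tr[OF sqi_borel[OF Z'(3)] sqi_borel[OF d_v]] by simp
    ultimately have "\<bar>\<integral>z. (dv 0 1 u z - dv 0 1 w z) * dv 0 1 v z \<partial>lb_on \<Omega>\<bar> = \<bar>\<integral>z. ?s Z\<^sub>1 z * dv 1 0 v z \<partial>lb_on \<Omega>\<bar>"
      by simp
    also have "\<dots> \<le> sqrt (\<integral>z. (?s Z\<^sub>1 z)\<^sup>2 \<partial>lb_on \<Omega>) * sqrt (\<integral>z. (dv 1 0 v z)\<^sup>2 \<partial>lb_on \<Omega>)"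
      by (rule Cauchy_Schwarz_integral_sqrt[OF Z'(2) vx])
    also have "(\<integral>z. (?s Z\<^sub>1 z)\<^sup>2 \<partial>lb_on \<Omega>) = (\<integral>z. (Z\<^sub>1 z)\<^sup>2 \<partial>lb_on ?\<Omega>)"
      using sm[of "\<lambda>z. (?s Z\<^sub>1 z)\<^sup>2"] by simp
    also have "sqrt (\<integral>z. (Z\<^sub>1 z)\<^sup>2 \<partial>lb_on ?\<Omega>) * sqrt (\<integral>z. (dv 1 0 v z)\<^sup>2 \<partial>lb_on \<Omega>)
      \<le> h ^ (l + 3) * sqrt (\<integral>z. (dv (l + 2) 2 u z)\<^sup>2 \<partial>lb_on \<Omega>) * sqrt (\<integral>z. (dv 1 0 v z)\<^sup>2 \<partial>lb_on \<Omega>)"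
      using b sm[OF m(2)] by (intro mult_right_mono) (simp_all add: integral_nonneg_AE)
    finally show ?thesis .
  qed
qed

end

section \<open>The error estimate on a fixed grid\<close>

lemma Cauchy_Schwarz_2:
  fixes a b c d :: real
  shows "(a * c + b * d)\<^sup>2 \<le> (a\<^sup>2 + b\<^sup>2) * (c\<^sup>2 + d\<^sup>2)"
proof -
  have "(a\<^sup>2 + b\<^sup>2) * (c\<^sup>2 + d\<^sup>2) - (a * c + b * d)\<^sup>2 = (a * d - b * c)\<^sup>2"
    by (simp add: power2_eq_square algebra_simps)
  then show ?thesis using zero_le_power2[of "a * d - b * c"] by linarith
qed

lemma Qpoly_qpol: "q \<in> Qpoly m l \<longleftrightarrow> (\<exists>cf. q = qpol m l cf)"
proof -
  have "(\<lambda>(x, y). \<Sum>i\<le>m. \<Sum>j\<le>l. c i j * x ^ i * y ^ j) = qpol m l c" for c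
    by (auto simp: qpol_def fun_eq_iff)
  then show ?thesis by (auto simp: Qpoly_def)
qed

lemma deg_lt_Suc_iff: "deg_lt (Suc n) r \<longleftrightarrow> degree r \<le> n"
  by (auto simp: deg_lt_def coeff_eq_0 intro!: degree_le)

lemma poly_sum_atMost:
  assumes "degree (r :: real poly) \<le> n"
  shows "poly r x = (\<Sum>i\<le>n. coeff r i * x ^ i)"
  unfolding poly_altdef by (rule sum.mono_neutral_left) (use assms in \<open>auto simp: coeff_eq_0\<close>)

lemma tensor_Qpoly:
  assumes "degree r \<le> m" "degree s \<le> l"
  shows "(\<lambda>z. poly r (fst z) * poly s (snd z)) \<in> Qpoly m l"
  unfolding Qpoly_qpol
  by (rule exI[of _ "\<lambda>i j. coeff r i * coeff s j"])
    (simp add: fun_eq_iff qpol_def poly_sum_atMost[OF assms(1)] poly_sum_atMost[OF assms(2)] sum_product ac_simps)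

text \<open>Degrees written as double successors make the bound \<open>m - 2\<close> of
  \<open>interpolates_on\<close> and the bound \<open>deg_lt (m - 1)\<close> of
  \<open>interp\<close> the same, free of truncated subtraction.\<close>

lemma interpolates_on_interp:
  assumes ip: "interpolates_on (Suc (Suc m)) (Suc (Suc l)) a b c d g w" and lt: "a < b" "c < d"
    and g': "g' \<in> borel_measurable borel" "\<And>z. z \<in> {a..b} \<times> {c..d} \<Longrightarrow> g' z = g z"
  shows "\<exists>cf. interp (Suc (Suc m)) (Suc (Suc l)) a b c d g' cf \<and> (\<forall>z\<in>{a..b} \<times> {c..d}. w z = qpol (Suc (Suc m)) (Suc (Suc l)) cf z)"
proof -
  obtain cf where cf: "\<And>z. z \<in> {a..b} \<times> {c..d} \<Longrightarrow> w z = qpol (Suc (Suc m)) (Suc (Suc l)) cf z"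
  proof -
    have "\<exists>q\<in>Qpoly (Suc (Suc m)) (Suc (Suc l)). \<forall>z\<in>{a..b} \<times> {c..d}. w z = q z"
      using ip unfolding interpolates_on_def by (rule conjunct1)
    then show ?thesis using that Qpoly_qpol by metis
  qed
  let ?e = "\<lambda>z. g' z - qpol (Suc (Suc m)) (Suc (Suc l)) cf z"
  have eb: "?e \<in> borel_measurable borel" using g'(1) by simp
  have e: "?e z = g z - w z" if "z \<in> {a..b} \<times> {c..d}" for z using cf[OF that] g'(2)[OF that] by simp
  have x: "(\<integral>x. ?e (x, y) * poly r x \<partial>lb_on {a..b}) = 0" if "y \<in> {c, d}" "degree r \<le> m" for y r
  proof -
    have "(\<lambda>x. ?e (x, y) * poly r x) \<in> borel_measurable borel"
      by (intro borel_measurable_times poly_borel borel_slice(2)[OF eb])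
    then have "(\<integral>x. ?e (x, y) * poly r x \<partial>lb_on {a..b}) = (\<integral>x. ?e (x, y) * poly r x \<partial>lebesgue_on {a..b})"
      by (intro lebesgue_on_integral(1)[symmetric]) auto
    also have "\<dots> = (\<integral>x. (g (x, y) - w (x, y)) * poly r x \<partial>lebesgue_on {a..b})"
      by (rule Bochner_Integration.integral_cong) (use e that lt in auto)
    also have "\<dots> = 0" using ip that unfolding interpolates_on_def by auto
    finally show ?thesis .
  qed
  have y: "(\<integral>y. ?e (x, y) * poly r y \<partial>lb_on {c..d}) = 0" if "x \<in> {a, b}" "degree r \<le> l" for x r
  proof -
    have "(\<lambda>y. ?e (x, y) * poly r y) \<in> borel_measurable borel"
      by (intro borel_measurable_times poly_borel borel_slice(1)[OF eb])
    then have "(\<integral>y. ?e (x, y) * poly r y \<partial>lb_on {c..d}) = (\<integral>y. ?e (x, y) * poly r y \<partial>lebesgue_on {c..d})"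
      by (intro lebesgue_on_integral(1)[symmetric]) auto
    also have "\<dots> = (\<integral>y. (g (x, y) - w (x, y)) * poly r y \<partial>lebesgue_on {c..d})"
      by (rule Bochner_Integration.integral_cong) (use e that lt in auto)
    also have "\<dots> = 0" using ip that unfolding interpolates_on_def by auto
    finally show ?thesis .
  qed
  have xy: "(\<integral>z. ?e z * (poly r (fst z) * poly s (snd z)) \<partial>lb_on ({a..b} \<times> {c..d})) = 0"
    if "degree r \<le> m" "degree s \<le> l" for r s
  proof -
    have "(\<lambda>z. ?e z * (poly r (fst z) * poly s (snd z))) \<in> borel_measurable borel"
      by (intro borel_measurable_times eb borel_fst_snd[OF poly_borel])
    then have "(\<integral>z. ?e z * (poly r (fst z) * poly s (snd z)) \<partial>lb_on ({a..b} \<times> {c..d}))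
      = (\<integral>z. ?e z * (poly r (fst z) * poly s (snd z)) \<partial>lebesgue_on ({a..b} \<times> {c..d}))"
      by (intro lebesgue_on_integral(1)[symmetric]) auto
    also have "\<dots> = (\<integral>z. (g z - w z) * (poly r (fst z) * poly s (snd z)) \<partial>lebesgue_on ({a..b} \<times> {c..d}))"
      by (rule Bochner_Integration.integral_cong) (use e in auto)
    also have "\<dots> = 0"
    proof -
      have "\<forall>q\<in>Qpoly m l. (\<integral>z. (g z - w z) * q z \<partial>lebesgue_on ({a..b} \<times> {c..d})) = 0"
        using ip unfolding interpolates_on_def by simp
      from bspec[OF this tensor_Qpoly[OF that]] show ?thesis .
    qed
    finally show ?thesis .
  qed
  have "g' (x, y) = qpol (Suc (Suc m)) (Suc (Suc l)) cf (x, y)" if "x \<in> {a, b}" "y \<in> {c, d}" for x y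
  proof -
    have "g (x, y) - w (x, y) = 0" using ip that unfolding interpolates_on_def by auto
    then show ?thesis using e[of "(x, y)"] that lt by auto
  qed
  then have "interp (Suc (Suc m)) (Suc (Suc l)) a b c d g' cf"
    using x y xy unfolding interp_def by (simp add: deg_lt_Suc_iff)
  with cf show ?thesis by blast
qed

context dgrid
begin

section \<open>From finite element functions and the Stokes forms to the cell data\<close>

lemma cell_closure: "(a, b, c, d) \<in> Q \<Longrightarrow> {a..b} \<times> {c..d} \<subseteq> closure \<Omega>"
  using closure_mono[OF sub, of "(a, b, c, d)"] pos[of a b c d] by (simp add: closure_Times)

lemma FE_space_local:
  assumes "v \<in> FE_space \<Omega> T m l" "K \<in> T"
  shows "\<exists>cf. AE z in lebesgue_on K. v z = qpol m l cf z"
proof -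
  have "\<forall>K\<in>T. \<exists>q\<in>Qpoly m l. AE z in lebesgue_on K. v z = q z" using assms(1) by (simp add: FE_space_def)
  from bspec[OF this assms(2)] show ?thesis unfolding Bex_def Qpoly_qpol by auto
qed

lemma FE_space_diff:
  assumes v: "v \<in> FE_space \<Omega> T m l" and w: "w \<in> FE_space \<Omega> T m l"
  shows "(\<lambda>z. v z - w z) \<in> FE_space \<Omega> T m l"
proof -
  have "\<exists>q\<in>Qpoly m l. AE z in lebesgue_on K. v z - w z = q z" if K: "K \<in> T" for K
  proof -
    obtain cf dc where c: "AE z in lebesgue_on K. v z = qpol m l cf z" "AE z in lebesgue_on K. w z = qpol m l dc z"
      using FE_space_local[OF v K] FE_space_local[OF w K] by blast
    have "AE z in lebesgue_on K. v z - w z = qpol m l (\<lambda>i j. cf i j - dc i j) z"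
      using c by eventually_elim (simp add: qpol_def left_diff_distrib sum_subtractf)
    then show ?thesis unfolding Bex_def Qpoly_qpol by blast
  qed
  then show ?thesis using v w H1_0_diff by (simp add: FE_space_def)
qed

lemma fem_interpolant:
  assumes ip: "interpolant \<Omega> T (Suc (Suc m)) (Suc (Suc l)) u w" and T: "\<And>a b c d. (a, b, c, d) \<in> Q \<Longrightarrow> {a..b} \<times> {c..d} \<in> T"
    and w: "w \<in> Hspace 1 \<Omega>" and v: "v \<in> FE_space \<Omega> T (Suc (Suc m)) (Suc (Suc l))"
  obtains g where "fem (Suc (Suc m)) (Suc (Suc l)) g u w v"
proof -
  obtain g where g: "continuous_on (closure \<Omega>) g" "AE z in lebesgue_on \<Omega>. g z = u z"
    "\<And>a b c d. a < b \<Longrightarrow> c < d \<Longrightarrow> {a..b} \<times> {c..d} \<in> T \<Longrightarrow> interpolates_on (Suc (Suc m)) (Suc (Suc l)) a b c d g w"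
    using ip by (auto simp: interpolant_def)
  \<comment> \<open>Continuity is given on the closure only; the value 0 outside makes the function
    Borel on the plane without changing it on cells.\<close>
  define g' where "g' z = indicator (closure \<Omega>) z *\<^sub>R g z" for z
  have g'm: "g' \<in> borel_measurable borel"
    unfolding g'_def by (rule borel_measurable_continuous_on_indicator[OF _ g(1)]) simp
  have g'e: "g' z = g z" if "z \<in> closure \<Omega>" for z using that by (simp add: g'_def)
  have gae: "AE z in lb_on \<Omega>. g z = u z" using g(2) by (simp add: AE_lebesgue_on_iff)
  have "fem (Suc (Suc m)) (Suc (Suc l)) g' u w v"
    unfolding fem_def
  proof (intro conjI allI impI)
    show "AE z in lb_on \<Omega>. g' z = u z"
      using gae AE_lb_on_in[OF \<Omega>_borel] by eventually_elim (use subsetD[OF closure_subset, of _ \<Omega>] g'e in auto)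
    show "v \<in> H1_0 \<Omega>" using v by (simp add: FE_space_def)
    fix a b c d assume q: "(a, b, c, d) \<in> Q"
    let ?K = "{a..b} \<times> {c..d}"
    note K = cell_closure[OF q]
    have ge: "g' z = g z" if "z \<in> ?K" for z using g'e K that by blast
    show "continuous_on ?K g'"
      by (subst continuous_on_cong[OF refl ge]) (auto intro: continuous_on_subset[OF g(1) K])
    have lt: "a < b" "c < d" using pos[OF q] by auto
    obtain cf where cf: "interp (Suc (Suc m)) (Suc (Suc l)) a b c d g' cf" "\<And>z. z \<in> ?K \<Longrightarrow> w z = qpol (Suc (Suc m)) (Suc (Suc l)) cf z"
      using interpolates_on_interp[OF g(3)[OF lt T[OF q]] lt g'm ge] by blast
    have "AE z in lb_on ?K. w z = qpol (Suc (Suc m)) (Suc (Suc l)) cf z"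
      using AE_lb_on_in[of ?K, OF rect_borel] by eventually_elim (rule cf(2))
    with cf(1) show "\<exists>cf. interp (Suc (Suc m)) (Suc (Suc l)) a b c d g' cf \<and> (AE z in lb_on ?K. w z = qpol (Suc (Suc m)) (Suc (Suc l)) cf z)"
      by blast
    show "\<exists>r. AE z in lb_on ?K. v z = qpol (Suc (Suc m)) (Suc (Suc l)) r z"
      using FE_space_local[OF v T[OF q]] unfolding AE_lebesgue_on_iff[of ?K, OF rect_borel] .
  qed (use g'm w in auto)
  then show ?thesis by (rule that)
qed

text \<open>The Dirichlet form of one component; the form \<open>a\<close> of the problem is the sum
  over both components.\<close>

definition dip :: "sfield \<Rightarrow> sfield \<Rightarrow> real" where
  "dip f g = (\<integral>z. dv 1 0 f z * dv 1 0 g z \<partial>lb_on \<Omega>) + (\<integral>z. dv 0 1 f z * dv 0 1 g z \<partial>lb_on \<Omega>)"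

lemma a_form_dip:
  assumes "u \<in> both_components (Hspace 1 \<Omega>)" "v \<in> both_components (Hspace 1 \<Omega>)"
  shows "a_form \<Omega> u v = dip (fst \<circ> u) (fst \<circ> v) + dip (snd \<circ> u) (snd \<circ> v)"
proof -
  have H: "fst \<circ> u \<in> Hspace 1 \<Omega>" "snd \<circ> u \<in> Hspace 1 \<Omega>" "fst \<circ> v \<in> Hspace 1 \<Omega>" "snd \<circ> v \<in> Hspace 1 \<Omega>"
    using assms by (auto simp: both_components_def)
  have o: "1 + 0 \<le> (1 :: nat)" "0 + 1 \<le> (1 :: nat)" by auto
  note L = H[THEN weak_deriv_L2(1)[OF _ o(1)], THEN L2_measurable] H[THEN weak_deriv_L2(1)[OF _ o(2)], THEN L2_measurable]
  note s = H[THEN dv_sqi(1)[OF _ o(1)]] H[THEN dv_sqi(1)[OF _ o(2)]]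
  let ?F = "\<lambda>z. dv 1 0 (fst \<circ> u) z * dv 1 0 (fst \<circ> v) z + dv 0 1 (fst \<circ> u) z * dv 0 1 (fst \<circ> v) z +
    (dv 1 0 (snd \<circ> u) z * dv 1 0 (snd \<circ> v) z + dv 0 1 (snd \<circ> u) z * dv 0 1 (snd \<circ> v) z)"
  have "a_form \<Omega> u v = (\<integral>z. ?F z \<partial>lb_on \<Omega>)"
    unfolding a_form_def
  proof (rule lebesgue_on_integral_cong(1)[OF \<Omega>_borel])
    note [measurable] = L
    show "(\<lambda>z. grad_dot \<Omega> (fst \<circ> u) (fst \<circ> v) z + grad_dot \<Omega> (snd \<circ> u) (snd \<circ> v) z) \<in> borel_measurable (lebesgue_on \<Omega>)"
      unfolding grad_dot_def by measurable
    note [measurable] = s[THEN sqi_borel]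
    show "?F \<in> borel_measurable borel" by measurable
    show "AE z in lb_on \<Omega>. grad_dot \<Omega> (fst \<circ> u) (fst \<circ> v) z + grad_dot \<Omega> (snd \<circ> u) (snd \<circ> v) z = ?F z"
      using H[THEN dv_sqi(2)[OF _ o(1)]] H[THEN dv_sqi(2)[OF _ o(2)]]
      by eventually_elim (simp add: grad_dot_def)
  qed
  also have "\<dots> = dip (fst \<circ> u) (fst \<circ> v) + dip (snd \<circ> u) (snd \<circ> v)"
    unfolding dip_def
    using sqi_mult_integrable[OF s(1,3)] sqi_mult_integrable[OF s(2,4)] sqi_mult_integrable[OF s(5,7)] sqi_mult_integrable[OF s(6,8)]
    by simp
  finally show ?thesis .
qed

lemma dip_diff_left:
  assumes "f \<in> Hspace 1 \<Omega>" "g \<in> Hspace 1 \<Omega>" "v \<in> Hspace 1 \<Omega>"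
  shows "dip (\<lambda>z. f z - g z) v = dip f v - dip g v"
    and "dip f v - dip g v = (\<integral>z. (dv 1 0 f z - dv 1 0 g z) * dv 1 0 v z \<partial>lb_on \<Omega>) + (\<integral>z. (dv 0 1 f z - dv 0 1 g z) * dv 0 1 v z \<partial>lb_on \<Omega>)"
proof -
  have *: "(\<integral>z. dv i j (\<lambda>z. f z - g z) z * dv i j v z \<partial>lb_on \<Omega>) = (\<integral>z. (dv i j f z - dv i j g z) * dv i j v z \<partial>lb_on \<Omega>)"
    "(\<integral>z. (dv i j f z - dv i j g z) * dv i j v z \<partial>lb_on \<Omega>) = (\<integral>z. dv i j f z * dv i j v z \<partial>lb_on \<Omega>) - (\<integral>z. dv i j g z * dv i j v z \<partial>lb_on \<Omega>)"
    if o: "i + j \<le> 1" for i j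
  proof -
    note s = assms[THEN dv_sqi(1)[OF _ o]]
    note d = Hspace_diff[OF assms(1,2)]
    note [measurable] = s[THEN sqi_borel] dv_sqi(1)[OF d(1) o, THEN sqi_borel]
    show "(\<integral>z. dv i j (\<lambda>z. f z - g z) z * dv i j v z \<partial>lb_on \<Omega>) = (\<integral>z. (dv i j f z - dv i j g z) * dv i j v z \<partial>lb_on \<Omega>)"
      by (rule integral_cong_AE) (use d(2)[OF o] in \<open>auto elim: eventually_mono\<close>)
    show "(\<integral>z. (dv i j f z - dv i j g z) * dv i j v z \<partial>lb_on \<Omega>) = (\<integral>z. dv i j f z * dv i j v z \<partial>lb_on \<Omega>) - (\<integral>z. dv i j g z * dv i j v z \<partial>lb_on \<Omega>)"
      using sqi_mult_integrable[OF s(1,3)] sqi_mult_integrable[OF s(2,3)] by (simp add: left_diff_distrib)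
  qed
  show "dip (\<lambda>z. f z - g z) v = dip f v - dip g v" using *[of 1 0] *[of 0 1] by (simp add: dip_def)
  show "dip f v - dip g v = (\<integral>z. (dv 1 0 f z - dv 1 0 g z) * dv 1 0 v z \<partial>lb_on \<Omega>) + (\<integral>z. (dv 0 1 f z - dv 0 1 g z) * dv 0 1 v z \<partial>lb_on \<Omega>)"
    using *[of 1 0] *[of 0 1] by (simp add: dip_def)
qed

text \<open>The factor 2 counts the two partial derivatives, each bounded by the same quantity; both
  use derivatives of \<open>u\<close> of order exactly \<open>k + 3\<close>.\<close>

lemma fst_component_bound:
  assumes F: "fem (Suc k) k g u w v" and u: "u \<in> Hspace (k + 3) \<Omega>" "u \<in> Hspace 1 \<Omega>" and k: "2 \<le> k"
  shows "\<bar>dip u v - dip w v\<bar> \<le> 2 * h ^ (k + 2) * Hnorm (k + 3) \<Omega> u * sqrt (dip v v)"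
proof -
  obtain l where l: "k = Suc l" "1 \<le> l" using k by (cases k) auto
  note f = femD[OF F]
  let ?N = "Hnorm (k + 3) \<Omega> u"
  have vv: "sqrt (\<integral>z. (dv 0 1 v z)\<^sup>2 \<partial>lb_on \<Omega>) \<le> sqrt (dip v v)"
    by (auto simp: dip_def power2_eq_square intro!: integral_nonneg_AE)
  have nn: "0 \<le> h ^ (k + 2) * ?N" using h0 Hnorm_nonneg by simp
  \<comment> \<open>In \<open>y\<close> the interpolant has degree \<open>k\<close> only, so the
    second primitive is needed. With \<open>k = Suc l\<close> the exponent \<open>l + 3\<close> is
    \<open>k + 2\<close>.\<close>
  have 1: "\<bar>\<integral>z. (dv 1 0 u z - dv 1 0 w z) * dv 1 0 v z \<partial>lb_on \<Omega>\<bar> \<le> h ^ (k + 2) * ?N * sqrt (dip v v)"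
  proof -
    have "\<bar>\<integral>z. (dv 1 0 u z - dv 1 0 w z) * dv 1 0 v z \<partial>lb_on \<Omega>\<bar>
      \<le> h ^ (k + 2) * sqrt (\<integral>z. (dv 2 (l + 2) u z)\<^sup>2 \<partial>lb_on \<Omega>) * sqrt (\<integral>z. (dv 0 1 v z)\<^sup>2 \<partial>lb_on \<Omega>)"
      using x_super[OF F[unfolded l] _ l(2)] u(1) l by (simp add: eval_nat_numeral)
    also have "\<dots> \<le> h ^ (k + 2) * ?N * sqrt (dip v v)"
      using h0 dv_le_Hnorm[OF u(1), of 2 "l + 2"] l nn vv by (intro mult_mono mult_left_mono) (auto intro!: integral_nonneg_AE)
    finally show ?thesis .
  qed
  \<comment> \<open>In \<open>x\<close> the degree is \<open>k + 1\<close>, so the projection is one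
    degree richer and a single primitive suffices.\<close>
  have 2: "\<bar>\<integral>z. (dv 0 1 u z - dv 0 1 w z) * dv 0 1 v z \<partial>lb_on \<Omega>\<bar> \<le> h ^ (k + 2) * ?N * sqrt (dip v v)"
  proof -
    have "\<bar>\<integral>z. (dv 0 1 u z - dv 0 1 w z) * dv 0 1 v z \<partial>lb_on \<Omega>\<bar>
      \<le> h ^ (k + 2) * sqrt (\<integral>z. (dv (k + 2) 1 u z)\<^sup>2 \<partial>lb_on \<Omega>) * sqrt (\<integral>z. (dv 0 1 v z)\<^sup>2 \<partial>lb_on \<Omega>)"
      using y_direct[of k l g u w v] F u(1) by (simp add: l)
    also have "\<dots> \<le> h ^ (k + 2) * ?N * sqrt (dip v v)"
      using h0 dv_le_Hnorm[OF u(1), of "k + 2" 1] nn vv by (intro mult_mono mult_left_mono) (auto intro!: integral_nonneg_AE)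
    finally show ?thesis .
  qed
  show ?thesis using dip_diff_left(2)[OF u(2) f(3) H1_0_Hspace[OF f(4)]] 1 2 by linarith
qed

lemma snd_component_bound:
  assumes F: "fem k (Suc k) g u w v" and u: "u \<in> Hspace (k + 3) \<Omega>" "u \<in> Hspace 1 \<Omega>" and k: "2 \<le> k"
  shows "\<bar>dip u v - dip w v\<bar> \<le> 2 * h ^ (k + 2) * Hnorm (k + 3) \<Omega> u * sqrt (dip v v)"
proof -
  obtain l where l: "k = Suc l" "1 \<le> l" using k by (cases k) auto
  note f = femD[OF F]
  let ?N = "Hnorm (k + 3) \<Omega> u"
  have vv: "sqrt (\<integral>z. (dv 1 0 v z)\<^sup>2 \<partial>lb_on \<Omega>) \<le> sqrt (dip v v)"
    by (auto simp: dip_def power2_eq_square intro!: integral_nonneg_AE)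
  have nn: "0 \<le> h ^ (k + 2) * ?N" using h0 Hnorm_nonneg by simp
  have 1: "\<bar>\<integral>z. (dv 0 1 u z - dv 0 1 w z) * dv 0 1 v z \<partial>lb_on \<Omega>\<bar> \<le> h ^ (k + 2) * ?N * sqrt (dip v v)"
  proof -
    have "\<bar>\<integral>z. (dv 0 1 u z - dv 0 1 w z) * dv 0 1 v z \<partial>lb_on \<Omega>\<bar>
      \<le> h ^ (k + 2) * sqrt (\<integral>z. (dv (l + 2) 2 u z)\<^sup>2 \<partial>lb_on \<Omega>) * sqrt (\<integral>z. (dv 1 0 v z)\<^sup>2 \<partial>lb_on \<Omega>)"
      using y_super[OF F[unfolded l] _ l(2)] u(1) l by (simp add: eval_nat_numeral)
    also have "\<dots> \<le> h ^ (k + 2) * ?N * sqrt (dip v v)"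
      using h0 dv_le_Hnorm[OF u(1), of "l + 2" 2] l nn vv by (intro mult_mono mult_left_mono) (auto intro!: integral_nonneg_AE)
    finally show ?thesis .
  qed
  have 2: "\<bar>\<integral>z. (dv 1 0 u z - dv 1 0 w z) * dv 1 0 v z \<partial>lb_on \<Omega>\<bar> \<le> h ^ (k + 2) * ?N * sqrt (dip v v)"
  proof -
    have "\<bar>\<integral>z. (dv 1 0 u z - dv 1 0 w z) * dv 1 0 v z \<partial>lb_on \<Omega>\<bar>
      \<le> h ^ (k + 2) * sqrt (\<integral>z. (dv 1 (k + 2) u z)\<^sup>2 \<partial>lb_on \<Omega>) * sqrt (\<integral>z. (dv 1 0 v z)\<^sup>2 \<partial>lb_on \<Omega>)"
      using x_direct[of l k g u w v] F u(1) by (simp add: l)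
    also have "\<dots> \<le> h ^ (k + 2) * ?N * sqrt (dip v v)"
      using h0 dv_le_Hnorm[OF u(1), of 1 "k + 2"] nn vv by (intro mult_mono mult_left_mono) (auto intro!: integral_nonneg_AE)
    finally show ?thesis .
  qed
  show ?thesis using dip_diff_left(2)[OF u(2) f(3) H1_0_Hspace[OF f(4)]] 1 2 by linarith
qed

lemma divg_dv:
  assumes "v \<in> both_components (Hspace 1 \<Omega>)"
  shows "AE z in lb_on \<Omega>. divg \<Omega> v z = dv 1 0 (fst \<circ> v) z + dv 0 1 (snd \<circ> v) z"
    and "divg \<Omega> v \<in> borel_measurable (lebesgue_on \<Omega>)"
    and "sqi (lb_on \<Omega>) (\<lambda>z. dv 1 0 (fst \<circ> v) z + dv 0 1 (snd \<circ> v) z)"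
proof -
  have H: "fst \<circ> v \<in> Hspace 1 \<Omega>" "snd \<circ> v \<in> Hspace 1 \<Omega>" using assms by (auto simp: both_components_def)
  have o: "1 + 0 \<le> (1 :: nat)" "0 + 1 \<le> (1 :: nat)" by auto
  show "AE z in lb_on \<Omega>. divg \<Omega> v z = dv 1 0 (fst \<circ> v) z + dv 0 1 (snd \<circ> v) z"
    using dv_sqi(2)[OF H(1) o(1)] dv_sqi(2)[OF H(2) o(2)] by eventually_elim (simp add: divg_def)
  note [measurable] = L2_measurable[OF weak_deriv_L2(1)[OF H(1) o(1)]] L2_measurable[OF weak_deriv_L2(1)[OF H(2) o(2)]]
  show "divg \<Omega> v \<in> borel_measurable (lebesgue_on \<Omega>)" unfolding divg_def[abs_def] by measurable
  show "sqi (lb_on \<Omega>) (\<lambda>z. dv 1 0 (fst \<circ> v) z + dv 0 1 (snd \<circ> v) z)"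
    by (intro sqi_add dv_sqi(1)[OF H(1) o(1)] dv_sqi(1)[OF H(2) o(2)])
qed

text \<open>Tested with the divergence itself, the form \<open>b\<close> is minus its squared
  norm.\<close>

lemma divg_zero:
  assumes v: "v \<in> both_components (Hspace 1 \<Omega>)" and b: "b_form \<Omega> v (divg \<Omega> v) = 0"
  shows "AE z in lb_on \<Omega>. divg \<Omega> v z = 0"
proof -
  let ?d = "\<lambda>z. dv 1 0 (fst \<circ> v) z + dv 0 1 (snd \<circ> v) z"
  note d = divg_dv[OF v]
  have "(\<integral>z. divg \<Omega> v z * divg \<Omega> v z \<partial>lebesgue_on \<Omega>) = (\<integral>z. (?d z)\<^sup>2 \<partial>lb_on \<Omega>)"
  proof (rule lebesgue_on_integral_cong(1)[OF \<Omega>_borel])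
    show "AE z in lb_on \<Omega>. divg \<Omega> v z * divg \<Omega> v z = (?d z)\<^sup>2"
      using d(1) by eventually_elim (simp add: power2_eq_square)
  qed (use d(2) sqi_borel[OF d(3)] in auto)
  then have "(\<integral>z. (?d z)\<^sup>2 \<partial>lb_on \<Omega>) = 0" using b by (simp add: b_form_def)
  moreover have "integrable (lb_on \<Omega>) (\<lambda>z. (?d z)\<^sup>2)" using d(3) by (simp add: sqi_def)
  ultimately have "AE z in lb_on \<Omega>. (?d z)\<^sup>2 = 0"
    using integral_nonneg_eq_0_iff_AE[of "lb_on \<Omega>" "\<lambda>z. (?d z)\<^sup>2"] by simp
  with d(1) show ?thesis by eventually_elim simp
qed

lemma b_form_zero:
  assumes "AE z in lb_on \<Omega>. divg \<Omega> v z = 0"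
  shows "b_form \<Omega> v q = 0"
proof -
  have "AE z in lebesgue_on \<Omega>. divg \<Omega> v z * q z = 0"
    using assms by (auto simp: AE_lebesgue_on_iff elim: eventually_mono)
  then show ?thesis by (simp add: b_form_def integral_eq_zero_AE)
qed

text \<open>The square of the Poincare constant \<open>2 * B\<close> gives
  \<open>4 * B\<^sup>2\<close>; the 1 accounts for the gradient itself.\<close>

lemma poincare_Hnorm:
  assumes v: "v \<in> H1_0 \<Omega>"
  shows "(Hnorm 1 \<Omega> v)\<^sup>2 \<le> (1 + 4 * B\<^sup>2) * dip v v"
proof -
  let ?I = "\<lambda>i j. \<integral>z. (dv i j v z)\<^sup>2 \<partial>lb_on \<Omega>"
  have nn: "0 \<le> ?I i j" for i j by (rule integral_nonneg_AE) simp
  have "?I 0 0 = (sqrt (?I 0 0))\<^sup>2" using nn by simp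
  also have "\<dots> \<le> (2 * B * sqrt (?I 0 1))\<^sup>2" by (rule power_mono[OF poincare[OF v]]) (simp add: nn)
  also have "\<dots> = 4 * B\<^sup>2 * ?I 0 1" using nn by (simp add: power_mult_distrib)
  also have "\<dots> \<le> 4 * B\<^sup>2 * (?I 1 0 + ?I 0 1)" using nn by (intro mult_left_mono) auto
  finally have "?I 0 0 \<le> 4 * B\<^sup>2 * (?I 1 0 + ?I 0 1)" .
  then show ?thesis
    unfolding Hnorm_1_sq[OF H1_0_Hspace[OF v]] dip_def by (simp add: power2_eq_square algebra_simps)
qed

lemma dip_nonneg: "0 \<le> dip v v"
  unfolding dip_def by (intro add_nonneg_nonneg integral_nonneg_AE) auto

lemma error_estimate:
  assumes k: "2 \<le> k" and T: "\<And>a b c d. (a, b, c, d) \<in> Q \<Longrightarrow> {a..b} \<times> {c..d} \<in> T"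
    and weak: "stokes_weak_solution \<Omega> f u p" and uH: "u \<in> both_components (Hspace (k + 3) \<Omega>)"
    and FE: "stokes_FE_solution \<Omega> T k f u\<^sub>h p\<^sub>h" and Ih: "is_Ih \<Omega> T k u w" and wZ: "w \<in> Zh \<Omega> T k"
  shows "Hnorm_vec 1 \<Omega> (\<lambda>z. u\<^sub>h z - w z) \<le> 2 * sqrt (1 + 4 * B\<^sup>2) * h ^ (k + 2) * Hnorm_vec (k + 3) \<Omega> u"
proof -
  define e where "e z = u\<^sub>h z - w z" for z
  have e1: "fst \<circ> e = (\<lambda>z. (fst \<circ> u\<^sub>h) z - (fst \<circ> w) z)" and e2: "snd \<circ> e = (\<lambda>z. (snd \<circ> u\<^sub>h) z - (snd \<circ> w) z)"
    by (auto simp: e_def fun_eq_iff)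
  have uV: "u\<^sub>h \<in> Vh \<Omega> T k" and wV: "w \<in> Vh \<Omega> T k" using FE wZ by (auto simp: stokes_FE_solution_def Zh_def)
  then have eV: "e \<in> Vh \<Omega> T k" unfolding Vh_def by (simp only: e1 e2 mem_Collect_eq FE_space_diff simp_thms)
  have V0: "v \<in> both_components (H1_0 \<Omega>)" if "v \<in> Vh \<Omega> T k" for v
    using that by (auto simp: Vh_def FE_space_def both_components_def)
  have V1: "v \<in> both_components (Hspace 1 \<Omega>)" if "v \<in> both_components (H1_0 \<Omega>)" for v
    using that H1_0_Hspace by (auto simp: both_components_def)
  have u0: "u \<in> both_components (H1_0 \<Omega>)" using weak by (simp add: stokes_weak_solution_def)
  note u1 = V1[OF u0] and w1 = V1[OF V0[OF wV]] and uh1 = V1[OF V0[OF uV]] and ev1 = V1[OF V0[OF eV]]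
  \<comment> \<open>The pressure space is the range of the divergence, so the divergence of the
    discrete velocity is an admissible test function and must vanish.\<close>
  have uh_div: "AE z in lb_on \<Omega>. divg \<Omega> u\<^sub>h z = 0"
  proof (rule divg_zero[OF uh1])
    have "divg \<Omega> u\<^sub>h \<in> Ph \<Omega> T k" using uV by (auto simp: Ph_def)
    then show "b_form \<Omega> u\<^sub>h (divg \<Omega> u\<^sub>h) = 0" using FE by (simp add: stokes_FE_solution_def)
  qed
  have w_div: "AE z in lb_on \<Omega>. divg \<Omega> w z = 0" using wZ by (simp add: Zh_def AE_lebesgue_on_iff)
  have c: "fst \<circ> u \<in> Hspace 1 \<Omega>" "snd \<circ> u \<in> Hspace 1 \<Omega>" "fst \<circ> w \<in> Hspace 1 \<Omega>" "snd \<circ> w \<in> Hspace 1 \<Omega>"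
    "fst \<circ> u\<^sub>h \<in> Hspace 1 \<Omega>" "snd \<circ> u\<^sub>h \<in> Hspace 1 \<Omega>" "fst \<circ> e \<in> Hspace 1 \<Omega>" "snd \<circ> e \<in> Hspace 1 \<Omega>"
    using u1 w1 uh1 ev1 by (simp_all add: both_components_def)
  have e_div: "AE z in lb_on \<Omega>. divg \<Omega> e z = 0"
  proof -
    have "AE z in lb_on \<Omega>. dv 1 0 (fst \<circ> e) z = dv 1 0 (fst \<circ> u\<^sub>h) z - dv 1 0 (fst \<circ> w) z"
      unfolding e1 by (rule Hspace_diff(2)[OF c(5,3)]) simp
    moreover have "AE z in lb_on \<Omega>. dv 0 1 (snd \<circ> e) z = dv 0 1 (snd \<circ> u\<^sub>h) z - dv 0 1 (snd \<circ> w) z"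
      unfolding e2 by (rule Hspace_diff(2)[OF c(6,4)]) simp
    ultimately show ?thesis
      using uh_div w_div divg_dv(1)[OF uh1] divg_dv(1)[OF w1] divg_dv(1)[OF ev1] by eventually_elim simp
  qed
  \<comment> \<open>Since the error is divergence free, neither pressure appears, and both problems
    give the same load.\<close>
  have "a_form \<Omega> u e = load \<Omega> f e"
    using weak V0[OF eV] b_form_zero[OF e_div, of p] by (auto simp: stokes_weak_solution_def)
  moreover have "a_form \<Omega> u\<^sub>h e = load \<Omega> f e"
    using FE eV b_form_zero[OF e_div, of p\<^sub>h] by (auto simp: stokes_FE_solution_def)
  ultimately have ort: "dip (fst \<circ> u) (fst \<circ> e) + dip (snd \<circ> u) (snd \<circ> e)
      = dip (fst \<circ> u\<^sub>h) (fst \<circ> e) + dip (snd \<circ> u\<^sub>h) (snd \<circ> e)"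
    using a_form_dip[OF u1 ev1] a_form_dip[OF uh1 ev1] by simp
  let ?E1 = "dip (fst \<circ> e) (fst \<circ> e)" and ?E2 = "dip (snd \<circ> e) (snd \<circ> e)"
  let ?N1 = "Hnorm (k + 3) \<Omega> (fst \<circ> u)" and ?N2 = "Hnorm (k + 3) \<Omega> (snd \<circ> u)"
  have "?E1 = dip (fst \<circ> u\<^sub>h) (fst \<circ> e) - dip (fst \<circ> w) (fst \<circ> e)"
    using dip_diff_left(1)[OF c(5,3,7)] unfolding e1[symmetric] .
  moreover have "?E2 = dip (snd \<circ> u\<^sub>h) (snd \<circ> e) - dip (snd \<circ> w) (snd \<circ> e)"
    using dip_diff_left(1)[OF c(6,4,8)] unfolding e2[symmetric] .
  ultimately have E: "?E1 + ?E2 = (dip (fst \<circ> u) (fst \<circ> e) - dip (fst \<circ> w) (fst \<circ> e))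
      + (dip (snd \<circ> u) (snd \<circ> e) - dip (snd \<circ> w) (snd \<circ> e))"
    using ort by simp
  define l where "l = k - 2"
  have l: "k = Suc (Suc l)" using k by (simp add: l_def)
  have I1: "interpolant \<Omega> T (Suc k) k (fst \<circ> u) (fst \<circ> w)" and I2: "interpolant \<Omega> T k (Suc k) (snd \<circ> u) (snd \<circ> w)"
    using Ih by (auto simp: is_Ih_def)
  have eF: "fst \<circ> e \<in> FE_space \<Omega> T (Suc k) k" "snd \<circ> e \<in> FE_space \<Omega> T k (Suc k)" using eV by (auto simp: Vh_def)
  have B1: "\<bar>dip (fst \<circ> u) (fst \<circ> e) - dip (fst \<circ> w) (fst \<circ> e)\<bar> \<le> 2 * h ^ (k + 2) * ?N1 * sqrt ?E1"
  proof -
    obtain g where "fem (Suc k) k g (fst \<circ> u) (fst \<circ> w) (fst \<circ> e)"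
      unfolding l by (rule fem_interpolant[OF I1[unfolded l] T c(3) eF(1)[unfolded l]])
    then show ?thesis by (rule fst_component_bound) (use uH c(1) k in \<open>auto simp: both_components_def\<close>)
  qed
  have B2: "\<bar>dip (snd \<circ> u) (snd \<circ> e) - dip (snd \<circ> w) (snd \<circ> e)\<bar> \<le> 2 * h ^ (k + 2) * ?N2 * sqrt ?E2"
  proof -
    obtain g where "fem k (Suc k) g (snd \<circ> u) (snd \<circ> w) (snd \<circ> e)"
      unfolding l by (rule fem_interpolant[OF I2[unfolded l] T c(4) eF(2)[unfolded l]])
    then show ?thesis by (rule snd_component_bound) (use uH c(2) k in \<open>auto simp: both_components_def\<close>)
  qed
  define N where "N = Hnorm_vec (k + 3) \<Omega> u"
  define S where "S = sqrt (?E1 + ?E2)"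
  have nn: "0 \<le> ?E1" "0 \<le> ?E2" by (rule dip_nonneg)+
  have hk: "0 \<le> h ^ (k + 2)" using h0 by simp
  have N: "0 \<le> N" by (simp add: N_def Hnorm_vec_def)
  \<comment> \<open>Cauchy-Schwarz over the two components joins the separate bounds into vector
    norms.\<close>
  have CS: "?N1 * sqrt ?E1 + ?N2 * sqrt ?E2 \<le> N * S"
  proof -
    have "(?N1 * sqrt ?E1 + ?N2 * sqrt ?E2)\<^sup>2 \<le> (?N1\<^sup>2 + ?N2\<^sup>2) * ((sqrt ?E1)\<^sup>2 + (sqrt ?E2)\<^sup>2)"
      by (rule Cauchy_Schwarz_2)
    then have "(?N1 * sqrt ?E1 + ?N2 * sqrt ?E2)\<^sup>2 \<le> (N * S)\<^sup>2"
      using nn by (simp add: N_def S_def Hnorm_vec_def power_mult_distrib)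
    moreover have "0 \<le> N * S" using N nn by (simp add: S_def)
    ultimately show ?thesis by (rule power2_le_imp_le)
  qed
  have "S * S = ?E1 + ?E2" using nn by (simp add: S_def)
  also have "\<dots> \<le> 2 * h ^ (k + 2) * (?N1 * sqrt ?E1 + ?N2 * sqrt ?E2)"
    using E B1 B2 by (simp add: algebra_simps)
  also have "\<dots> \<le> 2 * h ^ (k + 2) * (N * S)" using CS hk by (intro mult_left_mono) auto
  finally have SS: "S * S \<le> (2 * h ^ (k + 2) * N) * S" by (simp add: mult.assoc)
  \<comment> \<open>One factor \<open>S\<close> cancels; the case \<open>S = 0\<close> is
    trivial.\<close>
  have S: "S \<le> 2 * h ^ (k + 2) * N"
  proof (cases "S = 0")
    case True
    then show ?thesis using hk N by simp
  next
    case False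
    then have "0 < S" using nn by (simp add: S_def less_le)
    then show ?thesis using SS mult_le_cancel_right_pos by blast
  qed
  have "(Hnorm 1 \<Omega> (fst \<circ> e))\<^sup>2 + (Hnorm 1 \<Omega> (snd \<circ> e))\<^sup>2 \<le> (1 + 4 * B\<^sup>2) * (?E1 + ?E2)"
    using poincare_Hnorm[of "fst \<circ> e"] poincare_Hnorm[of "snd \<circ> e"] V0[OF eV]
    by (simp add: both_components_def distrib_left)
  then have "Hnorm_vec 1 \<Omega> e \<le> sqrt ((1 + 4 * B\<^sup>2) * (?E1 + ?E2))"
    unfolding Hnorm_vec_def by (rule real_sqrt_le_mono)
  also have "\<dots> = sqrt (1 + 4 * B\<^sup>2) * S" by (simp add: S_def real_sqrt_mult)
  also have "\<dots> \<le> sqrt (1 + 4 * B\<^sup>2) * (2 * h ^ (k + 2) * N)" using S by (intro mult_left_mono) auto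
  finally show ?thesis by (simp add: N_def e_def[abs_def] mult_ac)
qed

end

section \<open>Conforming grids\<close>

text \<open>\<open>conf\<close> is what the face condition of \<open>conforming_grid\<close> says about the horizontal and vertical
  segments through a common point of two cells.\<close>

locale cgrid =
  fixes \<Omega> :: "(real \<times> real) set" and Q :: "(real \<times> real \<times> real \<times> real) set" and h :: real
  assumes op: "open \<Omega>" and fin: "finite Q"
    and pos: "(a, b, c, d) \<in> Q \<Longrightarrow> a < b \<and> c < d \<and> b - a \<le> h \<and> d - c \<le> h"
    and cover: "\<Omega> \<subseteq> (\<Union>q\<in>Q. cell q)"
    and largest: "open U \<Longrightarrow> U \<subseteq> (\<Union>q\<in>Q. cell q) \<Longrightarrow> U \<subseteq> \<Omega>"
    and disj: "q \<in> Q \<Longrightarrow> q' \<in> Q \<Longrightarrow> q \<noteq> q' \<Longrightarrow> ocell q \<inter> ocell q' = {}"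
    and conf: "(a, b, c, d) \<in> Q \<Longrightarrow> (a', b', c', d') \<in> Q \<Longrightarrow> a \<le> x \<Longrightarrow> x \<le> b \<Longrightarrow> a' \<le> x \<Longrightarrow> x \<le> b' \<Longrightarrow>
      c \<le> y \<Longrightarrow> y \<le> d \<Longrightarrow> c' \<le> y \<Longrightarrow> y \<le> d' \<Longrightarrow>
      (a < x \<and> x < b \<longrightarrow> a' \<le> a \<and> b \<le> b') \<and> (c < y \<and> y < d \<longrightarrow> c' \<le> c \<and> d \<le> d')"
begin

lemma open_ocell: "open (ocell q)"
  by (cases q) (simp add: open_Times)

text \<open>Finitely many closed cells do not contain \<open>p\<close> and stay away from a ball
  around it, so every cell met close to \<open>p\<close> in direction \<open>v\<close> also contains
  \<open>p\<close>.\<close>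

lemma cell_direction:
  fixes p v :: "real \<times> real"
  assumes p: "p \<in> \<Omega>" and v: "norm v = 1"
  obtains t q where "0 < t" "q \<in> Q" "p \<in> cell q" "p + t *\<^sub>R v \<in> cell q"
proof -
  define U where "U = \<Omega> - (\<Union>q\<in>{q \<in> Q. p \<notin> cell q}. cell q)"
  have cl: "closed (cell q)" for q by (cases q) (simp add: closed_Times)
  have "open U" unfolding U_def using fin op cl by (intro open_Diff closed_UN) auto
  moreover have "p \<in> U" using p by (auto simp: U_def)
  ultimately obtain e where e: "0 < e" "ball p e \<subseteq> U" by (meson open_contains_ball)
  have "p + (e / 2) *\<^sub>R v \<in> ball p e" using e v by (simp add: dist_norm)
  then have u: "p + (e / 2) *\<^sub>R v \<in> U" using e by blast
  then obtain q where q: "q \<in> Q" "p + (e / 2) *\<^sub>R v \<in> cell q" using cover by (auto simp: U_def)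
  then have "p \<in> cell q" using u unfolding U_def by blast
  then show ?thesis using that[of "e / 2" q] e q by simp
qed

text \<open>The cell just to the right of an inner point of the edge is the neighbour: conformity in
  both directions leaves no choice for its \<open>y\<close>-interval or its left end.\<close>

lemma right_neighbour:
  assumes q: "(a, b, c, d) \<in> Q" and y: "c < y" "y < d" and p: "(b, y) \<in> \<Omega>"
  shows "\<exists>b'. (b, b', c, d) \<in> Q"
proof -
  obtain t q' where t: "0 < t" "q' \<in> Q" "(b, y) \<in> cell q'" "(b, y) + t *\<^sub>R (1, 0) \<in> cell q'"
    by (rule cell_direction[OF p, of "(1, 0)"]) (simp add: norm_Pair)
  obtain a' b' c' d' where e: "q' = (a', b', c', d')" by (cases q')
  have q': "(a', b', c', d') \<in> Q" and i: "a' \<le> b" "b + t \<le> b'" "c' \<le> y" "y \<le> d'" using t e by auto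
  note ab = pos[OF q]
  have 1: "c' \<le> c" "d \<le> d'" using conf[OF q q', of b y] i ab y t(1) by auto
  \<comment> \<open>If \<open>a'\<close> were less than \<open>b\<close>, then \<open>b\<close>
    would be interior to the \<open>x\<close>-interval of \<open>q'\<close>, and conformity would
    force \<open>b' \<le> b\<close>, against \<open>b + t \<le> b'\<close>.\<close>
  have 2: "a' = b" using conf[OF q' q, of b y] i ab y t(1) by auto
  have "c \<le> c'" "d' \<le> d" using conf[OF q' q, of b y] 1 i ab y t(1) by auto
  then have "c' = c" "d' = d" using 1 by auto
  with q' 2 show ?thesis by auto
qed

lemma left_neighbour:
  assumes q: "(a, b, c, d) \<in> Q" and y: "c < y" "y < d" and p: "(a, y) \<in> \<Omega>"
  shows "\<exists>a'. (a', a, c, d) \<in> Q"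
proof -
  obtain t q' where t: "0 < t" "q' \<in> Q" "(a, y) \<in> cell q'" "(a, y) + t *\<^sub>R (-1, 0) \<in> cell q'"
    by (rule cell_direction[OF p, of "(-1, 0)"]) (simp add: norm_Pair)
  obtain a' b' c' d' where e: "q' = (a', b', c', d')" by (cases q')
  have q': "(a', b', c', d') \<in> Q" and i: "a' \<le> a - t" "a \<le> b'" "c' \<le> y" "y \<le> d'" using t e by auto
  note ab = pos[OF q]
  have 1: "c' \<le> c" "d \<le> d'" using conf[OF q q', of a y] i ab y t(1) by auto
  have 2: "b' = a" using conf[OF q' q, of a y] i ab y t(1) by auto
  have "c \<le> c'" "d' \<le> d" using conf[OF q' q, of a y] 1 i ab y t(1) by auto
  then have "c' = c" "d' = d" using 1 by auto
  with q' 2 show ?thesis by auto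
qed

lemma xgrid: "xgrid \<Omega> Q h"
proof
  show "ocell q \<subseteq> \<Omega>" if "q \<in> Q" for q
  proof (rule largest[OF open_ocell])
    have "ocell q \<subseteq> cell q" by (cases q) auto
    then show "ocell q \<subseteq> (\<Union>q\<in>Q. cell q)" using that by blast
  qed
  show "(\<exists>b'. (b, b', c, d) \<in> Q) \<or> (\<forall>y\<in>{c<..<d}. (b, y) \<notin> \<Omega>)" if "(a, b, c, d) \<in> Q" for a b c d
    using right_neighbour[OF that] by auto
  show "(\<exists>a'. (a', a, c, d) \<in> Q) \<or> (\<forall>y\<in>{c<..<d}. (a, y) \<notin> \<Omega>)" if "(a, b, c, d) \<in> Q" for a b c d
    using left_neighbour[OF that] by auto
qed (use op fin pos cover disj in auto)

text \<open>The open joined box is contained in two cells, and the domain contains every open set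
  covered by cells; so there is no slit along the common edge.\<close>

lemma join:
  assumes "(a, e, c, d) \<in> Q" "(e, b, c, d) \<in> Q"
  shows "ocell (a, b, c, d) \<subseteq> \<Omega>"
proof (rule largest[OF open_ocell])
  have "ocell (a, b, c, d) \<subseteq> cell (a, e, c, d) \<union> cell (e, b, c, d)" by auto
  then show "ocell (a, b, c, d) \<subseteq> (\<Union>q\<in>Q. cell q)" using assms by blast
qed

lemma swap: "cgrid {z. (snd z, fst z) \<in> \<Omega>} {(c, d, a, b). (a, b, c, d) \<in> Q} h"
proof
  let ?Q = "{(c, d, a, b). (a, b, c, d) \<in> Q}"
  have co: "continuous_on UNIV (\<lambda>z :: real \<times> real. (snd z, fst z))" by (intro continuous_intros)
  have os: "open {z :: real \<times> real. (snd z, fst z) \<in> U}" if "open U" for U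
    using open_vimage[OF that co] by (simp add: vimage_def)
  show "open {z. (snd z, fst z) \<in> \<Omega>}" by (rule os[OF op])
  have Q: "?Q = (\<lambda>(a, b, c, d). (c, d, a, b)) ` Q" by force
  then show "finite ?Q" using fin by simp
  have U: "(\<Union>q\<in>?Q. cell q) = {z. (snd z, fst z) \<in> (\<Union>q\<in>Q. cell q)}"
    unfolding Q by force
  show "{z. (snd z, fst z) \<in> \<Omega>} \<subseteq> (\<Union>q\<in>?Q. cell q)" unfolding U using cover by blast
  show "V \<subseteq> {z. (snd z, fst z) \<in> \<Omega>}" if V: "open V" "V \<subseteq> (\<Union>q\<in>?Q. cell q)" for V
  proof -
    have "{z. (snd z, fst z) \<in> V} \<subseteq> \<Omega>" by (rule largest[OF os[OF V(1)]]) (use V(2)[unfolded U] in force)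
    then show ?thesis by auto
  qed
  show "ocell q \<inter> ocell q' = {}" if qq: "q \<in> ?Q" "q' \<in> ?Q" "q \<noteq> q'" for q q'
  proof -
    obtain c d a b where e: "q = (c, d, a, b)" by (cases q)
    obtain c' d' a' b' where e': "q' = (c', d', a', b')" by (cases q')
    have "ocell (a, b, c, d) \<inter> ocell (a', b', c', d') = {}" by (rule disj) (use qq e e' in auto)
    then show ?thesis unfolding e e' by auto
  qed
  show "(c < y \<and> y < d \<longrightarrow> c' \<le> c \<and> d \<le> d') \<and> (a < x \<and> x < b \<longrightarrow> a' \<le> a \<and> b \<le> b')"
    if "(c, d, a, b) \<in> ?Q" "(c', d', a', b') \<in> ?Q" "c \<le> y" "y \<le> d" "c' \<le> y" "y \<le> d'"
      "a \<le> x" "x \<le> b" "a' \<le> x" "x \<le> b'" for a b c d a' b' c' d' x y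
    using conf[of a b c d a' b' c' d' x y] that by blast
qed (use pos in auto)

end

lemma cgrid_dgrid:
  assumes "cgrid \<Omega> Q h" and bnd: "\<Omega> \<subseteq> {-B<..<B} \<times> {-B<..<B}" "0 < B" and ne: "\<Omega> \<noteq> {}"
  shows "dgrid \<Omega> Q h B"
proof -
  interpret cgrid \<Omega> Q h by fact
  interpret S: cgrid "{z. (snd z, fst z) \<in> \<Omega>}" "{(c, d, a, b). (a, b, c, d) \<in> Q}" h by (rule swap)
  interpret X: xgrid \<Omega> Q h by (rule xgrid)
  interpret Y: xgrid "{z. (snd z, fst z) \<in> \<Omega>}" "{(c, d, a, b). (a, b, c, d) \<in> Q}" h by (rule S.xgrid)
  show ?thesis
  proof unfold_locales
    show "\<Omega> \<subseteq> {-B<..<B} \<times> {-B<..<B}" "0 < B" by fact+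
    \<comment> \<open>A nonempty domain has a cell, and its positive width is at most
      \<open>h\<close>.\<close>
    obtain q where "q \<in> Q" using ne cover by blast
    then obtain a b c d where "(a, b, c, d) \<in> Q" by (cases q) auto
    from pos[OF this] show "0 \<le> h" by simp
    show "ocell (a, b, c, d) \<subseteq> \<Omega>" if "X.box_ok a b c d" for a b c d
      using that X.sub join unfolding X.box_ok_def by blast
    show "ocell (a, b, c, d) \<subseteq> \<Omega>" if "Y.box_ok c d a b" for a b c d
    proof -
      have "ocell (c, d, a, b) \<subseteq> {z. (snd z, fst z) \<in> \<Omega>}"
        using that Y.sub S.join unfolding Y.box_ok_def by blast
      then show ?thesis by auto
    qed
  qed
qed

text \<open>The defining property of a face: it contains a segment of \<open>K\<close> as soon as it
  contains an inner point of that segment.\<close>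

lemma segment_in_face:
  assumes F: "K \<inter> K' face_of K" and p: "p \<in> K \<inter> K'" and r: "r \<in> K" and s: "s \<in> K" and rs: "r \<noteq> s"
    and u: "0 < u" "u < 1" "p = (1 - u) *\<^sub>R r + u *\<^sub>R s"
  shows "r \<in> K'" "s \<in> K'"
proof -
  have "p \<in> open_segment r s" unfolding in_segment using rs u by blast
  with face_ofD[OF F _ r s p] show "r \<in> K'" "s \<in> K'" by auto
qed

lemma between_convex:
  fixes a b x :: real
  assumes "a < x" "x < b"
  obtains u where "0 < u" "u < 1" "x = (1 - u) * a + u * b"
proof -
  have "(1 - (x - a) / (b - a)) * a + (x - a) / (b - a) * b = a + (x - a) / (b - a) * (b - a)"
    by (simp only: algebra_simps)
  also have "\<dots> = x" using assms by simp
  finally have "x = (1 - (x - a) / (b - a)) * a + (x - a) / (b - a) * b" by simp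
  with assms show ?thesis by (intro that[of "(x - a) / (b - a)"]) (auto simp: field_simps)
qed

lemma conforming_cgrid:
  assumes dom: "\<Omega> = interior (closure \<Omega>)" and grid: "conforming_grid \<Omega> h T"
  shows "cgrid \<Omega> {(a, b, c, d). a < b \<and> c < d \<and> {a..b} \<times> {c..d} \<in> T} h"
proof
  let ?Q = "{(a, b, c, d). a < b \<and> c < d \<and> {a..b} \<times> {c..d} \<in> T}"
  have T: "T division_of closure \<Omega>" "\<And>K. K \<in> T \<Longrightarrow> rectangle K"
    "\<And>K K'. K \<in> T \<Longrightarrow> K' \<in> T \<Longrightarrow> K \<inter> K' face_of K"
    "\<And>a b c d. a < b \<Longrightarrow> c < d \<Longrightarrow> {a..b} \<times> {c..d} \<in> T \<Longrightarrow> max (b - a) (d - c) \<le> h"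
    using grid by (auto simp: conforming_grid_def)
  note D = division_ofD[OF T(1)]
  show "open \<Omega>" by (subst dom) simp
  \<comment> \<open>A nondegenerate rectangle determines its four coordinates, so quadruples and
    cells correspond and finiteness carries over.\<close>
  have inj: "inj_on cell ?Q" by (auto simp: inj_on_def times_eq_iff Icc_eq_Icc)
  have "cell ` ?Q \<subseteq> T" by auto
  then show "finite ?Q" using D(1) inj finite_subset finite_imageD by blast
  have "K \<in> cell ` ?Q" if K: "K \<in> T" for K
  proof -
    obtain a b c d where "a < b" "c < d" "K = {a..b} \<times> {c..d}" using T(2)[OF K] by (auto simp: rectangle_def)
    then show ?thesis using K by (intro image_eqI[of _ _ "(a, b, c, d)"]) auto
  qed
  then have "cell ` ?Q = T" using \<open>cell ` ?Q \<subseteq> T\<close> by blast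
  then have U: "(\<Union>q\<in>?Q. cell q) = closure \<Omega>" using D(6) by simp
  show "\<Omega> \<subseteq> (\<Union>q\<in>?Q. cell q)" unfolding U by (rule closure_subset)
  \<comment> \<open>The union of the cells is the closure of the domain, and the domain is the
    interior of its closure.\<close>
  show "V \<subseteq> \<Omega>" if "open V" "V \<subseteq> (\<Union>q\<in>?Q. cell q)" for V
    using interior_maximal[OF that(2,1)] unfolding U dom[symmetric] .
  show "a < b \<and> c < d \<and> b - a \<le> h \<and> d - c \<le> h" if "(a, b, c, d) \<in> ?Q" for a b c d
    using T(4)[of a b c d] that by simp
  show "ocell q \<inter> ocell q' = {}" if q: "q \<in> ?Q" "q' \<in> ?Q" "q \<noteq> q'" for q q'
  proof -
    have io: "interior (cell q) = ocell q" for q by (cases q) (simp add: interior_Times)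
    have "cell q \<noteq> cell q'" using inj q by (auto dest: inj_onD)
    moreover have "cell q \<in> T" "cell q' \<in> T" using q by auto
    ultimately show ?thesis using D(5) io by metis
  qed
  show "(a < x \<and> x < b \<longrightarrow> a' \<le> a \<and> b \<le> b') \<and> (c < y \<and> y < d \<longrightarrow> c' \<le> c \<and> d \<le> d')"
    if q: "(a, b, c, d) \<in> ?Q" "(a', b', c', d') \<in> ?Q" and i: "a \<le> x" "x \<le> b" "a' \<le> x" "x \<le> b'"
      "c \<le> y" "y \<le> d" "c' \<le> y" "y \<le> d'" for a b c d a' b' c' d' x y
  proof (intro conjI impI)
    let ?K = "{a..b} \<times> {c..d}" and ?K' = "{a'..b'} \<times> {c'..d'}"
    have F: "?K \<inter> ?K' face_of ?K" by (rule T(3)) (use q in auto)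
    have p: "(x, y) \<in> ?K \<inter> ?K'" using i by auto
    { assume ab: "a < x \<and> x < b"
      then obtain u where u: "0 < u" "u < 1" "x = (1 - u) * a + u * b" using between_convex by blast
      \<comment> \<open>The common point is inner to the horizontal segment through the first cell,
        so the whole segment belongs to the face and hence to the second cell.\<close>
      have e: "(x, y) = (1 - u) *\<^sub>R (a, y) + u *\<^sub>R (b, y)" using u(3) by (simp add: algebra_simps)
      have "(a, y) \<in> ?K'" "(b, y) \<in> ?K'"
        by (rule segment_in_face[OF F p _ _ _ u(1,2) e]; use ab i in auto)+
      then show "a' \<le> a" "b \<le> b'" by auto }
    { assume cd: "c < y \<and> y < d"
      then obtain u where u: "0 < u" "u < 1" "y = (1 - u) * c + u * d" using between_convex by blast
      have e: "(x, y) = (1 - u) *\<^sub>R (x, c) + u *\<^sub>R (x, d)" using u(3) by (simp add: algebra_simps)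
      have "(x, c) \<in> ?K'" "(x, d) \<in> ?K'"
        by (rule segment_in_face[OF F p _ _ _ u(1,2) e]; use cd i in auto)+
      then show "c' \<le> c" "d \<le> d'" by auto }
  qed
qed

lemma rectangular_domain_bounded:
  assumes "rectangular_domain \<Omega>"
  obtains B where "0 < B" "\<Omega> \<subseteq> {-B<..<B} \<times> {-B<..<B}"
proof -
  obtain R where "R division_of closure \<Omega>" using assms by (auto simp: rectangular_domain_def)
  then have "bounded (closure \<Omega>)" by (rule elementary_bounded)
  then obtain B where B: "0 < B" "\<And>z. z \<in> closure \<Omega> \<Longrightarrow> norm z < B" unfolding bounded_pos_less by blast
  have "\<Omega> \<subseteq> {-B<..<B} \<times> {-B<..<B}"
  proof
    fix z assume "z \<in> \<Omega>"
    then have "norm z < B" using B(2) closure_subset by blast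
    then have "\<bar>fst z\<bar> < B" "\<bar>snd z\<bar> < B" using norm_fst_le[of "fst z" "snd z"] norm_snd_le[of "snd z" "fst z"] by auto
    then show "z \<in> {-B<..<B} \<times> {-B<..<B}" by (cases z) auto
  qed
  with B(1) show ?thesis by (rule that)
qed

theorem theorem3p2:
  fixes \<Omega> :: "(real \<times> real) set" and k :: nat
  assumes "k > 1" and "rectangular_domain \<Omega>"
  shows "\<exists>C :: real. \<forall>(h :: real) T (f :: vfield) (u :: vfield) (p :: sfield)
           (u\<^sub>h :: vfield) (p\<^sub>h :: sfield) (I\<^sub>hu :: vfield).
           conforming_grid \<Omega> h T \<longrightarrow>
           f \<in> both_components (L2 \<Omega>) \<longrightarrow>
           stokes_weak_solution \<Omega> f u p \<longrightarrow>
           u \<in> both_components (Hspace (k + 3) \<Omega>) \<longrightarrow>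
           stokes_FE_solution \<Omega> T k f u\<^sub>h p\<^sub>h \<longrightarrow>
           is_Ih \<Omega> T k u I\<^sub>hu \<longrightarrow>
           I\<^sub>hu \<in> Zh \<Omega> T k \<longrightarrow>
           Hnorm_vec 1 \<Omega> (\<lambda>z. u\<^sub>h z - I\<^sub>hu z) \<le> C * h ^ (k + 2) * Hnorm_vec (k + 3) \<Omega> u"
proof -
  obtain B where B: "0 < B" "\<Omega> \<subseteq> {-B<..<B} \<times> {-B<..<B}"
    using rectangular_domain_bounded[OF assms(2)] by blast
  have dom: "\<Omega> = interior (closure \<Omega>)" "\<Omega> \<noteq> {}" using assms(2) by (auto simp: rectangular_domain_def)
  show ?thesis
  \<comment> \<open>The 2 counts the partial derivatives of a component, the root stems from
    Poincare's inequality; \<open>B\<close> depends on the domain only.\<close>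
  proof (intro exI[of _ "2 * sqrt (1 + 4 * B\<^sup>2)"] allI impI)
    fix h T f u p u\<^sub>h p\<^sub>h w
    assume grid: "conforming_grid \<Omega> h T" and sol: "stokes_weak_solution \<Omega> f u p"
      "u \<in> both_components (Hspace (k + 3) \<Omega>)" "stokes_FE_solution \<Omega> T k f u\<^sub>h p\<^sub>h" "is_Ih \<Omega> T k u w" "w \<in> Zh \<Omega> T k"
    interpret dgrid \<Omega> "{(a, b, c, d). a < b \<and> c < d \<and> {a..b} \<times> {c..d} \<in> T}" h B
      by (rule cgrid_dgrid[OF conforming_cgrid[OF dom(1) grid] B(2,1) dom(2)])
    show "Hnorm_vec 1 \<Omega> (\<lambda>z. u\<^sub>h z - w z) \<le> 2 * sqrt (1 + 4 * B\<^sup>2) * h ^ (k + 2) * Hnorm_vec (k + 3) \<Omega> u"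
      by (rule error_estimate[OF _ _ sol]) (use assms(1) in auto)
  qed
qed

end
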